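(* For every $\varepsilon>0$ and every integer $Y\ge 1$ there is a constant $c_0(\varepsilon,Y)>0$ such that, for every sufficiently large integer $q$ (in terms of $\varepsilon$ and $Y$) and every subgroup $H\subseteq (\mathbb{Z}/q\mathbb{Z})^{\times}$ of index $Y$, there exists a prime $$p\le c_0(\varepsilon,Y)\cdot q^{\frac{Y-1}{3}+\varepsilon}$$ such that $p \bmod q\in H$. Further, if $q$ is cube-free, the exponent $\frac{Y-1}{3}$ can be replaced by $\frac{Y-1}{4}$.
   Context: An integer $q$ is cube-free if no cube of a prime divides $q$. *)

theory Defs
  imports Complex_Main
    "HOL-Algebra.Coset"
    "HOL-Number_Theory.Residues"
    "HOL-Computational_Algebra.Primes"
begin

(* The elements are the integers a with 0 <= a < q that are coprime to q (for q > 1),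
   multiplied modulo q; so the class of n lies in H iff "int n mod int q \<in> H". *)
definition mod_units :: "nat \<Rightarrow> int monoid" where
  "mod_units q = units_of (residue_ring (int q))"

(* As card of an infinite set is 0, this value is meaningful only when the index is finite,
   in particular whenever G is finite. *)
definition subgroup_index :: "('a, 'b) monoid_scheme \<Rightarrow> 'a set \<Rightarrow> nat" where
  "subgroup_index G H = card (rcosets\<^bsub>G\<^esub> H)"

definition cube_free :: "nat \<Rightarrow> bool" where
  "cube_free q \<longleftrightarrow> (\<forall>p::nat. prime p \<longrightarrow> \<not> p ^ 3 dvd q)"

lemma mod_units_group:
  assumes "q > 1"
  shows "comm_group (mod_units q)"
proof -
  interpret residues "int q" "residue_ring (int q)"
    using assms by unfold_locales auto
  show ?thesis unfolding mod_units_def by (rule units_comm_group)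
qed

lemma carrier_mod_units:
  assumes "q > 1"
  shows "carrier (mod_units q) = {a. 0 < a \<and> a < int q \<and> coprime a (int q)}"
proof -
  interpret residues "int q" "residue_ring (int q)"
    using assms by unfold_locales auto
  show ?thesis unfolding mod_units_def units_of_carrier by (rule res_units_eq)
qed

lemma mult_mod_units:
  "x \<otimes>\<^bsub>mod_units q\<^esub> y = x * y mod int q"
  by (simp add: mod_units_def units_of_mult residue_ring_def)

end

theory Submission
  imports "HOL-Analysis.Analysis" "HOL-Number_Theory.Number_Theory"
    "HOL-Computational_Algebra.Squarefree" "Berlekamp_Zassenhaus.Finite_Field" Defs
begin

text \<open>
  Let \<open>X\<close> be the group of characters modulo \<open>Q = q Y\<close> that come from characters of
  \<open>(Z/q)\<^sup>*\<close> trivial on \<open>H\<close>; it has at most \<open>Y\<close> elements, all of exponent \<open>Y\<close>, and it separates \<open>H\<close> from its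
  complement. A character modulo \<open>Q\<close> of exponent \<open>Y\<close> dividing \<open>Q\<close> is, up to a factor of bounded period, a character
  of squarefree modulus. So Burgess's method, fed by Stepanov's proof of the Weil bound, gives
  cancellation in its sums of length \<open>Q\<^bsup>1/4+\<epsilon>\<^esup>\<close> for every \<open>q\<close>; the exponent \<open>(Y - 1)/4\<close>
  therefore holds without the cube-free hypothesis, and it implies the exponent \<open>(Y - 1)/3\<close>.

  Let \<open>F\<close> be the Dirichlet convolution of the nontrivial elements of \<open>X\<close>, and \<open>f = 1 * F\<close>. The hyperbola method gives
  \<open>\<Sum>n\<le>N. f(n) = N \<lambda> + O(N Q\<^bsup>-\<delta>\<^esup>)\<close> with \<open>\<lambda> = \<Prod>\<xi>. L(1, \<xi>)\<close>, as soon as \<open>N\<close> exceeds \<open>Q\<^bsup>(Y-1)/4+\<epsilon>\<^esup>\<close>. The identity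
  \<open>f log = f * (\<Lambda> \<cdot> (1 + \<Sum>\<xi>))\<close> shows \<open>f \<ge> 0\<close>, and that, if no prime \<open>p \<le> N\<close> lies in \<open>H\<close>, \<open>f\<close>
  is supported up to \<open>N\<close> on integers that are squarefull apart from primes dividing \<open>Q\<close>; then the sum is \<open>O(N\<^bsup>3/4\<^esup>)\<close>.
  This contradicts Siegel's bound \<open>\<lambda> \<ge> c(\<eta>) Q\<^bsup>-\<eta>\<^esup>\<close>, which is proved for all groups of characters of bounded order at once: if \<open>F(\<beta>)\<close>
  is nonnegative for some \<open>\<beta> < 1\<close> close to 1, then \<open>\<zeta>(\<beta>) F(\<beta>) \<le> 0\<close> and \<open>f(1) = 1\<close> bound
  \<open>\<lambda>\<close> from below; otherwise one fixed exceptional group \<open>X\<^sub>1\<close> has a real zero \<open>\<beta>\<close>, and the product group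
  \<open>X X\<^sub>1\<close> inherits it, for every \<open>X\<close>.
\<close>

section \<open>Stepanov's method\<close>

hide_const (open) up_ring.coeff module.smult Coset.order

text \<open>The reduction to squarefree moduli rests on Hensel lifting: an integer congruent to 1
  modulo \<open>Y ^ 2\<close> times the radical of \<open>Q\<close> is a \<open>Y\<close>-th power
  modulo \<open>Q\<close>, so a character of exponent \<open>Y\<close> takes the value 1 there. High
  prime powers in \<open>q\<close> thus disappear, and with them the obstacle that ties the full
  strength of Burgess's method to cube-free moduli. The factor \<open>Y - 1\<close> in the exponent
  arises because thresholds multiply under convolution: with the hyperbola cut at the right power,
  two functions that cancel beyond \<open>Q ^ a\<close> and \<open>Q ^ b\<close> have a convolution
  that cancels just beyond \<open>Q ^ (a + b)\<close>. Uniformity in \<open>X\<close> is the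
  constant concern. Siegel's bound must lose less than the power of \<open>Q\<close> that
  oscillation saves, with constants depending on \<open>Y\<close> and \<epsilon> only. Treating a
  whole group at once makes the convolution of 1 and \<open>F\<close> nonnegative without separating
  real from complex characters; they are separated only to exclude a zero at 1. All series are taken
  at real arguments, and convergence slightly to the left of 1 comes from explicit rates for partial
  sums.\<close>

definition polys_below :: "nat => 'a::comm_ring_1 poly set" where
 "polys_below n = {q. \<forall>i\<ge>n. coeff q i = 0}"

lemma polys_below_iff: "q \<in> polys_below n \<longleftrightarrow> q = 0 \<or> degree q < n"
 unfolding polys_below_def by (auto simp: coeff_eq_0 not_le)

lemma polys_below_0 [simp]: "0 \<in> polys_below n"
 by (simp add: polys_below_def)

lemma polys_below_add: "q \<in> polys_below n ==> r \<in> polys_below n ==> q + r \<in> polys_below n"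
 by (simp add: polys_below_def)

lemma polys_below_diff: "q \<in> polys_below n ==> r \<in> polys_below n ==> q - r \<in> polys_below n"
 by (simp add: polys_below_def)

lemma polys_below_smult: "q \<in> polys_below n ==> smult a q \<in> polys_below n"
 by (simp add: polys_below_def)

lemma polys_below_sum: "(\<And>i. i \<in> A ==> f i \<in> polys_below n) ==> sum f A \<in> polys_below n"
 by (induction A rule: infinite_finite_induct) (auto intro: polys_below_add)

lemma polys_below_pderiv:
 fixes q :: "'a::idom poly"
 shows "q \<in> polys_below n ==> pderiv q \<in> polys_below n"
 by (simp add: polys_below_def coeff_pderiv)

lemma polys_below_mult:
 fixes q :: "'a::idom poly"
 assumes "q \<in> polys_below n" "degree r <= m"
 shows "r * q \<in> polys_below (n + m)"
proof (cases "q = 0 \<or> r = 0")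
 case False
 then have "degree q < n" "degree (r * q) = degree r + degree q"
  using assms by (auto simp: polys_below_iff degree_mult_eq)
 with assms(2) show ?thesis by (auto simp: polys_below_iff)
qed auto

text \<open>The set contains 0 and is described by free coefficients, so the count is an exact
  power; the pigeonhole argument of \<open>stepanov_coeffs_exist\<close> compares two such
  powers.\<close>

lemma card_polys_below:
 "finite (polys_below n :: 'a::{finite,comm_ring_1} poly set)"
 "card (polys_below n :: 'a::{finite,comm_ring_1} poly set) = CARD('a) ^ n"
proof -
 let ?L = "{xs::'a list. set xs \<subseteq> UNIV \<and> length xs = n}"
 have bij: "bij_betw (\<lambda>q. map (coeff q) [0..<n]) (polys_below n) ?L"
 proof (rule bij_betwI[where g = "\<lambda>xs. Poly xs"])
  show "(\<lambda>xs. Poly xs) \<in> ?L \<rightarrow> polys_below n"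
   by (auto simp: polys_below_def nth_default_def)
  show "Poly (map (coeff q) [0..<n]) = q" if "q \<in> polys_below n" for q :: "'a poly"
   using that by (intro poly_eqI) (auto simp: polys_below_def nth_default_def)
  show "map (coeff (Poly xs)) [0..<n] = xs" if "xs \<in> ?L" for xs
   using that by (intro nth_equalityI) (auto simp: nth_default_def)
 qed auto
 have "finite ?L" "card ?L = CARD('a) ^ n"
  using finite_lists_length_eq[of "UNIV::'a set" n] card_lists_length_eq[of "UNIV::'a set" n] by auto
 then show "finite (polys_below n :: 'a poly set)" "card (polys_below n :: 'a poly set) = CARD('a) ^ n"
  using bij_betw_finite[OF bij] bij_betw_same_card[OF bij] by auto
qed

text \<open>The nonzero summand of least order at \<open>c\<close> survives modulo the next power of
  \<open>X - c\<close>, where all other summands vanish. This is how the auxiliary polynomial will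
  be seen to be nonzero.\<close>

lemma sum_nonzero_of_distinct_orders:
 fixes T :: "'i => 'a::field poly"
 assumes "finite J" "\<exists>i\<in>J. T i \<noteq> 0"
  and inj: "\<And>i j. i \<in> J ==> j \<in> J ==> T i \<noteq> 0 ==> T j \<noteq> 0 ==> order c (T i) = order c (T j) ==> i = j"
 shows "sum T J \<noteq> 0"
proof
 assume 0: "sum T J = 0"
 define N where "N = {i\<in>J. T i \<noteq> 0}"
 have N: "finite N" "N \<noteq> {}" using assms(1,2) by (auto simp: N_def)
 obtain i0 where i0: "i0 \<in> N" "\<And>i. i \<in> N ==> order c (T i0) <= order c (T i)"
  using ex_min_if_finite[of "(\<lambda>i. order c (T i)) ` N"] N
  by (metis (no_types, lifting) arg_min_if_finite(1) arg_min_least)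
 have "sum T J = sum T N" using assms(1) by (intro sum.mono_neutral_right) (auto simp: N_def)
 also have "... = T i0 + sum T (N - {i0})" using N i0 by (simp add: sum.remove)
 finally have "T i0 = - sum T (N - {i0})" using 0 by (simp add: eq_neg_iff_add_eq_0)
 moreover have "[:-c,1:] ^ Suc (order c (T i0)) dvd sum T (N - {i0})"
 proof (rule dvd_sum)
  fix i assume i: "i \<in> N - {i0}"
  then have "order c (T i0) \<noteq> order c (T i)" using inj[of i0 i] i0 by (auto simp: N_def)
  then have "Suc (order c (T i0)) <= order c (T i)" using i0(2)[of i] i by simp
  then show "[:-c,1:] ^ Suc (order c (T i0)) dvd T i" by (simp only: order_divides) auto
 qed
 ultimately have "[:-c,1:] ^ Suc (order c (T i0)) dvd T i0" by simp
 then show False using order_2[of "T i0" c] i0(1) by (auto simp: N_def)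
qed

text \<open>Each application of \<open>h * pderiv\<close> lowers the order at \<open>x\<close> by
  exactly one, since the order, being below \<open>M\<close>, is a nonzero scalar as long as it is
  positive. The factor \<open>h\<close> does not vanish at \<open>x\<close> and leaves the order
  alone.\<close>

lemma order_ge_of_derivatives:
 fixes P h :: "'a::field poly"
 assumes "M <= CHAR('a)" "poly h x \<noteq> 0" "P \<noteq> 0"
  and van: "\<And>l. l < M ==> poly (((\<lambda>Q. h * pderiv Q) ^^ l) P) x = 0"
 shows "M <= order x P"
proof (rule ccontr)
 define s where "s = order x P"
 assume "\<not> M <= order x P"
 then have sM: "s < M" by (simp add: s_def)
 obtain Q where Q: "P = [:-x,1:] ^ s * Q" "\<not> [:-x,1:] dvd Q"
  using order_decomp[OF \<open>P \<noteq> 0\<close>, of x] by (auto simp: s_def)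
 have "\<exists>R. ((\<lambda>Q. h * pderiv Q) ^^ j) P = [:-x,1:] ^ (s - j) * R \<and> poly R x \<noteq> 0" if "j <= s" for j
  using that
 proof (induction j)
  case 0
  then show ?case using Q by (intro exI[of _ Q]) (auto simp: poly_eq_0_iff_dvd)
 next
  case (Suc j)
  then obtain R where R: "((\<lambda>Q. h * pderiv Q) ^^ j) P = [:-x,1:] ^ (s - j) * R" "poly R x \<noteq> 0" by auto
  obtain n where n: "s - j = Suc n" "s - Suc j = n" using Suc.prems by (metis Suc_diff_Suc Suc_le_lessD)
  have "of_nat (Suc n) \<noteq> (0::'a)"
  proof
   assume "of_nat (Suc n) = (0::'a)"
   then have "CHAR('a) dvd Suc n" by (simp only: of_nat_eq_0_iff_char_dvd)
   then have "CHAR('a) <= Suc n" by (rule dvd_imp_le) simp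
   then show False using sM assms(1) n by simp
  qed
  moreover have "((\<lambda>Q. h * pderiv Q) ^^ Suc j) P
    = [:-x,1:] ^ n * (smult (of_nat (Suc n)) (h * R) + [:-x,1:] * (h * pderiv R))"
   by (simp add: R n pderiv_mult pderiv_power_Suc pderiv_pCons algebra_simps del: power_Suc)
     (simp add: algebra_simps)
  ultimately show ?case using R assms(2) n
   by (intro exI[of _ "smult (of_nat (Suc n)) (h * R) + [:-x,1:] * (h * pderiv R)"]) (simp del: of_nat_Suc)
 qed
 from this[of s] obtain R where "((\<lambda>Q. h * pderiv Q) ^^ s) P = R" "poly R x \<noteq> 0" by auto
 then show False using van[OF sM] by simp
qed

lemma sum_orders_le_degree:
 fixes P :: "'a::field poly"
 assumes "finite A" "P \<noteq> 0" "\<And>x. x \<in> A ==> M <= order x P"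
 shows "card A * M <= degree P"
proof -
 have "card A * M <= (\<Sum>x\<in>A. count (proots P) x)"
  using assms sum_mono[of A "\<lambda>_. M" "\<lambda>x. count (proots P) x"] by simp
 also have "... <= size (proots P)"
 proof -
  have "(\<Sum>x\<in>A. count (proots P) x) = (\<Sum>x\<in>A \<inter> set_mset (proots P). count (proots P) x)"
   using assms(1) by (intro sum.mono_neutral_right) (auto simp: not_in_iff)
  also have "... <= size (proots P)"
   unfolding size_multiset_overloaded_eq by (intro sum_mono2) auto
  finally show ?thesis .
 qed
 also have "... <= degree P" by (rule size_proots_le)
 finally show ?thesis .
qed

text \<open>Iterating \<open>h * pderiv\<close> instead of \<open>pderiv\<close> keeps the exponent
  of \<open>h\<close> fixed: the image of \<open>k * h ^ n * w\<close>, with \<open>w\<close> of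
  zero derivative, is a coefficient times the same \<open>h ^ n * w\<close>. These are the
  coefficients; one step raises the degree bound by no more than the bound for
  \<open>h\<close>.\<close>

fun stepanov_coeff :: "'a::field poly => nat => nat => 'a poly => 'a poly" where
 "stepanov_coeff h n 0 k = k"
| "stepanov_coeff h n (Suc l) k =
   h * pderiv (stepanov_coeff h n l k) + smult (of_nat n) (pderiv h * stepanov_coeff h n l k)"

lemma stepanov_coeff_below:
 assumes "degree h <= m" "k \<in> polys_below n"
 shows "stepanov_coeff h u l k \<in> polys_below (n + l * m)"
proof (induction l)
 case (Suc l)
 have "degree (pderiv h) <= m" using assms(1)
  by (intro degree_le) (auto simp: coeff_pderiv coeff_eq_0)
 then show ?case
  using polys_below_mult[OF Suc \<open>degree (pderiv h) <= m\<close>] polys_below_mult[OF polys_below_pderiv[OF Suc] assms(1)]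
  by (auto intro!: polys_below_add polys_below_smult simp: algebra_simps)
qed (use assms in auto)

lemma stepanov_coeff_diff:
 "stepanov_coeff h u l (k - k') = stepanov_coeff h u l k - stepanov_coeff h u l k'"
 by (induction l) (simp_all add: pderiv_diff ring_distribs smult_diff_right)

text \<open>In the application \<open>w\<close> is a \<open>p\<close>-th power, hence a constant for
  differentiation in characteristic \<open>p\<close>.\<close>

lemma stepanov_derivative:
 fixes h w :: "'a::field poly"
 assumes "pderiv w = 0"
 shows "((\<lambda>Q. h * pderiv Q) ^^ l) (k * h ^ n * w) = stepanov_coeff h n l k * h ^ n * w"
proof (induction l)
 case (Suc l)
 have *: "h * pderiv (h ^ n) = smult (of_nat n) (pderiv h * h ^ n)"
  by (cases n) (simp_all add: pderiv_power_Suc mult_ac del: power_Suc, simp add: mult_ac)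
 have "((\<lambda>Q. h * pderiv Q) ^^ Suc l) (k * h ^ n * w) = h * pderiv (stepanov_coeff h n l k * h ^ n * w)"
  by (simp add: Suc)
 also have "... = h * pderiv (stepanov_coeff h n l k) * h ^ n * w
   + stepanov_coeff h n l k * (h * pderiv (h ^ n)) * w"
  by (simp add: pderiv_mult assms algebra_simps)
 also have "... = stepanov_coeff h n (Suc l) k * h ^ n * w"
  unfolding * by (simp add: algebra_simps)
 finally show ?case .
qed simp

lemma funpow_pderiv_sum:
 fixes h :: "'a::field poly"
 shows "((\<lambda>Q. h * pderiv Q) ^^ l) (\<Sum>i\<in>I. f i) = (\<Sum>i\<in>I. ((\<lambda>Q. h * pderiv Q) ^^ l) (f i))"
 by (induction l) (simp_all add: pderiv_sum sum_distrib_left)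


text \<open>Pigeonhole in place of linear algebra: there are more families \<open>k\<close> of
  polynomials of degree below \<open>K\<close> than there are possible values of the
  \<open>M\<close> expressions, so two families collide. All expressions are additive in
  \<open>k\<close>, and the difference of the two families is a nonzero solution.\<close>

lemma stepanov_coeffs_exist:
 fixes h :: "'a::finite_field poly"
 assumes h: "degree h <= m" and count: "(\<Sum>l<M. K + l * m + I) < I * d * K"
 shows "\<exists>k. (\<forall>i<I. \<forall>j<d. k (i, j) \<in> polys_below K) \<and> (\<exists>i<I. \<exists>j<d. k (i, j) \<noteq> 0) \<and>
  (\<forall>l<M. (\<Sum>(i, j)\<in>{..<I} \<times> {..<d}. smult (a ^ j) (stepanov_coeff h (t * j) l (k (i, j))) * [:-c,1:] ^ i) = 0)"
proof -
 define J where "J = {..<I} \<times> {..<d}"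
 define F where "F = (\<lambda>k l. \<Sum>(i, j)\<in>J. smult (a ^ j) (stepanov_coeff h (t * j) l (k (i, j))) * [:-c,1:] ^ i)"
 define S where "S = PiE J (\<lambda>_. polys_below K :: 'a poly set)"
 define R where "R = PiE {..<M} (\<lambda>l. polys_below (K + l * m + I) :: 'a poly set)"
 have J: "finite J" "card J = I * d" by (auto simp: J_def)
 have "(\<lambda>k. \<lambda>l\<in>{..<M}. F k l) \<in> S \<rightarrow> R"
 proof
  fix k assume k: "k \<in> S"
  have "F k l \<in> polys_below (K + l * m + I)" for l
   unfolding F_def
  proof (intro polys_below_sum, clarify)
   fix i j assume ij: "(i, j) \<in> J"
   then have "k (i, j) \<in> polys_below K" using k by (auto simp: S_def)
   from stepanov_coeff_below[OF h this] have "stepanov_coeff h (t * j) l (k (i, j)) \<in> polys_below (K + l * m)" .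
   from polys_below_mult[OF polys_below_smult[OF this], of "[:-c,1:] ^ i" I "a ^ j"]
   show "smult (a ^ j) (stepanov_coeff h (t * j) l (k (i, j))) * [:-c,1:] ^ i \<in> polys_below (K + l * m + I)"
    using ij by (simp add: J_def degree_power_eq mult.commute)
  qed
  then show "(\<lambda>l\<in>{..<M}. F k l) \<in> R" by (auto simp: R_def)
 qed
 then have im: "(\<lambda>k. \<lambda>l\<in>{..<M}. F k l) ` S \<subseteq> R" by auto
 have cS: "card S = CARD('a) ^ (I * d * K)"
  using J by (simp add: S_def card_PiE card_polys_below power_mult[symmetric] mult.commute)
 have cR: "card R = CARD('a) ^ (\<Sum>l<M. K + l * m + I)" "finite R"
  unfolding R_def by (auto simp: card_PiE card_polys_below power_sum[symmetric] intro!: finite_PiE)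
 have "1 < CARD('a)" using card_mono[of UNIV "{0::'a, 1}"] by simp
 then have "card R < card S" unfolding cS cR using count by (intro power_strict_increasing)
 then have "\<not> inj_on (\<lambda>k. \<lambda>l\<in>{..<M}. F k l) S"
  using card_inj_on_le[OF _ im cR(2)] by auto
 then obtain k k' where kk: "k \<in> S" "k' \<in> S" "k \<noteq> k'" "(\<lambda>l\<in>{..<M}. F k l) = (\<lambda>l\<in>{..<M}. F k' l)"
  by (auto simp: inj_on_def)
 have "F (\<lambda>x. k x - k' x) l = 0" if "l < M" for l
 proof -
  have "F k l = F k' l" using kk(4) that by (auto simp: fun_eq_iff restrict_def split: if_splits)
  moreover have "F (\<lambda>x. k x - k' x) l = F k l - F k' l"
   unfolding F_def sum_subtractf[symmetric]
   by (intro sum.cong) (auto simp: stepanov_coeff_diff smult_diff_right algebra_simps)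
  ultimately show ?thesis by simp
 qed
 moreover have "\<exists>x\<in>J. k x \<noteq> k' x"
  using kk(1-3) unfolding S_def by (metis PiE_ext)
 moreover have "k x - k' x \<in> polys_below K" if "x \<in> J" for x
  using kk that by (auto simp: S_def intro!: polys_below_diff)
 ultimately show ?thesis
  by (intro exI[of _ "\<lambda>x. k x - k' x"]) (auto simp: J_def F_def)
qed

lemma pderiv_power_char:
 "CHAR('a) dvd n ==> pderiv ((w :: 'a::field poly) ^ n) = 0"
 by (simp add: pderiv_power of_nat_eq_0_iff_char_dvd)

text \<open>The auxiliary polynomial is the sum of
  \<open>k (i, j) * h ^ (t * j) * w ^ (p * i)\<close> with \<open>w = X - c\<close>. At a point
  where \<open>h ^ t\<close> takes the value \<open>a\<close>, the identity
  \<open>w(x) ^ p = w(x)\<close> turns its iterated derivatives into the low degree expressions that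
  \<open>stepanov_coeffs_exist\<close> makes vanish. So every such point is a zero of order at least
  \<open>M\<close>, while the degree is at most \<open>p * (1 + m + I)\<close>.\<close>

lemma stepanov_zeros:
 fixes h :: "'a::finite_field poly"
 defines "p \<equiv> CARD('a)"
 assumes char: "CHAR('a) = p" and dt: "d * t = p - 1" and h: "h \<noteq> 0" "degree h <= m"
  and e: "order c h = e" "coprime e d" "e < d"
  and K: "d * K + (d - 1) * e < p" "K <= p" and M: "M <= p"
  and count: "(\<Sum>l<M. K + l * m + I) < I * d * K"
 shows "card {x. poly h x \<noteq> 0 \<and> poly h x ^ t = a} * M <= p * (1 + m + I)"
proof -
 define A where "A = {x. poly h x \<noteq> 0 \<and> poly h x ^ t = a}"
 define w where "w = [:-c,1:]"
 define J where "J = {..<I} \<times> {..<d}"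
 obtain k where k: "\<And>i j. i < I ==> j < d ==> k (i, j) \<in> polys_below K" "\<exists>x\<in>J. k x \<noteq> 0"
  "\<And>l. l < M ==> (\<Sum>(i, j)\<in>J. smult (a ^ j) (stepanov_coeff h (t * j) l (k (i, j))) * w ^ i) = 0"
  using stepanov_coeffs_exist[OF h(2) count, of a t c] unfolding J_def w_def by blast
 define T where "T = (\<lambda>(i, j). k (i, j) * h ^ (t * j) * w ^ (p * i))"
 define P where "P = sum T J"
 have w0: "w \<noteq> 0" by (simp add: w_def)
 have T0: "T x \<noteq> 0 \<longleftrightarrow> k x \<noteq> 0" for x using h w0 by (auto simp: T_def split: prod.splits)
 have p: "p > 0" by (simp add: p_def card_gt_0_iff)
 have oT: "order c (T (i, j)) = order c (k (i, j)) + t * j * e + p * i" if "k (i, j) \<noteq> 0" for i j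
 proof -
  have "order c (w ^ n) = n" for n unfolding w_def by (rule order_power_n_n)
  moreover have "order c (h ^ n) = n * e" for n
   using h e(1) by (induction n) (simp_all add: order_mult)
  ultimately show ?thesis
   using T0[of "(i, j)"] that by (simp add: T_def order_mult)
 qed
 have P0: "P \<noteq> 0"
  unfolding P_def
 proof (rule sum_nonzero_of_distinct_orders)
  show "finite J" by (simp add: J_def)
  show "\<exists>x\<in>J. T x \<noteq> 0" using k(2) T0 by blast
  fix x y assume xy: "x \<in> J" "y \<in> J" "T x \<noteq> 0" "T y \<noteq> 0" "order c (T x) = order c (T y)"
  obtain i j i' j' where ij: "x = (i, j)" "y = (i', j')" by (cases x, cases y)
  have lt: "i < I" "j < d" "i' < I" "j' < d" using xy ij by (auto simp: J_def)
  have nz: "k (i, j) \<noteq> 0" "k (i', j') \<noteq> 0" using xy ij T0 by auto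
  define s s' where "s = order c (k (i, j))" and "s' = order c (k (i', j'))"
  have "s < K" "s' < K" using order_degree[OF nz(1), of c] order_degree[OF nz(2), of c] k(1)[OF lt(1,2)] k(1)[OF lt(3,4)] nz
   by (auto simp: polys_below_iff s_def s'_def)
  then have sK: "int d * s <= d * K" "int d * s' <= d * K" "0 <= int d * s" "0 <= int d * s'"
   by (auto simp flip: of_nat_mult)
  \<comment> \<open>Multiplying the orders by \<open>d\<close> turns \<open>d * t\<close> into
    \<open>p - 1\<close>. The identity then equates a multiple of \<open>p\<close> with a quantity
    of absolute value below \<open>p\<close>, so both are 0; coprimality of \<open>e\<close> and
    \<open>d\<close> yields \<open>j = j'\<close>, and \<open>i = i'\<close> follows.\<close>
  have "d * (s + t * j * e + p * i) = d * (s' + t * j' * e + p * i')"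
   using xy(5) ij nz by (simp add: oT s_def s'_def)
  then have "int d * s + int (d * t) * j * e + int d * p * i = int d * s' + int (d * t) * j' * e + int d * p * i'"
   by (simp only: of_nat_mult[symmetric] of_nat_add[symmetric] of_nat_eq_iff) (simp add: algebra_simps)
  moreover have dt': "int (d * t) = int p - 1" using dt p by simp
  ultimately have eq: "int p * ((int j - int j') * e + int d * (int i - int i')) = int d * s' - int d * s + (int j - int j') * e"
   unfolding dt' by (simp add: algebra_simps)
  have "\<bar>(int j - int j') * e\<bar> <= int ((d - 1) * e)"
   unfolding abs_mult of_nat_mult using lt by (intro mult_mono) auto
  then have "\<bar>int d * s' - int d * s + (int j - int j') * e\<bar> < int p"
   using sK K by linarith
  then have "\<bar>int p * ((int j - int j') * e + int d * (int i - int i'))\<bar> < int p" by (simp only: eq)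
  then have "(int j - int j') * e + int d * (int i - int i') = 0"
   using p by (simp add: abs_mult)
  then have "(int j - int j') * e = int d * (int i' - int i)" by (simp add: algebra_simps)
  then have "int d dvd (int j - int j') * e" by simp
  moreover have "coprime (int d) (int e)" using e(2) by (simp add: coprime_commute)
  ultimately have "int d dvd int j - int j'" by (simp add: coprime_dvd_mult_left_iff)
  then have "j = j'" using lt zdvd_imp_le[of "int d" "\<bar>int j - int j'\<bar>"] by (cases "j = j'") auto
  moreover from this have "i = i'"
   using \<open>(int j - int j') * e + int d * (int i - int i') = 0\<close> lt by simp
  ultimately show "x = y" by (simp add: ij)
 qed
 have deg: "degree P <= p * (1 + m + I)"
  unfolding P_def
 proof (intro degree_sum_le)
  fix x assume x: "x \<in> J"
  obtain i j where ij: "x = (i, j)" by (cases x)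
  have lt: "i < I" "j < d" using x ij by (auto simp: J_def)
  have "degree (T x) <= degree (k (i, j)) + degree (h ^ (t * j)) + degree (w ^ (p * i))"
   unfolding T_def ij by (simp add: degree_mult_le order_trans[OF degree_mult_le] add_mono)
  also have "degree (w ^ (p * i)) = p * i" by (simp add: w_def degree_power_eq)
  also have "p * i <= p * I" using lt by simp
  also have "degree (h ^ (t * j)) <= (t * j) * m" using h by (simp add: degree_power_eq)
  also have "t * j <= d * t" using lt by (simp add: mult.commute)
  also have "d * t <= p" using dt by simp
  also have "degree (k (i, j)) <= p" using k(1)[OF lt] K by (auto simp: polys_below_iff)
  finally show "degree (T x) <= p * (1 + m + I)" by (simp add: algebra_simps)
 qed (simp add: J_def)
 have "M <= order x P" if x: "x \<in> A" for x
 proof (rule order_ge_of_derivatives[where h = h])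
  fix l assume l: "l < M"
  have "poly (((\<lambda>Q. h * pderiv Q) ^^ l) P) x = (\<Sum>y\<in>J. poly (((\<lambda>Q. h * pderiv Q) ^^ l) (T y)) x)"
   unfolding P_def funpow_pderiv_sum poly_sum ..
  also have "... = (\<Sum>(i, j)\<in>J. poly (smult (a ^ j) (stepanov_coeff h (t * j) l (k (i, j))) * w ^ i) x)"
  proof (intro sum.cong refl, clarify)
   fix i j
   have "((\<lambda>Q. h * pderiv Q) ^^ l) (T (i, j)) = stepanov_coeff h (t * j) l (k (i, j)) * h ^ (t * j) * w ^ (p * i)"
    unfolding T_def prod.case by (rule stepanov_derivative) (simp add: pderiv_power_char char)
   moreover have "poly h x ^ (t * j) = a ^ j" using x by (simp add: A_def power_mult)
   moreover have "poly w x ^ (p * i) = poly w x ^ i"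
    by (simp add: power_mult p_def finite_field_power_card_eq_same)
   ultimately show "poly (((\<lambda>Q. h * pderiv Q) ^^ l) (T (i, j))) x
     = poly (smult (a ^ j) (stepanov_coeff h (t * j) l (k (i, j))) * w ^ i) x" by simp
  qed
  also have "... = poly (\<Sum>(i, j)\<in>J. smult (a ^ j) (stepanov_coeff h (t * j) l (k (i, j))) * w ^ i) x"
   unfolding poly_sum by (intro sum.cong) auto
  also have "... = 0" using k(3)[OF l] by simp
  finally show "poly (((\<lambda>Q. h * pderiv Q) ^^ l) P) x = 0" .
 qed (use M char x P0 in \<open>auto simp: A_def\<close>)
 then have "card A * M <= degree P" using P0 by (intro sum_orders_le_degree) (auto simp: A_def)
 then show ?thesis using deg by (simp add: A_def)
qed

text \<open>The order \<open>M\<close> is about \<open>sqrt p\<close>, \<open>K\<close> is nearly as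
  large as nonvanishing of the auxiliary polynomial permits, and \<open>I\<close> is as small as the
  coefficient count permits. Dividing the degree by \<open>M\<close> leaves the expected
  \<open>p / d\<close> from \<open>M div d\<close> and a multiple of \<open>sqrt p\<close> from the
  rest.\<close>

lemma stepanov_bound:
 fixes h :: "'a::finite_field poly" and d t m e :: nat
 defines "p \<equiv> CARD('a)"
 assumes char: "CHAR('a) = p" and dt: "d * t = p - 1" and h: "h \<noteq> 0" "degree h <= m"
  and e: "order c h = e" "coprime e d" "e < d" and p: "64 + 2 * (d\<^sup>2 + d) <= p"
 shows "real (card {x. poly h x \<noteq> 0 \<and> poly h x ^ t = a}) <= p / d + (10 * m + 12) * sqrt p"
proof -
 \<comment> \<open>Subtracting \<open>d\<close> leaves room for the term
   \<open>(d - 1) * e < d * d\<close> in the condition that keeps the orders distinct.\<close>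
 define K where "K = p div d - d"
 define M where "M = nat \<lfloor>sqrt p\<rfloor>"
 \<comment> \<open>With \<open>8 * M <= p\<close> and \<open>2 * d * K >= p\<close> the count
   reduces to \<open>8 * m + 8 + q < 4 * (q - 1)\<close>, which this value satisfies.\<close>
 define q where "q = 4 * m + 5"
 define I where "I = M div d + q"
 have d: "d >= 1" using e by simp
 have p64: "64 <= p" using p by simp
 have Ms: "real M <= sqrt p" "sqrt p < real M + 1" unfolding M_def by (simp, linarith)
 have "real M * real M <= sqrt p * sqrt p" using Ms by (intro mult_mono) auto
 then have MM: "M * M <= p" by (simp flip: of_nat_mult)
 have M8: "8 * M <= p"
 proof (rule ccontr)
  assume "\<not> 8 * M <= p"
  then have "M * M < 8 * M" using MM by linarith
  then have "M < 8" using mult_less_cancel2[of M M 8] by blast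
  then show False using \<open>\<not> 8 * M <= p\<close> p64 by simp
 qed
 have "p div d >= d"
 proof -
  have "d * d <= p" using p by (simp add: power2_eq_square)
  then show ?thesis using d by (simp add: less_eq_div_iff_mult_less_eq)
 qed
 then have dK: "d * K + d * d = d * (p div d)" by (simp add: K_def diff_mult_distrib2)
 have dp: "d * (p div d) <= p" "p < d * (p div d) + d"
  using d by (simp_all add: mult.commute) (metis add.commute add_less_cancel_right d div_mult_mod_eq mod_less_divisor mult.commute less_eq_Suc_le One_nat_def nat_add_left_cancel_less)
 have dK2: "2 * (d * K) >= p" using dK dp p by (simp add: power2_eq_square)
 have "(d - 1) * e <= (d - 1) * (d - 1)" using e by (intro mult_mono) auto
 also have "... < d * d" using d by (cases d) auto
 finally have c1: "d * K + (d - 1) * e < p" using dK dp(1) by linarith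
 have c2: "K <= p" using c1 d by (metis add_leD1 less_imp_le mult_le_mono1 mult_1 order_trans)
 have "(\<Sum>l<M. K + l * m + I) <= (\<Sum>l<M. K + M * m + I)" by (intro sum_mono) auto
 also have "... = M * K + M * M * m + M * I" by (simp add: algebra_simps)
 also have "M * M * m <= p * m" using MM by simp
 also have "M * I <= p + M * q"
 proof -
  have "M * (M div d) <= M * M" by (intro mult_le_mono2) simp
  moreover have "M * I = M * (M div d) + M * q" by (simp add: I_def algebra_simps)
  ultimately show ?thesis using MM by linarith
 qed
 finally have s1: "(\<Sum>l<M. K + l * m + I) <= M * K + p * m + (p + M * q)" by simp
 have "d * I >= M + d * (q - 1)"
 proof -
  have "M < d * (M div d) + d" using d
   by (metis add.commute div_mult_mod_eq less_eq_Suc_le One_nat_def mod_less_divisor mult.commute nat_add_left_cancel_less)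
  then show ?thesis by (simp add: I_def q_def algebra_simps)
 qed
 then have "I * d * K >= (M + d * (q - 1)) * K" by (simp add: mult.commute)
 also have "(M + d * (q - 1)) * K = M * K + (q - 1) * (d * K)" by (simp add: algebra_simps)
 finally have s2: "I * d * K >= M * K + (q - 1) * (d * K)" by simp
 have "p * m + (p + M * q) < (q - 1) * (d * K)"
 proof -
  have "8 * (p * m + (p + M * q)) = 8 * p * m + 8 * p + (8 * M) * q" by (simp add: algebra_simps)
  also have "... <= 8 * p * m + 8 * p + p * q" using M8 by (intro add_left_mono mult_right_mono) auto
  also have "... < 4 * ((q - 1) * p)" using p64 by (simp add: q_def algebra_simps)
  also have "... <= 4 * ((q - 1) * (2 * (d * K)))" using dK2 by (intro mult_le_mono2) auto
  finally show ?thesis by simp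
 qed
 with s1 s2 have c3: "(\<Sum>l<M. K + l * m + I) < I * d * K" by linarith
 have Mp: "M <= p" using M8 by simp
 have "M >= 1"
 proof -
  have "sqrt p >= sqrt 64" using p64 by (intro real_sqrt_le_mono) simp
  moreover have "sqrt 64 = (8::real)" by (rule real_sqrt_unique) auto
  ultimately have "real M >= 1" using Ms by linarith
  then show ?thesis by simp
 qed
 define C where "C = card {x. poly h x \<noteq> 0 \<and> poly h x ^ t = a}"
 have "C * M <= p * (1 + m + I)" unfolding C_def p_def
  by (rule stepanov_zeros[where d = d and K = K and e = e and c = c])
    (use char dt h e c1 c2 c3 Mp in \<open>simp_all add: p_def\<close>)
 also have "real (p * (1 + m + I)) <= p * (1 + m + q + M / d)"
 proof -
  have "real (1 + m + I) <= 1 + m + q + M / d"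
   using of_nat_div_le_of_nat[of M d, where 'a = real] by (simp add: I_def)
  then show ?thesis unfolding of_nat_mult by (intro mult_left_mono) auto
 qed
 finally have "C * M <= p * (1 + m + q + M / d)" by simp
 then have "C <= p * (1 + m + q + M / d) / M"
  using \<open>M >= 1\<close> by (simp add: pos_le_divide_eq)
 also have "... = p / d + (5 * m + 6) * (p / M)" using \<open>M >= 1\<close> d by (simp add: field_simps q_def)
 also have "(5 * m + 6) * (p / M) <= (5 * m + 6) * (2 * sqrt p)"
 proof (intro mult_left_mono)
  have "sqrt p * sqrt p <= (2 * M) * sqrt p" using Ms \<open>M >= 1\<close> by (intro mult_right_mono) auto
  then show "p / M <= 2 * sqrt p" using \<open>M >= 1\<close> by (simp add: pos_divide_le_eq mult_ac)
 qed simp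
 finally show ?thesis by (simp add: C_def algebra_simps)
qed

text \<open>Stated with congruences of integers, the bound is a property of the number
  \<open>p\<close> and mentions no field. The root \<open>- \<beta> i0\<close>, distinct from the
  others modulo \<open>p\<close> and of multiplicity coprime to \<open>d\<close>, takes the role of
  \<open>c\<close>. Since \<open>a\<close> is a unit, zeros of the polynomial are not
  counted.\<close>

definition stepanov_holds :: "nat => bool" where
 "stepanov_holds p \<longleftrightarrow> (\<forall>(d::nat) t k (\<beta> :: nat => int) (e :: nat => nat) i0 a.
   d * t = p - 1 --> i0 < k --> (\<forall>j<k. j \<noteq> i0 --> \<not> int p dvd \<beta> j - \<beta> i0) -->
   coprime (e i0) d --> e i0 < d --> (\<forall>j<k. e j <= d) --> \<not> int p dvd a --> 64 + 2 * (d\<^sup>2 + d) <= p -->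
   real (card {x\<in>{0..<int p}. [(\<Prod>j<k. (x + \<beta> j) ^ e j) ^ t = a] (mod int p)})
    <= p / d + (10 * real (k * d) + 12) * sqrt p)"

text \<open>Types cannot depend on a prime, so the field with \<open>p\<close> elements is built for one
 prime only, chosen to violate the bound if any prime does.\<close>

definition bad_prime :: nat where
 "bad_prime = (if \<exists>p. prime p \<and> \<not> stepanov_holds p then SOME p. prime p \<and> \<not> stepanov_holds p else 2)"

lemma prime_bad_prime: "prime bad_prime"
 and stepanov_bad_prime: "stepanov_holds bad_prime ==> prime p ==> stepanov_holds p"
proof -
 show "prime bad_prime"
  using someI_ex[of "\<lambda>p. prime p \<and> \<not> stepanov_holds p"] by (auto simp: bad_prime_def)
 show "stepanov_holds p" if "stepanov_holds bad_prime" "prime p"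
  using that someI_ex[of "\<lambda>p. prime p \<and> \<not> stepanov_holds p"] by (auto simp: bad_prime_def split: if_splits)
qed

section \<open>The prime field with \<open>bad_prime\<close> elements\<close>

typedef bad_index = "{0..<bad_prime}"
 using prime_gt_0_nat[OF prime_bad_prime] by auto

lemma CARD_bad_index: "CARD(bad_index) = bad_prime"
 using type_definition.card[OF type_definition_bad_index] by simp

instance bad_index :: finite
proof
 show "finite (UNIV :: bad_index set)"
  using type_definition.univ[OF type_definition_bad_index] by (metis finite_atLeastLessThan finite_imageI)
qed

instance bad_index :: prime_card
 by standard (simp add: CARD_bad_index prime_bad_prime)

lemma of_int_eq_mod_ring_iff:
 "(of_int a :: 'a::prime_card mod_ring) = of_int b \<longleftrightarrow> [a = b] (mod int CARD('a))"
 unfolding of_int_of_int_mod_ring by transfer (simp add: cong_def)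

lemma bij_betw_of_int_mod_ring:
 "bij_betw (of_int :: int => 'a::prime_card mod_ring) {0..<int CARD('a)} UNIV"
 unfolding of_int_of_int_mod_ring
 by (rule bij_betwI[where g = to_int_mod_ring])
   (use range_to_int_mod_ring[where 'a = 'a] in auto)

lemma stepanov_holds_card:
 assumes "CARD('a::prime_card) = p"
 shows "stepanov_holds p"
 unfolding stepanov_holds_def
proof (intro allI impI)
 fix d t k :: nat and \<beta> :: "nat => int" and e :: "nat => nat" and i0 a
 assume dt: "d * t = p - 1" and i0: "i0 < k" and dist: "\<forall>j<k. j \<noteq> i0 --> \<not> int p dvd \<beta> j - \<beta> i0"
  and cop: "coprime (e i0) d" and lt: "e i0 < d" and le: "\<forall>j<k. e j <= d" and a: "\<not> int p dvd a"
  and p: "64 + 2 * (d\<^sup>2 + d) <= p"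
 define h :: "'a mod_ring poly" where "h = (\<Prod>j<k. [:of_int (\<beta> j), 1:] ^ e j)"
 have h0: "h \<noteq> 0" by (auto simp: h_def)
 have ph: "poly h (of_int x) = of_int (\<Prod>j<k. (x + \<beta> j) ^ e j)" for x
  by (simp add: h_def poly_prod add.commute)
 have t: "t > 0" using dt p by (cases t) auto
 have deg: "degree h <= k * d"
 proof -
  have "degree h = (\<Sum>j<k. e j)" unfolding h_def by (subst degree_prod_eq_sum_degree) (auto simp: degree_power_eq)
  also have "... <= (\<Sum>j<k. d)" using le by (intro sum_mono) auto
  finally show ?thesis by simp
 qed
 have ord: "order (- of_int (\<beta> i0)) h = e i0"
 proof -
  have h': "h = [:of_int (\<beta> i0), 1:] ^ e i0 * (\<Prod>j\<in>{..<k} - {i0}. [:of_int (\<beta> j), 1:] ^ e j)"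
   unfolding h_def using i0 by (subst prod.remove[of _ i0]) auto
  have "poly (\<Prod>j\<in>{..<k} - {i0}. [:of_int (\<beta> j), 1:] ^ e j) (- of_int (\<beta> i0)) \<noteq> (0 :: 'a mod_ring)"
  proof -
   have "(of_int (\<beta> j) :: 'a mod_ring) \<noteq> of_int (\<beta> i0)" if "j < k" "j \<noteq> i0" for j
    using that dist assms by (simp add: of_int_eq_mod_ring_iff cong_iff_dvd_diff)
   then show ?thesis by (auto simp: poly_prod)
  qed
  then have "order (- of_int (\<beta> i0)) (\<Prod>j\<in>{..<k} - {i0}. [:of_int (\<beta> j), 1:] ^ e j :: 'a mod_ring poly) = 0"
   by (simp add: order_0I)
  moreover have "order (- of_int (\<beta> i0)) ([:of_int (\<beta> i0), 1:] ^ e i0 :: 'a mod_ring poly) = e i0"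
   using order_power_n_n[of "- of_int (\<beta> i0) :: 'a mod_ring" "e i0"] by simp
  ultimately show ?thesis using h0 unfolding h' by (subst order_mult) auto
 qed
 let ?S = "{x\<in>{0..<int p}. [(\<Prod>j<k. (x + \<beta> j) ^ e j) ^ t = a] (mod int p)}"
 let ?Z = "{x. poly h x \<noteq> 0 \<and> poly h x ^ t = of_int a}"
 have a0: "(of_int a :: 'a mod_ring) \<noteq> 0"
  using a assms of_int_eq_mod_ring_iff[of a 0, where 'a = 'a] by (auto simp: cong_0_iff)
 have "(of_int :: int => 'a mod_ring) ` ?S \<subseteq> ?Z"
 proof clarify
  fix x assume "[(\<Prod>j<k. (x + \<beta> j) ^ e j) ^ t = a] (mod int p)"
  then have "(of_int ((\<Prod>j<k. (x + \<beta> j) ^ e j) ^ t) :: 'a mod_ring) = of_int a"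
   by (simp only: of_int_eq_mod_ring_iff assms)
  then have *: "poly h (of_int x) ^ t = of_int a" by (simp only: ph of_int_power)
  moreover have "poly h (of_int x) \<noteq> 0" using * a0 zero_power[OF t] by metis
  ultimately show "poly h (of_int x) \<noteq> 0 \<and> poly h (of_int x) ^ t = of_int a" by simp
 qed
 moreover have "inj_on (of_int :: int => 'a mod_ring) ?S"
  using bij_betw_of_int_mod_ring[where 'a = 'a] assms by (auto simp: bij_betw_def intro: inj_on_subset)
 ultimately have "card ?S <= card ?Z" by (intro card_inj_on_le[of of_int]) auto
 also have "real (card ?Z) <= CARD('a mod_ring) / d + (10 * (k * d) + 12) * sqrt CARD('a mod_ring)"
  by (rule stepanov_bound[where c = "- of_int (\<beta> i0)" and e = "e i0"])
    (use dt h0 deg ord cop lt p assms in auto)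
 finally show "real (card ?S) <= p / d + (10 * real (k * d) + 12) * sqrt p" using assms by simp
qed

lemma stepanov:
 assumes "prime p" shows "stepanov_holds p"
 using stepanov_bad_prime[OF stepanov_holds_card[OF CARD_bad_index]] assms by blast

section \<open>Complete character sums modulo a prime\<close>

text \<open>A Dirichlet character as a function on all integers that vanishes off the units;
  characters of different moduli can then be multiplied pointwise, and a character may be regarded
  under another modulus without changing the function.\<close>

definition dchar :: "nat => (int => complex) => bool" where
 "dchar m \<xi> \<longleftrightarrow> (\<forall>a b. \<xi> (a * b) = \<xi> a * \<xi> b) \<and> (\<forall>a b. [a = b] (mod int m) --> \<xi> a = \<xi> b) \<and>
   (\<forall>a. \<xi> a \<noteq> 0 \<longleftrightarrow> coprime a (int m))"

definition trivial_char :: "nat => (int => complex) => bool" where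
 "trivial_char m \<xi> \<longleftrightarrow> (\<forall>a. coprime a (int m) --> \<xi> a = 1)"

definition order_dvd :: "nat => nat => (int => complex) => bool" where
 "order_dvd Y m \<xi> \<longleftrightarrow> (\<forall>a. coprime a (int m) --> \<xi> a ^ Y = 1)"

lemma dchar_mult: "dchar m \<xi> ==> \<xi> (a * b) = \<xi> a * \<xi> b"
 and dchar_cong: "dchar m \<xi> ==> [a = b] (mod int m) ==> \<xi> a = \<xi> b"
 and dchar_eq_0_iff: "dchar m \<xi> ==> \<xi> a = 0 \<longleftrightarrow> \<not> coprime a (int m)"
 by (auto simp: dchar_def)

lemma dchar_1: assumes "dchar m \<xi>" shows "\<xi> 1 = 1"
 using dchar_mult[OF assms, of 1 1] dchar_eq_0_iff[OF assms, of 1] by simp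

lemma dchar_power: "dchar m \<xi> ==> \<xi> (a ^ n) = \<xi> a ^ n"
 by (induction n) (simp_all add: dchar_1 dchar_mult)

lemma dchar_prod: "dchar m \<xi> ==> \<xi> (\<Prod>i\<in>A. f i) = (\<Prod>i\<in>A. \<xi> (f i))"
 by (induction A rule: infinite_finite_induct) (simp_all add: dchar_1 dchar_mult)

lemma dchar_totient:
 assumes "dchar m \<xi>" "coprime a (int m)" "m > 0"
 shows "\<xi> a ^ totient m = 1"
proof -
 define b where "b = nat (a mod int m)"
 have b: "[int b = a] (mod int m)" using assms(3) by (simp add: b_def cong_def)
 then have "coprime (int b) (int m)" using assms(2) cong_imp_coprime[OF cong_sym[OF b]] by simp
 then have "coprime b m" by simp
 then have "[b ^ totient m = 1] (mod m)" by (rule euler_theorem)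
 then have "[int (b ^ totient m) = int 1] (mod int m)" by (simp only: cong_int_iff)
 moreover have "[int b ^ totient m = a ^ totient m] (mod int m)" using b by (rule cong_pow)
 ultimately have "[a ^ totient m = 1] (mod int m)" by (metis cong_sym cong_trans of_nat_1 of_nat_power)
 from dchar_cong[OF assms(1) this] show ?thesis by (simp add: dchar_power[OF assms(1)] dchar_1[OF assms(1)])
qed

lemma dchar_norm:
 assumes "dchar m \<xi>" "coprime a (int m)" "m > 0"
 shows "norm (\<xi> a) = 1"
proof -
 have "norm (\<xi> a) ^ totient m = 1" using dchar_totient[OF assms] by (metis norm_one norm_power)
 then show ?thesis using assms(3) using power_eq_imp_eq_base[of "norm (\<xi> a)" "totient m" 1] by simp
qed

lemma dchar_norm_le: "dchar m \<xi> ==> m > 0 ==> norm (\<xi> a) <= 1"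
 using dchar_norm[of m \<xi> a] dchar_eq_0_iff[of m \<xi> a] by (cases "coprime a (int m)") auto

text \<open>Conjugates become powers, so a product of values and conjugated values is a single value
  of \<psi> at a product of powers of linear factors, which is what Stepanov's method treats. The
  exponents that occur, 1 and \<open>d - 1\<close>, are both coprime to \<open>d\<close>.\<close>

lemma dchar_root_of_unity:
 assumes "dchar p \<psi>" "order_dvd d p \<psi>" "d >= 2"
 shows "cnj (\<psi> z) = \<psi> (z ^ (d - 1))"
proof (cases "coprime z (int p)")
 case True
 have 1: "\<psi> z ^ d = 1" using True assms by (simp add: order_dvd_def)
 then have "norm (\<psi> z) = 1" by (metis norm_one norm_power power_eq_1_iff assms(3) norm_ge_zero not_numeral_le_zero)
 then have "cnj (\<psi> z) * \<psi> z = 1" by (simp add: complex_norm_square[symmetric] mult.commute)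
 moreover have "\<psi> z ^ (d - 1) * \<psi> z = 1" using 1 assms(3) by (cases d) (auto simp: mult.commute)
 ultimately show ?thesis using dchar_eq_0_iff[OF assms(1), of z] True
  by (metis dchar_power[OF assms(1)] mult_right_cancel)
next
 case False
 then have "\<psi> z = 0" using assms dchar_eq_0_iff by blast
 then show ?thesis using assms by (simp add: dchar_power)
qed

text \<open>Twice the error for one class of equal character values, taken over at most
  \<open>Y\<close> classes, plus \<open>k\<close> for the zeros of the linear factors.\<close>

definition weil_const :: "nat => nat => nat" where
 "weil_const Y k = 2 * Y * (10 * (k * Y) + 2 * Y + 22) + k"

text \<open>Stepanov's method bounds each class of equal character values from above only. The
  classes together contain all but \<open>k\<close> residues, so the upper bounds force lower bounds
  as well, and the common main term \<open>p / d\<close> cancels in the sum over the powers of a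
  root of unity.\<close>

lemma local_character_sum_bound:
 fixes \<beta> :: "nat => int" and \<sigma> :: "nat => bool"
 assumes p: "prime p" and \<psi>: "dchar p \<psi>" "\<not> trivial_char p \<psi>" "order_dvd Y p \<psi>" and Y: "Y > 0"
  and i0: "i0 < k" and dist: "\<And>j. j < k ==> j \<noteq> i0 ==> \<not> int p dvd \<beta> j - \<beta> i0"
 shows "norm (\<Sum>x\<in>{0..<int p}. \<Prod>i<k. if \<sigma> i then cnj (\<psi> (x + \<beta> i)) else \<psi> (x + \<beta> i))
  <= weil_const Y k * sqrt p"
proof -
 have p1: "p > 1" using p prime_gt_1_nat by blast
 obtain g where g: "residue_primroot p g" using prime_primitive_root_exists[OF p1 p] by blast
 have gen: "\<exists>n. [z = int g ^ n] (mod int p)" if "coprime z (int p)" for z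
 proof -
  define b where "b = nat (z mod int p)"
  have b: "[int b = z] (mod int p)" using p1 by (simp add: b_def cong_def)
  have "coprime (int b) (int p)" using cong_imp_coprime[OF cong_sym[OF b] that] .
  then have "coprime b p" by simp
  moreover have "b < p" using p1 by (simp add: b_def nat_less_iff)
  moreover from \<open>coprime b p\<close> have "b > 0" using p1 by (cases b) auto
  ultimately have "b \<in> totatives p" by (simp add: in_totatives_iff)
  then obtain n where "b = g ^ n mod p"
   using residue_primroot_is_generator[OF p1 g] by (auto simp: bij_betw_def)
  then have "[int b = int g ^ n] (mod int p)" by (simp add: cong_def zmod_int)
  then show ?thesis using b by (metis cong_sym cong_trans)
 qed
 have cg: "coprime (int g) (int p)" using g by (simp add: residue_primroot_def coprime_commute)
 \<comment> \<open>The values of \<psi> have exponent \<open>Y\<close> and also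
   \<open>p - 1\<close>. Passing to the gcd makes the exponent divide \<open>p - 1\<close>, as the
   relation \<open>d * t = p - 1\<close> requires.\<close>
 define d where "d = gcd Y (p - 1)"
 define \<omega> where "\<omega> = \<psi> (int g)"
 have gn: "\<psi> z = \<omega> ^ n" if "[z = int g ^ n] (mod int p)" for z n
  using dchar_cong[OF \<psi>(1) that] by (simp add: dchar_power[OF \<psi>(1)] \<omega>_def)
 have "\<omega> ^ Y = 1" using \<psi>(3) cg by (simp add: \<omega>_def order_dvd_def)
 moreover have "\<omega> ^ (p - 1) = 1" using dchar_totient[OF \<psi>(1) cg] p p1 by (simp add: \<omega>_def totient_prime)
 ultimately have \<omega>d: "\<omega> ^ d = 1"
 proof -
  obtain u v where "Y * u = (p - 1) * v + d" using bezout_nat[of Y "p - 1"] Y by (auto simp: d_def)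
  then have "\<omega> ^ (Y * u) = \<omega> ^ ((p - 1) * v) * \<omega> ^ d" by (simp add: power_add)
  then show ?thesis using \<open>\<omega> ^ Y = 1\<close> \<open>\<omega> ^ (p - 1) = 1\<close> by (simp add: power_mult)
 qed
 have \<omega>1: "\<omega> \<noteq> 1"
 proof
  assume "\<omega> = 1"
  then have "\<psi> a = 1" if "coprime a (int p)" for a using gen[OF that] gn by fastforce
  then show False using \<psi>(2) by (auto simp: trivial_char_def)
 qed
 have d0: "d > 0" using Y by (simp add: d_def)
 have d2: "d >= 2" using \<omega>d \<omega>1 d0 by (cases "d = 1") auto
 have dY: "d <= Y" using Y by (simp add: d_def)
 define t where "t = (p - 1) div d"
 have dt: "d * t = p - 1" by (simp add: t_def d_def)
 have ordd: "order_dvd d p \<psi>"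
  unfolding order_dvd_def
 proof clarify
  fix a assume "coprime a (int p)"
  then obtain n where "\<psi> a = \<omega> ^ n" using gen gn by blast
  then have "\<psi> a ^ d = (\<omega> ^ d) ^ n" by (simp add: power_mult[symmetric] mult.commute)
  then show "\<psi> a ^ d = 1" by (simp add: \<omega>d)
 qed
 define e where "e = (\<lambda>i. if \<sigma> i then d - 1 else 1 :: nat)"
 define H where "H = (\<lambda>x. \<Prod>i<k. (x + \<beta> i) ^ e i)"
 have summand: "(\<Prod>i<k. if \<sigma> i then cnj (\<psi> (x + \<beta> i)) else \<psi> (x + \<beta> i)) = \<psi> (H x)" for x
  unfolding H_def dchar_prod[OF \<psi>(1)]
  by (intro prod.cong refl) (auto simp: e_def dchar_root_of_unity[OF \<psi>(1) ordd d2] dchar_power[OF \<psi>(1)])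
 define X where "X = {x\<in>{0..<int p}. coprime (H x) (int p)}"
 have finX: "finite X" by (rule finite_subset[of _ "{0..<int p}"]) (auto simp: X_def)
 obtain ix where ix: "\<And>x. x \<in> X ==> [H x = int g ^ ix x] (mod int p)"
 proof -
  have "\<forall>x\<in>X. \<exists>n. [H x = int g ^ n] (mod int p)" using gen by (simp add: X_def)
  then show ?thesis using that by metis
 qed
 define A where "A = (\<lambda>j. {x\<in>X. ix x mod d = j})"
 have sqp: "sqrt p >= 1" using p1 by simp
 \<comment> \<open>The summands \<open>2 * Y + 22\<close> also cover the small primes excluded from
   Stepanov's bound, where the trivial estimate \<open>p <= (10 + 2 * d) * sqrt p\<close> is
   used.\<close>
 define B where "B = (10 * (k * Y) + 2 * Y + 22) * sqrt p"
 have cardA: "card (A j) <= p / d + B" for j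
 proof (cases "64 + 2 * (d\<^sup>2 + d) <= p")
  case True
  define S where "S = {x\<in>{0..<int p}. [(\<Prod>i<k. (x + \<beta> i) ^ e i) ^ t = int g ^ (t * j)] (mod int p)}"
  have "A j \<subseteq> S"
  proof
   fix x assume x: "x \<in> A j"
   then have "[H x ^ t = (int g ^ ix x) ^ t] (mod int p)" using ix by (auto simp: A_def intro: cong_pow)
   also have "(int g ^ ix x) ^ t = int g ^ (t * j) * (int g ^ (d * t)) ^ (ix x div d)"
   proof -
    have "ix x = j + d * (ix x div d)" using x by (auto simp: A_def)
    then have "ix x * t = t * j + d * t * (ix x div d)" by (metis (no_types, lifting) add_mult_distrib mult.assoc mult.commute)
    then show ?thesis by (metis power_add power_mult)
   qed
   also have "[int g ^ (t * j) * (int g ^ (d * t)) ^ (ix x div d) = int g ^ (t * j) * 1 ^ (ix x div d)] (mod int p)"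
   proof (intro cong_mult cong_pow cong_refl)
    have "[g ^ totient p = 1] (mod p)" using cg by (intro euler_theorem) simp
    then have "[int (g ^ totient p) = int 1] (mod int p)" by (simp only: cong_int_iff)
    then show "[int g ^ (d * t) = 1] (mod int p)" using p dt by (simp add: totient_prime)
   qed
   finally show "x \<in> S" using x by (simp add: S_def H_def A_def X_def)
  qed
  moreover have "finite S" by (rule finite_subset[of _ "{0..<int p}"]) (auto simp: S_def)
  ultimately have "card (A j) <= card S" by (intro card_mono)
  also have "real (card S) <= p / d + (10 * real (k * d) + 12) * sqrt p"
  proof -
   have "\<not> int p dvd int g ^ (t * j)"
    using cg p by (metis coprime_commute coprime_power_right_iff not_coprimeI dvd_refl prime_nat_int_transfer not_prime_unit coprime_absorb_left)
   moreover have "coprime (e i0) d" "e i0 < d" "\<forall>j<k. e j <= d"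
    using d2 coprime_diff_one_left_nat[of d] by (auto simp: e_def)
   ultimately show ?thesis
    using stepanov[OF p, unfolded stepanov_holds_def, rule_format, OF dt i0, of \<beta> e "int g ^ (t * j)"] True dist
    unfolding S_def by blast
  qed
  also have "... <= p / d + B"
  proof -
   have "10 * real (k * d) + 12 <= 10 * real (k * Y) + 2 * Y + 22"
    using mult_left_mono[of d Y "real k"] dY by simp
   then show ?thesis unfolding B_def by (intro add_left_mono mult_right_mono) auto
  qed
  finally show ?thesis by simp
 next
  case False
  have "card (A j) <= card {0..<int p}" by (intro card_mono) (auto simp: A_def X_def)
  then have "real (card (A j)) <= sqrt p * sqrt p" by simp
  also have "sqrt p * sqrt p <= (10 + 2 * d) * sqrt p"
  proof (rule mult_right_mono)
   show "sqrt p <= real (10 + 2 * d)"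
  proof (rule real_le_lsqrt)
   have "p <= 64 + 2 * (d\<^sup>2 + d)" using False by simp
   also have "... <= (10 + 2 * d)\<^sup>2" by (simp add: power2_eq_square algebra_simps)
   finally show "real p <= (real (10 + 2 * d))\<^sup>2" by (metis of_nat_le_iff of_nat_power)
  qed auto
  qed simp
  also have "... <= B"
  proof -
   have "real (10 + 2 * d) <= 10 * real (k * Y) + 2 * Y + 22"
   proof -
    have "real d <= Y" "0 <= real k * real Y" using dY by auto
    then show ?thesis unfolding of_nat_add of_nat_mult of_nat_numeral by linarith
   qed
   then show ?thesis unfolding B_def by (intro mult_right_mono) auto
  qed
  also have "B <= p / d + B" by simp
  finally show ?thesis by simp
 qed
 have X_card: "p <= card X + k"
 proof -
  have "{0..<int p} - X \<subseteq> (\<lambda>i. (- \<beta> i) mod int p) ` {..<k}"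
  proof
   fix x assume x: "x \<in> {0..<int p} - X"
   then have "\<not> coprime (int p) (H x)" by (auto simp: X_def coprime_commute)
   then have "int p dvd H x" using p by (meson prime_imp_coprime prime_nat_int_transfer)
   then obtain i where i: "i < k" "int p dvd x + \<beta> i"
    using p by (auto simp: H_def prime_dvd_prod_iff prime_dvd_power_iff dest!: prime_dvd_power[rotated])
   then have "[x = - \<beta> i] (mod int p)" by (simp add: cong_iff_dvd_diff)
   then have "x = (- \<beta> i) mod int p" using x by (simp add: cong_def)
   then show "x \<in> (\<lambda>i. (- \<beta> i) mod int p) ` {..<k}" using i by blast
  qed
  then have "card ({0..<int p} - X) <= k"
   by (metis card_image_le card_lessThan card_mono finite_imageI finite_lessThan order_trans)
  moreover have "card ({0..<int p} - X) = p - card X" using finX by (subst card_Diff_subset) (auto simp: X_def)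
  ultimately show ?thesis by simp
 qed
 have "(\<Sum>j<d. card (A j)) = card X"
 proof -
  have "X = (\<Union>j<d. A j)" using d0 by (auto simp: A_def)
  moreover have "card (\<Union>j<d. A j) = (\<Sum>j<d. card (A j))"
   by (intro card_UN_disjoint) (auto simp: A_def finX)
  ultimately show ?thesis by simp
 qed
 then have sumA: "(\<Sum>j<d. real (card (A j))) = card X" by (metis of_nat_sum)
 have "(\<Sum>x\<in>{0..<int p}. \<psi> (H x)) = (\<Sum>x\<in>X. \<psi> (H x))"
  by (intro sum.mono_neutral_right) (auto simp: X_def dchar_eq_0_iff[OF \<psi>(1)])
 also have "... = (\<Sum>j<d. \<Sum>x\<in>A j. \<psi> (H x))"
  unfolding A_def by (subst sum.group) (use d0 finX in auto)
 also have "... = (\<Sum>j<d. \<omega> ^ j * card (A j))"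
 proof (intro sum.cong refl)
  fix j
  have "\<psi> (H x) = \<omega> ^ j" if x: "x \<in> A j" for x
  proof -
   have "\<psi> (H x) = \<omega> ^ ix x" using gn ix x by (auto simp: A_def)
   also have "ix x = d * (ix x div d) + j" using x by (auto simp: A_def)
   also have "\<omega> ^ (d * (ix x div d) + j) = \<omega> ^ j" by (simp add: power_add power_mult \<omega>d)
   finally show ?thesis .
  qed
  then show "(\<Sum>x\<in>A j. \<psi> (H x)) = \<omega> ^ j * card (A j)" by simp
 qed
 also have "... = (\<Sum>j<d. \<omega> ^ j * complex_of_real (card (A j) - p / d))"
 proof -
  have "(\<Sum>j<d. \<omega> ^ j) = 0" using geometric_sum[OF \<omega>1] \<omega>d by simp
  then have "(\<Sum>j<d. \<omega> ^ j * complex_of_real (p / d)) = 0" by (simp only: sum_distrib_right[symmetric]) simp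
  then show ?thesis by (simp add: right_diff_distrib sum_subtractf)
 qed
 also have "norm ... <= (\<Sum>j<d. \<bar>card (A j) - p / d\<bar>)"
 proof (rule sum_norm_le)
  have "norm \<omega> = 1" using dchar_norm[OF \<psi>(1) cg] p1 by (simp add: \<omega>_def)
  then show "norm (\<omega> ^ j * complex_of_real (card (A j) - p / d)) <= \<bar>card (A j) - p / d\<bar>" for j
   by (simp only: norm_mult norm_power norm_of_real) simp
 qed
 \<comment> \<open>From \<open>u <= B\<close> and \<open>B >= 0\<close> follows
   \<open>|u| <= 2 * B - u\<close>; here \<open>u\<close> is the deviation of one class from
   \<open>p / d\<close>, and the sum of all deviations is at least \<open>- k\<close>.\<close>
 also have "... <= (\<Sum>j<d. 2 * B - (card (A j) - p / d))"
 proof (rule sum_mono)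
  fix j
  have "B >= 0" by (simp add: B_def)
  then show "\<bar>card (A j) - p / d\<bar> <= 2 * B - (card (A j) - p / d)" using cardA[of j] by linarith
 qed
 also have "... = 2 * d * B - (real (card X) - real p)" using d0 by (simp add: sum_subtractf sumA)
 also have "... <= 2 * d * B + k" using X_card by linarith
 also have "... <= 2 * Y * B + k * sqrt p"
  using dY sqp by (intro add_mono mult_right_mono) (auto simp: B_def mult_le_cancel_left1)
 also have "... = weil_const Y k * sqrt p" by (simp add: B_def weil_const_def algebra_simps)
 finally show ?thesis by (simp add: summand)
qed

section \<open>Moments of short sums\<close>

text \<open>The Chinese remainder theorem for complete sums: the pair of residues runs through the
  full rectangle.\<close>

lemma sum_mod_mult:
 fixes A B :: "int => 'a::comm_semiring_1"
 assumes cop: "coprime m n" and pos: "m > 0" "n > 0"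
  and A: "\<And>x y. [x = y] (mod int m) ==> A x = A y" and B: "\<And>x y. [x = y] (mod int n) ==> B x = B y"
 shows "(\<Sum>x\<in>{0..<int (m * n)}. A x * B x) = (\<Sum>x\<in>{0..<int m}. A x) * (\<Sum>x\<in>{0..<int n}. B x)"
proof -
 define \<phi> where "\<phi> = (\<lambda>x. (x mod int m, x mod int n))"
 let ?D = "{0..<int (m * n)}" and ?R = "{0..<int m} \<times> {0..<int n}"
 have inj: "inj_on \<phi> ?D"
 proof (rule inj_onI)
  fix x y assume xy: "x \<in> ?D" "y \<in> ?D" "\<phi> x = \<phi> y"
  then have "[x = y] (mod int m)" "[x = y] (mod int n)" by (auto simp: \<phi>_def cong_def)
  then have "[x = y] (mod int m * int n)" using cop by (intro coprime_cong_mult) auto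
  then show "x = y" using xy by (auto simp: cong_def)
 qed
 have "\<phi> ` ?D \<subseteq> ?R" using pos by (auto simp: \<phi>_def)
 moreover have "card (\<phi> ` ?D) = card ?R"
  unfolding card_image[OF inj] by (simp add: card_cartesian_product nat_mult_distrib)
 ultimately have im: "\<phi> ` ?D = ?R" by (intro card_subset_eq) auto
 have "(\<Sum>x\<in>{0..<int m}. A x) * (\<Sum>x\<in>{0..<int n}. B x) = (\<Sum>(x, y)\<in>?R. A x * B y)"
  by (simp add: sum_product sum.cartesian_product)
 also have "... = (\<Sum>x\<in>?D. A (x mod int m) * B (x mod int n))"
  unfolding im[symmetric] by (subst sum.reindex[OF inj]) (simp add: \<phi>_def)
 also have "... = (\<Sum>x\<in>?D. A x * B x)"
  by (intro sum.cong refl arg_cong2[where f = "(*)"] A B) (simp_all add: cong_def)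
 finally show ?thesis ..
qed

lemma prod_cong_mod:
 fixes A :: "nat => int => 'a::comm_semiring_1"
 assumes "finite P" "\<And>p x y. p \<in> P ==> [x = y] (mod int p) ==> A p x = A p y" "[x = y] (mod int (\<Prod>P))"
 shows "(\<Prod>p\<in>P. A p x) = (\<Prod>p\<in>P. A p y)"
proof (intro prod.cong refl assms(2))
 fix p assume "p \<in> P"
 then have "p dvd \<Prod>P" using assms(1) by (intro dvd_prodI[where f = "\<lambda>x. x", simplified]) auto
 then have "int p dvd int (\<Prod>P)" by (simp only: of_nat_dvd_iff)
 then show "[x = y] (mod int p)" using assms(3) by (rule cong_dvd_modulus[rotated])
qed

lemma sum_mod_prod:
 fixes A :: "nat => int => 'a::comm_semiring_1"
 assumes "finite P" "\<And>p. p \<in> P ==> prime p" "\<And>p x y. p \<in> P ==> [x = y] (mod int p) ==> A p x = A p y"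
 shows "(\<Sum>x\<in>{0..<int (\<Prod>P)}. \<Prod>p\<in>P. A p x) = (\<Prod>p\<in>P. \<Sum>x\<in>{0..<int p}. A p x)"
 using assms
proof (induction P rule: finite_induct)
 case (insert q P)
 have "coprime q (\<Prod>P)" using insert by (intro prod_coprime_right primes_coprime) auto
 moreover have "\<Prod>P > 0" using insert by (intro prod_pos) (auto simp: prime_gt_0_nat)
 moreover have "q > 0" using insert by (auto simp: prime_gt_0_nat)
 ultimately have "(\<Sum>x\<in>{0..<int (q * \<Prod>P)}. A q x * (\<Prod>p\<in>P. A p x))
   = (\<Sum>x\<in>{0..<int q}. A q x) * (\<Sum>x\<in>{0..<int (\<Prod>P)}. \<Prod>p\<in>P. A p x)"
  using insert.prems insert.hyps by (intro sum_mod_mult) (auto intro: prod_cong_mod)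
 then show ?case using insert by simp
qed auto

lemma prod_primes_dvd:
 assumes "finite S" "\<And>p. p \<in> S ==> prime p" "\<And>p. p \<in> S ==> p dvd t"
 shows "\<Prod>S dvd (t::nat)"
 using assms
proof (induction S rule: finite_induct)
 case (insert q S)
 have "coprime q (\<Prod>S)" using insert by (intro prod_coprime_right primes_coprime) auto
 then show ?case using insert by (simp add: divides_mult)
qed auto

definition char_family :: "nat => nat set => (nat => int => complex) => bool" where
 "char_family Y P \<psi> \<longleftrightarrow> finite P \<and> (\<forall>p\<in>P. prime p \<and> dchar p (\<psi> p) \<and> \<not> trivial_char p (\<psi> p) \<and> order_dvd Y p (\<psi> p))"

text \<open>This is the gcd of \<open>t\<close> with \<Prod>P when \<open>P\<close> consists of
  primes. The product form is the one in which the bounds prime by prime deliver it.\<close>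

definition gcd_weight :: "nat set => int => nat" where
 "gcd_weight P t = (\<Prod>p\<in>P. if int p dvd t then p else 1)"

text \<open>The gcd is at most the sum of all divisors \<Prod>S of \<open>t\<close> with
  \<open>S\<close> a subset of \<open>P\<close>. A fixed divisor has at most
  \<open>B div \<Prod>S\<close> multiples up to \<open>B\<close>, so it contributes at most
  \<open>B\<close>, and there are \<open>2 ^ card P\<close> of them.\<close>

lemma sum_gcd_weight:
 assumes "finite P" "\<And>p. p \<in> P ==> prime p"
 shows "(\<Sum>t=1..B. gcd_weight P (int t)) <= 2 ^ card P * B"
proof -
 have pos: "\<Prod>S > 0" if "S \<subseteq> P" for S using that assms by (intro prod_pos) (auto simp: prime_gt_0_nat)
 have "gcd_weight P (int t) <= (\<Sum>S\<in>Pow P. if \<Prod>S dvd t then \<Prod>S else 0)" for t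
 proof -
  define S where "S = {p\<in>P. p dvd t}"
  have "gcd_weight P (int t) = \<Prod>S"
   unfolding gcd_weight_def S_def using assms(1) by (simp add: prod.inter_filter)
  moreover have "\<Prod>S dvd t"
   using assms by (intro prod_primes_dvd) (auto simp: S_def)
  ultimately have "gcd_weight P (int t) = (\<Sum>S\<in>{S}. if \<Prod>S dvd t then \<Prod>S else 0)" by simp
  also have "... <= (\<Sum>S\<in>Pow P. if \<Prod>S dvd t then \<Prod>S else 0)"
   using assms by (intro sum_mono2) (auto simp: S_def)
  finally show ?thesis .
 qed
 then have "(\<Sum>t=1..B. gcd_weight P (int t)) <= (\<Sum>t=1..B. \<Sum>S\<in>Pow P. if \<Prod>S dvd t then \<Prod>S else 0)"
  by (intro sum_mono) auto
 also have "... = (\<Sum>S\<in>Pow P. \<Sum>t=1..B. if \<Prod>S dvd t then \<Prod>S else 0)" by (rule sum.swap)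
 also have "... <= (\<Sum>S\<in>Pow P. B)"
 proof (intro sum_mono)
  fix S assume "S \<in> Pow P"
  then have p: "\<Prod>S > 0" using pos by auto
  have "{t\<in>{1..B}. \<Prod>S dvd t} \<subseteq> (\<lambda>k. \<Prod>S * k) ` {1..B div \<Prod>S}"
  proof clarify
   fix t assume "t \<in> {1..B}" "\<Prod>S dvd t"
   then obtain k where "t = \<Prod>S * k" "t >= 1" "t <= B" by auto
   then show "t \<in> (\<lambda>k. \<Prod>S * k) ` {1..B div \<Prod>S}"
    using p by (intro image_eqI[of _ _ k]) (auto simp: less_eq_div_iff_mult_less_eq mult.commute Suc_le_eq)
  qed
  then have "card {t\<in>{1..B}. \<Prod>S dvd t} <= card {1..B div \<Prod>S}" by (intro surj_card_le) auto
  then have "card {t\<in>{1..B}. \<Prod>S dvd t} * \<Prod>S <= B div \<Prod>S * \<Prod>S" by (intro mult_le_mono1) simp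
  moreover have "(\<Sum>t=1..B. if \<Prod>S dvd t then \<Prod>S else 0) = card {t\<in>{1..B}. \<Prod>S dvd t} * \<Prod>S"
   unfolding sum.inter_filter[symmetric, OF finite_atLeastAtMost] by simp
  ultimately show "(\<Sum>t=1..B. if \<Prod>S dvd t then \<Prod>S else 0) <= B"
   using div_times_less_eq_dividend[of B "\<Prod>S"] by linarith
 qed
 also have "... = 2 ^ card P * B" using assms by (simp add: card_Pow)
 finally show ?thesis .
qed

lemma gcd_weight_minus: "gcd_weight P (- t) = gcd_weight P t"
 by (simp add: gcd_weight_def)

lemma sum_gcd_weight_shift:
 assumes "finite P" "\<And>p. p \<in> P ==> prime p" "b0 \<in> {1..B}"
 shows "(\<Sum>b\<in>{1..B} - {b0}. gcd_weight P (int b - int b0)) <= 2 * (2 ^ card P * B)"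
proof -
 have "(\<Sum>b\<in>{1..<b0}. gcd_weight P (int b - int b0)) = (\<Sum>t\<in>{1..<b0}. gcd_weight P (int t))"
  by (rule sum.reindex_bij_witness[of _ "\<lambda>t. b0 - t" "\<lambda>t. b0 - t"])
    (auto simp: of_nat_diff, metis gcd_weight_minus minus_diff_eq)
 moreover have "(\<Sum>b\<in>{b0<..B}. gcd_weight P (int b - int b0)) = (\<Sum>t\<in>{1..B-b0}. gcd_weight P (int t))"
  by (rule sum.reindex_bij_witness[of _ "\<lambda>t. t + b0" "\<lambda>t. t - b0"]) (auto simp: of_nat_diff)
 moreover have eq: "{1..B} - {b0} = {1..<b0} \<union> {b0<..B}" using assms by auto
 moreover have "(\<Sum>t\<in>{1..<b0}. gcd_weight P (int t)) <= (\<Sum>t=1..B. gcd_weight P (int t))"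
  using assms by (intro sum_mono2) auto
 moreover have "(\<Sum>t\<in>{1..B-b0}. gcd_weight P (int t)) <= (\<Sum>t=1..B. gcd_weight P (int t))"
  by (intro sum_mono2) auto
 moreover have "(\<Sum>b\<in>{1..<b0} \<union> {b0<..B}. gcd_weight P (int b - int b0))
   = (\<Sum>b\<in>{1..<b0}. gcd_weight P (int b - int b0)) + (\<Sum>b\<in>{b0<..B}. gcd_weight P (int b - int b0))"
  by (rule sum.union_disjoint) auto
 moreover have "(\<Sum>t=1..B. gcd_weight P (int t)) <= 2 ^ card P * B" using assms by (intro sum_gcd_weight)
 ultimately show ?thesis unfolding eq by linarith
qed

lemma weil_const_ge_1: "k > 0 ==> weil_const Y k >= 1"
 by (simp add: weil_const_def)

text \<open>The complete sum belonging to one tuple of shifts when the moment of order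
  \<open>2 * r\<close> of a short sum is expanded; the last \<open>r\<close> factors come from the
  conjugate.\<close>

definition tuple_sum :: "nat set => (nat => int => complex) => nat => (nat => nat) => complex" where
 "tuple_sum P \<psi> r \<beta> = (\<Sum>x\<in>{0..<int (\<Prod>P)}. \<Prod>p\<in>P. \<Prod>i<2*r.
   if r <= i then cnj (\<psi> p (x + int (\<beta> i))) else \<psi> p (x + int (\<beta> i)))"

lemma char_family_summand_cong:
 assumes "char_family Y P \<psi>" "p \<in> P" "[x = y] (mod int p)"
 shows "(\<Prod>i<k. if r <= i then cnj (\<psi> p (x + int (\<beta> i))) else \<psi> p (x + int (\<beta> i)))
  = (\<Prod>i<k. if r <= i then cnj (\<psi> p (y + int (\<beta> i))) else \<psi> p (y + int (\<beta> i)))"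
proof -
 have "\<psi> p (x + b) = \<psi> p (y + b)" for b
  using assms by (intro dchar_cong[of p]) (auto simp: char_family_def intro: cong_add)
 then show ?thesis by (simp only:)
qed

lemma norm_char_summand_le:
 assumes "char_family Y P \<psi>" "p \<in> P"
 shows "norm (\<Prod>i<k. if r <= i then cnj (\<psi> p (f i)) else \<psi> p (f i)) <= (1::real)"
proof -
 have "norm (\<Prod>i<k. if r <= i then cnj (\<psi> p (f i)) else \<psi> p (f i)) <= (\<Prod>i<k. 1)"
  unfolding prod_norm[symmetric] using assms
  by (intro prod_mono) (auto simp: char_family_def intro!: dchar_norm_le prime_gt_0_nat)
 then show ?thesis by simp
qed

lemma tuple_sum_trivial:
 assumes "char_family Y P \<psi>"
 shows "norm (tuple_sum P \<psi> r \<beta>) <= \<Prod>P"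
proof -
 have "norm (tuple_sum P \<psi> r \<beta>) <= (\<Sum>x\<in>{0..<int (\<Prod>P)}. 1)"
  unfolding tuple_sum_def
 proof (intro sum_norm_le)
  fix x
  have "norm (\<Prod>p\<in>P. \<Prod>i<2*r. if r <= i then cnj (\<psi> p (x + int (\<beta> i))) else \<psi> p (x + int (\<beta> i))) <= (\<Prod>p\<in>P. 1)"
   by (subst prod_norm[symmetric]) (intro prod_mono conjI norm_ge_zero norm_char_summand_le[OF assms])
  then show "norm (\<Prod>p\<in>P. \<Prod>i<2*r. if r <= i then cnj (\<psi> p (x + int (\<beta> i))) else \<psi> p (x + int (\<beta> i))) <= 1" by simp
 qed
 then show ?thesis by (simp del: of_nat_prod)
qed

text \<open>The sum factors over the primes. Where \<beta>\<open>(i0)\<close> is separated from all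
  other shifts modulo \<open>p\<close> there is square root cancellation; at any other prime the
  trivial bound \<open>p\<close> is used, and that factor \<open>p\<close> is already contained in
  one of the gcd weights.\<close>

lemma tuple_sum_bound:
 assumes fam: "char_family Y P \<psi>" and Y: "Y > 0" and i0: "i0 < 2 * r"
 shows "norm (tuple_sum P \<psi> r \<beta>) <= real (weil_const Y (2 * r)) ^ card P * sqrt (\<Prod>P) *
   (\<Prod>j\<in>{..<2*r} - {i0}. gcd_weight P (int (\<beta> j) - int (\<beta> i0)))"
proof -
 define k where "k = 2 * r"
 define C where "C = real (weil_const Y k)"
 have P: "finite P" "\<And>p. p \<in> P ==> prime p" using fam by (auto simp: char_family_def)
 have C1: "C >= 1" using weil_const_ge_1[of k Y] i0 by (simp add: C_def k_def)
 define w where "w = (\<lambda>p t. if int p dvd t then p else 1)"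
 define T where "T = (\<lambda>p. \<Sum>x\<in>{0..<int p}. \<Prod>i<k. if r <= i then cnj (\<psi> p (x + int (\<beta> i))) else \<psi> p (x + int (\<beta> i)))"
 have w1: "w p t >= 1" if "p \<in> P" for p t using P(2)[OF that] prime_ge_1_nat by (simp add: w_def)
 have loc: "norm (T p) <= C * sqrt p * (\<Prod>j\<in>{..<k}-{i0}. w p (int (\<beta> j) - int (\<beta> i0)))" if p: "p \<in> P" for p
 proof (cases "\<exists>j<k. j \<noteq> i0 \<and> int p dvd int (\<beta> j) - int (\<beta> i0)")
  case False
  then have "norm (T p) <= C * sqrt p"
   unfolding T_def C_def using fam p Y i0
   by (intro local_character_sum_bound[where ?i0.0 = i0]) (auto simp: char_family_def k_def)
  moreover have "1 <= (\<Prod>j\<in>{..<k}-{i0}. w p (int (\<beta> j) - int (\<beta> i0)))" using w1[OF p] by (intro prod_ge_1) auto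
  then have "C * sqrt p * 1 <= C * sqrt p * real (\<Prod>j\<in>{..<k}-{i0}. w p (int (\<beta> j) - int (\<beta> i0)))"
   using C1 by (intro mult_left_mono) (auto simp del: of_nat_prod)
  ultimately show ?thesis by simp
 next
  case True
  then obtain j where j: "j < k" "j \<noteq> i0" "int p dvd int (\<beta> j) - int (\<beta> i0)" by blast
  have "norm (T p) <= (\<Sum>x\<in>{0..<int p}. 1)"
   unfolding T_def by (intro sum_norm_le norm_char_summand_le[OF fam p])
  then have "norm (T p) <= p" by simp
  also have "p <= w p (int (\<beta> j) - int (\<beta> i0)) * (\<Prod>j\<in>{..<k}-{i0}-{j}. w p (int (\<beta> j) - int (\<beta> i0)))"
  proof -
   have "1 <= (\<Prod>j\<in>{..<k}-{i0}-{j}. w p (int (\<beta> j) - int (\<beta> i0)))" using w1[OF p] by (intro prod_ge_1) auto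
   then show ?thesis using j by (simp add: w_def)
  qed
  also have "... = (\<Prod>j\<in>{..<k}-{i0}. w p (int (\<beta> j) - int (\<beta> i0)))"
   using j by (intro prod.remove[symmetric]) auto
  finally have "norm (T p) <= real (\<Prod>j\<in>{..<k}-{i0}. w p (int (\<beta> j) - int (\<beta> i0)))" by simp
  also have "... <= C * sqrt p * (\<Prod>j\<in>{..<k}-{i0}. w p (int (\<beta> j) - int (\<beta> i0)))"
  proof -
   have "1 <= C * sqrt p"
    using C1 P(2)[OF p] prime_ge_1_nat mult_mono[of 1 C 1 "sqrt p"] by simp
   then show ?thesis using mult_right_mono[of 1 "C * sqrt p" "real (\<Prod>j\<in>{..<k}-{i0}. w p (int (\<beta> j) - int (\<beta> i0)))"]
    by (simp del: of_nat_prod)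
  qed
  finally show ?thesis .
 qed
 have "tuple_sum P \<psi> r \<beta> = (\<Prod>p\<in>P. T p)"
  unfolding tuple_sum_def T_def k_def
  by (rule sum_mod_prod[OF P char_family_summand_cong[OF fam]])
 then have "norm (tuple_sum P \<psi> r \<beta>) = (\<Prod>p\<in>P. norm (T p))" by (simp add: prod_norm)
 also have "... <= (\<Prod>p\<in>P. C * sqrt p * (\<Prod>j\<in>{..<k}-{i0}. w p (int (\<beta> j) - int (\<beta> i0))))"
  using loc by (intro prod_mono) auto
 also have "... = C ^ card P * (\<Prod>p\<in>P. sqrt p) * (\<Prod>p\<in>P. \<Prod>j\<in>{..<k}-{i0}. w p (int (\<beta> j) - int (\<beta> i0)))"
  by (simp add: prod.distrib)
 also have "(\<Prod>p\<in>P. \<Prod>j\<in>{..<k}-{i0}. w p (int (\<beta> j) - int (\<beta> i0))) = (\<Prod>j\<in>{..<k}-{i0}. gcd_weight P (int (\<beta> j) - int (\<beta> i0)))"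
  unfolding gcd_weight_def w_def by (rule prod.swap)
 also have "(\<Prod>p\<in>P. sqrt p) = sqrt (\<Prod>P)"
  using P(1) by (induction P rule: finite_induct) (auto simp: real_sqrt_mult)
 finally show ?thesis by (simp add: C_def k_def)
qed

section \<open>Expansion of the moment over tuples of shifts\<close>

lemma power_sum_PiE:
 fixes z :: "'b => complex"
 assumes "finite I"
 shows "complex_of_real (norm (\<Sum>b\<in>I. z b) ^ (2 * r)) =
  (\<Sum>\<beta>\<in>{..<2*r} \<rightarrow>\<^sub>E I. \<Prod>i<2*r. if r <= i then cnj (z (\<beta> i)) else z (\<beta> i))"
proof -
 define s where "s = (\<Sum>b\<in>I. z b)"
 have "complex_of_real (norm s ^ (2 * r)) = (complex_of_real ((norm s)\<^sup>2)) ^ r"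
  by (simp only: power_mult of_real_power)
 also have "... = s ^ r * cnj s ^ r" by (subst complex_norm_square) (rule power_mult_distrib)
 also have "... = (\<Prod>i<2*r. if r <= i then cnj s else s)"
 proof -
  have "{..<2*r} = {..<r} \<union> {r..<2*r}" by auto
  then have "(\<Prod>i<2*r. if r <= i then cnj s else s)
    = (\<Prod>i<r. if r <= i then cnj s else s) * (\<Prod>i\<in>{r..<2*r}. if r <= i then cnj s else s)"
   by (metis (mono_tags, lifting) finite_atLeastLessThan finite_lessThan ivl_disj_int_one(2) prod.union_disjoint)
  also have "(\<Prod>i<r. if r <= i then cnj s else s) = (\<Prod>i<r. s)" by (intro prod.cong) auto
  also have "(\<Prod>i\<in>{r..<2*r}. if r <= i then cnj s else s) = (\<Prod>i\<in>{r..<2*r}. cnj s)" by (intro prod.cong) auto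
  finally show ?thesis by simp
 qed
 also have "... = (\<Prod>i<2*r. \<Sum>b\<in>I. if r <= i then cnj (z b) else z b)"
  by (intro prod.cong refl) (simp add: s_def cnj_sum)
 also have "... = (\<Sum>\<beta>\<in>{..<2*r} \<rightarrow>\<^sub>E I. \<Prod>i<2*r. if r <= i then cnj (z (\<beta> i)) else z (\<beta> i))"
  using assms by (subst prod_sum_PiE) auto
 finally show ?thesis by (simp add: s_def)
qed

lemma moment_eq:
 "complex_of_real (\<Sum>x\<in>{0..<int (\<Prod>P)}. norm (\<Sum>b=1..B. \<Prod>p\<in>P. \<psi> p (x + int b)) ^ (2 * r))
  = (\<Sum>\<beta>\<in>{..<2*r} \<rightarrow>\<^sub>E {1..B}. tuple_sum P \<psi> r \<beta>)"
proof -
 have "complex_of_real (\<Sum>x\<in>{0..<int (\<Prod>P)}. norm (\<Sum>b=1..B. \<Prod>p\<in>P. \<psi> p (x + int b)) ^ (2 * r))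
  = (\<Sum>x\<in>{0..<int (\<Prod>P)}. \<Sum>\<beta>\<in>{..<2*r} \<rightarrow>\<^sub>E {1..B}. \<Prod>i<2*r. if r <= i then cnj (\<Prod>p\<in>P. \<psi> p (x + int (\<beta> i)))
    else \<Prod>p\<in>P. \<psi> p (x + int (\<beta> i)))"
  unfolding of_real_sum by (intro sum.cong refl power_sum_PiE) simp
 also have "... = (\<Sum>\<beta>\<in>{..<2*r} \<rightarrow>\<^sub>E {1..B}. \<Sum>x\<in>{0..<int (\<Prod>P)}. \<Prod>i<2*r. if r <= i then cnj (\<Prod>p\<in>P. \<psi> p (x + int (\<beta> i)))
    else \<Prod>p\<in>P. \<psi> p (x + int (\<beta> i)))" by (rule sum.swap)
 also have "... = (\<Sum>\<beta>\<in>{..<2*r} \<rightarrow>\<^sub>E {1..B}. tuple_sum P \<psi> r \<beta>)"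
  unfolding tuple_sum_def
 proof (intro sum.cong refl)
  fix \<beta> :: "nat => nat" and x
  have "(\<Prod>i<2*r. if r <= i then cnj (\<Prod>p\<in>P. \<psi> p (x + int (\<beta> i))) else \<Prod>p\<in>P. \<psi> p (x + int (\<beta> i)))
    = (\<Prod>i<2*r. \<Prod>p\<in>P. if r <= i then cnj (\<psi> p (x + int (\<beta> i))) else \<psi> p (x + int (\<beta> i)))"
   by (intro prod.cong refl) (simp add: cnj_prod)
  then show "(\<Prod>i<2*r. if r <= i then cnj (\<Prod>p\<in>P. \<psi> p (x + int (\<beta> i))) else \<Prod>p\<in>P. \<psi> p (x + int (\<beta> i)))
    = (\<Prod>p\<in>P. \<Prod>i<2*r. if r <= i then cnj (\<psi> p (x + int (\<beta> i))) else \<psi> p (x + int (\<beta> i)))"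
   by (rule trans) (rule prod.swap)
 qed
 finally show ?thesis .
qed

text \<open>If every entry occurs at least twice, there are at most \<open>r\<close> distinct
  values. The tuple is then a choice \<open>s\<close> of \<open>r\<close> values composed with a map
  \<open>t\<close> from the \<open>2 * r\<close> positions to these values.\<close>

lemma card_repeating_tuples:
 "card {\<beta>\<in>{..<2*r} \<rightarrow>\<^sub>E {1..B}. \<forall>i<2*r. \<exists>j<2*r. j \<noteq> i \<and> \<beta> j = \<beta> i} <= r ^ (2 * r) * B ^ r"
proof -
 define k where "k = 2 * r"
 let ?bad = "{\<beta>\<in>{..<k} \<rightarrow>\<^sub>E {1..B}. \<forall>i<k. \<exists>j<k. j \<noteq> i \<and> \<beta> j = \<beta> i}"
 let ?S = "({..<r} \<rightarrow>\<^sub>E {1..B}) \<times> ({..<k} \<rightarrow>\<^sub>E {..<r})"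
 have "?bad \<subseteq> (\<lambda>(s, t). \<lambda>i\<in>{..<k}. s (t i)) ` ?S"
 proof
  fix \<beta> assume \<beta>: "\<beta> \<in> ?bad"
  define V where "V = \<beta> ` {..<k}"
  have V: "finite V" "V \<subseteq> {1..B}" using \<beta> by (auto simp: V_def)
  have "2 * card V <= (\<Sum>v\<in>V. card {i\<in>{..<k}. \<beta> i = v})"
  proof -
   have "2 <= card {i\<in>{..<k}. \<beta> i = v}" if v: "v \<in> V" for v
   proof -
    obtain i where i: "i < k" "\<beta> i = v" using v by (auto simp: V_def)
    moreover obtain j where "j < k" "j \<noteq> i" "\<beta> j = v" using \<beta> i by blast
    ultimately have "i < k" "j < k" "\<beta> i = v" "\<beta> j = v" "j \<noteq> i" by auto
    then have "card {i, j} <= card {i\<in>{..<k}. \<beta> i = v}" by (intro card_mono) auto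
    then show ?thesis using \<open>j \<noteq> i\<close> by simp
   qed
   then show ?thesis using sum_mono[of V "\<lambda>_. 2" "\<lambda>v. card {i\<in>{..<k}. \<beta> i = v}"] by simp
  qed
  also have "... = (\<Sum>v\<in>V. \<Sum>i | i \<in> {..<k} \<and> \<beta> i = v. 1)" by simp
  also have "... = (\<Sum>i<k. 1)" using V(1) by (intro sum.group) (auto simp: V_def)
  finally have cV: "card V <= r" by (simp add: k_def)
  show "\<beta> \<in> (\<lambda>(s, t). \<lambda>i\<in>{..<k}. s (t i)) ` ?S"
  proof (cases "k = 0")
   case True
   then show ?thesis using \<beta> by (auto simp: k_def)
  next
   case False
   then have "0 \<in> {..<k}" by simp
   then have ne: "V \<noteq> {}" by (auto simp: V_def)
   obtain h where h: "bij_betw h {0..<card V} V" using ex_bij_betw_nat_finite[OF V(1)] by blast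
   obtain v0 where v0: "v0 \<in> V" using ne by blast
   define s where "s = (\<lambda>i\<in>{..<r}. if i < card V then h i else v0)"
   define t where "t = (\<lambda>i\<in>{..<k}. inv_into {0..<card V} h (\<beta> i))"
   have im: "h ` {0..<card V} = V" using h by (simp add: bij_betw_def)
   have ti: "inv_into {0..<card V} h v \<in> {0..<card V}" "h (inv_into {0..<card V} h v) = v" if "v \<in> V" for v
    using that im inv_into_into[of v h "{0..<card V}"] f_inv_into_f[of v h "{0..<card V}"] by simp_all
   have "h i \<in> {1..B}" if "i < card V" for i using im V(2) that by (metis atLeastLessThan_iff image_eqI subsetD zero_le)
   moreover have "v0 \<in> {1..B}" using v0 V(2) by auto
   ultimately have "s \<in> {..<r} \<rightarrow>\<^sub>E {1..B}" unfolding s_def by (intro restrict_PiE_iff[THEN iffD2]) auto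
   moreover have "inv_into {0..<card V} h (\<beta> i) < r" if "i < k" for i
    using ti(1)[of "\<beta> i"] cV that by (simp add: V_def)
   then have "t \<in> {..<k} \<rightarrow>\<^sub>E {..<r}" unfolding t_def by (intro restrict_PiE_iff[THEN iffD2]) auto
   moreover have "\<beta> = (\<lambda>i\<in>{..<k}. s (t i))"
   proof
    fix i
    show "\<beta> i = (\<lambda>i\<in>{..<k}. s (t i)) i"
    proof (cases "i < k")
     case True
     then have "\<beta> i \<in> V" by (simp add: V_def)
     then show ?thesis using ti[of "\<beta> i"] cV True by (simp add: s_def t_def)
    next
     case False
     then show ?thesis using \<beta> by (auto simp: PiE_def extensional_def)
    qed
   qed
   ultimately show ?thesis by (intro image_eqI[of _ _ "(s, t)"]) auto
  qed
 qed
 then have "card ?bad <= card ?S" by (intro surj_card_le) (auto intro!: finite_cartesian_product finite_PiE)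
 also have "... = r ^ k * B ^ r" by (simp add: card_cartesian_product card_PiE)
 finally show ?thesis by (simp add: k_def)
qed

lemma sum_gcd_weight_tuples:
 assumes "finite P" "\<And>p. p \<in> P ==> prime p" "i0 < k"
 shows "(\<Sum>\<beta>\<in>{\<beta>\<in>{..<k} \<rightarrow>\<^sub>E {1..B}. \<forall>j<k. j \<noteq> i0 --> \<beta> j \<noteq> \<beta> i0}.
   \<Prod>j\<in>{..<k} - {i0}. gcd_weight P (int (\<beta> j) - int (\<beta> i0))) <= B * (2 * (2 ^ card P * B)) ^ (k - 1)"
proof -
 \<comment> \<open>Once the value \<open>b0\<close> of the distinguished entry is fixed, zero
   weights encode both that entry and the condition that the others avoid it. The summand becomes a
   product over positions, and the sum over tuples factors.\<close>
 define w where "w = (\<lambda>b0 j b. if j = i0 then (if b = b0 then 1 else 0)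
  else if b = b0 then 0 else gcd_weight P (int b - int b0))"
 have "(\<Sum>\<beta>\<in>{\<beta>\<in>{..<k} \<rightarrow>\<^sub>E {1..B}. \<forall>j<k. j \<noteq> i0 --> \<beta> j \<noteq> \<beta> i0}.
   \<Prod>j\<in>{..<k} - {i0}. gcd_weight P (int (\<beta> j) - int (\<beta> i0)))
  = (\<Sum>\<beta>\<in>{\<beta>\<in>{..<k} \<rightarrow>\<^sub>E {1..B}. \<forall>j<k. j \<noteq> i0 --> \<beta> j \<noteq> \<beta> i0}. \<Prod>j<k. w (\<beta> i0) j (\<beta> j))"
 proof (intro sum.cong refl)
  fix \<beta> assume \<beta>: "\<beta> \<in> {\<beta>\<in>{..<k} \<rightarrow>\<^sub>E {1..B}. \<forall>j<k. j \<noteq> i0 --> \<beta> j \<noteq> \<beta> i0}"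
  have "(\<Prod>j<k. w (\<beta> i0) j (\<beta> j)) = w (\<beta> i0) i0 (\<beta> i0) * (\<Prod>j\<in>{..<k} - {i0}. w (\<beta> i0) j (\<beta> j))"
   using assms(3) by (intro prod.remove) auto
  also have "... = (\<Prod>j\<in>{..<k} - {i0}. gcd_weight P (int (\<beta> j) - int (\<beta> i0)))"
   using \<beta> by (auto simp: w_def intro!: prod.cong)
  finally show "(\<Prod>j\<in>{..<k} - {i0}. gcd_weight P (int (\<beta> j) - int (\<beta> i0))) = (\<Prod>j<k. w (\<beta> i0) j (\<beta> j))" ..
 qed
 also have "... <= (\<Sum>\<beta>\<in>{..<k} \<rightarrow>\<^sub>E {1..B}. \<Prod>j<k. w (\<beta> i0) j (\<beta> j))"
  by (intro sum_mono2 finite_PiE) auto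
 also have "... <= (\<Sum>\<beta>\<in>{..<k} \<rightarrow>\<^sub>E {1..B}. \<Sum>b0=1..B. \<Prod>j<k. w b0 j (\<beta> j))"
 proof (intro sum_mono)
  fix \<beta> assume "\<beta> \<in> {..<k} \<rightarrow>\<^sub>E {1..B}"
  then have "\<beta> i0 \<in> {1..B}" using PiE_mem[of \<beta> "{..<k}" "\<lambda>_. {1..B}" i0] assms(3) by simp
  then show "(\<Prod>j<k. w (\<beta> i0) j (\<beta> j)) <= (\<Sum>b0=1..B. \<Prod>j<k. w b0 j (\<beta> j))"
   by (intro member_le_sum[where f = "\<lambda>b0. \<Prod>j<k. w b0 j (\<beta> j)"]) auto
 qed
 also have "... = (\<Sum>b0=1..B. \<Sum>\<beta>\<in>{..<k} \<rightarrow>\<^sub>E {1..B}. \<Prod>j<k. w b0 j (\<beta> j))" by (rule sum.swap)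
 also have "... = (\<Sum>b0=1..B. \<Prod>j<k. \<Sum>b=1..B. w b0 j b)"
 proof (intro sum.cong refl)
  fix b0
  show "(\<Sum>\<beta>\<in>{..<k} \<rightarrow>\<^sub>E {1..B}. \<Prod>j<k. w b0 j (\<beta> j)) = (\<Prod>j<k. \<Sum>b=1..B. w b0 j b)"
   using prod_sum_PiE[of "{..<k}" "\<lambda>_. {1..B}" "w b0"] by simp
 qed
 also have "... <= (\<Sum>b0=1..B. (2 * (2 ^ card P * B)) ^ (k - 1))"
 proof (intro sum_mono)
  fix b0 assume b0: "b0 \<in> {1..B}"
  have "(\<Prod>j<k. \<Sum>b=1..B. w b0 j b) = (\<Sum>b=1..B. w b0 i0 b) * (\<Prod>j\<in>{..<k} - {i0}. \<Sum>b=1..B. w b0 j b)"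
   using assms(3) by (intro prod.remove) auto
  also have "(\<Sum>b=1..B. w b0 i0 b) = 1" using b0 by (simp add: w_def)
  also have "(\<Prod>j\<in>{..<k} - {i0}. \<Sum>b=1..B. w b0 j b) <= (\<Prod>j\<in>{..<k} - {i0}. 2 * (2 ^ card P * B))"
  proof (intro prod_mono conjI)
   fix j assume j: "j \<in> {..<k} - {i0}"
   have "(\<Sum>b=1..B. w b0 j b) = (\<Sum>b\<in>{1..B} - {b0}. w b0 j b)"
    using j by (intro sum.mono_neutral_right) (auto simp: w_def)
   also have "... = (\<Sum>b\<in>{1..B} - {b0}. gcd_weight P (int b - int b0))"
    using j by (intro sum.cong) (auto simp: w_def)
   also have "... <= 2 * (2 ^ card P * B)" using assms b0 by (intro sum_gcd_weight_shift) auto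
   finally show "(\<Sum>b=1..B. w b0 j b) <= 2 * (2 ^ card P * B)" .
  qed auto
  also have "... = (2 * (2 ^ card P * B)) ^ (k - 1)" using assms(3) by simp
  finally show "(\<Prod>j<k. \<Sum>b=1..B. w b0 j b) <= (2 * (2 ^ card P * B)) ^ (k - 1)" by simp
 qed
 finally show ?thesis by simp
qed

text \<open>Tuples in which every entry is repeated are few and receive the trivial bound; they give
  the diagonal term. Any other tuple has an entry \<open>i0\<close> different from all the rest, so
  its complete sum cancels up to gcd factors, which are small on average.\<close>

lemma moment_bound:
 assumes fam: "char_family Y P \<psi>" and Y: "Y > 0" and r: "r > 0"
 shows "(\<Sum>x\<in>{0..<int (\<Prod>P)}. norm (\<Sum>b=1..B. \<Prod>p\<in>P. \<psi> p (x + int b)) ^ (2 * r))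
  <= real r ^ (2 * r) * real (\<Prod>P) * real B ^ r
   + 2 * r * real (weil_const Y (2 * r)) ^ card P * sqrt (real (\<Prod>P)) * (2 * 2 ^ card P * real B) ^ (2 * r)"
proof -
 define k where "k = 2 * r"
 define T where "T = {..<k} \<rightarrow>\<^sub>E {1..B}"
 define bad where "bad = {\<beta>\<in>T. \<forall>i<k. \<exists>j<k. j \<noteq> i \<and> \<beta> j = \<beta> i}"
 define good where "good = (\<lambda>i0. {\<beta>\<in>T. \<forall>j<k. j \<noteq> i0 --> \<beta> j \<noteq> \<beta> i0})"
 define C where "C = real (weil_const Y k) ^ card P * sqrt (real (\<Prod>P))"
 have P: "finite P" "\<And>p. p \<in> P ==> prime p" using fam by (auto simp: char_family_def)
 have fin: "finite T" unfolding T_def by (intro finite_PiE) auto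
 have C0: "C >= 0" by (simp add: C_def prod_nonneg)
 have "(\<Sum>x\<in>{0..<int (\<Prod>P)}. norm (\<Sum>b=1..B. \<Prod>p\<in>P. \<psi> p (x + int b)) ^ (2 * r))
   = norm (complex_of_real (\<Sum>x\<in>{0..<int (\<Prod>P)}. norm (\<Sum>b=1..B. \<Prod>p\<in>P. \<psi> p (x + int b)) ^ (2 * r)))"
  by (simp only: norm_of_real) (intro abs_of_nonneg[symmetric] sum_nonneg, auto)
 also have "... = norm (\<Sum>\<beta>\<in>T. tuple_sum P \<psi> r \<beta>)" unfolding moment_eq T_def k_def ..
 also have "... <= (\<Sum>\<beta>\<in>T. norm (tuple_sum P \<psi> r \<beta>))" by (rule norm_sum)
 also have "... <= (\<Sum>\<beta>\<in>bad. norm (tuple_sum P \<psi> r \<beta>)) + (\<Sum>i0<k. \<Sum>\<beta>\<in>good i0. norm (tuple_sum P \<psi> r \<beta>))"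
 proof -
  have "T \<subseteq> bad \<union> (\<Union>i0<k. good i0)" by (auto simp: bad_def good_def)
  then have "(\<Sum>\<beta>\<in>T. norm (tuple_sum P \<psi> r \<beta>)) <= (\<Sum>\<beta>\<in>bad \<union> (\<Union>i0<k. good i0). norm (tuple_sum P \<psi> r \<beta>))"
   using fin by (intro sum_mono2) (auto simp: bad_def good_def)
  also have "... <= (\<Sum>\<beta>\<in>bad. norm (tuple_sum P \<psi> r \<beta>)) + (\<Sum>\<beta>\<in>(\<Union>i0<k. good i0). norm (tuple_sum P \<psi> r \<beta>))"
   using fin by (subst sum.union_inter[symmetric]) (auto simp: bad_def good_def intro!: sum_nonneg)
  also have "(\<Sum>\<beta>\<in>(\<Union>i0<k. good i0). norm (tuple_sum P \<psi> r \<beta>)) <= (\<Sum>i0<k. \<Sum>\<beta>\<in>good i0. norm (tuple_sum P \<psi> r \<beta>))"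
  proof -
   have "finite (good i0)" for i0 using fin by (simp add: good_def)
   then have "(\<Sum>i0<k. \<Sum>\<beta>\<in>good i0. norm (tuple_sum P \<psi> r \<beta>)) = (\<Sum>(i0, \<beta>)\<in>Sigma {..<k} good. norm (tuple_sum P \<psi> r \<beta>))"
    by (intro sum.Sigma) auto
   moreover have "(\<Sum>\<beta>\<in>snd ` Sigma {..<k} good. norm (tuple_sum P \<psi> r \<beta>)) <= (\<Sum>z\<in>Sigma {..<k} good. norm (tuple_sum P \<psi> r (snd z)))"
    using \<open>\<And>i0. finite (good i0)\<close> sum_image_le[of "Sigma {..<k} good" "\<lambda>\<beta>. norm (tuple_sum P \<psi> r \<beta>)" snd]
    by (simp add: o_def)
   moreover have "snd ` Sigma {..<k} good = (\<Union>i0<k. good i0)" by force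
   ultimately show ?thesis by (simp add: case_prod_unfold)
  qed
  finally show ?thesis by simp
 qed
 also have "(\<Sum>\<beta>\<in>bad. norm (tuple_sum P \<psi> r \<beta>)) <= real r ^ (2 * r) * real (\<Prod>P) * real B ^ r"
 proof -
  have "(\<Sum>\<beta>\<in>bad. norm (tuple_sum P \<psi> r \<beta>)) <= (\<Sum>\<beta>\<in>bad. real (\<Prod>P))"
   by (intro sum_mono tuple_sum_trivial[OF fam])
  also have "... = real (card bad) * real (\<Prod>P)" by simp
  also have "... <= real (r ^ (2 * r) * B ^ r) * real (\<Prod>P)"
   using card_repeating_tuples[of r B] unfolding bad_def T_def k_def
   by (intro mult_right_mono) (simp_all only: of_nat_le_iff of_nat_0_le_iff)
  finally show ?thesis by (simp add: mult_ac)
 qed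
 also have "(\<Sum>i0<k. \<Sum>\<beta>\<in>good i0. norm (tuple_sum P \<psi> r \<beta>)) <= (\<Sum>i0<k. C * (2 * 2 ^ card P * real B) ^ k)"
 proof (intro sum_mono)
  fix i0 assume "i0 \<in> {..<k}"
  then have i0: "i0 < k" by simp
  have "(\<Sum>\<beta>\<in>good i0. norm (tuple_sum P \<psi> r \<beta>))
    <= (\<Sum>\<beta>\<in>good i0. C * real (\<Prod>j\<in>{..<k} - {i0}. gcd_weight P (int (\<beta> j) - int (\<beta> i0))))"
   using tuple_sum_bound[OF fam Y, of i0 r] i0 unfolding C_def k_def by (intro sum_mono) simp
  also have "... = C * real (\<Sum>\<beta>\<in>good i0. \<Prod>j\<in>{..<k} - {i0}. gcd_weight P (int (\<beta> j) - int (\<beta> i0)))"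
   by (simp only: sum_distrib_left of_nat_sum)
  also have "... <= C * real (B * (2 * (2 ^ card P * B)) ^ (k - 1))"
   using sum_gcd_weight_tuples[OF P i0, of B] C0 unfolding good_def T_def
   by (intro mult_left_mono) (simp_all only: of_nat_le_iff)
  also have "real (B * (2 * (2 ^ card P * B)) ^ (k - 1)) <= (2 * 2 ^ card P * real B) ^ k"
  proof -
   have "B * (2 * (2 ^ card P * B)) ^ (k - 1) <= (2 * (2 ^ card P * B)) * (2 * (2 ^ card P * B)) ^ (k - 1)"
    by (intro mult_le_mono1) simp
   also have "... = (2 * 2 ^ card P * B) ^ k" using i0 by (cases k) (auto simp: mult.assoc)
   finally have "real (B * (2 * (2 ^ card P * B)) ^ (k - 1)) <= real ((2 * 2 ^ card P * B) ^ k)" by (simp only: of_nat_le_iff)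
   then show ?thesis by simp
  qed
  finally show "(\<Sum>\<beta>\<in>good i0. norm (tuple_sum P \<psi> r \<beta>)) <= C * (2 * 2 ^ card P * real B) ^ k"
   using C0 by (simp add: mult_left_mono)
 qed
 finally show ?thesis by (simp add: C_def k_def mult_ac)
qed

section \<open>Burgess's bound\<close>

definition divisor_count :: "nat => nat" where
 "divisor_count n = card {d. d dvd n}"

lemma divisor_count_prime_power_mult:
 assumes p: "prime p" and "\<not> p dvd m" "m > 0"
 shows "divisor_count (p ^ a * m) <= (a + 1) * divisor_count m"
proof -
 have "{d. d dvd p ^ a * m} \<subseteq> (\<lambda>(i, e). p ^ i * e) ` ({..a} \<times> {e. e dvd m})"
 proof
  fix d assume "d \<in> {d. d dvd p ^ a * m}"
  then obtain x y where xy: "d = x * y" "x dvd p ^ a" "y dvd m" using division_decomp[of d "p ^ a" m] by auto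
  then obtain i where "i <= a" "x = p ^ i" using divides_primepow_nat[OF p] by auto
  then show "d \<in> (\<lambda>(i, e). p ^ i * e) ` ({..a} \<times> {e. e dvd m})" using xy by force
 qed
 then have "divisor_count (p ^ a * m) <= card ({..a} \<times> {e. e dvd m})"
  unfolding divisor_count_def using assms by (intro surj_card_le) (auto simp: finite_divisors_nat)
 then show ?thesis by (simp add: card_cartesian_product divisor_count_def)
qed

text \<open>Split off one prime power \<open>p ^ a\<close> at a time. For \<open>p\<close> at least
  \<open>2 powr (1 / \<epsilon>)\<close> the factor \<open>a + 1 <= 2 ^ a\<close> is paid by
  \<open>p ^ a\<close> itself; each smaller prime costs the constant \<open>c\<close>, and there are
  boundedly many of them.\<close>

lemma divisor_bound:
 assumes \<epsilon>: "\<epsilon> > 0"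
 obtains C :: real where "C >= 1" "\<And>n. n > 0 ==> real (divisor_count n) <= C * real n powr \<epsilon>"
proof -
 define c where "c = 1 + 1 / (\<epsilon> * ln 2)"
 define T where "T = 2 powr (1 / \<epsilon>)"
 have c1: "c >= 1" using \<epsilon> by (simp add: c_def)
 have small: "real (a + 1) <= c * real (p ^ a) powr \<epsilon>" if "prime p" for p a :: nat
 proof -
  have p2: "real p >= 2" using prime_ge_2_nat[OF that] by simp
  define x where "x = \<epsilon> * ln 2"
  have x: "x > 0" using \<epsilon> by (simp add: x_def)
  have "a + 1 <= (1 + 1 / x) * (1 + a * x)" using x by (simp add: field_simps)
  also have "1 + a * x <= exp (a * x)" by (rule exp_ge_add_one_self)
  also have "exp (a * x) <= exp (\<epsilon> * (a * ln p))"
   using p2 \<epsilon> by (simp add: x_def mult_left_mono mult.left_commute)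
  also have "... = real (p ^ a) powr \<epsilon>" using p2 by (simp add: powr_def ln_realpow)
  finally show ?thesis using x by (simp add: c_def x_def mult_left_mono)
 qed
 have big: "real (a + 1) <= real (p ^ a) powr \<epsilon>" if "prime p" "T <= p" for p a :: nat
 proof -
  have "2 = T powr \<epsilon>" using \<epsilon> by (simp add: T_def powr_powr)
  also have "... <= real p powr \<epsilon>" using that \<epsilon> by (intro powr_mono2) (auto simp: T_def)
  finally have "2 ^ a <= (real p powr \<epsilon>) ^ a" by (intro power_mono) auto
  also have "... = real (p ^ a) powr \<epsilon>"
   using prime_gt_0_nat[OF that(1)] by (simp add: powr_realpow[symmetric] powr_powr mult.commute)
  finally have "2 ^ a <= real (p ^ a) powr \<epsilon>" .
  moreover have "real (a + 1) <= 2 ^ a"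
   using less_exp[of a] by (metis Suc_eq_plus1 Suc_leI of_nat_le_iff of_nat_numeral of_nat_power)
  ultimately show ?thesis by linarith
 qed
 define S where "S = (\<lambda>n. {p. prime p \<and> p dvd n \<and> real p < T})"
 have finS: "finite (S n)" for n
  by (rule finite_subset[of _ "{..nat \<lceil>T\<rceil>}"]) (auto simp: S_def, linarith)
 have main: "real (divisor_count n) <= c ^ card (S n) * real n powr \<epsilon>" if "n > 0" for n
  using that
 proof (induction n rule: less_induct)
  case (less n)
  show ?case
  proof (cases "n = 1")
   case True
   then have "S n = {}" by (auto simp: S_def)
   with True show ?thesis by (simp add: divisor_count_def)
  next
   case False
   then obtain p where p: "prime p" "p dvd n" using prime_factor_nat by blast
   define a where "a = multiplicity p n"
   obtain m where m: "n = p ^ a * m" "\<not> p dvd m"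
    using multiplicity_decompose'[of n p] less.prems p not_prime_unit unfolding a_def by (metis gr_implies_not0)
   have a: "a > 0" using p m less.prems by (cases a) auto
   have m0: "m > 0" using m less.prems by (cases m) auto
   have "p ^ a > 1" using one_less_power[of p a] a prime_gt_1_nat[OF p(1)] by blast
   then have mn: "m < n" using m m0 by simp
   have Sn: "S n = (if p < T then insert p (S m) else S m)"
   proof -
    have "x dvd n \<longleftrightarrow> x = p \<or> x dvd m" if "prime x" for x
     using that p m(1) by (metis prime_dvd_mult_iff prime_dvd_power primes_dvd_imp_eq)
    then show ?thesis using p by (auto simp: S_def)
   qed
   have pm: "p \<notin> S m" using m by (simp add: S_def)
   have "real (divisor_count n) <= real (a + 1) * real (divisor_count m)"
    using divisor_count_prime_power_mult[OF p(1) m(2) m0, of a] m(1) by (metis of_nat_le_iff of_nat_mult)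
   also have "... <= real (a + 1) * (c ^ card (S m) * real m powr \<epsilon>)"
    using less.IH[OF mn m0] by (intro mult_left_mono) auto
   also have "... <= ((if p < T then c else 1) * real (p ^ a) powr \<epsilon>) * (c ^ card (S m) * real m powr \<epsilon>)"
    using small[OF p(1)] big[OF p(1)] c1 by (intro mult_right_mono) auto
   also have "... = c ^ card (S n) * real n powr \<epsilon>"
   proof -
    have "c ^ card (S n) = (if p < T then c else 1) * c ^ card (S m)"
     using pm finS[of m] by (simp add: Sn)
    moreover have "real n powr \<epsilon> = real (p ^ a) powr \<epsilon> * real m powr \<epsilon>"
     by (subst m(1)) (simp only: of_nat_mult powr_mult of_nat_0_le_iff)
    ultimately show ?thesis by (simp only: mult_ac)
   qed
   finally show ?thesis .
  qed
 qed
 show ?thesis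
 proof (rule that[of "c ^ card {p. prime p \<and> real p < T}"])
  show "1 <= c ^ card {p::nat. prime p \<and> real p < T}" using c1 by (rule one_le_power)
  fix n :: nat assume n: "n > 0"
  have "finite {p::nat. prime p \<and> real p < T}"
   by (rule finite_subset[of _ "{..nat \<lceil>T\<rceil>}"]) (auto, linarith)
  then have "card (S n) <= card {p::nat. prime p \<and> real p < T}" by (intro card_mono) (auto simp: S_def)
  then have "c ^ card (S n) <= c ^ card {p::nat. prime p \<and> real p < T}" using c1 by (intro power_increasing)
  then show "real (divisor_count n) <= c ^ card {p::nat. prime p \<and> real p < T} * real n powr \<epsilon>"
   using main[OF n] by (meson mult_right_mono order_trans powr_ge_zero)
 qed
qed

text \<open>A prime of size at least \<open>K powr (1 / \<epsilon>)\<close> pays for its own factor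
  \<open>K\<close>; the number of smaller primes is bounded independently of \<open>P\<close>. This
  disposes of all losses exponential in the number of prime factors.\<close>

lemma power_card_primes_bound:
 fixes K \<epsilon> :: real
 assumes K: "K >= 1" and \<epsilon>: "\<epsilon> > 0"
 obtains C :: real where "C >= 1"
  "\<And>P. finite P ==> (\<And>p. p \<in> P ==> prime p) ==> K ^ card P <= C * real (\<Prod>P) powr \<epsilon>"
proof -
 define T where "T = K powr (1 / \<epsilon>)"
 show ?thesis
 proof (rule that[of "K ^ (nat \<lceil>T\<rceil> + 1)"])
  show "1 <= K ^ (nat \<lceil>T\<rceil> + 1)" using K by (rule one_le_power)
  fix P :: "nat set" assume P: "finite P" "\<And>p. p \<in> P ==> prime p"
  define S where "S = {p\<in>P. real p < T}"
  define L where "L = {p\<in>P. \<not> real p < T}"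
  have "S \<subseteq> {..nat \<lceil>T\<rceil>}" by (auto simp: S_def) linarith
  then have cS: "card S <= nat \<lceil>T\<rceil> + 1" using card_mono[of "{..nat \<lceil>T\<rceil>}" S] by simp
  have SL: "P = S \<union> L" "S \<inter> L = {}" "finite S" "finite L" using P by (auto simp: S_def L_def)
  have "K ^ card P = K ^ card S * (\<Prod>p\<in>L. K)" using SL by (simp add: card_Un_disjoint power_add)
  also have "... <= K ^ (nat \<lceil>T\<rceil> + 1) * (\<Prod>p\<in>L. real p powr \<epsilon>)"
  proof (intro mult_mono prod_mono power_increasing conjI)
   fix p assume p: "p \<in> L"
   have "K = T powr \<epsilon>" using \<epsilon> K by (simp add: T_def powr_powr)
   also have "... <= real p powr \<epsilon>" using p \<epsilon> by (intro powr_mono2) (auto simp: T_def L_def)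
   finally show "K <= real p powr \<epsilon>" .
  qed (use K cS in \<open>auto intro!: prod_nonneg\<close>)
  also have "(\<Prod>p\<in>L. real p powr \<epsilon>) = real (\<Prod>L) powr \<epsilon>"
   using SL(4) by (induction L rule: finite_induct) (auto simp: powr_mult prod_nonneg)
  also have "... <= real (\<Prod>P) powr \<epsilon>"
  proof (intro powr_mono2)
   have "1 <= \<Prod>S" using SL(3) P(2) by (intro prod_ge_1) (auto simp: S_def prime_ge_Suc_0_nat)
   then have "\<Prod>L <= \<Prod>P" using SL by (simp add: prod.union_disjoint)
   then show "real (\<Prod>L) <= real (\<Prod>P)" by (simp only: of_nat_le_iff)
  qed (use \<epsilon> in \<open>auto simp del: of_nat_prod\<close>)
  finally show "K ^ card P <= K ^ (nat \<lceil>T\<rceil> + 1) * real (\<Prod>P) powr \<epsilon>"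
   using K by (simp add: mult_left_mono)
 qed
qed

lemma sieve_multiples:
 fixes q :: nat
 assumes "prime q" "q \<notin> P" "\<And>p. p \<in> P ==> prime p"
 shows "{a\<in>{1..A}. \<forall>p\<in>insert q P. \<not> p dvd a} =
   {a\<in>{1..A}. \<forall>p\<in>P. \<not> p dvd a} - (\<lambda>a. q * a) ` {a\<in>{1..A div q}. \<forall>p\<in>P. \<not> p dvd a}"
  "(\<lambda>a. q * a) ` {a\<in>{1..A div q}. \<forall>p\<in>P. \<not> p dvd a} \<subseteq> {a\<in>{1..A}. \<forall>p\<in>P. \<not> p dvd a}"
proof -
 have q: "q > 0" using prime_gt_0_nat[OF assms(1)] .
 have *: "(\<forall>p\<in>P. \<not> p dvd q * a) \<longleftrightarrow> (\<forall>p\<in>P. \<not> p dvd a)" for a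
  using assms by (metis prime_dvd_mult_iff primes_dvd_imp_eq)
 have **: "q * a \<in> {1..A} \<longleftrightarrow> a \<in> {1..A div q}" for a
  using q by (auto simp: less_eq_div_iff_mult_less_eq mult.commute Suc_le_eq)
 have im: "(\<lambda>a. q * a) ` {a\<in>{1..A div q}. \<forall>p\<in>P. \<not> p dvd a} = {a\<in>{1..A}. (\<forall>p\<in>P. \<not> p dvd a) \<and> q dvd a}"
 proof (intro equalityI subsetI)
  fix x assume "x \<in> {a\<in>{1..A}. (\<forall>p\<in>P. \<not> p dvd a) \<and> q dvd a}"
  then obtain a where "x = q * a" "q * a \<in> {1..A}" "\<forall>p\<in>P. \<not> p dvd q * a" by (auto elim!: dvdE)
  then show "x \<in> (\<lambda>a. q * a) ` {a\<in>{1..A div q}. \<forall>p\<in>P. \<not> p dvd a}" using * ** by blast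
 qed (use * ** q in \<open>auto simp: Suc_le_eq\<close>)
 show "{a\<in>{1..A}. \<forall>p\<in>insert q P. \<not> p dvd a} =
   {a\<in>{1..A}. \<forall>p\<in>P. \<not> p dvd a} - (\<lambda>a. q * a) ` {a\<in>{1..A div q}. \<forall>p\<in>P. \<not> p dvd a}"
  unfolding im by auto
 show "(\<lambda>a. q * a) ` {a\<in>{1..A div q}. \<forall>p\<in>P. \<not> p dvd a} \<subseteq> {a\<in>{1..A}. \<forall>p\<in>P. \<not> p dvd a}"
  unfolding im by auto
qed

text \<open>Legendre's sieve. Adding a prime doubles the error and contributes one more rounding
  error of at most 1, which is the recursion solved by \<open>2 ^ card P - 1\<close>.\<close>

lemma sieve_count:
 assumes "finite P" "\<And>p. p \<in> P ==> prime p"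
 shows "\<bar>real (card {a\<in>{1..A}. \<forall>p\<in>P. \<not> p dvd a}) - real A * (\<Prod>p\<in>P. 1 - 1 / real p)\<bar> <= 2 ^ card P - 1"
 using assms
proof (induction P arbitrary: A rule: finite_induct)
 case (insert q P)
 define N where "N = (\<lambda>A. card {a\<in>{1..A}. \<forall>p\<in>P. \<not> p dvd a})"
 define \<rho> where "\<rho> = (\<Prod>p\<in>P. 1 - 1 / real p)"
 have q: "q > 0" using insert.prems prime_gt_0_nat by auto
 have \<rho>: "0 <= \<rho>" "\<rho> <= 1"
 proof -
  have "1 / real p <= 1" if "p \<in> P" for p using insert.prems that prime_ge_1_nat[of p] by simp
  then show "0 <= \<rho>" "\<rho> <= 1" unfolding \<rho>_def by (auto intro!: prod_nonneg prod_le_1)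
 qed
 have IH: "\<bar>real (N A) - real A * \<rho>\<bar> <= 2 ^ card P - 1" for A
  using insert.IH[of A] insert.prems by (simp add: N_def \<rho>_def)
 have "prime q" using insert.prems by simp
 note sm = sieve_multiples[OF this insert.hyps(2) insert.prems[OF insertI2], of A]
 have "card {a\<in>{1..A}. \<forall>p\<in>insert q P. \<not> p dvd a} = N A - card ((\<lambda>a. q * a) ` {a\<in>{1..A div q}. \<forall>p\<in>P. \<not> p dvd a})"
  unfolding N_def by (subst sm(1), assumption, rule card_Diff_subset)
   (rule finite_subset[OF sm(2)], assumption, simp, rule sm(2), assumption)
 moreover have "card ((\<lambda>a. q * a) ` {a\<in>{1..A div q}. \<forall>p\<in>P. \<not> p dvd a}) = N (A div q)"
  unfolding N_def using q by (intro card_image) (auto simp: inj_on_def)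
 moreover have "card ((\<lambda>a. q * a) ` {a\<in>{1..A div q}. \<forall>p\<in>P. \<not> p dvd a}) <= N A"
  unfolding N_def using insert.prems by (intro card_mono sm(2)) auto
 ultimately have eq: "real (card {a\<in>{1..A}. \<forall>p\<in>insert q P. \<not> p dvd a}) = real (N A) - real (N (A div q))" by simp
 have "real A / q - 1 <= real (A div q)" "real (A div q) <= real A / q"
  using floor_divide_of_nat_eq[of A q, where 'a = real] by linarith+
 then have "\<bar>\<rho> * (real A / q - real (A div q))\<bar> <= 1 * 1"
  unfolding abs_mult using \<rho> by (intro mult_mono) auto
 then have fr: "\<bar>\<rho> * (real A / q) - real (A div q) * \<rho>\<bar> <= 1" by (simp add: algebra_simps)
 have e1: "real A * ((1 - 1 / q) * \<rho>) = real A * \<rho> - \<rho> * (real A / q)" by (simp add: algebra_simps)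
 have e2: "(\<Prod>p\<in>insert q P. 1 - 1 / real p) = (1 - 1 / q) * \<rho>" using insert.hyps by (simp add: \<rho>_def)
 have e3: "(2::real) ^ card (insert q P) = 2 * 2 ^ card P" using insert.hyps by simp
 show ?case unfolding eq e2 e1 e3 using IH[of A] IH[of "A div q"] fr by linarith
next
 case empty
 have "{a\<in>{1..A}. \<forall>p\<in>{}. \<not> p dvd a} = {1..A}" by auto
 then show ?case by simp
qed

text \<open>Chebyshev's sum inequality for similarly ordered families; it drives the induction for
  the power mean inequality.\<close>

lemma sum_mult_le_card_sum:
 fixes a b :: "'i => real"
 assumes "finite I" "\<And>i j. i \<in> I ==> j \<in> I ==> 0 <= (a i - a j) * (b i - b j)"
 shows "(\<Sum>i\<in>I. a i) * (\<Sum>i\<in>I. b i) <= card I * (\<Sum>i\<in>I. a i * b i)"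
proof -
 have "0 <= (\<Sum>i\<in>I. \<Sum>j\<in>I. (a i - a j) * (b i - b j))" using assms(2) by (intro sum_nonneg)
 also have "... = (\<Sum>i\<in>I. \<Sum>j\<in>I. a i * b i + a j * b j - a i * b j - a j * b i)"
  by (simp add: algebra_simps)
 also have "... = 2 * (card I * (\<Sum>i\<in>I. a i * b i)) - 2 * ((\<Sum>i\<in>I. a i) * (\<Sum>i\<in>I. b i))"
 proof -
  have "(\<Sum>i\<in>I. \<Sum>j\<in>I. a j * b i) = (\<Sum>i\<in>I. a i) * (\<Sum>i\<in>I. b i)"
   by (subst sum.swap) (simp add: sum_product)
  then show ?thesis
   by (simp add: sum.distrib sum_subtractf sum_product sum_distrib_left[symmetric])
 qed
 finally show ?thesis by simp
qed

lemma power_sum_le: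
 fixes a :: "'i => real"
 assumes "finite I" "\<And>i. i \<in> I ==> a i >= 0"
 shows "(\<Sum>i\<in>I. a i) ^ Suc r <= real (card I) ^ r * (\<Sum>i\<in>I. a i ^ Suc r)"
proof (induction r)
 case (Suc r)
 have "(\<Sum>i\<in>I. a i) ^ Suc (Suc r) = (\<Sum>i\<in>I. a i) * (\<Sum>i\<in>I. a i) ^ Suc r" by simp
 also have "... <= (\<Sum>i\<in>I. a i) * (real (card I) ^ r * (\<Sum>i\<in>I. a i ^ Suc r))"
  using assms by (intro mult_left_mono Suc sum_nonneg) auto
 also have "... = real (card I) ^ r * ((\<Sum>i\<in>I. a i) * (\<Sum>i\<in>I. a i ^ Suc r))" by simp
 also have "... <= real (card I) ^ r * (card I * (\<Sum>i\<in>I. a i * a i ^ Suc r))"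
 proof (intro mult_left_mono sum_mult_le_card_sum[OF assms(1)])
  fix i j assume ij: "i \<in> I" "j \<in> I"
  show "0 <= (a i - a j) * (a i ^ Suc r - a j ^ Suc r)"
  proof (cases "a i <= a j")
   case True
   then have "a i ^ Suc r <= a j ^ Suc r" using assms(2) ij by (intro power_mono)
   then show ?thesis using True by (simp add: mult_nonpos_nonpos)
  next
   case False
   then have "a j ^ Suc r <= a i ^ Suc r" using assms(2) ij by (intro power_mono) auto
   then show ?thesis using False by (intro mult_nonneg_nonneg) auto
  qed
 qed simp
 finally show ?case by (simp add: mult_ac)
qed simp

text \<open>Hoelder's inequality in two steps with integer exponents: the power mean inequality
  reaches exponent \<open>r\<close>, and Cauchy-Schwarz against the multiplicities \<nu> doubles it.
  The number of coincidences is the second moment of \<nu>.\<close>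

lemma weighted_sum_moment:
 fixes w :: "'x => real" and x :: "'i => 'x"
 assumes "finite I" "finite X" "\<And>i. i \<in> I ==> x i \<in> X" "\<And>y. w y >= 0" "r > 0"
 shows "(\<Sum>i\<in>I. w (x i)) ^ (2 * r) \<le>
  real (card I) ^ (2 * (r - 1)) * real (card {(i, j). i \<in> I \<and> j \<in> I \<and> x i = x j}) * (\<Sum>y\<in>X. w y ^ (2 * r))"
proof -
 define \<nu> where "\<nu> = (\<lambda>y. real (card {i\<in>I. x i = y}))"
 obtain s where s: "r = Suc s" using assms(5) by (cases r) auto
 have "(\<Sum>i\<in>I. w (x i)) ^ r <= real (card I) ^ s * (\<Sum>i\<in>I. w (x i) ^ r)"
  unfolding s using assms by (intro power_sum_le) auto
 then have "((\<Sum>i\<in>I. w (x i)) ^ r)\<^sup>2 <= (real (card I) ^ s * (\<Sum>i\<in>I. w (x i) ^ r))\<^sup>2"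
  using assms by (intro power_mono zero_le_power sum_nonneg) auto
 also have "... = real (card I) ^ (2 * s) * (\<Sum>i\<in>I. w (x i) ^ r)\<^sup>2"
  by (simp add: power_mult_distrib power_mult[symmetric] mult.commute)
 also have "(\<Sum>i\<in>I. w (x i) ^ r) = (\<Sum>y\<in>X. \<nu> y * w y ^ r)"
 proof -
  have "(\<Sum>i\<in>I. w (x i) ^ r) = (\<Sum>y\<in>X. \<Sum>i\<in>{i\<in>I. x i = y}. w (x i) ^ r)"
   using assms by (intro sum.group[symmetric]) auto
  also have "... = (\<Sum>y\<in>X. \<nu> y * w y ^ r)" by (intro sum.cong) (auto simp: \<nu>_def)
  finally show ?thesis .
 qed
 also have "real (card I) ^ (2 * s) * (\<Sum>y\<in>X. \<nu> y * w y ^ r)\<^sup>2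
   <= real (card I) ^ (2 * s) * ((\<Sum>y\<in>X. (\<nu> y)\<^sup>2) * (\<Sum>y\<in>X. (w y ^ r)\<^sup>2))"
  by (intro mult_left_mono Cauchy_Schwarz_ineq_sum) simp
 also have "(\<Sum>y\<in>X. (w y ^ r)\<^sup>2) = (\<Sum>y\<in>X. w y ^ (2 * r))" by (simp add: power_mult[symmetric] mult.commute)
 also have "(\<Sum>y\<in>X. (\<nu> y)\<^sup>2) = real (card {(i, j). i \<in> I \<and> j \<in> I \<and> x i = x j})"
 proof -
  have "{(i, j). i \<in> I \<and> j \<in> I \<and> x i = x j} = (\<Union>y\<in>X. {i\<in>I. x i = y} \<times> {i\<in>I. x i = y})"
   using assms(3) by auto
  also have "card ... = (\<Sum>y\<in>X. card ({i\<in>I. x i = y} \<times> {i\<in>I. x i = y}))"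
   using assms by (intro card_UN_disjoint) auto
  finally show ?thesis by (simp add: card_cartesian_product \<nu>_def power2_eq_square)
 qed
 moreover have "((\<Sum>i\<in>I. w (x i)) ^ r)\<^sup>2 = (\<Sum>i\<in>I. w (x i)) ^ (2 * r)"
  by (simp add: power_mult[symmetric] mult.commute)
 ultimately show ?thesis by (simp add: s mult.assoc)
qed

section \<open>Counting coincidences\<close>

lemma card_le_fibres:
 assumes "finite S" "finite Z" "g ` S \<subseteq> Z" "\<And>z. z \<in> Z ==> card {s\<in>S. g s = z} <= m"
 shows "card S <= card Z * m"
proof -
 have "S = (\<Union>z\<in>Z. {s\<in>S. g s = z})" using assms(3) by auto
 then have "card S <= (\<Sum>z\<in>Z. card {s\<in>S. g s = z})" using card_UN_le[OF assms(2)] by metis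
 also have "... <= (\<Sum>z\<in>Z. m)" using assms(4) by (intro sum_mono)
 finally show ?thesis by simp
qed

lemma card_congruent_pairs:
 assumes f: "f > (0::nat)"
 shows "card {(u, v). u \<in> {1..V} \<and> v \<in> {1..V} \<and> [u = v] (mod f)} <= V * (V div f + 1)"
proof -
 have "{(u, v). u \<in> {1..V} \<and> v \<in> {1..V} \<and> [u = v] (mod f)} = Sigma {1..V} (\<lambda>u. {v\<in>{1..V}. [u = v] (mod f)})" by auto
 also have "card ... = (\<Sum>u\<in>{1..V}. card {v\<in>{1..V}. [u = v] (mod f)})" by (intro card_SigmaI) auto
 also have "... <= (\<Sum>u\<in>{1..V}. V div f + 1)"
 proof (intro sum_mono)
  fix u
  have "inj_on (\<lambda>v. v div f) {v\<in>{1..V}. [u = v] (mod f)}"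
   by (rule inj_onI) (auto simp: cong_def, metis div_mult_mod_eq)
  moreover have "(\<lambda>v. v div f) ` {v\<in>{1..V}. [u = v] (mod f)} \<subseteq> {..V div f}" by (auto intro: div_le_mono)
  ultimately have "card {v\<in>{1..V}. [u = v] (mod f)} <= card {..V div f}" by (intro card_inj_on_le) auto
  then show "card {v\<in>{1..V}. [u = v] (mod f)} <= V div f + 1" by simp
 qed
 finally show ?thesis by simp
qed

text \<open>Equality of the two residues forces \<open>n * a'\<close> and \<open>n' * a\<close> to
  be congruent modulo \<open>f\<close>. For given products \<open>u\<close> and \<open>v\<close>,
  the factors \<open>n\<close> of \<open>u\<close> and \<open>n'\<close> of \<open>v\<close>
  determine \<open>a'\<close> and \<open>a\<close>, so divisor counts bound the fibres over the
  congruent pairs.\<close>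

lemma card_collisions:
 assumes f: "f > 0" and x: "\<And>n a. n \<in> {1..N} ==> a \<in> \<A> ==> [int K * int a * x n a = int n] (mod int f)"
  and \<A>: "\<A> \<subseteq> {1..A}" and T: "\<And>u. u \<in> {1..N * A} ==> divisor_count u <= T"
 shows "card {((n, a), (n', a')). (n, a) \<in> {1..N} \<times> \<A> \<and> (n', a') \<in> {1..N} \<times> \<A> \<and> x n a = x n' a'}
  <= T\<^sup>2 * (N * A * (N * A div f + 1))"
proof -
 define S where "S = {((n, a), (n', a')). (n, a) \<in> {1..N} \<times> \<A> \<and> (n', a') \<in> {1..N} \<times> \<A> \<and> x n a = x n' a'}"
 define g where "g = (\<lambda>((n, a), (n', a')). (n * a', n' * a) :: nat \<times> nat)"
 define Z where "Z = {(u, v). u \<in> {1..N * A} \<and> v \<in> {1..N * A} \<and> [u = v] (mod f)}"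
 have finA: "finite \<A>" using \<A> finite_subset by blast
 have finS: "finite S" by (rule finite_subset[of _ "({1..N} \<times> \<A>) \<times> ({1..N} \<times> \<A>)"]) (auto simp: S_def finA)
 have finZ: "finite Z" by (rule finite_subset[of _ "{1..N * A} \<times> {1..N * A}"]) (auto simp: Z_def)
 have gS: "g ` S \<subseteq> Z"
 proof clarify
  fix n a n' a' u v assume s: "((n, a), (n', a')) \<in> S" and uv: "(u, v) = g ((n, a), (n', a'))"
  have mem: "n \<in> {1..N}" "n' \<in> {1..N}" "a \<in> \<A>" "a' \<in> \<A>" and eq: "x n a = x n' a'" using s by (auto simp: S_def)
  have "[int n * int a' = int K * int a * x n a * int a'] (mod int f)"
   using x[OF mem(1,3)] by (intro cong_mult cong_refl) (simp add: cong_sym)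
  also have "int K * int a * x n a * int a' = int K * int a' * x n' a' * int a" by (simp add: eq)
  also have "[int K * int a' * x n' a' * int a = int n' * int a] (mod int f)"
   using x[OF mem(2,4)] by (intro cong_mult cong_refl)
  finally have "[n * a' = n' * a] (mod f)" by (simp flip: of_nat_mult add: cong_int_iff)
  moreover have "n * a' \<in> {1..N * A}" "n' * a \<in> {1..N * A}" using mem \<A> by (auto intro!: mult_le_mono simp: Suc_le_eq)
  ultimately show "(u, v) \<in> Z" using uv by (simp add: Z_def g_def)
 qed
 have "card {s\<in>S. g s = z} <= T\<^sup>2" if z: "z \<in> Z" for z
 proof -
  obtain u v where uv: "z = (u, v)" "u \<in> {1..N * A}" "v \<in> {1..N * A}" using z by (auto simp: Z_def)
  let ?D = "{d. d dvd u} \<times> {d. d dvd v}"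
  have fin: "finite ?D" using uv by (auto intro!: finite_divisors_nat)
  have "inj_on (\<lambda>((n, a), (n', a')). (n, n')) {s\<in>S. g s = z}"
   using uv by (auto simp: inj_on_def S_def g_def)
  moreover have "(\<lambda>((n, a), (n', a')). (n, n')) ` {s\<in>S. g s = z} \<subseteq> ?D" using uv by (auto simp: g_def)
  ultimately have "card {s\<in>S. g s = z} <= card ?D" using fin by (intro card_inj_on_le)
  also have "... = divisor_count u * divisor_count v" by (simp add: card_cartesian_product divisor_count_def)
  also have "... <= T * T" using T uv by (intro mult_le_mono) auto
  finally show ?thesis by (simp add: power2_eq_square)
 qed
 then have "card S <= card Z * T\<^sup>2" by (rule card_le_fibres[OF finS finZ gS])
 also have "card Z * T\<^sup>2 <= (N * A * (N * A div f + 1)) * T\<^sup>2"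
  unfolding Z_def by (intro mult_le_mono1 card_congruent_pairs f)
 finally show ?thesis by (simp add: S_def mult.commute)
qed

lemma sum_shift_bound:
 fixes c :: "nat => 'a::real_normed_vector"
 assumes "\<And>n. norm (c n) <= 1"
 shows "norm ((\<Sum>n=1..N. c n) - (\<Sum>n=1..N. c (n + h))) <= 2 * real h"
proof (induction h)
 case (Suc h)
 have "(\<Sum>n=1..N. c (n + h)) + c (N + h + 1) = c (1 + h) + (\<Sum>n=1..N. c (n + Suc h))"
 proof -
  have "(\<Sum>n=1..N+1. c (n + h)) = c (1 + h) + (\<Sum>n=2..N+1. c (n + h))"
   by (subst sum.atLeast_Suc_atMost) (auto simp: numeral_2_eq_2)
  also have "(\<Sum>n=2..N+1. c (n + h)) = (\<Sum>n=1..N. c (n + Suc h))"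
   by (rule sum.reindex_bij_witness[of _ "\<lambda>n. n + 1" "\<lambda>n. n - 1"]) auto
  finally show ?thesis by (simp add: add_ac)
 qed
 then have "(\<Sum>n=1..N. c n) - (\<Sum>n=1..N. c (n + Suc h))
   = ((\<Sum>n=1..N. c n) - (\<Sum>n=1..N. c (n + h))) + (c (1 + h) - c (N + h + 1))"
  by (simp add: algebra_simps)
 also have "norm ... <= norm ((\<Sum>n=1..N. c n) - (\<Sum>n=1..N. c (n + h))) + norm (c (1 + h) - c (N + h + 1))"
  by (rule norm_triangle_ineq)
 also have "norm (c (1 + h) - c (N + h + 1)) <= norm (c (1 + h)) + norm (c (N + h + 1))"
  by (rule norm_triangle_ineq4)
 finally show ?case using Suc assms[of "1 + h"] assms[of "N + h + 1"] by simp
qed simp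

section \<open>Characters of squarefree modulus and shifted sums\<close>

definition fam_char :: "nat set => (nat => int => complex) => int => complex" where
 "fam_char P \<psi> x = (\<Prod>p\<in>P. \<psi> p x)"

lemma fam_char_mult: "char_family Y P \<psi> ==> fam_char P \<psi> (a * b) = fam_char P \<psi> a * fam_char P \<psi> b"
 unfolding fam_char_def prod.distrib[symmetric] by (intro prod.cong) (auto simp: char_family_def dchar_mult)

lemma fam_char_cong: "char_family Y P \<psi> ==> [x = y] (mod int (\<Prod>P)) ==> fam_char P \<psi> x = fam_char P \<psi> y"
 unfolding fam_char_def by (rule prod_cong_mod) (auto simp: char_family_def dchar_cong)

lemma fam_char_norm_le: "char_family Y P \<psi> ==> norm (fam_char P \<psi> x) <= 1"
proof -
 assume "char_family Y P \<psi>"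
 then have "(\<Prod>p\<in>P. norm (\<psi> p x)) <= (\<Prod>p\<in>P. 1)"
  by (intro prod_mono) (auto simp: char_family_def intro!: dchar_norm_le prime_gt_0_nat)
 then show ?thesis by (simp add: fam_char_def prod_norm)
qed

text \<open>Shifting by multiples of \<open>K\<close> leaves the factor \<kappa> of period
  \<open>K\<close> unchanged, so it can be pulled out of the sum over \<open>b\<close> together with
  the value at \<open>K * a\<close>. What remains depends on \<open>n\<close> and \<open>a\<close>
  only through the residue \<open>x n a\<close>.\<close>

lemma burgess_shift:
 assumes fam: "char_family Y P \<psi>" and f: "f = \<Prod>P"
  and \<kappa>: "\<And>a b. [a = b] (mod int K) ==> \<kappa> a = \<kappa> b" "\<And>a. norm (\<kappa> a :: complex) <= 1"
  and x: "\<And>n a. n \<in> {1..N} ==> a \<in> \<A> ==> [int K * int a * x n a = int n] (mod int f)"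
  and \<A>: "\<A> \<subseteq> {1..A}"
 shows "real (card \<A> * B) * norm (\<Sum>n=1..N. \<kappa> (int n) * fam_char P \<psi> (int n)) \<le>
  real (card \<A> * B) * (2 * real (K * A * B)) + (\<Sum>(n, a)\<in>{1..N} \<times> \<A>. norm (\<Sum>b=1..B. fam_char P \<psi> (x n a + int b)))"
proof -
 define c where "c = (\<lambda>n::nat. \<kappa> (int n) * fam_char P \<psi> (int n))"
 define S where "S = (\<Sum>n=1..N. c n)"
 have c1: "norm (c n) <= 1" for n
  unfolding c_def norm_mult using \<kappa>(2) fam_char_norm_le[OF fam] by (intro mult_le_one) auto
 have sh: "norm (S - (\<Sum>n=1..N. c (n + K * a * b))) <= 2 * real (K * A * B)" if "a \<in> \<A>" "b \<in> {1..B}" for a b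
 proof -
  have "norm (S - (\<Sum>n=1..N. c (n + K * a * b))) <= 2 * real (K * a * b)"
   unfolding S_def by (rule sum_shift_bound[OF c1])
  also have "K * a * b <= K * A * B" using that \<A> by (intro mult_le_mono) auto
  then have "2 * real (K * a * b) <= 2 * real (K * A * B)" by (simp only: of_nat_le_iff mult_le_cancel_left_pos zero_less_numeral)
  finally show ?thesis .
 qed
 have "real (card \<A> * B) * norm S = norm (\<Sum>a\<in>\<A>. \<Sum>b=1..B. S)" by (simp add: norm_mult)
 also have "(\<Sum>a\<in>\<A>. \<Sum>b=1..B. S) = (\<Sum>a\<in>\<A>. \<Sum>b=1..B. S - (\<Sum>n=1..N. c (n + K * a * b)))
   + (\<Sum>a\<in>\<A>. \<Sum>b=1..B. \<Sum>n=1..N. c (n + K * a * b))"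
  by (simp add: sum_subtractf)
 also have "norm ... <= norm (\<Sum>a\<in>\<A>. \<Sum>b=1..B. S - (\<Sum>n=1..N. c (n + K * a * b)))
   + norm (\<Sum>a\<in>\<A>. \<Sum>b=1..B. \<Sum>n=1..N. c (n + K * a * b))" by (rule norm_triangle_ineq)
 also have "norm (\<Sum>a\<in>\<A>. \<Sum>b=1..B. S - (\<Sum>n=1..N. c (n + K * a * b))) <= (\<Sum>a\<in>\<A>. \<Sum>b=1..B. 2 * real (K * A * B))"
  using sh by (intro sum_norm_le) auto
 also have "(\<Sum>a\<in>\<A>. \<Sum>b=1..B. 2 * real (K * A * B)) = real (card \<A> * B) * (2 * real (K * A * B))" by simp
 also have "(\<Sum>a\<in>\<A>. \<Sum>b=1..B. \<Sum>n=1..N. c (n + K * a * b)) = (\<Sum>(n, a)\<in>{1..N} \<times> \<A>. \<Sum>b=1..B. c (n + K * a * b))"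
 proof -
  have "(\<Sum>a\<in>\<A>. \<Sum>b=1..B. \<Sum>n=1..N. c (n + K * a * b)) = (\<Sum>a\<in>\<A>. \<Sum>n=1..N. \<Sum>b=1..B. c (n + K * a * b))"
   by (intro sum.cong refl sum.swap)
  also have "... = (\<Sum>n=1..N. \<Sum>a\<in>\<A>. \<Sum>b=1..B. c (n + K * a * b))" by (rule sum.swap)
  finally show ?thesis by (simp only: sum.cartesian_product[symmetric])
 qed
 also have "norm ... <= (\<Sum>(n, a)\<in>{1..N} \<times> \<A>. norm (\<Sum>b=1..B. fam_char P \<psi> (x n a + int b)))"
 proof (intro sum_norm_le, clarify)
  fix n a assume na: "n \<in> {1..N}" "a \<in> \<A>"
  have "c (n + K * a * b) = \<kappa> (int n) * fam_char P \<psi> (int K * int a) * fam_char P \<psi> (x n a + int b)" for b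
  proof -
   have "\<kappa> (int (n + K * a * b)) = \<kappa> (int n)" by (intro \<kappa>(1)) (simp add: cong_def mult.assoc)
   moreover have "fam_char P \<psi> (int (n + K * a * b)) = fam_char P \<psi> (int K * int a * (x n a + int b))"
    using x[OF na] f by (intro fam_char_cong[OF fam]) (simp add: distrib_left cong_add cong_sym)
   ultimately show ?thesis by (simp add: c_def fam_char_mult[OF fam])
  qed
  then have "(\<Sum>b=1..B. c (n + K * a * b)) = \<kappa> (int n) * fam_char P \<psi> (int K * int a) * (\<Sum>b=1..B. fam_char P \<psi> (x n a + int b))"
   by (simp add: sum_distrib_left)
  also have "norm ... <= 1 * 1 * norm (\<Sum>b=1..B. fam_char P \<psi> (x n a + int b))"
   unfolding norm_mult using \<kappa>(2) fam_char_norm_le[OF fam] by (intro mult_mono) auto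
  finally show "norm (\<Sum>b=1..B. c (n + K * a * b)) <= norm (\<Sum>b=1..B. fam_char P \<psi> (x n a + int b))" by simp
 qed
 finally show ?thesis by (simp add: S_def c_def)
qed

lemma moment_ratio_bound:
 fixes X L V T k M B F :: real
 assumes X: "X ^ (2 * r) <= L ^ (2 * (r - 1)) * (T\<^sup>2 * (V * (V / F + 1))) * M" and L: "L > 0" and VL: "V <= L * (2 * k)"
  and V: "V > 0" and B: "B > 0" and M: "M >= 0" and F: "F > 0" and r: "r > 0"
 shows "(X / (L * B)) ^ (2 * r) <= 4 * k\<^sup>2 * T\<^sup>2 * (1 / F + 1 / V) * (M / B ^ (2 * r))"
proof -
 have Lr: "L ^ (2 * r) = L ^ (2 * (r - 1)) * L\<^sup>2" using r by (cases r) (auto simp: power2_eq_square)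
 have "V\<^sup>2 <= (L * (2 * k))\<^sup>2" using VL V by (intro power_mono) auto
 then have VL2: "V\<^sup>2 / L\<^sup>2 <= 4 * k\<^sup>2" using L by (simp add: pos_divide_le_eq power_mult_distrib mult_ac)
 have "(X / (L * B)) ^ (2 * r) = X ^ (2 * r) / (L ^ (2 * r) * B ^ (2 * r))" by (simp add: power_divide power_mult_distrib)
 also have "... <= L ^ (2 * (r - 1)) * (T\<^sup>2 * (V * (V / F + 1))) * M / (L ^ (2 * r) * B ^ (2 * r))"
  using X L B by (intro divide_right_mono) auto
 also have "... = (T\<^sup>2 * (V * (V / F + 1))) / L\<^sup>2 * (M / B ^ (2 * r))" using L by (simp add: Lr)
 also have "V * (V / F + 1) = V\<^sup>2 * (1 / F + 1 / V)" using V by (simp add: field_simps power2_eq_square)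
 also have "(T\<^sup>2 * (V\<^sup>2 * (1 / F + 1 / V))) / L\<^sup>2 * (M / B ^ (2 * r)) = (V\<^sup>2 / L\<^sup>2) * (T\<^sup>2 * (1 / F + 1 / V) * (M / B ^ (2 * r)))"
  by simp
 also have "... <= (4 * k\<^sup>2) * (T\<^sup>2 * (1 / F + 1 / V) * (M / B ^ (2 * r)))"
  using VL2 V B M F by (intro mult_right_mono) auto
 finally show ?thesis by (simp add: mult_ac)
qed

lemma prod_one_minus_inverse_ge:
 assumes "finite P" "\<And>p. p \<in> P ==> prime (p::nat)"
 shows "(1 / 2) ^ card P <= (\<Prod>p\<in>P. 1 - 1 / real p)"
proof -
 have "(\<Prod>p\<in>P. 1 / 2) <= (\<Prod>p\<in>P. 1 - 1 / real p)"
 proof (intro prod_mono conjI)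
  fix p assume "p \<in> P"
  then have "real p >= 2" using assms(2) prime_ge_2_nat by fastforce
  then have "1 / real p <= 1 / 2" by (intro divide_left_mono) auto
  then show "1 / 2 <= 1 - 1 / real p" by simp
 qed auto
 then show ?thesis by simp
qed

text \<open>The sieved density is at least \<open>(1 / 2) ^ card P\<close>; the hypothesis on
  \<open>A\<close> makes half of the resulting main term absorb the error of the sieve.\<close>

lemma coprime_sieve_lower_bound:
 assumes "finite P" "\<And>p. p \<in> P ==> prime (p::nat)" "2 * (2 ^ card P)\<^sup>2 <= real A"
 shows "real A <= real (card {a\<in>{1..A}. \<forall>p\<in>P. \<not> p dvd a}) * (2 * 2 ^ card P)"
proof -
 define k :: real where "k = 2 ^ card P"
 have k: "k >= 1" by (simp add: k_def)
 define c where "c = real (card {a\<in>{1..A}. \<forall>p\<in>P. \<not> p dvd a})"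
 have "1 / k <= (\<Prod>p\<in>P. 1 - 1 / real p)" using prod_one_minus_inverse_ge[OF assms(1,2)] by (simp add: k_def power_one_over)
 then have "real A * (1 / k) <= real A * (\<Prod>p\<in>P. 1 - 1 / real p)" by (intro mult_left_mono) auto
 then have "real A * (1 / k) - k <= c" using sieve_count[OF assms(1,2), of A] by (simp add: k_def c_def)
 then have "(real A * (1 / k) - k) * (2 * k) <= c * (2 * k)" using k by (intro mult_right_mono) auto
 moreover have "(real A * (1 / k) - k) * (2 * k) = real A + (real A - 2 * k\<^sup>2)"
  using k by (simp add: field_simps power2_eq_square)
 ultimately have "real A + (real A - 2 * k\<^sup>2) <= c * (2 * k)" by (simp only:)
 moreover have "2 * k\<^sup>2 <= real A" using assms(3) by (simp add: k_def)
 ultimately have "real A <= c * (2 * k)" by linarith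
 then show ?thesis by (simp only: k_def c_def)
qed

lemma norm_char_sum_le:
 assumes "\<And>n. norm (c n :: complex) <= 1"
 shows "norm (\<Sum>n=1..N. c n) <= real N"
 using sum_norm_le[of "{1..N}" c "\<lambda>_. 1"] assms by simp

text \<open>A twist \<kappa> of bounded period is carried along because characters of bounded order
  are squarefree characters with such a twist. The upper limit on \<open>N\<close> keeps all divisor
  counts below a small power of the modulus; longer sums are left to periodicity.\<close>

theorem burgess:
 assumes Y: "Y > 0" and \<epsilon>: "0 < \<epsilon>" "\<epsilon> <= 1 / 4"
 obtains \<delta> C :: real where "\<delta> > 0" "\<delta> <= 1" "C >= 1"
  "\<And>K \<kappa> P \<psi> N. K > 0 ==> K <= K0 ==> char_family Y P \<psi> ==> coprime K (\<Prod>P) ==>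
   (\<And>a b. [a = b] (mod int K) ==> \<kappa> a = \<kappa> b) ==> (\<And>a. norm (\<kappa> a :: complex) <= 1) ==>
   real (\<Prod>P) powr (1 / 4 + \<epsilon>) <= real N ==> N <= (\<Prod>P) ^ 16 ==>
   norm (\<Sum>n=1..N. \<kappa> (int n) * fam_char P \<psi> (int n)) <= C * real N * real (\<Prod>P) powr (- \<delta>)"
proof -
 define r where "r = nat \<lceil>2 / \<epsilon>\<rceil>"
 have r2: "real r >= 2 / \<epsilon>" using \<epsilon> by (simp add: r_def)
 have "2 / \<epsilon> >= 8" using \<epsilon> by (simp add: field_simps)
 then have r8: "real r >= 8" using r2 by linarith
 then have r0: "r > 0" by (cases r) auto
 have re: "real r * \<epsilon> >= 2" using r2 \<epsilon> by (simp add: field_simps)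
 \<comment> \<open>The final exponent is - \<epsilon> plus losses \<open>5 * e + 2 * r * e\<close>,
   which this choice keeps below \<epsilon>\<open>/ 2\<close>. The choice of \<delta> spreads the
   remaining \<epsilon>\<open>/ 2\<close> over a root of order \<open>2 * r\<close>.\<close>
 define e where "e = \<epsilon> / (14 * r)"
 define \<delta> where "\<delta> = \<epsilon> / (4 * r)"
 have e0: "e > 0" using \<epsilon> r0 by (simp add: e_def)
 have \<delta>0: "\<delta> > 0" using \<epsilon> r0 by (simp add: \<delta>_def)
 have e16: "2 * e <= 1 / 8"
 proof -
  have "2 * e = \<epsilon> / (7 * r)" by (simp add: e_def)
  also have "... <= (1 / 4) / 1" using \<epsilon> r8 by (intro frac_le) auto
  finally have "2 * e <= (1/4) / 1" .
  moreover have "2 * e * (7 * r) = \<epsilon>" using r0 by (simp add: e_def)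
  moreover have "2 * e * 56 <= 2 * e * (7 * r)" using r8 e0 by (intro mult_left_mono) auto
  ultimately show ?thesis using \<epsilon> by linarith
 qed
 have er: "1 / (2 * real r) <= \<epsilon> / 4" using re r0 by (simp add: field_simps)
 have \<delta>\<epsilon>: "\<delta> <= \<epsilon> / 4"
  unfolding \<delta>_def using \<epsilon> r8 by (intro divide_left_mono) auto
 obtain C1 where C1: "C1 >= 1" "\<And>P. finite P ==> (\<And>p. p \<in> P ==> prime p) ==> 2 ^ card P <= C1 * real (\<Prod>P) powr e"
  using power_card_primes_bound[of 2 e] e0 by auto
 define w where "w = real (weil_const Y (2 * r))"
 have w1: "w >= 1" using weil_const_ge_1[of "2 * r" Y] r0 by (simp add: w_def)
 obtain C2 where C2: "C2 >= 1" "\<And>P. finite P ==> (\<And>p. p \<in> P ==> prime p) ==> w ^ card P <= C2 * real (\<Prod>P) powr e"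
  using power_card_primes_bound[OF w1 e0] by auto
 \<comment> \<open>Divisor counts are taken at products up to \<open>N * A\<close>, which is at most
   the 32nd power of the modulus; hence the exponent \<open>e / 32\<close>.\<close>
 obtain Cd where Cd: "Cd >= 1" "\<And>n. n > 0 ==> real (divisor_count n) <= Cd * real n powr (e / 32)"
  using divisor_bound[of "e / 32"] e0 by auto
 \<comment> \<open>Beyond this size the modulus guarantees the hypothesis of the sieve on
   \<open>A\<close>. For smaller moduli the trivial bound is absorbed into the summand
   \<open>f0 powr \<delta>\<close> of \<open>C\<close>.\<close>
 define f0 where "f0 = (4 * C1\<^sup>2) powr 8"
 have C1sq: "1 <= 4 * C1\<^sup>2" using one_le_power[OF C1(1), of 2] by linarith
 then have f01: "f0 >= 1" unfolding f0_def by (intro ge_one_powr_ge_zero) auto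
 define D where "D = real r ^ (2 * r) * 2 ^ r + 2 * r * C2 * (2 * C1) ^ (2 * r)"
 have "1 * 1 <= real r ^ (2 * r) * 2 ^ r" using r8 by (intro mult_mono one_le_power) auto
 moreover have "0 <= 2 * r * C2 * (2 * C1) ^ (2 * r)" using C1 C2 by (intro mult_nonneg_nonneg) auto
 ultimately have D1: "D >= 1" unfolding D_def by linarith
 define D' where "D' = 4 * C1\<^sup>2 * Cd\<^sup>2 * 3 * D"
 have D'1: "D' >= 1"
 proof -
  have "1 * 1 * 1 * 1 <= (4 * C1\<^sup>2) * Cd\<^sup>2 * 3 * D" using C1sq Cd(1) D1 one_le_power[of Cd 2]
   by (intro mult_mono) auto
  then show ?thesis by (simp add: D'_def)
 qed
 define C where "C = 2 * K0 + D' + f0 powr \<delta>"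
 show ?thesis
 proof (rule that[of \<delta> C])
  show "\<delta> > 0" "\<delta> <= 1" using \<delta>0 \<delta>\<epsilon> \<epsilon> by auto
  show "C >= 1" using D'1 powr_ge_zero[of f0 \<delta>] unfolding C_def by linarith
  fix K \<kappa> P \<psi> N
  assume K: "K > 0" "K <= K0" and fam: "char_family Y P \<psi>" and cop: "coprime K (\<Prod>P)"
   and \<kappa>: "\<And>a b. [a = b] (mod int K) ==> \<kappa> a = \<kappa> b" "\<And>a. norm (\<kappa> a :: complex) <= 1"
   and N: "real (\<Prod>P) powr (1 / 4 + \<epsilon>) <= real N" "N <= (\<Prod>P) ^ 16"
  have P: "finite P" "\<And>p. p \<in> P ==> prime p" using fam by (auto simp: char_family_def)
  define f where "f = \<Prod>P"
  define F where "F = real f"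
  have "f >= 1" unfolding f_def using P prime_ge_1_nat by (intro prod_ge_1) auto
  then have F1: "F >= 1" and f1: "f > 0" by (auto simp: F_def)
  have N1: "F powr (1 / 4 + \<epsilon>) <= real N" and N16: "real N <= F ^ 16"
   using N by (simp_all only: F_def f_def of_nat_power[symmetric] of_nat_le_iff)
  have "1 <= F powr (1 / 4 + \<epsilon>)" using F1 \<epsilon> by (intro ge_one_powr_ge_zero) auto
  then have Npos: "real N >= 1" using N1 by linarith
  define S where "S = (\<Sum>n=1..N. \<kappa> (int n) * fam_char P \<psi> (int n))"
  have "norm S <= C * real N * F powr (- \<delta>)"
  proof (cases "F >= f0")
   case False
   have "norm S <= real N" unfolding S_def
    using \<kappa>(2) fam_char_norm_le[OF fam] by (intro norm_char_sum_le) (auto simp: norm_mult intro!: mult_le_one)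
   also have "... = real N * (F powr \<delta> * F powr (- \<delta>))" using F1 by (simp add: powr_minus)
   also have "... <= real N * (f0 powr \<delta> * F powr (- \<delta>))"
    using False F1 \<delta>0 by (intro mult_left_mono mult_right_mono powr_mono2) auto
   also have "... <= C * real N * F powr (- \<delta>)"
   proof -
    have "f0 powr \<delta> <= C" using D'1 by (simp add: C_def)
    then have "f0 powr \<delta> * (real N * F powr (- \<delta>)) <= C * (real N * F powr (- \<delta>))" by (intro mult_right_mono) auto
    then show ?thesis by (simp add: mult_ac)
   qed
   finally show ?thesis .
  next
   case True
   define k :: real where "k = 2 ^ card P"
   have k1: "k >= 1" by (simp add: k_def)
   have kF: "k <= C1 * F powr e" using C1(2)[OF P] by (simp add: k_def F_def f_def)
   \<comment> \<open>This length balances the two parts of the moment bound: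
     \<open>F * B ^ r\<close> and \<open>sqrt F * B ^ (2 * r)\<close> both become
     \<open>F powr (3 / 2)\<close> up to constants.\<close>
   define R where "R = F powr (1 / (2 * r))"
   have R1: "R >= 1" unfolding R_def using F1 by (intro ge_one_powr_ge_zero) auto
   define B where "B = nat \<lfloor>R\<rfloor>"
   have B1: "real B <= R" "B >= 1" "R <= 2 * real B"
   proof -
    show "real B <= R" using R1 by (simp add: B_def)
    show "B >= 1" using R1 by (simp add: B_def le_nat_iff)
    moreover have "R < real B + 1" using R1 unfolding B_def by linarith
    ultimately show "R <= 2 * real B" by simp
   qed
   \<comment> \<open>\<open>A\<close> is taken as large as the shift error permits:
     \<open>A * B\<close> stays within the saving \<open>N * F powr (- \<delta>)\<close>, and
     \<open>K\<close> is bounded.\<close>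
   define G where "G = real N * F powr (- \<delta>) / real B"
   define A where "A = nat \<lfloor>G\<rfloor>"
   have G4: "F powr (1 / 4) <= G"
   proof -
    have "F powr (1 / 4) * R <= F powr (1 / 4) * F powr (\<epsilon> - \<delta>)"
     unfolding R_def using F1 er \<delta>\<epsilon> \<epsilon> by (intro mult_left_mono powr_mono) auto
    also have "... = F powr (1 / 4 + \<epsilon>) * F powr (- \<delta>)" by (simp add: powr_add[symmetric] algebra_simps)
    also have "... <= real N * F powr (- \<delta>)" using N1 by (intro mult_right_mono) auto
    finally have "F powr (1 / 4) * real B <= real N * F powr (- \<delta>)"
     using B1(1) by (meson mult_left_mono order_trans powr_ge_zero)
    then show ?thesis using B1 by (simp add: G_def pos_le_divide_eq)
   qed
   have "1 <= F powr (1 / 4)" using F1 by (intro ge_one_powr_ge_zero) auto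
   then have G1: "G >= 1" using G4 by linarith
   have A1: "real A <= G" "A >= 1" "G <= 2 * real A"
   proof -
    show "real A <= G" using G1 by (simp add: A_def)
    show "A >= 1" using G1 by (simp add: A_def le_nat_iff)
    moreover have "G < real A + 1" using G1 unfolding A_def by linarith
    ultimately show "G <= 2 * real A" by simp
   qed
   have AB: "real A * real B <= real N * F powr (- \<delta>)"
    using A1(1) B1(2) by (simp add: G_def pos_le_divide_eq)
   define \<A> where "\<A> = {a\<in>{1..A}. \<forall>p\<in>P. \<not> p dvd a}"
   have finA: "finite \<A>" and subA: "\<A> \<subseteq> {1..A}" by (auto simp: \<A>_def)
   have A\<A>: "real A <= real (card \<A>) * (2 * k)"
    unfolding \<A>_def k_def
   proof (rule coprime_sieve_lower_bound[OF P])
    have "4 * k\<^sup>2 <= 4 * (C1 * F powr e)\<^sup>2" using kF k1 by (intro mult_left_mono power_mono) auto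
    also have "... = 4 * C1\<^sup>2 * F powr (2 * e)" using F1
     by (simp add: power_mult_distrib powr_realpow[symmetric] powr_powr mult.commute)
    also have "... <= F powr (1 / 8) * F powr (1 / 8)"
    proof (intro mult_mono)
     have "4 * C1\<^sup>2 = f0 powr (1 / 8)" unfolding f0_def powr_powr using C1 by simp
     also have "... <= F powr (1 / 8)" using True f01 by (intro powr_mono2) auto
     finally show "4 * C1\<^sup>2 <= F powr (1 / 8)" .
     show "F powr (2 * e) <= F powr (1 / 8)" using F1 e16 by (intro powr_mono) auto
    qed auto
    also have "... = F powr (1 / 4)" by (simp flip: powr_add)
    also have "... <= 2 * real A" using G4 A1(3) by linarith
    finally show "2 * (2 ^ card P)\<^sup>2 <= real A" by (simp add: k_def)
   qed
   have cA: "real (card \<A>) > 0"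
   proof (rule ccontr)
    assume "\<not> real (card \<A>) > 0"
    then have "card \<A> = 0" by simp
    then show False using A\<A> A1(2) by simp
   qed
   have cop\<A>: "\<exists>y. y \<in> {0..<int f} \<and> [int K * int a * y = int n] (mod int f)" if "a \<in> \<A>" for a n
   proof -
    have "coprime a p" if "p \<in> P" for p
     using that \<open>a \<in> \<A>\<close> P prime_imp_coprime[of p a] by (auto simp: \<A>_def coprime_commute)
    then have "coprime a (\<Prod>P)" by (intro prod_coprime_right) auto
    then have "coprime (int K * int a) (int f)" using cop by (simp add: f_def flip: of_nat_mult of_nat_prod)
    then obtain y where "[int K * int a * y = 1] (mod int f)" using cong_solve_coprime_int by blast
    then have "[int K * int a * y * int n = 1 * int n] (mod int f)" by (intro cong_mult cong_refl)
    then have "[int K * int a * ((y * int n) mod int f) = int n] (mod int f)"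
     by (metis cong_def mod_mult_right_eq mult.assoc mult_1)
    moreover have "(y * int n) mod int f \<in> {0..<int f}" using f1 by simp
    ultimately show ?thesis by blast
   qed
   define x where "x = (\<lambda>n a. SOME y. y \<in> {0..<int f} \<and> [int K * int a * y = int n] (mod int f))"
   have x: "x n a \<in> {0..<int f}" "[int K * int a * x n a = int n] (mod int f)" if "a \<in> \<A>" for n a
    using someI_ex[OF cop\<A>[OF that, of n]] by (simp_all add: x_def)
   define W where "W = (\<lambda>y. norm (\<Sum>b=1..B. fam_char P \<psi> (y + int b)))"
   define X where "X = (\<Sum>(n, a)\<in>{1..N} \<times> \<A>. W (x n a))"
   have shift: "real (card \<A> * B) * norm S <= real (card \<A> * B) * (2 * real (K * A * B)) + X"
    unfolding S_def X_def W_def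
    by (rule burgess_shift[OF fam f_def \<kappa> x(2) subA])
   define T where "T = nat \<lfloor>Cd * F powr e\<rfloor>"
   have TF: "real T <= Cd * F powr e" using Cd by (simp add: T_def)
   have Tb: "divisor_count u <= T" if u: "u \<in> {1..N * A}" for u
   proof -
    have "F powr (- \<delta>) <= 1" using powr_mono[of "- \<delta>" 0 F] F1 \<delta>0 by simp
    then have "G <= real N * 1 / 1" unfolding G_def using B1 by (intro frac_le mult_left_mono) auto
    then have "real A <= real N" using A1(1) by simp
    have "real u <= real (N * A)" using u by (simp only: of_nat_le_iff) simp
    also have "... <= real N * real N" using \<open>real A <= real N\<close> by (simp add: mult_left_mono)
    also have "... <= F ^ 16 * F ^ 16" using N16 F1 by (intro mult_mono) auto
    also have "... = F powr 32" using F1 by (simp flip: power_add)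
    finally have "real u powr (e / 32) <= (F powr 32) powr (e / 32)" using e0 by (intro powr_mono2) auto
    also have "... = F powr e" by (simp add: powr_powr)
    finally have "Cd * real u powr (e / 32) <= Cd * F powr e" using Cd by (intro mult_left_mono) auto
    moreover have "real (divisor_count u) <= Cd * real u powr (e / 32)" using u by (intro Cd(2)) simp
    ultimately show ?thesis by (simp add: T_def le_nat_floor)
   qed
   define M where "M = (\<Sum>y\<in>{0..<int f}. W y ^ (2 * r))"
   have M0: "M >= 0" by (simp add: M_def W_def sum_nonneg)
   define L where "L = real N * real (card \<A>)"
   define V where "V = real N * real A"
   have L0: "L > 0" using cA Npos by (simp add: L_def)
   have V0: "V > 0" using A1 Npos by (simp add: V_def)
   have VL: "V <= L * (2 * k)" using mult_left_mono[OF A\<A>, of "real N"] by (simp add: V_def L_def mult_ac)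
   have Xpow: "X ^ (2 * r) <= L ^ (2 * (r - 1)) * ((real T)\<^sup>2 * (V * (V / F + 1))) * M"
   proof -
    define I where "I = {1..N} \<times> \<A>"
    let ?c = "card {((n, a), (n', a')). (n, a) \<in> {1..N} \<times> \<A> \<and> (n', a') \<in> {1..N} \<times> \<A> \<and> x n a = x n' a'}"
    have "X ^ (2 * r) = (\<Sum>i\<in>I. W (case i of (n, a) => x n a)) ^ (2 * r)"
     unfolding X_def I_def by (simp add: case_prod_unfold)
    also have "... <= real (card I) ^ (2 * (r - 1)) *
      real (card {(i, j). i \<in> I \<and> j \<in> I \<and> (case i of (n, a) => x n a) = (case j of (n, a) => x n a)}) * M"
     unfolding M_def
    proof (rule weighted_sum_moment)
     show "(case i of (n, a) => x n a) \<in> {0..<int f}" if "i \<in> I" for i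
      using that x(1) by (cases i) (simp add: I_def)
    qed (use r0 finA in \<open>simp_all add: I_def W_def\<close>)
    also have "{(i, j). i \<in> I \<and> j \<in> I \<and> (case i of (n, a) => x n a) = (case j of (n, a) => x n a)}
      = {((n, a), (n', a')). (n, a) \<in> {1..N} \<times> \<A> \<and> (n', a') \<in> {1..N} \<times> \<A> \<and> x n a = x n' a'}"
     unfolding I_def by auto
    also have "card I = N * card \<A>" by (simp add: I_def card_cartesian_product)
    also have "real (N * card \<A>) ^ (2 * (r - 1)) * real (?c) * M
      <= real (N * card \<A>) ^ (2 * (r - 1)) * ((real T)\<^sup>2 * (V * (V / F + 1))) * M"
    proof (intro mult_right_mono mult_left_mono M0)
     have "?c
       <= T\<^sup>2 * (N * A * (N * A div f + 1))"
      by (rule card_collisions[OF f1 x(2) subA Tb])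
     then have "real (?c)
       <= real (T\<^sup>2 * (N * A * (N * A div f + 1)))" by (simp only: of_nat_le_iff)
     also have "... = (real T)\<^sup>2 * (V * (real (N * A div f) + 1))" by (simp add: V_def algebra_simps)
     also have "... <= (real T)\<^sup>2 * (V * (V / F + 1))"
      using of_nat_div_le_of_nat[of "N * A" f, where 'a = real] V0
      by (intro mult_left_mono add_right_mono) (auto simp: V_def F_def)
     finally show "real (?c)
       <= (real T)\<^sup>2 * (V * (V / F + 1))" .
    qed auto
    finally show ?thesis by (simp add: L_def)
   qed
   define z where "z = X / (L * real B)"
   have z0: "z >= 0" using L0 by (simp add: z_def X_def W_def sum_nonneg case_prod_unfold)
   have z1: "z ^ (2 * r) <= 4 * k\<^sup>2 * (real T)\<^sup>2 * (1 / F + 1 / V) * (M / real B ^ (2 * r))"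
    unfolding z_def by (rule moment_ratio_bound[OF Xpow L0 VL V0]) (use B1 M0 F1 r0 in auto)
   have b1: "4 * k\<^sup>2 <= 4 * C1\<^sup>2 * F powr (2 * e)"
   proof -
    have "4 * k\<^sup>2 <= 4 * (C1 * F powr e)\<^sup>2" using kF k1 by (intro mult_left_mono power_mono) auto
    then show ?thesis using F1 by (simp add: power_mult_distrib powr_realpow[symmetric] powr_powr mult.commute)
   qed
   have b2: "(real T)\<^sup>2 <= Cd\<^sup>2 * F powr (2 * e)"
   proof -
    have "(real T)\<^sup>2 <= (Cd * F powr e)\<^sup>2" using TF by (intro power_mono) auto
    then show ?thesis using F1 by (simp add: power_mult_distrib powr_realpow[symmetric] powr_powr mult.commute)
   qed
   have b3: "1 / F + 1 / V <= 3 * F powr (- (1 / 2) - \<epsilon>)"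
   proof -
    have "F powr (1 / 2 + \<epsilon>) <= F powr (1 / 4 + \<epsilon>) * F powr (1 / 4)"
     using F1 \<epsilon> by (simp flip: powr_add)
    also have "... <= real N * (2 * real A)" using N1 G4 A1(3) by (intro mult_mono) auto
    finally have "F powr (1 / 2 + \<epsilon>) / 2 <= V" by (simp add: V_def)
    then have "1 / V <= 1 / (F powr (1 / 2 + \<epsilon>) / 2)" using F1 V0 by (intro divide_left_mono) auto
    also have "... = 2 * F powr (- (1 / 2) - \<epsilon>)"
     using powr_minus_divide[of F "1 / 2 + \<epsilon>"] by simp
    finally have "1 / V <= 2 * F powr (- (1 / 2) - \<epsilon>)" .
    moreover have "1 / F = F powr (- 1)" using F1 by (simp add: powr_minus_divide)
    moreover have "F powr (- 1) <= F powr (- (1 / 2) - \<epsilon>)" using F1 \<epsilon> by (intro powr_mono) auto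
    ultimately show ?thesis by linarith
   qed
   have b4: "M / real B ^ (2 * r) <= D * F powr (1 / 2 + e + 2 * r * e)"
   proof -
    have Br: "F powr (1 / 2) <= 2 ^ r * real B ^ r"
    proof -
     have "F powr (1 / 2) = R ^ r" using F1 r0 by (simp add: R_def powr_realpow[symmetric] powr_powr)
     also have "... <= (2 * real B) ^ r" using B1 R1 by (intro power_mono) auto
     finally show ?thesis by (simp add: power_mult_distrib)
    qed
    have "M <= real r ^ (2 * r) * F * real B ^ r + 2 * r * w ^ card P * sqrt F * (2 * k * real B) ^ (2 * r)"
     using moment_bound[OF fam Y r0, of B] unfolding M_def W_def fam_char_def F_def f_def w_def k_def by simp
    then have "M / real B ^ (2 * r) <= (real r ^ (2 * r) * F * real B ^ r + 2 * r * w ^ card P * sqrt F * (2 * k * real B) ^ (2 * r)) / real B ^ (2 * r)"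
     by (intro divide_right_mono) auto
    also have "... = real r ^ (2 * r) * (F / real B ^ r) + 2 * r * w ^ card P * sqrt F * (2 * k) ^ (2 * r)"
    proof -
     have "real B ^ (2 * r) = real B ^ r * real B ^ r" by (metis mult_2 power_add)
     then have "real r ^ (2 * r) * F * real B ^ r / real B ^ (2 * r) = real r ^ (2 * r) * (F / real B ^ r)"
      using B1 by simp
     moreover have "(2 * k * real B) ^ (2 * r) = (2 * k) ^ (2 * r) * real B ^ (2 * r)" by (rule power_mult_distrib)
     then have "2 * r * w ^ card P * sqrt F * (2 * k * real B) ^ (2 * r) / real B ^ (2 * r)
       = 2 * r * w ^ card P * sqrt F * (2 * k) ^ (2 * r)"
      using B1 by simp
     ultimately show ?thesis by (simp only: add_divide_distrib)
    qed
    also have "real r ^ (2 * r) * (F / real B ^ r) <= real r ^ (2 * r) * (2 ^ r * F powr (1 / 2 + e + 2 * r * e))"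
    proof (intro mult_left_mono)
     have "F = F powr (1 / 2) * F powr (1 / 2)" using F1 by (simp flip: powr_add)
     also have "... <= (2 ^ r * real B ^ r) * F powr (1 / 2)" using Br by (intro mult_right_mono) auto
     finally have "F / real B ^ r <= 2 ^ r * F powr (1 / 2)" using B1 by (simp add: pos_divide_le_eq mult_ac)
     also have "... <= 2 ^ r * F powr (1 / 2 + e + 2 * r * e)" using F1 e0 by (intro mult_left_mono powr_mono) auto
     finally show "F / real B ^ r <= 2 ^ r * F powr (1 / 2 + e + 2 * r * e)" .
    qed auto
    also have "2 * r * w ^ card P * sqrt F * (2 * k) ^ (2 * r)
      <= 2 * r * (C2 * F powr e) * F powr (1 / 2) * ((2 * C1) ^ (2 * r) * F powr (2 * r * e))"
    proof (intro mult_mono)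
     show "w ^ card P <= C2 * F powr e" using C2(2)[OF P] by (simp add: F_def f_def)
     show "sqrt F <= F powr (1 / 2)" using F1 by (simp add: powr_half_sqrt)
     have "(2 * k) ^ (2 * r) <= (2 * (C1 * F powr e)) ^ (2 * r)" using kF k1 by (intro power_mono mult_left_mono) auto
     also have "... = (2 * C1) ^ (2 * r) * (F powr e) ^ (2 * r)" by (simp only: power_mult_distrib mult.assoc)
     also have "(F powr e) ^ (2 * r) = F powr (2 * r * e)" using F1 by (simp add: powr_realpow[symmetric] powr_powr mult_ac)
     finally show "(2 * k) ^ (2 * r) <= (2 * C1) ^ (2 * r) * F powr (2 * r * e)" .
    qed (use w1 C2 k1 F1 in auto)
    also have "2 * r * (C2 * F powr e) * F powr (1 / 2) * ((2 * C1) ^ (2 * r) * F powr (2 * r * e))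
      = (2 * r * C2 * (2 * C1) ^ (2 * r)) * F powr (1 / 2 + e + 2 * r * e)"
     by (simp add: powr_add mult_ac)
    finally show ?thesis by (simp add: D_def algebra_simps)
   qed
   have "z ^ (2 * r) <= (4 * C1\<^sup>2 * F powr (2 * e)) * (Cd\<^sup>2 * F powr (2 * e)) * (3 * F powr (- (1 / 2) - \<epsilon>)) * (D * F powr (1 / 2 + e + 2 * r * e))"
    by (rule order_trans[OF z1 mult_mono[OF mult_mono[OF mult_mono[OF b1 b2] b3] b4]])
      (use F1 V0 M0 D1 in \<open>simp_all add: mult_nonneg_nonneg\<close>)
   also have "... = D' * F powr (2 * e + 2 * e + (- (1 / 2) - \<epsilon>) + (1 / 2 + e + 2 * r * e))"
    by (simp only: D'_def powr_add mult_ac)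
   also have "... <= D' * F powr (- (\<epsilon> / 2))"
   proof -
    have "14 * r * e = \<epsilon>" using r0 by (simp add: e_def)
    moreover have "5 * e <= 5 * r * e" using r8 e0 by simp
    ultimately have "2 * e + 2 * e + (- (1 / 2) - \<epsilon>) + (1 / 2 + e + 2 * r * e) <= - (\<epsilon> / 2)" by (simp add: algebra_simps)
    then show ?thesis using F1 D'1 by (intro mult_left_mono powr_mono) auto
   qed
   also have "... <= D' ^ (2 * r) * (F powr (- \<delta>)) ^ (2 * r)"
   proof (intro mult_mono)
    show "D' <= D' ^ (2 * r)" using D'1 r0 by (intro self_le_power) auto
    have "(F powr (- \<delta>)) ^ (2 * r) = F powr (- (\<epsilon> / 2))"
     using F1 r0 by (simp add: powr_realpow[symmetric] powr_powr \<delta>_def)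
    then show "F powr (- (\<epsilon> / 2)) <= (F powr (- \<delta>)) ^ (2 * r)" by simp
   qed (use D'1 in auto)
   also have "... = (D' * F powr (- \<delta>)) ^ (2 * r)" by (simp add: power_mult_distrib)
   finally have zD: "z <= D' * F powr (- \<delta>)"
    using power_mono_iff[of z "D' * F powr (- \<delta>)" "2 * r"] z0 D'1 r0 by simp
   define cB where "cB = real (card \<A> * B)"
   have cB: "cB > 0" using cA B1 by (simp add: cB_def)
   have "cB * norm S <= cB * (2 * real (K * A * B)) + cB * (real N * z)"
   proof -
    have "X = cB * (real N * z)" using L0 B1 Npos cA by (simp add: z_def cB_def L_def)
    then show ?thesis using shift by (simp add: cB_def)
   qed
   also have "... = cB * (2 * real (K * A * B) + real N * z)" by (simp add: algebra_simps)
   finally have "norm S <= 2 * real (K * A * B) + real N * z" using cB by simp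
   also have "2 * real (K * A * B) = 2 * real K * (real A * real B)" by simp
   also have "... <= 2 * real K0 * (real N * F powr (- \<delta>))" using K by (intro mult_mono[OF _ AB]) auto
   also have "real N * z <= real N * (D' * F powr (- \<delta>))" using zD by (intro mult_left_mono) auto
   also have "2 * real K0 * (real N * F powr (- \<delta>)) + real N * (D' * F powr (- \<delta>)) = (2 * real K0 + D') * (real N * F powr (- \<delta>))"
    by (simp add: algebra_simps)
   also have "... <= C * (real N * F powr (- \<delta>))" by (intro mult_right_mono) (auto simp: C_def)
   finally show ?thesis by (simp add: mult_ac)
  qed
  then show "norm (\<Sum>n=1..N. \<kappa> (int n) * fam_char P \<psi> (int n)) <= C * real N * real (\<Prod>P) powr (- \<delta>)"
   by (simp add: S_def F_def f_def)
 qed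
qed

section \<open>Characters of bounded order\<close>

lemma power_add_mod_square:
 fixes y h :: int
 shows "h\<^sup>2 dvd (y + h) ^ n - y ^ n - int n * y ^ (n - 1) * h"
proof (induction n)
 case (Suc n)
 show ?case
 proof (cases n)
  case (Suc m)
  obtain c where c: "(y + h) ^ n - y ^ n - int n * y ^ (n - 1) * h = h\<^sup>2 * c" using Suc.IH by (auto elim: dvdE)
  have e: "(y + h) ^ n = y ^ n + int n * y ^ (n - 1) * h + h\<^sup>2 * c" using c by simp
  have "(y + h) ^ Suc n - y ^ Suc n - int (Suc n) * y ^ (Suc n - 1) * h
    = (y + h) * (y + h) ^ n - y * y ^ n - (1 + int n) * y ^ n * h" by simp
  also have "... = h\<^sup>2 * (int n * y ^ (n - 1) + (y + h) * c)"
   unfolding e using Suc by (simp add: algebra_simps power2_eq_square)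
  finally show ?thesis by simp
 qed simp
qed simp

lemma dvd_radical_power:
 assumes "n > (0::nat)"
 shows "n dvd (\<Prod>(prime_factors n)) ^ n"
proof (rule multiplicity_le_imp_dvd)
 fix p :: nat assume p: "prime p"
 show "multiplicity p n <= multiplicity p ((\<Prod>(prime_factors n)) ^ n)"
 proof (cases "p dvd n")
  case True
  then have "p \<in> prime_factors n" using p assms by (simp add: prime_factors_dvd)
  then have "p dvd \<Prod>(prime_factors n)" by (rule dvd_prodI[where f = "\<lambda>x. x", rotated]) simp
  then have "p ^ n dvd (\<Prod>(prime_factors n)) ^ n" by (rule dvd_power_same)
  moreover have "\<Prod>(prime_factors n) \<noteq> 0" by (auto simp: prime_factors_dvd)
  ultimately have "n <= multiplicity p ((\<Prod>(prime_factors n)) ^ n)"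
   using p by (intro multiplicity_geI) (auto intro: prime_gt_1_nat dest: not_prime_unit)
  moreover have "multiplicity p n < n"
  proof -
   have "multiplicity p n < 2 ^ multiplicity p n" by (rule less_exp)
   also have "... <= p ^ multiplicity p n" using prime_ge_2_nat[OF p] by (intro power_mono) auto
   also have "... <= n" using assms multiplicity_dvd by (intro dvd_imp_le)
   finally show ?thesis .
  qed
  ultimately show ?thesis by simp
 qed (simp add: not_dvd_imp_multiplicity_0)
qed (use assms in simp)

text \<open>Newton's iteration for the \<open>Y\<close>-th root. The factor \<open>Y ^ 2\<close> in
  the modulus pays for the derivative \<open>Y * y ^ (Y - 1)\<close>, which need not be a unit, so
  primes dividing \<open>Y\<close> need no separate treatment.\<close>

lemma hensel_power:
 fixes n R :: int
 assumes Y: "Y > 0" and n: "[n = 1] (mod int Y ^ 2 * R)"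
 shows "\<exists>y. [y = 1] (mod R) \<and> [y ^ Y = n] (mod int Y ^ 2 * R ^ Suc k)"
proof (induction k)
 case 0
 then show ?case using n by (intro exI[of _ 1]) (simp add: cong_sym)
next
 case (Suc k)
 then obtain y where y: "[y = 1] (mod R)" "[n = y ^ Y] (mod int Y ^ 2 * R ^ Suc k)" using cong_sym by blast
 then obtain u where u: "n - y ^ Y = int Y ^ 2 * R ^ Suc k * u" by (auto simp: cong_iff_dvd_diff elim: dvdE)
 \<comment> \<open>The linear term \<open>Y * y ^ (Y - 1) * h\<close> reproduces the defect up to a
   further factor \<open>R\<close>, because \<open>y ^ (Y - 1)\<close> is 1 modulo \<open>R\<close>;
   the square \<open>h ^ 2\<close> contains that further factor anyway.\<close>
 define h where "h = int Y * R ^ Suc k * u"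
 obtain c where "(y + h) ^ Y - y ^ Y - int Y * y ^ (Y - 1) * h = h\<^sup>2 * c"
  using power_add_mod_square[of h y Y] by (auto elim: dvdE)
 then have e: "(y + h) ^ Y = y ^ Y + int Y * y ^ (Y - 1) * h + h\<^sup>2 * c" by simp
 have "[y ^ (Y - 1) = 1 ^ (Y - 1)] (mod R)" using y(1) by (rule cong_pow)
 then obtain v where v: "y ^ (Y - 1) = 1 + R * v" by (auto simp: cong_iff_dvd_diff elim!: dvdE) (metis add_diff_cancel_left' diff_add_cancel add.commute)
 have "(y + h) ^ Y - n = int Y ^ 2 * R ^ Suc k * u * (y ^ (Y - 1) - 1) + h\<^sup>2 * c"
 proof -
  have hh: "int Y ^ 2 * R ^ Suc k * u = int Y * h" by (simp add: h_def power2_eq_square)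
  show ?thesis using u unfolding hh e by (simp add: algebra_simps)
 qed
 also have "... = int Y ^ 2 * R ^ Suc (Suc k) * (u * v + R ^ k * u\<^sup>2 * c)"
  unfolding v h_def by (simp add: algebra_simps power2_eq_square)
 finally have "[(y + h) ^ Y = n] (mod int Y ^ 2 * R ^ Suc (Suc k))" by (simp add: cong_iff_dvd_diff)
 moreover have "[y + h = 1 + 0] (mod R)" using y(1) by (intro cong_add) (auto simp: h_def cong_0_iff)
 ultimately show ?case by auto
qed

lemma coprime_radical_iff:
 assumes "Q > (0::nat)"
 shows "coprime a (int (\<Prod>(prime_factors Q))) \<longleftrightarrow> coprime a (int Q)"
proof
 have "\<Prod>(prime_factors Q) dvd Q" by (rule prod_primes_dvd) (auto simp: prime_factors_dvd)
 then show "coprime a (int Q) ==> coprime a (int (\<Prod>(prime_factors Q)))"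
  by (meson coprime_divisors dvd_refl of_nat_dvd_iff)
 assume "coprime a (int (\<Prod>(prime_factors Q)))"
 then have "coprime a (int (\<Prod>(prime_factors Q) ^ Q))" by simp
 then show "coprime a (int Q)" using dvd_radical_power[OF assms] by (meson coprime_divisors dvd_refl of_nat_dvd_iff)
qed

text \<open>A character of exponent \<open>Y\<close> is trivial on \<open>Y\<close>-th powers of
  units, and by \<open>hensel_power\<close> these include, modulo \<open>Q\<close>, every integer
  congruent to 1 modulo \<open>Y ^ 2\<close> times the radical. The hypothesis
  \<open>Y dvd Q\<close> ensures that both moduli have the same units.\<close>

lemma dchar_reduce_modulus:
 assumes \<xi>: "dchar Q \<xi>" "order_dvd Y Q \<xi>" and Y: "Y > 0" "Y dvd Q" and Q: "Q > 0"
 shows "dchar (Y\<^sup>2 * \<Prod>(prime_factors Q)) \<xi>"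
proof -
 define R where "R = \<Prod>(prime_factors Q)"
 define M where "M = Y\<^sup>2 * R"
 have cop: "coprime a (int M) \<longleftrightarrow> coprime a (int Q)" for a
 proof
  assume "coprime a (int M)"
  then have "coprime a (int R)" by (simp add: M_def)
  then show "coprime a (int Q)" using coprime_radical_iff[OF Q] by (simp add: R_def)
 next
  assume a: "coprime a (int Q)"
  then have "coprime a (int Y)" using Y(2) by (meson coprime_divisors dvd_refl of_nat_dvd_iff)
  moreover have "coprime a (int R)" using a coprime_radical_iff[OF Q] by (simp add: R_def)
  ultimately show "coprime a (int M)" by (simp add: M_def)
 qed
 have "R > 0" unfolding R_def by (intro prod_pos) (auto intro: prime_gt_0_nat in_prime_factors_imp_prime)
 then have M0: "M > 0" using Y by (simp add: M_def)
 have one: "\<xi> n = 1" if n: "[n = 1] (mod int M)" for n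
 proof -
  obtain y where y: "[y ^ Y = n] (mod int Y ^ 2 * int R ^ Suc Q)"
   using hensel_power[OF Y(1), of n "int R" Q] n by (auto simp: M_def)
  have "int Q dvd int (R ^ Q)" using dvd_radical_power[OF Q] by (simp only: R_def of_nat_dvd_iff)
  then have "int Q dvd int Y ^ 2 * int R ^ Suc Q" by (simp add: dvd_mult)
  then have yQ: "[y ^ Y = n] (mod int Q)" using y by (rule cong_dvd_modulus[rotated])
  have "coprime n (int Q)" using n cop cong_imp_coprime[OF cong_sym[OF n]] by simp
  then have "coprime (y ^ Y) (int Q)" using cong_imp_coprime[OF cong_sym[OF yQ]] by blast
  then have "coprime y (int Q)" using Y by simp
  then have "\<xi> y ^ Y = 1" using \<xi>(2) by (simp add: order_dvd_def)
  then show ?thesis using dchar_cong[OF \<xi>(1) yQ] by (simp add: dchar_power[OF \<xi>(1)])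
 qed
 have "\<xi> a = \<xi> b" if ab: "[a = b] (mod int M)" for a b
 proof (cases "coprime a (int Q)")
  case False
  then have "\<not> coprime b (int Q)" using ab cop cong_imp_coprime[OF cong_sym[OF ab]] by blast
  with False show ?thesis using dchar_eq_0_iff[OF \<xi>(1)] by metis
 next
  case True
  then have b: "coprime b (int Q)" using ab cop cong_imp_coprime[OF ab] by blast
  then have "coprime b (int Q * int M)" using cop[of b] by simp
  then obtain b' where b': "[b * b' = 1] (mod int Q * int M)" using cong_solve_coprime_int by blast
  have bM: "[b * b' = 1] (mod int M)" and bQ: "[b * b' = 1] (mod int Q)"
   using b' cong_dvd_modulus dvd_triv_right dvd_triv_left by blast+
  have "[a * b' = 1] (mod int M)" using cong_trans[OF cong_mult[OF ab cong_refl[of b']] bM] .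
  then have "\<xi> a * \<xi> b' = 1" using one dchar_mult[OF \<xi>(1)] by metis
  moreover have "\<xi> b * \<xi> b' = 1" using dchar_cong[OF \<xi>(1) bQ] dchar_1[OF \<xi>(1)] dchar_mult[OF \<xi>(1)] by metis
  ultimately show ?thesis by (metis mult_cancel_right zero_neq_one mult_zero_right)
 qed
 then have "dchar M \<xi>" using \<xi>(1) cop by (simp add: dchar_def)
 then show ?thesis by (simp add: M_def R_def)
qed

text \<open>The argument \<open>a * e1 + e2\<close> is congruent to \<open>a\<close> modulo
  \<open>m1\<close> and to 1 modulo \<open>m2\<close>, so evaluating \<xi> there isolates its
  component of modulus \<open>m1\<close>.\<close>

lemma dchar_split_first:
 assumes \<xi>: "dchar (m1 * m2) \<xi>" and e1: "[e1 = 1] (mod int m1)" "[e1 = 0] (mod int m2)"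
  and e2: "[e2 = 0] (mod int m1)" "[e2 = 1] (mod int m2)" and m: "coprime m1 m2"
 shows "dchar m1 (\<lambda>a. \<xi> (a * e1 + e2))"
  "order_dvd Y (m1 * m2) \<xi> ==> order_dvd Y m1 (\<lambda>a. \<xi> (a * e1 + e2))"
proof -
 have c1: "[a * e1 + e2 = a] (mod int m1)" for a
  using cong_add[OF cong_mult[OF cong_refl[of a] e1(1)] e2(1)] by simp
 have c2: "[a * e1 + e2 = 1] (mod int m2)" for a
  using cong_add[OF cong_mult[OF cong_refl[of a] e1(2)] e2(2)] by simp
 have both: "[x = y] (mod int (m1 * m2))" if "[x = y] (mod int m1)" "[x = y] (mod int m2)" for x y
  using that m by (simp add: coprime_cong_mult)
 have cop: "coprime (a * e1 + e2) (int (m1 * m2)) \<longleftrightarrow> coprime a (int m1)" for a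
 proof -
  have "coprime (a * e1 + e2) (int m2)" using cong_imp_coprime[OF cong_sym[OF c2]] by simp
  moreover have "coprime (a * e1 + e2) (int m1) \<longleftrightarrow> coprime a (int m1)"
   using cong_imp_coprime[OF c1] cong_imp_coprime[OF cong_sym[OF c1]] by blast
  ultimately show ?thesis by simp
 qed
 show "dchar m1 (\<lambda>a. \<xi> (a * e1 + e2))"
  unfolding dchar_def
 proof (intro conjI allI impI)
  fix a b
  have "[a * b * e1 + e2 = (a * e1 + e2) * (b * e1 + e2)] (mod int (m1 * m2))"
  proof (rule both)
   show "[a * b * e1 + e2 = (a * e1 + e2) * (b * e1 + e2)] (mod int m1)"
    using c1[of "a * b"] cong_mult[OF c1[of a] c1[of b]] by (metis cong_sym cong_trans)
   show "[a * b * e1 + e2 = (a * e1 + e2) * (b * e1 + e2)] (mod int m2)"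
    using c2[of "a * b"] cong_mult[OF c2[of a] c2[of b]] by (metis cong_sym cong_trans mult_1)
  qed
  then show "\<xi> (a * b * e1 + e2) = \<xi> (a * e1 + e2) * \<xi> (b * e1 + e2)"
   using dchar_cong[OF \<xi>] dchar_mult[OF \<xi>] by metis
 next
  fix a b assume "[a = b] (mod int m1)"
  then have "[a * e1 + e2 = b * e1 + e2] (mod int (m1 * m2))"
   using c1 c2 by (intro both) (metis cong_sym cong_trans)+
  then show "\<xi> (a * e1 + e2) = \<xi> (b * e1 + e2)" by (rule dchar_cong[OF \<xi>])
 next
  fix a show "\<xi> (a * e1 + e2) \<noteq> 0 \<longleftrightarrow> coprime a (int m1)" using dchar_eq_0_iff[OF \<xi>] cop by simp
 qed
 show "order_dvd Y m1 (\<lambda>a. \<xi> (a * e1 + e2))" if "order_dvd Y (m1 * m2) \<xi>"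
  using that cop by (simp add: order_dvd_def)
qed

lemma dchar_split:
 assumes \<xi>: "dchar (m1 * m2) \<xi>" "order_dvd Y (m1 * m2) \<xi>" and m: "coprime m1 m2"
 obtains \<xi>1 \<xi>2 where "dchar m1 \<xi>1" "order_dvd Y m1 \<xi>1" "dchar m2 \<xi>2" "order_dvd Y m2 \<xi>2"
  "\<And>a. \<xi> a = \<xi>1 a * \<xi>2 a"
proof -
 have m': "coprime (int m1) (int m2)" using m by simp
 obtain e1 where e1: "[e1 = 1] (mod int m1)" "[e1 = 0] (mod int m2)"
  using binary_chinese_remainder_int[OF m', of 1 0] by blast
 obtain e2 where e2: "[e2 = 0] (mod int m1)" "[e2 = 1] (mod int m2)"
  using binary_chinese_remainder_int[OF m', of 0 1] by blast
 have \<xi>': "dchar (m2 * m1) \<xi>" "order_dvd Y (m2 * m1) \<xi>" using \<xi> by (simp_all add: mult.commute)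
 show ?thesis
 proof (rule that)
  show "dchar m1 (\<lambda>a. \<xi> (a * e1 + e2))" "order_dvd Y m1 (\<lambda>a. \<xi> (a * e1 + e2))"
   using dchar_split_first[OF \<xi>(1) e1 e2 m] \<xi>(2) by blast+
  show "dchar m2 (\<lambda>a. \<xi> (a * e2 + e1))" "order_dvd Y m2 (\<lambda>a. \<xi> (a * e2 + e1))"
   using dchar_split_first[OF \<xi>'(1) e2(2,1) e1(2,1)] \<xi>'(2) m by (simp_all add: coprime_commute)
  fix a
  have "[(a * e1 + e2) * (a * e2 + e1) = (a * 1 + 0) * (a * 0 + 1)] (mod int m1)"
   using e1 e2 by (intro cong_mult cong_add cong_refl)
  moreover have "[(a * e1 + e2) * (a * e2 + e1) = (a * 0 + 1) * (a * 1 + 0)] (mod int m2)"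
   using e1 e2 by (intro cong_mult cong_add cong_refl)
  ultimately have "[(a * e1 + e2) * (a * e2 + e1) = a] (mod int (m1 * m2))"
   using m by (simp add: coprime_cong_mult)
  from dchar_cong[OF \<xi>(1) this] show "\<xi> a = \<xi> (a * e1 + e2) * \<xi> (a * e2 + e1)"
   by (simp add: dchar_mult[OF \<xi>(1)])
 qed
qed

lemma dchar_split_primes:
 assumes "finite P" "\<And>p. p \<in> P ==> prime p" "coprime K (\<Prod>P)" "dchar (K * \<Prod>P) \<xi>" "order_dvd Y (K * \<Prod>P) \<xi>"
 shows "\<exists>\<kappa> \<psi>. dchar K \<kappa> \<and> (\<forall>p\<in>P. dchar p (\<psi> p) \<and> order_dvd Y p (\<psi> p)) \<and> (\<forall>a. \<xi> a = \<kappa> a * (\<Prod>p\<in>P. \<psi> p a))"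
 using assms
proof (induction P arbitrary: \<xi> rule: finite_induct)
 case empty
 then show ?case by (intro exI[of _ \<xi>]) auto
next
 case (insert q P)
 have copP: "coprime q (\<Prod>P)" using insert by (intro prod_coprime_right primes_coprime) auto
 have eq: "K * \<Prod>(insert q P) = q * (K * \<Prod>P)" using insert.hyps by simp
 have "coprime q (K * \<Prod>P)" using insert copP by (simp add: coprime_commute)
 then obtain \<xi>1 \<xi>2 where s: "dchar q \<xi>1" "order_dvd Y q \<xi>1" "dchar (K * \<Prod>P) \<xi>2" "order_dvd Y (K * \<Prod>P) \<xi>2"
  "\<And>a. \<xi> a = \<xi>1 a * \<xi>2 a"
  using dchar_split[of q "K * \<Prod>P" \<xi> Y] insert.prems unfolding eq by blast
 obtain \<kappa> \<psi> where k: "dchar K \<kappa>" "\<forall>p\<in>P. dchar p (\<psi> p) \<and> order_dvd Y p (\<psi> p)" "\<forall>a. \<xi>2 a = \<kappa> a * (\<Prod>p\<in>P. \<psi> p a)"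
  using insert.IH[of \<xi>2] insert.prems insert.hyps s by auto
 have "\<xi> a = \<kappa> a * (\<Prod>p\<in>insert q P. (\<psi>(q := \<xi>1)) p a)" for a
 proof -
  have "(\<Prod>p\<in>P. (\<psi>(q := \<xi>1)) p a) = (\<Prod>p\<in>P. \<psi> p a)" using insert.hyps by (intro prod.cong) auto
  then show ?thesis using insert.hyps s(5) k(3) by simp
 qed
 moreover have "\<forall>p\<in>insert q P. dchar p ((\<psi>(q := \<xi>1)) p) \<and> order_dvd Y p ((\<psi>(q := \<xi>1)) p)"
  using k(2) s insert.hyps by auto
 ultimately show ?case using k(1) by blast
qed

text \<open>All primes dividing \<open>Y\<close> are collected in \<open>K\<close>, which is
  \<open>Y ^ 2\<close> times the radical of \<open>Y\<close> and hence at most \<open>Y ^ 3\<close>.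
  Every other prime of \<open>Q\<close> enters the reduced modulus to the first power only.\<close>

lemma dchar_structure:
 assumes \<xi>: "dchar Q \<xi>" "order_dvd Y Q \<xi>" and Y: "Y > 0" "Y dvd Q" and Q: "Q > 0"
 shows "\<exists>K \<kappa> P \<psi>. K > 0 \<and> K <= Y ^ 3 \<and> dchar K \<kappa> \<and> finite P \<and> (\<forall>p\<in>P. prime p) \<and>
  (\<forall>p\<in>P. dchar p (\<psi> p) \<and> order_dvd Y p (\<psi> p)) \<and> coprime K (\<Prod>P) \<and> \<Prod>P dvd Q \<and>
  (\<forall>a. \<xi> a = \<kappa> a * (\<Prod>p\<in>P. \<psi> p a))"
proof -
 define P where "P = prime_factors Q - prime_factors Y"
 define K where "K = Y\<^sup>2 * \<Prod>(prime_factors Y)"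
 have sub: "prime_factors Y \<subseteq> prime_factors Q" using Y Q by (auto simp: prime_factors_dvd intro: dvd_trans)
 have P: "finite P" "\<And>p. p \<in> P ==> prime p" by (auto simp: P_def prime_factors_dvd)
 have "\<Prod>(prime_factors Q) = \<Prod>(prime_factors Y) * \<Prod>P"
  unfolding P_def using sub by (metis finite_set_mset mult.commute prod.subset_diff)
 then have M: "Y\<^sup>2 * \<Prod>(prime_factors Q) = K * \<Prod>P" by (simp add: K_def)
 have rY: "\<Prod>(prime_factors Y) > 0" by (intro prod_pos) (auto intro: prime_gt_0_nat in_prime_factors_imp_prime)
 have K0: "K > 0" using Y rY by (simp add: K_def)
 have "\<Prod>(prime_factors Y) dvd Y" by (rule prod_primes_dvd) (auto simp: prime_factors_dvd)
 then have "\<Prod>(prime_factors Y) <= Y" using Y by (intro dvd_imp_le)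
 then have "K <= Y\<^sup>2 * Y" unfolding K_def by (rule mult_le_mono2)
 then have K3: "K <= Y ^ 3" by (simp add: power2_eq_square power3_eq_cube)
 have cop: "coprime K (\<Prod>P)"
 proof (rule prod_coprime_right)
  fix p assume p: "p \<in> P"
  have "\<not> p dvd Y" using p Y by (auto simp: P_def prime_factors_dvd)
  then have "coprime p Y" using P(2)[OF p] by (simp add: prime_imp_coprime)
  moreover have "coprime p (\<Prod>(prime_factors Y))"
   using p by (intro prod_coprime_right primes_coprime) (auto simp: P_def prime_factors_dvd)
  ultimately show "coprime K p" by (simp add: K_def coprime_commute)
 qed
 have PQ: "\<Prod>P dvd Q" by (rule prod_primes_dvd) (use P in \<open>auto simp: P_def prime_factors_dvd\<close>)
 have d: "dchar (K * \<Prod>P) \<xi>" using dchar_reduce_modulus[OF assms] M by simp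
 have "coprime a (int (K * \<Prod>P)) \<longleftrightarrow> coprime a (int Q)" for a
  using dchar_eq_0_iff[OF d, of a] dchar_eq_0_iff[OF \<xi>(1), of a] by blast
 then have "order_dvd Y (K * \<Prod>P) \<xi>" using \<xi>(2) unfolding order_dvd_def by blast
 from dchar_split_primes[OF P cop d this] show ?thesis
  using K0 K3 P cop PQ by blast
qed

section \<open>Cancellation from periodicity, and sieved sums\<close>

lemma periodic_partial_sum_le:
 fixes c :: "int => complex"
 assumes m: "m > 0" and per: "\<And>a b. [a = b] (mod int m) ==> c a = c b" and le: "\<And>a. norm (c a) <= 1"
  and zero: "(\<Sum>x\<in>{0..<int m}. c x) = 0"
 shows "norm (\<Sum>n=1..N. c (int n)) <= real m"
proof (induction N rule: less_induct)
 case (less N)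
 show ?case
 proof (cases "N < m")
  case True
  then show ?thesis using norm_char_sum_le[of "\<lambda>n. c (int n)" N] le by (meson less_imp_le of_nat_le_iff order_trans)
 next
  case False
  define s where "s = (\<lambda>N. \<Sum>n=1..N. c (int n))"
  have "s (M + m) = s M" for M
  proof (induction M)
   case 0
   have "s m = (\<Sum>n<m. c (int n))"
   proof -
    have "c (int m) = c 0" by (rule per) (simp add: cong_def)
    moreover have "s m = (\<Sum>n=1..<m. c (int n)) + c (int m)"
     unfolding s_def using m by (metis One_nat_def Suc_leI atLeastLessThanSuc_atLeastAtMost sum.atLeastLessThan_Suc)
    moreover have "(\<Sum>n<m. c (int n)) = c 0 + (\<Sum>n=1..<m. c (int n))"
     using m sum.atLeast_Suc_lessThan[of 0 m "\<lambda>n. c (int n)"] by (simp add: lessThan_atLeast0)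
    ultimately show ?thesis by simp
   qed
   also have "... = (\<Sum>x\<in>{0..<int m}. c x)"
    by (rule sum.reindex_bij_witness[of _ nat int]) auto
   finally show ?case using zero by (simp add: s_def)
  next
   case (Suc M)
   have "c (int (Suc M + m)) = c (int (Suc M))" by (rule per) (simp add: cong_iff_dvd_diff)
   then show ?case using Suc by (simp add: s_def)
  qed
  from this[of "N - m"] have "s N = s (N - m)" using False by simp
  then show ?thesis using less.IH[of "N - m"] m False by (simp add: s_def)
 qed
qed

lemma dchar_period_sum:
 assumes \<xi>: "dchar m \<xi>" "\<not> trivial_char m \<xi>" and m: "m > 0"
 shows "(\<Sum>x\<in>{0..<int m}. \<xi> x) = 0"
proof -
 obtain a where a: "coprime a (int m)" "\<xi> a \<noteq> 1" using \<xi>(2) by (auto simp: trivial_char_def)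
 have bij: "bij_betw (\<lambda>x. (a * x) mod int m) {0..<int m} {0..<int m}"
 proof -
  have "inj_on (\<lambda>x. (a * x) mod int m) {0..<int m}"
  proof (rule inj_onI)
   fix x y assume xy: "x \<in> {0..<int m}" "y \<in> {0..<int m}" "(a * x) mod int m = (a * y) mod int m"
   then have "[x = y] (mod int m)" using a(1) by (simp add: cong_def[symmetric] cong_mult_lcancel coprime_commute)
   then show "x = y" using xy by (simp add: cong_def)
  qed
  moreover have "(\<lambda>x. (a * x) mod int m) ` {0..<int m} \<subseteq> {0..<int m}" using m by auto
  ultimately show ?thesis using endo_inj_surj[of "{0..<int m}"] by (simp add: bij_betw_def)
 qed
 have "(\<Sum>x\<in>{0..<int m}. \<xi> x) = (\<Sum>x\<in>{0..<int m}. \<xi> ((a * x) mod int m))"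
  by (rule sum.reindex_bij_betw[OF bij, symmetric])
 also have "... = (\<Sum>x\<in>{0..<int m}. \<xi> a * \<xi> x)"
  by (intro sum.cong refl) (metis cong_mod_left cong_refl dchar_cong dchar_mult \<xi>(1))
 also have "... = \<xi> a * (\<Sum>x\<in>{0..<int m}. \<xi> x)" by (simp only: sum_distrib_left)
 finally have "(\<Sum>x\<in>{0..<int m}. \<xi> x) = \<xi> a * (\<Sum>x\<in>{0..<int m}. \<xi> x)" .
 then show ?thesis using a(2) by (metis mult_cancel_right1)
qed

lemma dchar_partial_sum_le:
 assumes "dchar m \<xi>" "\<not> trivial_char m \<xi>" "m > 0"
 shows "norm (\<Sum>n=1..N. \<xi> (int n)) <= real m"
 by (rule periodic_partial_sum_le[OF assms(3) dchar_cong[OF assms(1)] dchar_norm_le[OF assms(1,3)] dchar_period_sum[OF assms]])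

lemma dchar_fam_char:
 assumes "finite P" "\<And>p. p \<in> P ==> prime p" "\<And>p. p \<in> P ==> dchar p (\<psi> p)"
 shows "dchar (\<Prod>P) (fam_char P \<psi>)"
 unfolding dchar_def
proof (intro conjI allI impI)
 fix a b
 show "fam_char P \<psi> (a * b) = fam_char P \<psi> a * fam_char P \<psi> b"
  unfolding fam_char_def prod.distrib[symmetric] using assms(3) by (intro prod.cong refl dchar_mult)
 show "fam_char P \<psi> a = fam_char P \<psi> b" if "[a = b] (mod int (\<Prod>P))"
  unfolding fam_char_def using assms that by (intro prod_cong_mod) (auto intro: dchar_cong)
 have "fam_char P \<psi> a \<noteq> 0 \<longleftrightarrow> (\<forall>p\<in>P. coprime a (int p))"
  unfolding fam_char_def using assms(1) by (auto simp: dchar_eq_0_iff[OF assms(3)])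
 also have "... \<longleftrightarrow> coprime a (int (\<Prod>P))"
 proof
  assume "\<forall>p\<in>P. coprime a (int p)"
  then show "coprime a (int (\<Prod>P))" by (simp add: prod_coprime_right)
 next
  assume a: "coprime a (int (\<Prod>P))"
  show "\<forall>p\<in>P. coprime a (int p)"
  proof
   fix p assume "p \<in> P"
   then have "p dvd \<Prod>P" using assms(1) by (intro dvd_prodI[where f = "\<lambda>x. x", simplified]) auto
   then have "int p dvd int (\<Prod>P)" by (simp only: of_nat_dvd_iff)
   then show "coprime a (int p)" using a by (meson coprime_divisors dvd_refl)
  qed
 qed
 finally show "fam_char P \<psi> a \<noteq> 0 \<longleftrightarrow> coprime a (int (\<Prod>P))" .
qed

lemma dchar_product:
 assumes "dchar m1 \<xi>1" "dchar m2 \<xi>2"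
 shows "dchar (m1 * m2) (\<lambda>a. \<xi>1 a * \<xi>2 a)"
 unfolding dchar_def
proof (intro conjI allI impI)
 fix a b
 show "\<xi>1 (a * b) * \<xi>2 (a * b) = \<xi>1 a * \<xi>2 a * (\<xi>1 b * \<xi>2 b)"
  by (simp add: dchar_mult[OF assms(1)] dchar_mult[OF assms(2)])
 show "\<xi>1 a * \<xi>2 a = \<xi>1 b * \<xi>2 b" if ab: "[a = b] (mod int (m1 * m2))"
 proof -
  have "[a = b] (mod int m1)" "[a = b] (mod int m2)" using cong_dvd_modulus[OF ab] by auto
  then show ?thesis using dchar_cong assms by metis
 qed
 show "\<xi>1 a * \<xi>2 a \<noteq> 0 \<longleftrightarrow> coprime a (int (m1 * m2))"
  using dchar_eq_0_iff[OF assms(1)] dchar_eq_0_iff[OF assms(2)] by simp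
qed

text \<open>Trivial local components still impose coprimality to their primes. By complete
  multiplicativity the multiples of a prime \<open>q\<close> contribute \<open>c q\<close> times a
  shorter sum, so removing them at most doubles the bound.\<close>

lemma sieved_sum_le:
 fixes c :: "nat => complex"
 assumes "finite P" "\<And>p. p \<in> P ==> prime p" and mult: "\<And>a b. c (a * b) = c a * c b" and le: "\<And>a. norm (c a) <= 1"
  and bd: "\<And>M. M <= N ==> norm (\<Sum>n=1..M. c n) <= b" and M: "M <= N"
 shows "norm (\<Sum>n\<in>{n\<in>{1..M}. \<forall>p\<in>P. \<not> p dvd n}. c n) <= 2 ^ card P * b"
 using assms(1,2) M
proof (induction P arbitrary: M rule: finite_induct)
 case empty
 have "{n\<in>{1..M}. \<forall>p\<in>{}. \<not> p dvd n} = {1..M}" by auto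
 then show ?case using bd empty by simp
next
 case (insert q P)
 define s where "s = (\<lambda>M. \<Sum>n\<in>{n\<in>{1..M}. \<forall>p\<in>P. \<not> p dvd n}. c n)"
 have q: "prime q" "q > 0" using insert.prems prime_gt_0_nat by auto
 have P: "\<And>p. p \<in> P ==> prime p" using insert.prems by auto
 have "(\<Sum>n\<in>{n\<in>{1..M}. \<forall>p\<in>insert q P. \<not> p dvd n}. c n)
   = s M - (\<Sum>n\<in>(\<lambda>n. q * n) ` {n\<in>{1..M div q}. \<forall>p\<in>P. \<not> p dvd n}. c n)"
  unfolding s_def
  by (subst sieve_multiples(1)[OF q(1) insert.hyps(2)], rule P, assumption, rule sum_diff)
    (simp, rule sieve_multiples(2)[OF q(1) insert.hyps(2)], rule P, assumption)
 also have "(\<Sum>n\<in>(\<lambda>n. q * n) ` {n\<in>{1..M div q}. \<forall>p\<in>P. \<not> p dvd n}. c n) = c q * s (M div q)"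
  using q by (subst sum.reindex) (auto simp: inj_on_def s_def mult sum_distrib_left)
 also have "norm (s M - c q * s (M div q)) <= norm (s M) + norm (c q) * norm (s (M div q))"
  by (metis norm_mult norm_triangle_ineq4)
 also have "... <= 2 ^ card P * b + 1 * (2 ^ card P * b)"
 proof (intro add_mono mult_mono)
  show "norm (s M) <= 2 ^ card P * b" unfolding s_def using insert by auto
  have "M div q <= N" using insert.prems(2) div_le_dividend order_trans by blast
  then show "norm (s (M div q)) <= 2 ^ card P * b" unfolding s_def using insert by auto
 qed (use le in auto)
 also have "... = 2 ^ card (insert q P) * b" using insert.hyps by simp
 finally show ?case .
qed

text \<open>Burgess's bound sees only the product \<open>f\<close> of the primes with nontrivial
  local component, which may be far smaller than \<open>Q\<close>. Sums of length at least
  \<open>Q ^ 2\<close> follow from periodicity modulo \<open>Q\<close>, small \<open>f\<close> from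
  periodicity modulo \<open>K * f\<close>, and the other primes are sieved out.\<close>

theorem dchar_sum_bound:
 assumes Y: "Y > 0" and \<epsilon>: "0 < \<epsilon>" "\<epsilon> <= 1 / 4"
 obtains \<delta> C :: real where "0 < \<delta>" "\<delta> <= 1 / 4" "C >= 1"
  "\<And>Q \<xi> N. Q > 0 ==> Y dvd Q ==> dchar Q \<xi> ==> order_dvd Y Q \<xi> ==> \<not> trivial_char Q \<xi> ==>
   real Q powr (1 / 4 + \<epsilon>) <= real N ==> norm (\<Sum>n=1..N. \<xi> (int n)) <= C * real N powr (1 - \<delta>)"
proof -
 have h: "0 < \<epsilon> / 2" "\<epsilon> / 2 <= 1 / 4" using \<epsilon> by auto
 show ?thesis
 proof (rule burgess[OF Y h, of "Y ^ 3"])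
 fix \<delta> C :: real
 assume \<delta>: "\<delta> > 0" "\<delta> <= 1" and C: "C >= 1"
  and B: "\<And>K \<kappa> P \<psi> N. K > 0 ==> K <= Y ^ 3 ==> char_family Y P \<psi> ==> coprime K (\<Prod>P) ==>
   (\<And>a b. [a = b] (mod int K) ==> \<kappa> a = \<kappa> b) ==> (\<And>a. norm (\<kappa> a :: complex) <= 1) ==>
   real (\<Prod>P) powr (1 / 4 + \<epsilon> / 2) <= real N ==> N <= (\<Prod>P) ^ 16 ==>
   norm (\<Sum>n=1..N. \<kappa> (int n) * fam_char P \<psi> (int n)) <= C * real N * real (\<Prod>P) powr (- \<delta>)"
 \<comment> \<open>With \<open>f\<close> above \<open>Q powr (1 / 8)\<close>, a saving
   \<open>f powr (- \<delta>)\<close> is at least \<open>Q powr (- (\<delta> / 8))\<close>. Half of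
   \<eta> pays for the sieve, and \<open>N < Q ^ 2\<close> turns the other half into a saving of
   exponent \<eta>\<open>/ 4\<close> in \<open>N\<close>.\<close>
 define \<eta> where "\<eta> = min (\<delta> / 8) (\<epsilon> / 2)"
 define e where "e = \<eta> / 2"
 have \<eta>: "\<eta> > 0" "\<eta> <= \<delta> / 8" "\<eta> <= \<epsilon> / 2" "\<eta> <= 1 / 8" using \<delta> \<epsilon> by (auto simp: \<eta>_def)
 have e: "e > 0" "e <= 1 / 16" using \<eta> by (auto simp: e_def)
 obtain C1 where C1: "C1 >= 1" "\<And>P. finite P ==> (\<And>p. p \<in> P ==> prime p) ==> 2 ^ card P <= C1 * real (\<Prod>P) powr e"
  using power_card_primes_bound[of 2 e] e by auto
 define C' where "C' = C1 * real (Y ^ 3) * C"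
 have Y3: "real (Y ^ 3) >= 1" using Y by (simp add: Suc_leI)
 have C'ge: "C' >= 1" "C1 * real (Y ^ 3) <= C'" "C1 * C <= C'"
 proof -
  have "1 * 1 * 1 <= C1 * real (Y ^ 3) * C" using C1(1) Y3 C by (intro mult_mono) auto
  then show "C' >= 1" by (simp add: C'_def)
  have "C1 * real (Y ^ 3) * 1 <= C1 * real (Y ^ 3) * C" using C1(1) Y3 C by (intro mult_left_mono) auto
  then show "C1 * real (Y ^ 3) <= C'" by (simp add: C'_def)
  have "C1 * 1 * C <= C1 * real (Y ^ 3) * C" using C1(1) Y3 C by (intro mult_right_mono mult_left_mono) auto
  then show "C1 * C <= C'" by (simp add: C'_def)
 qed
 show ?thesis
 proof (rule that[of "\<eta> / 4" C'])
  show "0 < \<eta> / 4" "\<eta> / 4 <= 1 / 4" "C' >= 1" using \<eta> C'ge by auto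
  fix Q \<xi> N
  assume Q: "Q > 0" "Y dvd Q" and \<xi>: "dchar Q \<xi>" "order_dvd Y Q \<xi>" "\<not> trivial_char Q \<xi>"
   and N: "real Q powr (1 / 4 + \<epsilon>) <= real N"
  define q where "q = real Q"
  have q1: "q >= 1" using Q by (simp add: q_def)
  have "1 <= q powr (1 / 4 + \<epsilon>)" using q1 \<epsilon> by (intro ge_one_powr_ge_zero) auto
  then have N1: "real N >= 1" using N by (simp add: q_def)
  have q2: "q\<^sup>2 = q powr 2" using q1 by simp
  define X where "X = real N"
  have X1: "X >= 1" using N1 by (simp add: X_def)
  define S where "S = (\<Sum>n=1..N. \<xi> (int n))"
  have "norm S <= C' * X powr (1 - \<eta> / 4)"
  proof (cases "q\<^sup>2 <= X")
   case True
   have "norm S <= q" unfolding S_def q_def using dchar_partial_sum_le[OF \<xi>(1,3) Q(1)] .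
   also have "q = (q\<^sup>2) powr (1 / 2)" using q1 by (simp add: powr_half_sqrt)
   also have "... <= X powr (1 / 2)" using True q1 by (intro powr_mono2) auto
   also have "... <= X powr (1 - \<eta> / 4)" using X1 \<eta> by (intro powr_mono) auto
   also have "... <= C' * X powr (1 - \<eta> / 4)" using C'ge(1) mult_right_mono[of 1 C' "X powr (1 - \<eta> / 4)"] by simp
   finally show ?thesis .
  next
   case False
   obtain K \<kappa> P \<psi> where st: "K > 0 \<and> K <= Y ^ 3 \<and> dchar K \<kappa> \<and> finite P \<and> (\<forall>p\<in>P. prime p) \<and>
     (\<forall>p\<in>P. dchar p (\<psi> p) \<and> order_dvd Y p (\<psi> p)) \<and> coprime K (\<Prod>P) \<and> \<Prod>P dvd Q \<and>
     (\<forall>a. \<xi> a = \<kappa> a * (\<Prod>p\<in>P. \<psi> p a))"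
    using dchar_structure[OF \<xi>(1,2) Y Q(2,1)] by (elim exE)
   then have K: "K > 0" "K <= Y ^ 3" "dchar K \<kappa>" and P: "finite P" "\<And>p. p \<in> P ==> prime p"
    and \<psi>: "\<And>p. p \<in> P ==> dchar p (\<psi> p) \<and> order_dvd Y p (\<psi> p)" and cop: "coprime K (\<Prod>P)" and PQ: "\<Prod>P dvd Q"
    and \<xi>eq: "\<And>a. \<xi> a = \<kappa> a * (\<Prod>p\<in>P. \<psi> p a)"
    by simp_all
   define P1 where "P1 = {p\<in>P. \<not> trivial_char p (\<psi> p)}"
   define P2 where "P2 = {p\<in>P. trivial_char p (\<psi> p)}"
   have PP: "P = P1 \<union> P2" "P1 \<inter> P2 = {}" "finite P1" "finite P2" using P by (auto simp: P1_def P2_def)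
   have pr: "\<And>p. p \<in> P1 ==> prime p" "\<And>p. p \<in> P2 ==> prime p" using P PP by auto
   have fam: "char_family Y P1 \<psi>" using PP(3) P \<psi> by (auto simp: char_family_def P1_def)
   have prodP: "\<Prod>P = \<Prod>P1 * \<Prod>P2" using PP by (simp add: prod.union_disjoint)
   define f where "f = real (\<Prod>P1)"
   define c where "c = (\<lambda>a. \<kappa> a * fam_char P1 \<psi> a)"
   have "\<Prod>P1 > 0" "\<Prod>P2 > 0" using pr prime_gt_0_nat by (auto intro!: prod_pos)
   then have f1: "f >= 1" by (simp add: f_def del: of_nat_prod)
   have "\<Prod>P1 dvd Q" "\<Prod>P2 dvd Q" using PQ prodP by (auto intro: dvd_mult_left dvd_mult_right)
   then have "\<Prod>P1 <= Q" and P2Q: "\<Prod>P2 <= Q" using Q(1) by (auto intro: dvd_imp_le)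
   then have P2q: "real (\<Prod>P2) <= q" by (simp only: q_def of_nat_le_iff)
   have fq: "f <= q" using \<open>\<Prod>P1 <= Q\<close> by (simp only: f_def q_def of_nat_le_iff)
   have cop1: "coprime K (\<Prod>P1)" using cop prodP by simp
   have dc: "dchar (K * \<Prod>P1) c"
    unfolding c_def using pr \<psi> PP by (intro dchar_product K dchar_fam_char) auto
   have ones: "(\<Prod>p\<in>P2. \<psi> p a) = (if \<forall>p\<in>P2. \<not> int p dvd a then 1 else 0)" for a
   proof -
    have *: "coprime a (int p) \<longleftrightarrow> \<not> int p dvd a" if "p \<in> P2" for p
    proof -
     have "prime (int p)" using pr(2)[OF that] by simp
     then show ?thesis using prime_imp_coprime[of "int p" a] not_coprimeI[of "int p" a "int p"] not_prime_unit[of "int p"]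
      by (auto simp: coprime_commute)
    qed
    have "\<psi> p a = (if int p dvd a then 0 else 1)" if "p \<in> P2" for p
     using *[OF that] that \<psi>[of p] dchar_eq_0_iff[of p "\<psi> p" a] by (auto simp: P2_def trivial_char_def)
    then have "(\<Prod>p\<in>P2. \<psi> p a) = (\<Prod>p\<in>P2. if int p dvd a then 0 else 1)" by (intro prod.cong) auto
    also have "... = (if \<forall>p\<in>P2. \<not> int p dvd a then 1 else 0)" using PP(4) by (auto intro!: prod_zero)
    finally show ?thesis .
   qed
   have \<xi>c: "\<xi> a = c a * (if \<forall>p\<in>P2. \<not> int p dvd a then 1 else 0)" for a
    unfolding \<xi>eq c_def fam_char_def ones[symmetric] using PP by (simp add: prod.union_disjoint)
   have nt: "\<not> trivial_char (K * \<Prod>P1) c"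
   proof
    assume t: "trivial_char (K * \<Prod>P1) c"
    have "\<xi> a = 1" if "coprime a (int Q)" for a
    proof -
     have "\<xi> a \<noteq> 0" using that dchar_eq_0_iff[OF \<xi>(1)] by blast
     then have "c a \<noteq> 0" "(\<forall>p\<in>P2. \<not> int p dvd a)" using \<xi>c[of a] by (auto split: if_splits)
     then show ?thesis using t dchar_eq_0_iff[OF dc] \<xi>c[of a] by (simp add: trivial_char_def)
    qed
    then show False using \<xi>(3) by (auto simp: trivial_char_def)
   qed
   have Kf: "K * \<Prod>P1 > 0" using K \<open>\<Prod>P1 > 0\<close> by simp
   have cmult: "c (int (a * b)) = c (int a) * c (int b)" for a b using dchar_mult[OF dc] by simp
   have cle: "norm (c a) <= 1" for a using dchar_norm_le[OF dc Kf] .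
   have SS: "S = (\<Sum>n\<in>{n\<in>{1..N}. \<forall>p\<in>P2. \<not> p dvd n}. c (int n))"
    unfolding S_def by (subst sum.inter_filter) (auto simp: \<xi>c intro!: sum.cong)
   have sieve: "norm S <= C1 * q powr e * b" if b: "\<And>M. M <= N ==> norm (\<Sum>n=1..M. c (int n)) <= b" for b
   proof -
    have "norm S <= 2 ^ card P2 * b"
     unfolding SS by (rule sieved_sum_le[where N = N]) (use PP pr cmult cle b in auto)
    also have "... <= (C1 * q powr e) * b"
    proof (intro mult_right_mono)
     have "2 ^ card P2 <= C1 * real (\<Prod>P2) powr e" using C1(2) PP pr by blast
     also have "... <= C1 * q powr e" using P2q C1(1) e
      by (intro mult_left_mono powr_mono2) (simp_all del: of_nat_prod)
     finally show "2 ^ card P2 <= C1 * q powr e" .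
     show "0 <= b" using b[of 0] by simp
    qed
    finally show ?thesis by simp
   qed
   show ?thesis
   \<comment> \<open>The threshold is the source of the exponent 16 in \<open>burgess\<close>: for
     larger \<open>f\<close> the length, below \<open>q ^ 2\<close>, is at most
     \<open>f ^ 16\<close>.\<close>
   proof (cases "f <= q powr (1 / 8)")
    case True
    have "norm (\<Sum>n=1..M. c (int n)) <= real (Y ^ 3) * q powr (1 / 8)" for M
    proof -
     have "norm (\<Sum>n=1..M. c (int n)) <= real K * f"
      using dchar_partial_sum_le[OF dc nt Kf] by (simp add: f_def)
     also have "real K <= real (Y ^ 3)" using K(2) by (simp only: of_nat_le_iff)
     then have "real K * f <= real (Y ^ 3) * q powr (1 / 8)" using True f1
      by (intro mult_mono) simp_all
     finally show ?thesis .
    qed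
    then have "norm S <= C1 * q powr e * (real (Y ^ 3) * q powr (1 / 8))" by (rule sieve)
    also have "... = (C1 * real (Y ^ 3)) * q powr (e + 1 / 8)" by (simp add: powr_add)
    also have "... <= C' * (q powr (1 / 4 + \<epsilon>)) powr (3 / 4)"
    proof (intro mult_mono)
     show "q powr (e + 1 / 8) <= (q powr (1 / 4 + \<epsilon>)) powr (3 / 4)"
      unfolding powr_powr using q1 e \<epsilon> by (intro powr_mono) auto
    qed (use C'ge in auto)
    also have "... <= C' * X powr (3 / 4)"
     using N C'ge by (intro mult_left_mono powr_mono2) (auto simp: X_def q_def)
    also have "... <= C' * X powr (1 - \<eta> / 4)"
     using X1 \<eta> C'ge by (intro mult_left_mono powr_mono) auto
    finally show ?thesis .
   next
    case fbig: False
    have "norm (\<Sum>n=1..M. c (int n)) <= C * X * q powr (- \<eta>)" if M: "M <= N" for M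
    \<comment> \<open>The sieve needs a bound for all initial segments. Those shorter than
      \<open>q powr (1 / 4 + \<epsilon> / 2)\<close> are bounded by their length, which is a power
      of \<open>q\<close> smaller than \<open>N\<close>; this is why Burgess's bound is invoked with
      \<epsilon>\<open>/ 2\<close>.\<close>
    proof (cases "real M >= q powr (1 / 4 + \<epsilon> / 2)")
     case True
     have "f powr (1 / 4 + \<epsilon> / 2) <= q powr (1 / 4 + \<epsilon> / 2)" using fq f1 \<epsilon> by (intro powr_mono2) auto
     then have 1: "real (\<Prod>P1) powr (1 / 4 + \<epsilon> / 2) <= real M" using True by (simp add: f_def)
     have "real M <= X" using M by (simp add: X_def)
     also have "X <= q\<^sup>2" using False by simp
     also have "q\<^sup>2 = (q powr (1 / 8)) ^ 16" using q1 by (simp add: powr_power)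
     also have "... <= f ^ 16" using fbig by (intro power_mono) auto
     finally have "real M <= real ((\<Prod>P1) ^ 16)" by (simp add: f_def)
     then have 2: "M <= (\<Prod>P1) ^ 16" by (simp only: of_nat_le_iff)
     have "norm (\<Sum>n=1..M. c (int n)) <= C * real M * f powr (- \<delta>)"
      unfolding c_def f_def
      by (rule B[OF K(1,2) fam cop1 dchar_cong[OF K(3)] dchar_norm_le[OF K(3,1)] 1 2])
     also have "... <= C * X * q powr (- \<eta>)"
     proof (intro mult_mono)
      have "f powr (- \<delta>) <= (q powr (1 / 8)) powr (- \<delta>)" using fbig q1 \<delta> by (intro powr_mono2') auto
      also have "... = q powr (- (\<delta> / 8))" by (simp add: powr_powr)
      also have "... <= q powr (- \<eta>)" using q1 \<eta> by (intro powr_mono) auto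
      finally show "f powr (- \<delta>) <= q powr (- \<eta>)" .
     qed (use C M X1 in \<open>auto simp: X_def\<close>)
     finally show ?thesis .
    next
     case small: False
     have "norm (\<Sum>n=1..M. c (int n)) <= real M" by (rule norm_char_sum_le) (rule cle)
     also have "... <= q powr (1 / 4 + \<epsilon> / 2)" using small by simp
     also have "... = q powr (1 / 4 + \<epsilon>) * q powr (- (\<epsilon> / 2))"
      unfolding powr_add[symmetric] by (rule arg_cong[where f = "(powr) q"]) simp
     also have "... <= X * q powr (- \<eta>)"
      using N q1 \<eta> by (intro mult_mono powr_mono) (auto simp: X_def q_def)
     also have "... <= C * (X * q powr (- \<eta>))" using C X1 mult_right_mono[of 1 C "X * q powr (- \<eta>)"] by simp
     finally show ?thesis by (simp add: mult_ac)
    qed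
    then have "norm S <= C1 * q powr e * (C * X * q powr (- \<eta>))" by (rule sieve)
    also have "... = (C1 * C) * X * q powr (e - \<eta>)" by (simp add: powr_add[symmetric] powr_diff powr_minus field_simps)
    also have "... <= C' * X * X powr (- (\<eta> / 4))"
    proof (intro mult_mono)
     have "q powr (e - \<eta>) = (q\<^sup>2) powr (- (\<eta> / 4))"
      unfolding q2 powr_powr by (simp add: e_def)
     also have "... <= X powr (- (\<eta> / 4))" using False X1 \<eta> by (intro powr_mono2') auto
     finally show "q powr (e - \<eta>) <= X powr (- (\<eta> / 4))" .
    qed (use C'ge X1 in auto)
    also have "... = C' * X powr (1 - \<eta> / 4)" using powr_add[of X 1 "- (\<eta> / 4)"] X1 by (simp add: mult.assoc)
    finally show ?thesis .
   qed
  qed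
  then show "norm (\<Sum>n=1..N. \<xi> (int n)) <= C' * real N powr (1 - \<eta> / 4)" by (simp add: S_def X_def)
 qed
 qed
qed

section \<open>Dirichlet convolution and the hyperbola method\<close>

lemma sum_powr_le:
 assumes s: "0 < s" "s <= 1"
 shows "(\<Sum>a=1..U. real a powr (s - 1)) <= real U powr s / s"
proof (induction U)
 case (Suc U)
 have key: "s * real (Suc U) powr (s - 1) <= real (Suc U) powr s - real U powr s"
 proof (cases "U = 0")
  case True
  then show ?thesis using s by simp
 next
  case False
  have "\<exists>z. z > real U \<and> z < real (Suc U) \<and> real (Suc U) powr s - real U powr s = (real (Suc U) - real U) * (s * z powr (s - 1))"
  proof (rule MVT2)
   fix x assume "real U <= x" "x <= real (Suc U)"
   then have "x > 0" using False by (meson of_nat_0_less_iff neq0_conv less_le_trans)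
   then show "((\<lambda>x. x powr s) has_real_derivative s * x powr (s - 1)) (at x)"
    by (rule has_real_derivative_powr)
  qed simp
  then obtain z where z: "z > real U" "z < real (Suc U)" "real (Suc U) powr s - real U powr s = s * z powr (s - 1)" by auto
  have "real (Suc U) powr (s - 1) <= z powr (s - 1)" using z s False by (intro powr_mono2') auto
  then show ?thesis using z s by (simp add: mult_left_mono)
 qed
 have "(\<Sum>a=1..Suc U. real a powr (s - 1)) <= real U powr s / s + real (Suc U) powr (s - 1)" using Suc by simp
 also have "real (Suc U) powr (s - 1) <= (real (Suc U) powr s - real U powr s) / s"
  using key s by (simp add: pos_le_divide_eq mult.commute)
 also have "real U powr s / s + (real (Suc U) powr s - real U powr s) / s = real (Suc U) powr s / s"
  by (simp add: diff_divide_distrib)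
 finally show ?case by simp
qed (use s in simp)

definition dconv :: "(nat => complex) => (nat => complex) => nat => complex" where
 "dconv g h n = (\<Sum>d | d dvd n. g d * h (n div d))"

definition dunit :: "nat => complex" where
 "dunit n = (if n = 1 then 1 else 0)"

lemma sum_dconv_weighted:
 "(\<Sum>n=1..N. dconv g h n * w n) = (\<Sum>(a, b)\<in>{(a, b). 1 <= a \<and> 1 <= b \<and> a * b <= N}. g a * h b * w (a * b))"
proof -
 have "(\<Sum>n=1..N. dconv g h n * w n) = (\<Sum>n=1..N. \<Sum>d | d dvd n. g d * h (n div d) * w n)"
  by (simp add: dconv_def sum_distrib_right)
 also have "... = (\<Sum>(n, d)\<in>Sigma {1..N} (\<lambda>n. {d. d dvd n}). g d * h (n div d) * w n)"
  by (rule sum.Sigma) (auto intro!: finite_divisors_nat)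
 also have "... = (\<Sum>(a, b)\<in>{(a, b). 1 <= a \<and> 1 <= b \<and> a * b <= N}. g a * h b * w (a * b))"
  by (rule sum.reindex_bij_witness[of _ "\<lambda>(a, b). (a * b, a)" "\<lambda>(n, d). (d, n div d)"])
    (auto elim!: dvdE simp: Suc_le_eq)
 finally show ?thesis .
qed

lemma finite_hyperbola: "finite {(a, b). 1 <= a \<and> 1 <= b \<and> a * b <= (N::nat)}"
proof (rule finite_subset[of _ "{..N} \<times> {..N}"])
 show "{(a, b). 1 <= a \<and> 1 <= b \<and> a * b <= N} \<subseteq> {..N} \<times> {..N}"
 proof clarify
  fix a b :: nat assume ab: "1 <= a" "1 <= b" "a * b <= N"
  have "a * 1 <= a * b" "1 * b <= a * b" using ab by (intro mult_le_mono; simp)+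
  then have "a <= N" "b <= N" using ab(3) by linarith+
  then show "a \<in> {..N} \<and> b \<in> {..N}" by simp
 qed
qed simp

text \<open>The cut at \<open>U\<close> is free, and both halves involve the factors only through
  coefficients of one and partial sums of the other. Cancellation in either factor can thus be used
  at its own threshold.\<close>

lemma hyperbola:
 fixes g h :: "nat => complex"
 shows "(\<Sum>n=1..N. dconv g h n) = (\<Sum>a=1..U. g a * (\<Sum>b=1..N div a. h b))
   + (\<Sum>b=1..N div Suc U. h b * ((\<Sum>a=1..N div b. g a) - (\<Sum>a=1..U. g a)))"
proof -
 let ?D = "{(a, b). 1 <= a \<and> 1 <= b \<and> a * b <= N}"
 let ?L = "Sigma {1..U} (\<lambda>a. {1..N div a})" and ?R = "Sigma {1..N div Suc U} (\<lambda>b. {Suc U..N div b})"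
 have le: "a * b <= N \<longleftrightarrow> b <= N div a" if "a >= 1" for a b
  using that by (simp add: less_eq_div_iff_mult_less_eq mult.commute)
 have fin: "finite ?D" by (rule finite_hyperbola)
 have "(\<Sum>n=1..N. dconv g h n) = (\<Sum>(a, b)\<in>?D. g a * h b)"
  using sum_dconv_weighted[of g h "\<lambda>_. 1" N] by simp
 also have "?D = ?D \<inter> {(a, b). a <= U} \<union> ?D \<inter> {(a, b). \<not> a <= U}" by auto
 also have "(\<Sum>(a, b)\<in>.... g a * h b) = (\<Sum>(a, b)\<in>?D \<inter> {(a, b). a <= U}. g a * h b) + (\<Sum>(a, b)\<in>?D \<inter> {(a, b). \<not> a <= U}. g a * h b)"
  using fin by (intro sum.union_disjoint) auto
 also have "?D \<inter> {(a, b). a <= U} = ?L" using le by auto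
 also have "(\<Sum>(a, b)\<in>?L. g a * h b) = (\<Sum>a=1..U. g a * (\<Sum>b=1..N div a. h b))"
  by (subst sum.Sigma[symmetric]) (auto simp: sum_distrib_left)
 also have "(\<Sum>(a, b)\<in>?D \<inter> {(a, b). \<not> a <= U}. g a * h b) = (\<Sum>(b, a)\<in>?R. g a * h b)"
 proof (rule sum.reindex_bij_witness[of _ "\<lambda>(b, a). (a, b)" "\<lambda>(a, b). (b, a)"])
  fix x assume "x \<in> ?D \<inter> {(a, b). \<not> a <= U}"
  then obtain a b where x: "x = (a, b)" "1 <= a" "1 <= b" "a * b <= N" "Suc U <= a" by auto
  have "Suc U * b <= a * b" using x by (intro mult_le_mono1)
  then have "Suc U * b <= N" using x by simp
  then have "b <= N div Suc U" using le[of "Suc U" b] by simp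
  moreover have "a <= N div b" using le[of b a] x by (simp add: mult.commute)
  ultimately show "(case x of (a, b) => (b, a)) \<in> ?R" using x by simp
 next
  fix x assume "x \<in> ?R"
  then obtain a b where x: "x = (b, a)" "1 <= b" "Suc U <= a" "a <= N div b" by auto
  then have "a * b <= N" using le[of b a] by (simp add: mult.commute)
  then show "(case x of (b, a) => (a, b)) \<in> ?D \<inter> {(a, b). \<not> a <= U}" using x by simp
 qed auto
 also have "... = (\<Sum>b=1..N div Suc U. \<Sum>a\<in>{Suc U..N div b}. g a * h b)"
  by (rule sum.Sigma[symmetric]) auto
 also have "... = (\<Sum>b=1..N div Suc U. h b * ((\<Sum>a=1..N div b. g a) - (\<Sum>a=1..U. g a)))"
 proof (intro sum.cong refl)
  fix b assume b: "b \<in> {1..N div Suc U}"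
  then have "b * Suc U <= N" using le[of "Suc U" b] by (simp add: mult.commute)
  then have "Suc U <= N div b" using le[of b "Suc U"] b by simp
  then have "{1..N div b} = {1..U} \<union> {Suc U..N div b}" by auto
  then have "(\<Sum>a=1..N div b. g a) = (\<Sum>a=1..U. g a) + (\<Sum>a\<in>{Suc U..N div b}. g a)"
   by (simp only:) (rule sum.union_disjoint, auto)
  then show "(\<Sum>a\<in>{Suc U..N div b}. g a * h b) = h b * ((\<Sum>a=1..N div b. g a) - (\<Sum>a=1..U. g a))"
   by (simp add: sum_distrib_left mult.commute)
 qed
 finally show ?thesis .
qed

lemma le_div_of_le_div_Suc:
 assumes "b \<in> {1..N div Suc U}"
 shows "Suc U <= N div b"
proof -
 have "b * Suc U <= N" using assms by (simp add: less_eq_div_iff_mult_less_eq)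
 then show ?thesis using assms by (simp add: less_eq_div_iff_mult_less_eq mult.commute)
qed

lemma of_nat_div_Suc_le: "U > 0 ==> real (N div Suc U) <= real N / real U"
proof -
 assume U: "U > 0"
 have "real (N div Suc U) <= real N / Suc U" using of_nat_div_le_of_nat[of N "Suc U", where 'a = real] by simp
 also have "... <= real N / U" using U by (intro divide_left_mono) auto
 finally show ?thesis .
qed

lemma divide_less_of_nat_div: "real N / real a < real (N div a) + 1"
 using floor_divide_of_nat_eq[of N a, where 'a = real] by linarith

lemma dconv_commute: "dconv g h n = dconv h g n" if "n > 0"
 unfolding dconv_def
 by (rule sum.reindex_bij_witness[of _ "\<lambda>d. n div d" "\<lambda>d. n div d"]) (use that in \<open>auto elim!: dvdE\<close>)

lemma dconv_assoc:
 assumes "n > 0"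
 shows "dconv (dconv g h) k n = dconv g (dconv h k) n"
proof -
 have fin: "finite {d. d dvd n}" "\<forall>d\<in>{d. d dvd n}. finite {e. e dvd d}" "\<forall>e\<in>{e. e dvd n}. finite {m. m dvd n div e}"
  using assms dvd_pos_nat[OF assms] by (auto intro!: finite_divisors_nat elim!: dvdE)
 have "dconv (dconv g h) k n = (\<Sum>d | d dvd n. \<Sum>e | e dvd d. g e * h (d div e) * k (n div d))"
  by (simp add: dconv_def sum_distrib_right)
 also have "... = (\<Sum>(d, e)\<in>Sigma {d. d dvd n} (\<lambda>d. {e. e dvd d}). g e * h (d div e) * k (n div d))"
  by (rule sum.Sigma[OF fin(1,2)])
 also have "... = (\<Sum>(e, m)\<in>Sigma {e. e dvd n} (\<lambda>e. {m. m dvd n div e}). g e * (h m * k (n div e div m)))"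
  by (rule sum.reindex_bij_witness[of _ "\<lambda>(e, m). (e * m, e)" "\<lambda>(d, e). (e, d div e)"])
    (use assms in \<open>auto elim!: dvdE simp: mult.assoc div_mult2_eq\<close>)
 also have "... = (\<Sum>e | e dvd n. \<Sum>m | m dvd n div e. g e * (h m * k (n div e div m)))"
  by (rule sum.Sigma[OF fin(1,3), symmetric])
 also have "... = dconv g (dconv h k) n" by (simp add: dconv_def sum_distrib_left)
 finally show ?thesis .
qed

lemma dconv_cong:
 assumes "n > 0" "\<And>m. m > 0 ==> g m = g' m" "\<And>m. m > 0 ==> h m = h' m"
 shows "dconv g h n = dconv g' h' n"
 unfolding dconv_def using assms by (intro sum.cong refl) (auto elim!: dvdE)

lemma dconv_dunit: "n > 0 ==> dconv g dunit n = g n"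
proof -
 assume n: "n > 0"
 have "dconv g dunit n = (\<Sum>d\<in>{n}. g d * dunit (n div d))"
  unfolding dconv_def using n
  by (intro sum.mono_neutral_right) (auto simp: dunit_def finite_divisors_nat elim!: dvdE)
 then show ?thesis using n by (simp add: dunit_def)
qed

section \<open>Iterated convolutions\<close>

fun dconvs :: "(nat => complex) list => nat => complex" where
 "dconvs [] = dunit"
| "dconvs (g # gs) = dconv g (dconvs gs)"

lemma divisor_count_pos: "n > 0 ==> divisor_count n >= 1"
 unfolding divisor_count_def using finite_divisors_nat[of n]
 by (metis One_nat_def Suc_leI card_gt_0_iff dvd_refl empty_iff mem_Collect_eq)

lemma divisor_count_mono: "d dvd n ==> n > 0 ==> divisor_count d <= divisor_count n"
 unfolding divisor_count_def by (intro card_mono finite_divisors_nat) (auto intro: dvd_trans)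

lemma norm_dconvs_le:
 assumes "\<And>g n. g \<in> set gs ==> norm (g n) <= 1" "n > 0"
 shows "norm (dconvs gs n) <= real (divisor_count n) ^ length gs"
 using assms
proof (induction gs arbitrary: n)
 case Nil
 then show ?case by (simp add: dunit_def)
next
 case (Cons g gs)
 have "norm (dconvs (g # gs) n) <= (\<Sum>d | d dvd n. real (divisor_count n) ^ length gs)"
  unfolding dconvs.simps dconv_def
 proof (rule sum_norm_le)
  fix d assume "d \<in> {d. d dvd n}"
  then have d: "d dvd n" by simp
  then have m: "n div d > 0" "n div d dvd n" using Cons.prems(2) by (auto elim!: dvdE)
  have "norm (g d * dconvs gs (n div d)) <= 1 * real (divisor_count (n div d)) ^ length gs"
   unfolding norm_mult using Cons m by (intro mult_mono) auto
  also have "... <= real (divisor_count n) ^ length gs"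
   using divisor_count_mono[OF m(2) Cons.prems(2)] by (simp add: power_mono)
  finally show "norm (g d * dconvs gs (n div d)) <= real (divisor_count n) ^ length gs" .
 qed
 also have "... = real (divisor_count n) ^ length (g # gs)" by (simp add: divisor_count_def)
 finally show ?case .
qed

lemma dconvs_powr_bound:
 assumes "e > 0"
 obtains B :: real where "B >= 1" "\<And>gs n. length gs <= k ==> (\<And>g n. g \<in> set gs ==> norm (g n) <= 1) ==>
   n > 0 ==> norm (dconvs gs n) <= B * real n powr e"
proof -
 obtain C where C: "C >= 1" "\<And>n. n > 0 ==> real (divisor_count n) <= C * real n powr (e / (k + 1))"
  using divisor_bound[of "e / (k + 1)"] assms by auto
 show ?thesis
 proof (rule that[of "C ^ k"])
  show "C ^ k >= 1" using C by simp
  fix gs :: "(nat => complex) list" and n :: nat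
  assume gs: "length gs <= k" "\<And>g n. g \<in> set gs ==> norm (g n) <= 1" and n: "n > 0"
  have "norm (dconvs gs n) <= real (divisor_count n) ^ length gs" using norm_dconvs_le gs(2) n by blast
  also have "... <= real (divisor_count n) ^ k" using divisor_count_pos[OF n] gs(1) by (intro power_increasing) auto
  also have "... <= (C * real n powr (e / (k + 1))) ^ k" using C(2)[OF n] by (intro power_mono) auto
  also have "... = C ^ k * real n powr (e / (k + 1) * k)" using n by (simp add: power_mult_distrib powr_realpow[symmetric] powr_powr)
  also have "... <= C ^ k * real n powr e"
   using n C assms by (intro mult_left_mono powr_mono) (auto simp: field_simps)
  finally show "norm (dconvs gs n) <= C ^ k * real n powr e" .
 qed
qed

text \<open>A power saving in partial sums from the threshold \<open>Z\<close> on. The threshold is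
  kept apart from the constant because its exponent is the quantity that adds up under convolution
  and becomes the exponent of the theorem.\<close>

definition osc :: "real => real => real => (nat => complex) => bool" where
 "osc C \<delta> Z g \<longleftrightarrow> (\<forall>N. real N >= Z --> norm (\<Sum>n=1..N. g n) <= C * real N powr (1 - \<delta>))"

lemma osc_mono:
 assumes "osc C \<delta> Z g" "C <= C'" "0 <= C" "\<delta>' <= \<delta>" "Z <= Z'" "1 <= Z'"
 shows "osc C' \<delta>' Z' g"
 unfolding osc_def
proof (intro allI impI)
 fix N assume N: "real N >= Z'"
 then have "norm (\<Sum>n=1..N. g n) <= C * real N powr (1 - \<delta>)" using assms by (auto simp: osc_def)
 also have "... <= C' * real N powr (1 - \<delta>')" using assms N by (intro mult_mono powr_mono) auto
 finally show "norm (\<Sum>n=1..N. g n) <= C' * real N powr (1 - \<delta>')" .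
qed

text \<open>With the cut at \<open>N powr \<alpha>\<close>, the partial sums of \<open>g\<close> are
  needed only beyond \<open>q powr a1\<close> and those of \<open>h\<close> only beyond
  \<open>q powr a2\<close>. The slack \<gamma> absorbs the factors 2 lost by rounding, which is the
  purpose of \<open>4 <= q powr \<gamma>\<close>.\<close>

lemma osc_dconv:
 fixes g h :: "nat => complex"
 assumes g: "osc C \<delta> (q powr a1) g" "\<And>n. n > 0 ==> norm (g n) <= B * real n powr e"
  and h: "osc C \<delta> (q powr a2) h" "\<And>n. n > 0 ==> norm (h n) <= B * real n powr e"
  and \<delta>: "0 < \<delta>" "\<delta> + e <= 1" and e: "0 <= e" and C: "C >= 0" "B >= 0"
  and a: "a1 > 0" "a2 > 0" "\<gamma> > 0" and q: "q >= 1" "4 <= q powr \<gamma>"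
  and \<alpha>: "\<alpha> = (a1 + \<gamma> / 2) / (a1 + a2 + \<gamma>)" and \<delta>': "\<delta>' <= \<alpha> * \<delta> - e" "\<delta>' <= (1 - \<alpha>) * \<delta> - e"
 shows "osc (5 * C * B / \<delta>) \<delta>' (q powr (a1 + a2 + \<gamma>)) (dconv g h)"
 unfolding osc_def
proof (intro allI impI)
 fix N assume N: "q powr (a1 + a2 + \<gamma>) <= real N"
 define G where "G = (\<lambda>N. \<Sum>n=1..N. g n)"
 define H where "H = (\<lambda>N. \<Sum>n=1..N. h n)"
 define X where "X = real N"
 have "1 <= q powr (a1 + a2 + \<gamma>)" using q a by (intro ge_one_powr_ge_zero) auto
 then have X1: "X >= 1" using N by (simp add: X_def)
 have \<alpha>01: "0 < \<alpha>" "\<alpha> < 1" and \<alpha>': "1 - \<alpha> = (a2 + \<gamma> / 2) / (a1 + a2 + \<gamma>)" using a by (auto simp: \<alpha> field_simps)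
 have q2: "2 <= q powr (\<gamma> / 2)"
 proof -
  have "2 = sqrt 4" by (simp add: real_sqrt_unique)
  also have "... <= sqrt (q powr \<gamma>)" using q by (intro real_sqrt_le_mono)
  also have "... = q powr (\<gamma> / 2)" using q by (simp add: powr_half_sqrt[symmetric] powr_powr)
  finally show ?thesis .
 qed
 have big: "2 * q powr a <= X powr ((a + \<gamma> / 2) / (a1 + a2 + \<gamma>))" if "a > 0" for a
 proof -
  have "2 * q powr a <= q powr (\<gamma> / 2) * q powr a" using q2 by (intro mult_right_mono) auto
  also have "... = (q powr (a1 + a2 + \<gamma>)) powr ((a + \<gamma> / 2) / (a1 + a2 + \<gamma>))"
   unfolding powr_powr using assms(9-11) a by (simp add: powr_add[symmetric] add.commute)
  also have "... <= X powr ((a + \<gamma> / 2) / (a1 + a2 + \<gamma>))" using N a that by (intro powr_mono2) (auto simp: X_def)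
  finally show ?thesis .
 qed
 have XA: "2 * q powr a1 <= X powr \<alpha>" and XB: "2 * q powr a2 <= X powr (1 - \<alpha>)"
  using big[of a1] big[of a2] a by (simp_all add: \<alpha> \<alpha>'[unfolded \<alpha>])
 have qa: "1 <= q powr a1" "1 <= q powr a2" using q a by (auto intro!: ge_one_powr_ge_zero)
 \<comment> \<open>At the smallest admissible \<open>N\<close> this is about
   \<open>q powr (a1 + \<gamma> / 2)\<close>, and the complementary length \<open>N / U\<close> is
   about \<open>q powr (a2 + \<gamma> / 2)\<close>.\<close>
 define U where "U = nat \<lfloor>X powr \<alpha>\<rfloor>"
 have U: "real U <= X powr \<alpha>" "X powr \<alpha> <= 2 * real U" "1 <= U"
 proof -
  have ge: "X powr \<alpha> >= 2" using XA qa by linarith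
  then show "real U <= X powr \<alpha>" by (simp add: U_def)
  show U1: "1 <= U" using ge by (simp add: U_def le_nat_iff le_floor_iff)
  have "X powr \<alpha> < real U + 1" using ge unfolding U_def by linarith
  then show "X powr \<alpha> <= 2 * real U" using U1 by simp
 qed
 have U0: "real U > 0" using U by simp
 have divle: "real (N div b) <= X / b" for b using of_nat_div_le_of_nat[of N b, where 'a = real] by (simp add: X_def)
 have s: "0 < e + \<delta>" "e + \<delta> <= 1" using \<delta> e by auto
 let ?a = "(\<Sum>a=1..U. g a * H (N div a))"
 let ?b = "(\<Sum>b=1..N div Suc U. h b * (G (N div b) - G U))"
 have tm: "(X / b) powr (1 - \<delta>) * (B * real b powr e) = B * X powr (1 - \<delta>) * real b powr (e + \<delta> - 1)" if "b > 0" for b :: nat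
  using that X1 by (simp add: powr_divide powr_add[symmetric] powr_diff powr_minus field_simps)
 have sumB: "(\<Sum>b=1..V. (X / b) powr (1 - \<delta>) * (B * real b powr e)) <= B / \<delta> * X powr (1 - \<delta>) * real V powr (e + \<delta>)" for V
 proof -
  have "(\<Sum>b=1..V. (X / b) powr (1 - \<delta>) * (B * real b powr e)) = B * X powr (1 - \<delta>) * (\<Sum>b=1..V. real b powr (e + \<delta> - 1))"
   unfolding sum_distrib_left by (intro sum.cong refl tm) auto
  also have "... <= B * X powr (1 - \<delta>) * (real V powr (e + \<delta>) / (e + \<delta>))"
   using sum_powr_le[OF s, of V] C by (intro mult_left_mono) auto
  also have "... <= B * X powr (1 - \<delta>) * (real V powr (e + \<delta>) / \<delta>)"
   using \<delta> e C by (intro mult_left_mono divide_left_mono) auto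
  finally show ?thesis by (simp add: mult_ac)
 qed
 have first: "norm ?a <= C * B / \<delta> * X powr (1 - \<delta>) * real U powr (e + \<delta>)"
 proof -
  have "norm ?a <= (\<Sum>a=1..U. C * ((X / a) powr (1 - \<delta>) * (B * real a powr e)))"
  proof (rule sum_norm_le)
   fix a assume a': "a \<in> {1..U}"
   have "q powr a2 <= real (N div a)"
   proof -
    have "X powr (1 - \<alpha>) * X powr \<alpha> = X" using X1 by (simp add: powr_add[symmetric])
    then have "X powr (1 - \<alpha>) * real U <= X" using U(1) by (metis mult_left_mono powr_ge_zero)
    moreover have "X powr (1 - \<alpha>) * real a <= X powr (1 - \<alpha>) * real U" using a' by (intro mult_left_mono) auto
    ultimately have "X powr (1 - \<alpha>) <= X / a" using a' by (simp add: pos_le_divide_eq)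
    moreover have "X / a < real (N div a) + 1"
     using floor_divide_of_nat_eq[of N a, where 'a = real] unfolding X_def by linarith
    ultimately show ?thesis using XB qa by linarith
   qed
   then have "norm (H (N div a)) <= C * real (N div a) powr (1 - \<delta>)" using h(1) by (simp add: osc_def H_def)
   also have "... <= C * (X / a) powr (1 - \<delta>)" using divle C \<delta> e by (intro mult_left_mono powr_mono2) auto
   finally have "norm (H (N div a)) <= C * (X / a) powr (1 - \<delta>)" .
   moreover have "norm (g a) <= B * real a powr e" using g(2) a' by simp
   ultimately have "norm (g a * H (N div a)) <= (B * real a powr e) * (C * (X / a) powr (1 - \<delta>))"
    unfolding norm_mult using C by (intro mult_mono) auto
   then show "norm (g a * H (N div a)) <= C * ((X / a) powr (1 - \<delta>) * (B * real a powr e))" by (simp add: mult_ac)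
  qed
  also have "... = C * (\<Sum>a=1..U. (X / a) powr (1 - \<delta>) * (B * real a powr e))" by (simp add: sum_distrib_left)
  also have "... <= C * (B / \<delta> * X powr (1 - \<delta>) * real U powr (e + \<delta>))" using sumB C by (intro mult_left_mono) auto
  finally show ?thesis by (simp add: mult_ac)
 qed
 have second: "norm ?b <= 2 * C * B / \<delta> * X powr (1 - \<delta>) * (X / U) powr (e + \<delta>)"
 proof -
  have "norm ?b <= (\<Sum>b=1..N div Suc U. 2 * C * ((X / b) powr (1 - \<delta>) * (B * real b powr e)))"
  proof (rule sum_norm_le)
   fix b assume b: "b \<in> {1..N div Suc U}"
   then have "Suc U <= N div b" by (rule le_div_of_le_div_Suc)
   then have Ub: "real U <= real (N div b)" by simp
   have qU: "q powr a1 <= real U" using XA U by linarith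
   have "norm (G (N div b)) <= C * real (N div b) powr (1 - \<delta>)" using g(1) Ub qU by (simp add: osc_def G_def)
   also have "... <= C * (X / b) powr (1 - \<delta>)" using divle C \<delta> e by (intro mult_left_mono powr_mono2) auto
   finally have 1: "norm (G (N div b)) <= C * (X / b) powr (1 - \<delta>)" .
   have "norm (G U) <= C * real U powr (1 - \<delta>)" using g(1) qU by (simp add: osc_def G_def)
   also have "... <= C * (X / b) powr (1 - \<delta>)"
    using order_trans[OF Ub divle] C \<delta> e by (intro mult_left_mono powr_mono2) auto
   finally have "norm (G (N div b) - G U) <= 2 * C * (X / b) powr (1 - \<delta>)"
    using 1 norm_triangle_ineq4[of "G (N div b)" "G U"] by linarith
   moreover have "norm (h b) <= B * real b powr e" using h(2) b by simp
   ultimately have "norm (h b * (G (N div b) - G U)) <= (B * real b powr e) * (2 * C * (X / b) powr (1 - \<delta>))"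
    unfolding norm_mult using C by (intro mult_mono) auto
   then show "norm (h b * (G (N div b) - G U)) <= 2 * C * ((X / b) powr (1 - \<delta>) * (B * real b powr e))" by (simp add: mult_ac)
  qed
  also have "... = 2 * C * (\<Sum>b=1..N div Suc U. (X / b) powr (1 - \<delta>) * (B * real b powr e))" by (simp add: sum_distrib_left)
  also have "... <= 2 * C * (B / \<delta> * X powr (1 - \<delta>) * real (N div Suc U) powr (e + \<delta>))" using sumB C by (intro mult_left_mono) auto
  also have "... <= 2 * C * (B / \<delta> * X powr (1 - \<delta>) * (X / U) powr (e + \<delta>))"
  proof (intro mult_left_mono powr_mono2)
   show "real (N div Suc U) <= X / U"
   proof -
    have "X / Suc U <= X / U" using X1 U0 by (intro divide_left_mono) auto
    then show ?thesis using divle[of "Suc U"] by linarith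
   qed
  qed (use C \<delta> e in auto)
  finally show ?thesis by (simp add: mult_ac)
 qed
 have p1: "X powr (1 - \<delta>) * real U powr (e + \<delta>) <= X powr (1 - \<delta>')"
 proof -
  have "X powr (1 - \<delta>) * real U powr (e + \<delta>) <= X powr (1 - \<delta>) * (X powr \<alpha>) powr (e + \<delta>)"
   using U \<delta> e by (intro mult_left_mono powr_mono2) auto
  also have "... = X powr (1 - \<delta> + \<alpha> * (e + \<delta>))"
   unfolding powr_powr by (rule powr_add[symmetric])
  also have "... <= X powr (1 - \<delta>')"
  proof (intro powr_mono)
   have "\<alpha> * e <= 1 * e" using \<alpha>01 e by (intro mult_right_mono) auto
   then show "1 - \<delta> + \<alpha> * (e + \<delta>) <= 1 - \<delta>'" using \<delta>' by (simp add: algebra_simps)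
  qed (use X1 in auto)
  finally show ?thesis .
 qed
 have p2: "X powr (1 - \<delta>) * (X / U) powr (e + \<delta>) <= 2 * X powr (1 - \<delta>')"
 proof -
  have "X / U <= X / (X powr \<alpha> / 2)" using U X1 U0 by (intro divide_left_mono) auto
  also have "... = 2 * X powr (1 - \<alpha>)" using X1 by (simp add: powr_diff)
  finally have "(X / U) powr (e + \<delta>) <= (2 * X powr (1 - \<alpha>)) powr (e + \<delta>)" using s X1 by (intro powr_mono2) auto
  also have "... = 2 powr (e + \<delta>) * X powr ((1 - \<alpha>) * (e + \<delta>))" by (simp add: powr_mult powr_powr)
  also have "... <= 2 powr 1 * X powr ((1 - \<alpha>) * (e + \<delta>))" using s by (intro mult_right_mono powr_mono) auto
  finally have "X powr (1 - \<delta>) * (X / U) powr (e + \<delta>) <= X powr (1 - \<delta>) * (2 * X powr ((1 - \<alpha>) * (e + \<delta>)))"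
   by (intro mult_left_mono) auto
  also have "... = 2 * X powr (1 - \<delta> + (1 - \<alpha>) * (e + \<delta>))" by (simp add: powr_add)
  also have "... <= 2 * X powr (1 - \<delta>')"
  proof (intro mult_left_mono powr_mono)
   have "(1 - \<alpha>) * e <= 1 * e" using \<alpha>01 e by (intro mult_right_mono) auto
   then show "1 - \<delta> + (1 - \<alpha>) * (e + \<delta>) <= 1 - \<delta>'" using \<delta>' by (simp add: algebra_simps)
  qed (use X1 in auto)
  finally show ?thesis .
 qed
 have "norm (\<Sum>n=1..N. dconv g h n) <= norm ?a + norm ?b"
  unfolding hyperbola[of g h N U] G_def H_def by (rule norm_triangle_ineq)
 also have "... <= C * B / \<delta> * (X powr (1 - \<delta>) * real U powr (e + \<delta>)) + 2 * C * B / \<delta> * (X powr (1 - \<delta>) * (X / U) powr (e + \<delta>))"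
  using first second by (simp add: mult.assoc)
 also have "... <= C * B / \<delta> * X powr (1 - \<delta>') + 2 * C * B / \<delta> * (2 * X powr (1 - \<delta>'))"
  using p1 p2 C \<delta> by (intro add_mono mult_left_mono) auto
 also have "... = 5 * C * B / \<delta> * X powr (1 - \<delta>')" by (simp add: algebra_simps add_divide_distrib[symmetric])
 finally show "norm (\<Sum>n=1..N. dconv g h n) <= 5 * C * B / \<delta> * real N powr (1 - \<delta>')" by (simp add: X_def)
qed

text \<open>Each further factor adds \<theta>\<open>+\<close>\<gamma> to the exponent of the
  threshold. The quantifiers matter: saving and constant depend on the number of factors and on the
  given parameters, but neither on \<open>q\<close> nor on the functions.\<close>

lemma osc_dconvs:
 fixes \<delta> C \<theta> \<gamma> :: real
 assumes "\<delta> > 0" "\<delta> <= 1 / 2" "C >= 1" "\<theta> > 0" "\<gamma> > 0"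
 shows "\<exists>\<delta>' C'. 0 < \<delta>' \<and> \<delta>' <= 1 / 2 \<and> C' >= 1 \<and> (\<forall>q gs. q >= 1 --> 4 <= q powr \<gamma> --> length gs = Suc k -->
   (\<forall>g\<in>set gs. osc C \<delta> (q powr \<theta>) g \<and> (\<forall>n. norm (g n) <= 1)) -->
   osc C' \<delta>' (q powr (Suc k * (\<theta> + \<gamma>))) (dconvs gs))"
proof (induction k)
 case 0
 show ?case
 proof (rule exI[of _ \<delta>], rule exI[of _ C], intro conjI allI impI)
  fix q :: real and gs :: "(nat => complex) list"
  assume q: "q >= 1" and gs: "length gs = Suc 0" "\<forall>g\<in>set gs. osc C \<delta> (q powr \<theta>) g \<and> (\<forall>n. norm (g n) <= 1)"
  then obtain g where g: "gs = [g]" by (auto simp: length_Suc_conv)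
  have "(\<Sum>n=1..N. dconvs gs n) = (\<Sum>n=1..N. g n)" for N
   unfolding g by (intro sum.cong refl) (simp add: dconv_dunit)
  moreover have "osc C \<delta> (q powr (Suc 0 * (\<theta> + \<gamma>))) g"
   by (rule osc_mono[of C \<delta> "q powr \<theta>" g])
     (use gs g assms q in \<open>auto intro!: powr_mono ge_one_powr_ge_zero\<close>)
  ultimately show "osc C \<delta> (q powr (Suc 0 * (\<theta> + \<gamma>))) (dconvs gs)" by (simp add: osc_def)
 qed (use assms in auto)
next
 case (Suc k)
 then obtain \<delta>1 C1 where IH': "0 < \<delta>1 \<and> \<delta>1 <= 1 / 2 \<and> C1 >= 1 \<and> (\<forall>q gs. q >= 1 --> 4 <= q powr \<gamma> --> length gs = Suc k -->
   (\<forall>g\<in>set gs. osc C \<delta> (q powr \<theta>) g \<and> (\<forall>n. norm (g n) <= 1)) -->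
   osc C1 \<delta>1 (q powr (Suc k * (\<theta> + \<gamma>))) (dconvs gs))" by (elim exE)
 note IH = IH'[THEN conjunct1] IH'[THEN conjunct2, THEN conjunct1] IH'[THEN conjunct2, THEN conjunct2, THEN conjunct1]
  IH'[THEN conjunct2, THEN conjunct2, THEN conjunct2]
 define \<delta>0 where "\<delta>0 = min \<delta> \<delta>1"
 define C0 where "C0 = max C C1"
 define a2 where "a2 = Suc k * (\<theta> + \<gamma>)"
 define \<alpha> where "\<alpha> = (\<theta> + \<gamma> / 2) / (\<theta> + a2 + \<gamma>)"
 have a2: "a2 > 0" using assms by (simp add: a2_def)
 have \<alpha>: "0 < \<alpha>" "\<alpha> < 1" using a2 assms by (auto simp: \<alpha>_def field_simps)
 \<comment> \<open>Coefficients of size \<open>n powr e\<close> may eat half of the saving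
   \<open>min \<alpha> (1 - \<alpha>) * \<delta>0\<close> left by the hyperbola method; the other
   half, again \<open>e\<close>, is the new saving.\<close>
 define e where "e = min \<alpha> (1 - \<alpha>) * \<delta>0 / 2"
 have \<delta>0: "0 < \<delta>0" "\<delta>0 <= 1 / 2" "\<delta>0 <= \<delta>" "\<delta>0 <= \<delta>1" using assms IH by (auto simp: \<delta>0_def)
 have mn: "0 < min \<alpha> (1 - \<alpha>)" "min \<alpha> (1 - \<alpha>) <= 1" "min \<alpha> (1 - \<alpha>) <= \<alpha>" "min \<alpha> (1 - \<alpha>) <= 1 - \<alpha>" using \<alpha> by auto
 have e0: "e > 0" using mn \<delta>0 by (simp add: e_def)
 have e2: "e <= \<delta>0 / 2" unfolding e_def using mn \<delta>0 by (simp add: mult_left_le_one_le)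
 obtain B where B: "B >= 1" "\<And>gs n. length gs <= Suc k ==> (\<And>g n. g \<in> set gs ==> norm (g n) <= 1) ==>
   n > 0 ==> norm (dconvs gs n) <= B * real n powr e"
  using dconvs_powr_bound[OF e0, of "Suc k"] by auto
 have C0: "C0 >= 1" "C <= C0" "C1 <= C0" using assms IH by (auto simp: C0_def)
 show ?case
 proof (rule exI[of _ e], rule exI[of _ "5 * C0 * B / \<delta>0"], intro conjI allI impI)
  show "0 < e" "e <= 1 / 2" using e0 e2 \<delta>0 by auto
  have "1 * 1 <= C0 * B" using C0 B by (intro mult_mono) auto
  then show "1 <= 5 * C0 * B / \<delta>0" using \<delta>0 by (simp add: pos_le_divide_eq)
  fix q :: real and gs :: "(nat => complex) list"
  assume q: "q >= 1" "4 <= q powr \<gamma>" and gs: "length gs = Suc (Suc k)" "\<forall>g\<in>set gs. osc C \<delta> (q powr \<theta>) g \<and> (\<forall>n. norm (g n) <= 1)"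
  then obtain g hs where g: "gs = g # hs" "length hs = Suc k" by (auto simp: length_Suc_conv)
  have o1: "osc C0 \<delta>0 (q powr \<theta>) g"
   by (rule osc_mono[of C \<delta> "q powr \<theta>" g])
     (use gs g assms q C0 \<delta>0 in \<open>auto intro!: ge_one_powr_ge_zero\<close>)
  have "osc C1 \<delta>1 (q powr a2) (dconvs hs)" unfolding a2_def using IH(4) q g gs by auto
  then have o2: "osc C0 \<delta>0 (q powr a2) (dconvs hs)"
   by (rule osc_mono[of C1 \<delta>1 "q powr a2" "dconvs hs"])
     (use IH(3) q C0 \<delta>0 a2 in \<open>auto intro!: ge_one_powr_ge_zero\<close>)
  have "osc (5 * C0 * B / \<delta>0) e (q powr (\<theta> + a2 + \<gamma>)) (dconv g (dconvs hs))"
  proof (rule osc_dconv[OF o1 _ o2 _ \<delta>0(1) _ _ _ _ _ a2 _ q \<alpha>_def])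
   show "norm (g n) <= B * real n powr e" if "n > 0" for n
   proof -
    have "1 * 1 <= B * real n powr e" using B e0 that by (intro mult_mono ge_one_powr_ge_zero) auto
    then show ?thesis using gs g by (metis list.set_intros(1) mult_1 order_trans)
   qed
   show "norm (dconvs hs n) <= B * real n powr e" if "n > 0" for n using B(2)[of hs n] that g gs by auto
   have "min \<alpha> (1 - \<alpha>) * \<delta>0 = 2 * e" by (simp add: e_def)
   moreover have "min \<alpha> (1 - \<alpha>) * \<delta>0 <= \<alpha> * \<delta>0" "min \<alpha> (1 - \<alpha>) * \<delta>0 <= (1 - \<alpha>) * \<delta>0"
    using mn \<delta>0 by (auto intro!: mult_right_mono)
   ultimately show "e <= \<alpha> * \<delta>0 - e" "e <= (1 - \<alpha>) * \<delta>0 - e" by linarith+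
  qed (use e0 e2 \<delta>0 C0 B assms in auto)
  moreover have "\<theta> + a2 + \<gamma> = Suc (Suc k) * (\<theta> + \<gamma>)" by (simp add: a2_def algebra_simps)
  ultimately show "osc (5 * C0 * B / \<delta>0) e (q powr (Suc (Suc k) * (\<theta> + \<gamma>))) (dconvs gs)" by (simp add: g)
 qed
qed

section \<open>Values of Dirichlet series\<close>

lemma powr_neg_diff:
 fixes s x :: real
 assumes "s > 0" "x > 0"
 shows "x powr (- s) - (x + 1) powr (- s) <= s * x powr (- s - 1)"
  "s * (x + 1) powr (- s - 1) <= x powr (- s) - (x + 1) powr (- s)"
proof -
 have "\<exists>z. z > x \<and> z < x + 1 \<and> (x + 1) powr (- s) - x powr (- s) = (x + 1 - x) * (- s * z powr (- s - 1))"
 proof (rule MVT2)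
  fix y assume "x <= y" "y <= x + 1"
  then show "((\<lambda>x. x powr (- s)) has_real_derivative - s * y powr (- s - 1)) (at y)"
   using assms by (intro has_real_derivative_powr) auto
 qed simp
 then obtain z where z: "z > x" "z < x + 1" "x powr (- s) - (x + 1) powr (- s) = s * z powr (- s - 1)" by auto
 have "z powr (- s - 1) <= x powr (- s - 1)" "(x + 1) powr (- s - 1) <= z powr (- s - 1)"
  using z assms by (auto intro!: powr_mono2')
 then show "x powr (- s) - (x + 1) powr (- s) <= s * x powr (- s - 1)"
  "s * (x + 1) powr (- s - 1) <= x powr (- s) - (x + 1) powr (- s)"
  using z(3) assms by (auto intro: mult_left_mono)
qed

lemma sum_neg_powr_tail:
 assumes "t > 0" "N >= 1" "N <= M"
 shows "(\<Sum>n=Suc N..M. real n powr (- t - 1)) <= (real N powr (- t) - real M powr (- t)) / t"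
 using assms(3)
proof (induction M rule: dec_induct)
 case (step M)
 have "t * real (Suc M) powr (- t - 1) <= real M powr (- t) - real (Suc M) powr (- t)"
  using powr_neg_diff(2)[of t "real M"] assms step.hyps by (simp add: add.commute)
 then have "real (Suc M) powr (- t - 1) <= (real M powr (- t) - real (Suc M) powr (- t)) / t"
  using assms by (simp add: pos_le_divide_eq mult.commute)
 then show ?case using step.IH step.hyps by (simp add: diff_divide_distrib)
qed simp

text \<open>Terms of a Dirichlet series at a real argument. Keeping the weighted sequence as a
  function lets weighting commute with convolution, see \<open>wt_dconv\<close>.\<close>

definition wt :: "real => (nat => complex) => nat => complex" where
 "wt s g n = g n * of_real (real n powr (- s))"

abbreviation wsum :: "real => (nat => complex) => nat => complex" where
 "wsum s g N \<equiv> \<Sum>n=1..N. wt s g n"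

lemma wt_summation_by_parts:
 fixes g :: "nat => complex"
 defines "G \<equiv> \<lambda>n. \<Sum>k=1..n. g k"
 assumes "N <= M"
 shows "wsum s g M - (wsum s g N)
  = G M * of_real (real M powr (- s)) - G N * of_real (real N powr (- s))
   + (\<Sum>n=N..<M. G n * of_real (real n powr (- s) - real (Suc n) powr (- s)))"
 using assms(2)
proof (induction M rule: dec_induct)
 case (step M)
 have "(\<Sum>n=1..Suc M. wt s g n) = wsum s g M + wt s g (Suc M)" by simp
 moreover have "wt s g (Suc M) = (G (Suc M) - G M) * of_real (real (Suc M) powr (- s))" by (simp add: wt_def G_def)
 moreover have "(\<Sum>n=N..<Suc M. G n * of_real (real n powr (- s) - real (Suc n) powr (- s)))
   = (\<Sum>n=N..<M. G n * of_real (real n powr (- s) - real (Suc n) powr (- s)))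
    + G M * of_real (real M powr (- s) - real (Suc M) powr (- s))"
  using step.hyps by simp
 moreover have "a = b + w ==> w = (gs - gm) * x ==> s2 = s1 + gm * (y - x) ==> b - c = gm * y - gn * z + s1
   ==> a - c = gs * x - gn * z + s2" for a b c w gs gm gn x y z s1 s2 :: complex
 proof -
  assume "a = b + w" "w = (gs - gm) * x" "s2 = s1 + gm * (y - x)" and bc: "b - c = gm * y - gn * z + s1"
  then have e: "a - c = (b - c) + (gs - gm) * x" "s2 = s1 + gm * (y - x)" by simp_all
  show ?thesis unfolding e bc by (simp add: algebra_simps)
 qed
 ultimately show ?case using step.IH unfolding of_real_diff by blast
qed simp

text \<open>Partial summation. A saving of exponent \<delta> gives convergence for
  \<open>s > 1 - \<delta>\<close>, that is, also slightly to the left of 1, where Siegel's argument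
  takes place.\<close>

lemma wt_tail:
 assumes G: "\<And>n. n >= N ==> norm (\<Sum>k=1..n. g k) <= C * real n powr (1 - \<delta>)"
  and N: "N >= 1" "N <= M" and s: "s > 0" "s + \<delta> > 1" and C: "C >= 0"
 shows "norm (wsum s g M - wsum s g N)
  <= C * (2 + s + s / (s + \<delta> - 1)) * real N powr (- (s + \<delta> - 1))"
proof -
 define t where "t = s + \<delta> - 1"
 have t: "t > 0" using s by (simp add: t_def)
 define G' where "G' = (\<lambda>n. \<Sum>k=1..n. g k)"
 have bd: "norm (G' n * of_real (real n powr (- s))) <= C * real n powr (- t)" if "n >= N" for n
 proof -
  have "norm (G' n * of_real (real n powr (- s))) <= (C * real n powr (1 - \<delta>)) * real n powr (- s)"
   unfolding norm_mult norm_of_real using G[OF that] C by (intro mult_mono) (auto simp: G'_def)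
  also have "... = C * real n powr (- t)" by (simp add: t_def powr_add[symmetric] algebra_simps)
  finally show ?thesis .
 qed
 have bd2: "norm (G' n * of_real (real n powr (- s) - real (Suc n) powr (- s))) <= C * s * real n powr (- t - 1)" if "n >= N" for n
 proof -
  have n0: "real n > 0" using that N by simp
  have "norm (G' n * of_real (real n powr (- s) - real (Suc n) powr (- s))) <= (C * real n powr (1 - \<delta>)) * (s * real n powr (- s - 1))"
   unfolding norm_mult norm_of_real
  proof (intro mult_mono)
   have "real (Suc n) powr (- s) <= real n powr (- s)" using s n0 by (intro powr_mono2') auto
   then show "\<bar>real n powr (- s) - real (Suc n) powr (- s)\<bar> <= s * real n powr (- s - 1)"
    using powr_neg_diff(1)[OF s(1) n0] by (simp add: add.commute)
  qed (use G[OF that] C in \<open>auto simp: G'_def\<close>)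
  also have "... = C * s * (real n powr (1 - \<delta>) * real n powr (- s - 1))" by simp
  also have "real n powr (1 - \<delta>) * real n powr (- s - 1) = real n powr (- t - 1)"
   unfolding powr_add[symmetric] by (simp add: t_def algebra_simps)
  finally show ?thesis .
 qed
 have mono: "real n powr (- t) <= real N powr (- t)" if "n >= N" for n
  using that N t by (intro powr_mono2') auto
 have "norm (wsum s g M - wsum s g N)
   <= norm (G' M * of_real (real M powr (- s))) + norm (G' N * of_real (real N powr (- s)))
    + norm (\<Sum>n=N..<M. G' n * of_real (real n powr (- s) - real (Suc n) powr (- s)))"
  unfolding wt_summation_by_parts[OF N(2)] G'_def
  by (intro norm_triangle_le add_right_mono norm_triangle_ineq4)
 also have "norm (G' M * of_real (real M powr (- s))) <= C * real N powr (- t)"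
  by (rule order_trans[OF bd[OF N(2)] mult_left_mono[OF mono[OF N(2)] C]])
 also have "norm (G' N * of_real (real N powr (- s))) <= C * real N powr (- t)" using bd by simp
 also have "norm (\<Sum>n=N..<M. G' n * of_real (real n powr (- s) - real (Suc n) powr (- s)))
   <= (\<Sum>n=N..<M. C * s * real n powr (- t - 1))"
  by (intro sum_norm_le bd2) auto
 also have "... <= C * s * (real N powr (- t) + real N powr (- t) / t)"
 proof (cases "N = M")
  case True
  then show ?thesis using C s t by simp
 next
  case False
  have "(\<Sum>n=N..<M. real n powr (- t - 1)) = real N powr (- t - 1) + (\<Sum>n=Suc N..M - 1. real n powr (- t - 1))"
  proof -
   have "{Suc N..M - 1} = {Suc N..<M}" using False N by auto
   then show ?thesis using False N by (simp add: sum.atLeast_Suc_lessThan)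
  qed
  also have "real N powr (- t - 1) <= real N powr (- t)" using N by (intro powr_mono) auto
  also have "(\<Sum>n=Suc N..M - 1. real n powr (- t - 1)) <= (real N powr (- t) - real (M - 1) powr (- t)) / t"
   using False N t by (intro sum_neg_powr_tail) auto
  also have "... <= real N powr (- t) / t" using t by (intro divide_right_mono) auto
  finally have "(\<Sum>n=N..<M. real n powr (- t - 1)) <= real N powr (- t) + real N powr (- t) / t" by simp
  then show ?thesis using C s by (simp add: sum_distrib_left[symmetric] mult_left_mono)
 qed
 finally have "norm (wsum s g M - wsum s g N) <= C * (2 + s + s / t) * real N powr (- t)"
  by (simp add: algebra_simps)
 then show ?thesis by (simp only: t_def)
qed

lemma limit_of_tail:
 fixes T :: "nat => complex"
 assumes tl: "\<And>N M. N >= N0 ==> M >= N ==> norm (T M - T N) <= b N" and b: "b \<longlonglongrightarrow> 0"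
 shows "T \<longlonglongrightarrow> lim T" "\<And>N. N >= N0 ==> norm (T N - lim T) <= b N"
proof -
 have "Cauchy T"
 proof (rule metric_CauchyI)
  fix e :: real assume "e > 0"
  then have "eventually (\<lambda>n. b n < e / 2) sequentially" by (intro order_tendstoD(2)[OF b]) simp
  then obtain N1 where N1: "\<And>n. n >= N1 ==> b n < e / 2" by (auto simp: eventually_sequentially)
  define N where "N = max N0 N1"
  have "dist (T m) (T n) < e" if "m >= N" "n >= N" for m n
  proof -
   have "norm (T m - T N) <= b N" "norm (T n - T N) <= b N" using that by (auto intro!: tl simp: N_def)
   moreover have "b N < e / 2" using N1 by (simp add: N_def)
   moreover have "dist (T m) (T n) <= norm (T m - T N) + norm (T n - T N)"
    using norm_triangle_ineq4[of "T m - T N" "T n - T N"] by (simp add: dist_norm)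
   ultimately show ?thesis by linarith
  qed
  then show "\<exists>M. \<forall>m\<ge>M. \<forall>n\<ge>M. dist (T m) (T n) < e" by blast
 qed
 then have "convergent T" by (rule Cauchy_convergent)
 then show lim: "T \<longlonglongrightarrow> lim T" by (simp add: convergent_LIMSEQ_iff)
 fix N assume N: "N >= N0"
 have "(\<lambda>M. norm (T M - T N)) \<longlonglongrightarrow> norm (lim T - T N)" using lim by (intro tendsto_intros)
 moreover have "eventually (\<lambda>M. norm (T M - T N) <= b N) sequentially"
  using tl[OF N] by (auto simp: eventually_sequentially)
 ultimately have "norm (lim T - T N) <= b N" by (intro tendsto_upperbound) auto
 then show "norm (T N - lim T) <= b N" by (simp add: norm_minus_commute)
qed

lemma powr_neg_tendsto_0: "t > 0 ==> (\<lambda>n. c * real n powr (- t)) \<longlonglongrightarrow> 0"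
 by (intro tendsto_mult_right_zero tendsto_neg_powr filterlim_real_sequentially) auto

definition Lval :: "(nat => complex) => real => complex" where
 "Lval g s = lim (\<lambda>N. \<Sum>n=1..N. wt s g n)"

lemma Lval_osc:
 assumes G: "\<And>n. n >= N0 ==> norm (\<Sum>k=1..n. g k) <= C * real n powr (1 - \<delta>)"
  and N0: "N0 >= 1" and s: "s > 0" "s + \<delta> > 1" and C: "C >= 0"
 shows "(\<lambda>N. \<Sum>n=1..N. wt s g n) \<longlonglongrightarrow> Lval g s"
  "\<And>N. N >= N0 ==> norm (wsum s g N - Lval g s) <= C * (2 + s + s / (s + \<delta> - 1)) * real N powr (- (s + \<delta> - 1))"
proof -
 have tl: "norm (wsum s g M - wsum s g N) <= C * (2 + s + s / (s + \<delta> - 1)) * real N powr (- (s + \<delta> - 1))"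
  if "N0 <= N" "N <= M" for M N using that N0 G by (intro wt_tail s C) auto
 have "(\<lambda>N. C * (2 + s + s / (s + \<delta> - 1)) * real N powr (- (s + \<delta> - 1))) \<longlonglongrightarrow> 0"
  using s by (intro powr_neg_tendsto_0) auto
 from limit_of_tail[of N0 "\<lambda>N. \<Sum>n=1..N. wt s g n", OF tl this]
 show "(\<lambda>N. \<Sum>n=1..N. wt s g n) \<longlonglongrightarrow> Lval g s"
  "\<And>N. N >= N0 ==> norm (wsum s g N - Lval g s) <= C * (2 + s + s / (s + \<delta> - 1)) * real N powr (- (s + \<delta> - 1))"
  unfolding Lval_def by blast+
qed

lemma Lval_bounded:
 assumes G: "\<And>n. norm (\<Sum>k=1..n. g k) <= K" and s: "s > 0" and N: "N >= 1"
 shows "(\<lambda>N. \<Sum>n=1..N. wt s g n) \<longlonglongrightarrow> Lval g s"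
  "norm (wsum s g N - Lval g s) <= K * (3 + s) * real N powr (- s)"
proof -
 have K: "K >= 0" using G[of 0] by simp
 have "norm (\<Sum>k=1..n. g k) <= K * real n powr (1 - 1)" if "n >= 1" for n using G[of n] that by simp
 from Lval_osc[OF this, of 1 s] s K N
 show "(\<lambda>N. \<Sum>n=1..N. wt s g n) \<longlonglongrightarrow> Lval g s"
  "norm (wsum s g N - Lval g s) <= K * (3 + s) * real N powr (- s)"
  by (auto simp: add.commute)
qed

text \<open>Convergence at a power rate. The rate makes the property survive Dirichlet convolution
  of series that converge only conditionally.\<close>

definition dtail :: "real => (nat => complex) => complex => bool" where
 "dtail t g G \<longleftrightarrow> (\<exists>C. \<forall>N\<ge>1. norm ((\<Sum>n=1..N. g n) - G) <= C * real N powr (- t))"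

lemma dtail_tendsto:
 assumes "dtail t g G" "t > 0"
 shows "(\<lambda>N. \<Sum>n=1..N. g n) \<longlonglongrightarrow> G"
proof -
 obtain C where C: "\<And>N. N >= 1 ==> norm ((\<Sum>n=1..N. g n) - G) <= C * real N powr (- t)"
  using assms(1) by (auto simp: dtail_def)
 have "(\<lambda>N. (\<Sum>n=1..N. g n) - G) \<longlonglongrightarrow> 0"
  by (rule Lim_null_comparison[OF _ powr_neg_tendsto_0[OF assms(2), of C]])
    (use C in \<open>auto simp: eventually_sequentially intro!: exI[of _ 1]\<close>)
 then show ?thesis by (rule LIM_zero_cancel)
qed

lemma dtail_weaken:
 assumes "dtail t g G" "t' <= t"
 shows "dtail t' g G"
proof -
 obtain C where C: "\<And>N. N >= 1 ==> norm ((\<Sum>n=1..N. g n) - G) <= C * real N powr (- t)"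
  using assms(1) by (auto simp: dtail_def)
 have "norm ((\<Sum>n=1..N. g n) - G) <= \<bar>C\<bar> * real N powr (- t')" if "N >= 1" for N
 proof -
  have "norm ((\<Sum>n=1..N. g n) - G) <= \<bar>C\<bar> * real N powr (- t)"
   using C[OF that] by (rule order_trans) (intro mult_right_mono abs_ge_self powr_ge_zero)
  also have "... <= \<bar>C\<bar> * real N powr (- t')" using that assms by (intro mult_left_mono powr_mono) auto
  finally show ?thesis .
 qed
 then show ?thesis by (auto simp: dtail_def)
qed

text \<open>The hyperbola is cut near \<open>sqrt N\<close>, so the tails of both factors are of
  size \<open>N powr (- (t / 2))\<close>, and the growth of the coefficients costs
  \<rho>\<open>/ 2\<close> in the exponent. The limit is the product of the two limits.\<close>

lemma dtail_dconv:
 fixes g h :: "nat => complex"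
 assumes g: "dtail t g G" "\<And>n. n > 0 ==> norm (g n) <= B * real n powr (\<rho> - 1)"
  and h: "dtail t h H" "\<And>n. n > 0 ==> norm (h n) <= B * real n powr (\<rho> - 1)"
  and t: "0 < t" "t <= 1 / 2" and \<rho>: "0 < \<rho>" "\<rho> <= 1 / 2" and B: "B >= 0"
 shows "dtail ((t - \<rho>) / 2) (dconv g h) (G * H)"
proof -
 obtain Cg where Cg: "\<And>N. N >= 1 ==> norm ((\<Sum>n=1..N. g n) - G) <= Cg * real N powr (- t)"
  using g(1) by (auto simp: dtail_def)
 obtain Ch where Ch: "\<And>N. N >= 1 ==> norm ((\<Sum>n=1..N. h n) - H) <= Ch * real N powr (- t)"
  using h(1) by (auto simp: dtail_def)
 define C where "C = max Cg Ch"
 have Cg': "norm ((\<Sum>n=1..N. g n) - G) <= C * real N powr (- t)"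
  and Ch': "norm ((\<Sum>n=1..N. h n) - H) <= C * real N powr (- t)" if "N >= 1" for N
  using Cg[OF that] Ch[OF that] mult_right_mono[of Cg C "real N powr (- t)"] mult_right_mono[of Ch C "real N powr (- t)"]
  by (auto simp: C_def)
 have C0: "C >= 0" using Cg'[of 1] norm_ge_zero[of "(\<Sum>n=1..1. g n) - G"] by (simp del: norm_ge_zero)
 define D where "D = 2 * C * B / (\<rho> + t) + 2 * C * B * 2 / \<rho> + norm H * C * 2"
 have "norm ((\<Sum>n=1..N. dconv g h n) - G * H) <= D * real N powr (- ((t - \<rho>) / 2))" if N: "N >= 1" for N
 proof -
  define X where "X = real N"
  have X1: "X >= 1" using N by (simp add: X_def)
  let ?X = "X powr (- ((t - \<rho>) / 2))"
  define U where "U = nat \<lfloor>sqrt X\<rfloor>"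
  have U: "real U <= sqrt X" "U >= 1" "sqrt X <= 2 * real U"
  proof -
   show "real U <= sqrt X" using X1 by (simp add: U_def)
   show "U >= 1" using X1 by (simp add: U_def le_nat_iff le_floor_iff)
   moreover have "sqrt X < real U + 1" using X1 unfolding U_def by linarith
   ultimately show "sqrt X <= 2 * real U" by simp
  qed
  have sq: "sqrt X = X powr (1 / 2)" using X1 by (simp add: powr_half_sqrt)
  have UX: "real U <= X"
  proof -
   have "sqrt X <= sqrt (X * X)" using X1 mult_left_mono[of 1 X X] by (intro real_sqrt_le_mono) auto
   then show ?thesis using U(1) X1 by simp
  qed
  define HH where "HH = (\<lambda>M. \<Sum>b=1..M. h b)"
  define GG where "GG = (\<lambda>M. \<Sum>a=1..M. g a)"
  let ?a = "(\<Sum>a=1..U. g a * (HH (N div a) - H))"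
  let ?b = "(\<Sum>b=1..N div Suc U. h b * (GG (N div b) - GG U))"
  have eq: "(\<Sum>n=1..N. dconv g h n) - G * H = ?a + H * (GG U - G)
    + ?b"
  proof -
   have "?a = (\<Sum>a=1..U. g a * HH (N div a)) - GG U * H"
    unfolding GG_def by (simp only: right_diff_distrib sum_subtractf sum_distrib_right)
   moreover have "(\<Sum>n=1..N. dconv g h n) = (\<Sum>a=1..U. g a * HH (N div a)) + ?b"
    unfolding HH_def GG_def by (rule hyperbola)
   ultimately show ?thesis by (simp only: right_diff_distrib) (simp add: mult.commute)
  qed
  have 1: "norm ?a <= 2 * C * B / (\<rho> + t) * ?X"
  proof -
   have "norm ?a <= (\<Sum>a=1..U. 2 * C * B * X powr (- t) * real a powr (\<rho> + t - 1))"
   proof (rule sum_norm_le)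
    fix a assume a: "a \<in> {1..U}"
    then have a0: "real a > 0" by simp
    have "a <= N" using a UX by (simp add: X_def)
    then have q1: "N div a >= 1" using a by (simp add: less_eq_div_iff_mult_less_eq)
    have "X / a < real (N div a) + 1"
     using divide_less_of_nat_div[of N a] unfolding X_def by linarith
    then have q2: "X / (2 * a) <= real (N div a)"
    proof -
     have "X / a <= 2 * real (N div a)" using \<open>X / a < real (N div a) + 1\<close> q1 by linarith
     then show ?thesis by simp
    qed
    have "norm (HH (N div a) - H) <= C * real (N div a) powr (- t)" unfolding HH_def by (rule Ch'[OF q1])
    also have "... <= C * (X / (2 * a)) powr (- t)" using q2 a0 X1 C0 t by (intro mult_left_mono powr_mono2') auto
    also have "(X / (2 * a)) powr (- t) = X powr (- t) * (2 powr t * real a powr t)"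
     using X1 a0 by (simp add: powr_divide powr_mult powr_minus field_simps)
    also have "2 powr t <= 2 powr 1" using t by (intro powr_mono) auto
    then have "C * (X powr (- t) * (2 powr t * real a powr t)) <= C * (X powr (- t) * (2 * real a powr t))"
     using C0 by (intro mult_left_mono mult_right_mono) auto
    finally have "norm (HH (N div a) - H) <= C * (X powr (- t) * (2 * real a powr t))" .
    then have "norm (g a * (HH (N div a) - H)) <= (B * real a powr (\<rho> - 1)) * (C * (X powr (- t) * (2 * real a powr t)))"
     unfolding norm_mult using g(2)[of a] a B by (intro mult_mono) auto
    also have "... = 2 * C * B * X powr (- t) * (real a powr (\<rho> - 1) * real a powr t)" by simp
    also have "real a powr (\<rho> - 1) * real a powr t = real a powr (\<rho> + t - 1)"
     unfolding powr_add[symmetric] by (simp add: algebra_simps)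
    finally show "norm (g a * (HH (N div a) - H)) <= 2 * C * B * X powr (- t) * real a powr (\<rho> + t - 1)" .
   qed
   also have "... = 2 * C * B * X powr (- t) * (\<Sum>a=1..U. real a powr (\<rho> + t - 1))" by (simp only: sum_distrib_left)
   also have "... <= 2 * C * B * X powr (- t) * (real U powr (\<rho> + t) / (\<rho> + t))"
    using t \<rho> C0 B by (intro mult_left_mono sum_powr_le) auto
   also have "... <= 2 * C * B * X powr (- t) * ((X powr (1 / 2)) powr (\<rho> + t) / (\<rho> + t))"
    using t \<rho> C0 B U(1) by (intro mult_left_mono divide_right_mono powr_mono2) (auto simp: sq)
   also have "... = 2 * C * B / (\<rho> + t) * (X powr (- t) * X powr ((\<rho> + t) / 2))" by (simp add: powr_powr)
   also have "X powr (- t) * X powr ((\<rho> + t) / 2) = ?X"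
    unfolding powr_add[symmetric] by (rule arg_cong[where f = "(powr) X"]) (simp add: field_simps)
   finally show ?thesis .
  qed
  have UT: "real U powr (- t) <= 2 * X powr (- (t / 2))"
  proof -
   have "real U powr (- t) <= (X powr (1 / 2) / 2) powr (- t)" using U X1 t by (intro powr_mono2') (auto simp: sq)
   also have "... = 2 powr t * X powr (- (t / 2))" using X1 by (simp add: powr_divide powr_powr powr_minus field_simps)
   also have "... <= 2 powr 1 * X powr (- (t / 2))" using t by (intro mult_right_mono powr_mono) auto
   finally show ?thesis by simp
  qed
  have 2: "norm (H * (GG U - G)) <= norm H * C * 2 * ?X"
  proof -
   have "norm (GG U - G) <= C * real U powr (- t)" unfolding GG_def by (rule Cg'[OF U(2)])
   also have "... <= C * (2 * X powr (- (t / 2)))" using UT C0 by (intro mult_left_mono) auto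
   also have "X powr (- (t / 2)) <= ?X" using X1 \<rho> by (intro powr_mono) auto
   finally have "norm (GG U - G) <= C * (2 * ?X)" using C0 by (simp add: mult_left_mono)
   then show ?thesis unfolding norm_mult by (metis (no_types, opaque_lifting) mult.assoc mult_left_mono norm_ge_zero)
  qed
  have 3: "norm ?b <= 2 * C * B * 2 / \<rho> * ?X"
  proof -
   have "norm ?b <= (\<Sum>b=1..N div Suc U. 2 * C * B * real U powr (- t) * real b powr (\<rho> - 1))"
   proof (rule sum_norm_le)
    fix b assume b: "b \<in> {1..N div Suc U}"
    then have "Suc U <= N div b" by (rule le_div_of_le_div_Suc)
    then have Ub: "U <= N div b" by simp
    have "norm (GG (N div b) - G) <= C * real (N div b) powr (- t)" unfolding GG_def using Ub U(2) by (intro Cg') simp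
    also have "... <= C * real U powr (- t)" using Ub U(2) C0 t by (intro mult_left_mono powr_mono2') auto
    finally have "norm (GG (N div b) - G) <= C * real U powr (- t)" .
    moreover have "norm (GG U - G) <= C * real U powr (- t)" unfolding GG_def by (rule Cg'[OF U(2)])
    ultimately have "norm (GG (N div b) - GG U) <= 2 * C * real U powr (- t)"
     using norm_triangle_ineq4[of "GG (N div b) - G" "GG U - G"] by simp
    then have "norm (h b * (GG (N div b) - GG U)) <= (B * real b powr (\<rho> - 1)) * (2 * C * real U powr (- t))"
     unfolding norm_mult using h(2)[of b] b B by (intro mult_mono) auto
    then show "norm (h b * (GG (N div b) - GG U)) <= 2 * C * B * real U powr (- t) * real b powr (\<rho> - 1)" by (simp add: mult_ac)
   qed
   also have "... = 2 * C * B * real U powr (- t) * (\<Sum>b=1..N div Suc U. real b powr (\<rho> - 1))" by (simp only: sum_distrib_left)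
   also have "... <= 2 * C * B * real U powr (- t) * (real (N div Suc U) powr \<rho> / \<rho>)"
    using \<rho> C0 B by (intro mult_left_mono sum_powr_le) auto
   also have "... <= 2 * C * B * (2 * X powr (- (t / 2))) * ((X powr (1 / 2)) powr \<rho> / \<rho>)"
   proof -
    have "real (N div Suc U) <= X / Suc U" using of_nat_div_le_of_nat[of N "Suc U", where 'a = real] by (simp add: X_def)
    also have "... <= X / sqrt X"
    proof (intro divide_left_mono)
     have "sqrt X < real U + 1" using X1 unfolding U_def by linarith
     then show "sqrt X <= real (Suc U)" by simp
    qed (use X1 in auto)
    also have "... = X powr (1 / 2)" using X1 by (simp add: sq[symmetric] real_div_sqrt)
    finally have "real (N div Suc U) powr \<rho> <= (X powr (1 / 2)) powr \<rho>" using \<rho> by (intro powr_mono2) auto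
    then have "real (N div Suc U) powr \<rho> / \<rho> <= (X powr (1 / 2)) powr \<rho> / \<rho>" using \<rho> by (intro divide_right_mono) auto
    moreover have "2 * C * B * real U powr (- t) <= 2 * C * B * (2 * X powr (- (t / 2)))" using UT C0 B by (intro mult_left_mono) auto
    ultimately show ?thesis using C0 B \<rho> by (intro mult_mono[of _ _ "real (N div Suc U) powr \<rho> / \<rho>"]) auto
   qed
   also have "... = 2 * C * B * 2 / \<rho> * (X powr (- (t / 2)) * X powr (\<rho> / 2))" by (simp add: powr_powr)
   also have "X powr (- (t / 2)) * X powr (\<rho> / 2) = ?X"
    unfolding powr_add[symmetric] by (rule arg_cong[where f = "(powr) X"]) (simp add: field_simps)
   finally show ?thesis .
  qed
  have "norm ((\<Sum>n=1..N. dconv g h n) - G * H) <= norm ?a + norm (H * (GG U - G))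
    + norm ?b"
   unfolding eq by (intro norm_triangle_mono order_refl)
  also have "... <= 2 * C * B / (\<rho> + t) * ?X + norm H * C * 2 * ?X
    + 2 * C * B * 2 / \<rho> * ?X"
   using 1 2 3 by (intro add_mono)
  also have "... = D * ?X" by (simp add: D_def algebra_simps)
  finally show ?thesis by (simp add: X_def)
 qed
 then show ?thesis by (auto simp: dtail_def)
qed

lemma wt_dconv: "n > 0 ==> dconv (wt s g) (wt s h) n = wt s (dconv g h) n"
 unfolding dconv_def wt_def sum_distrib_right
 by (intro sum.cong refl) (auto elim!: dvdE simp: powr_mult)

lemma dtail_cong: "(\<And>n. n > 0 ==> g n = h n) ==> dtail t g G = dtail t h G"
proof -
 assume "\<And>n. n > 0 ==> g n = h n"
 then have "(\<Sum>n=1..N. g n) = (\<Sum>n=1..N. h n)" for N by (intro sum.cong) auto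
 then show ?thesis by (simp add: dtail_def)
qed

text \<open>A convolution divides the rate by at most 4, since \<rho> is at most a quarter of the
  current rate and \<open>(t' - \<rho>) / 2 >= t' / 4\<close>. Keeping room for \<open>K\<close>
  factors is what limits how far \<open>s\<close> may lie to the left of 1.\<close>

lemma dtail_dconvs:
 assumes t: "0 < t" "t <= 1 / 2" and s: "1 - s < t / 4 ^ K" and len: "length gs <= K"
  and gs: "\<And>g. g \<in> set gs ==> dtail t (wt s g) (L g)" "\<And>g n. g \<in> set gs ==> norm (g n) <= 1"
 shows "dtail (t / 4 ^ length gs) (wt s (dconvs gs)) (\<Prod>g\<leftarrow>gs. L g)"
proof -
 define \<rho> where "\<rho> = t / 4 ^ K"
 have \<rho>: "0 < \<rho>" "\<rho> <= t" using t by (auto simp: \<rho>_def divide_le_eq mult_le_cancel_left1)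
 obtain B where B: "B >= 1" "\<And>gs n. length gs <= K ==> (\<And>g n. g \<in> set gs ==> norm (g n) <= 1) ==>
   n > 0 ==> norm (dconvs gs n) <= B * real n powr (\<rho> - 1 + s)"
  using dconvs_powr_bound[of "\<rho> - 1 + s" K] s by (auto simp: \<rho>_def)
 have gr: "norm (wt s (dconvs hs) n) <= B * real n powr (\<rho> - 1)"
  if "length hs <= K" "\<And>g n. g \<in> set hs ==> norm (g n) <= 1" "n > 0" for hs n
 proof -
  have "norm (wt s (dconvs hs) n) <= (B * real n powr (\<rho> - 1 + s)) * real n powr (- s)"
   unfolding wt_def norm_mult norm_of_real using B(1) B(2)[of hs n] that by (intro mult_mono) auto
  also have "... = B * (real n powr (\<rho> - 1 + s) * real n powr (- s))" by simp
  also have "real n powr (\<rho> - 1 + s) * real n powr (- s) = real n powr (\<rho> - 1)" unfolding powr_add[symmetric] by simp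
  finally show ?thesis .
 qed
 show ?thesis using len gs
 proof (induction gs)
  case Nil
  have "norm (wsum s dunit N - 1) <= 0 * real N powr (- t)" if "N >= 1" for N
  proof -
   have "wsum s dunit N = (\<Sum>n\<in>{1}. wt s dunit n)"
    using that by (intro sum.mono_neutral_right) (auto simp: wt_def dunit_def)
   then show ?thesis by (simp add: wt_def dunit_def)
  qed
  then have "dtail t (wt s dunit) 1" unfolding dtail_def by blast
  then show ?case by simp
 next
  case (Cons g gs)
  define t' where "t' = t / 4 ^ length gs"
  have lenlt: "length gs < K" using Cons.prems by simp
  have t': "0 < t'" "t' <= t" "t' <= 1 / 2"
  proof -
   show "0 < t'" using t by (simp add: t'_def)
   show "t' <= t" using t by (auto simp: t'_def divide_le_eq mult_le_cancel_left1)
   then show "t' <= 1 / 2" using t by simp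
  qed
  have IH: "dtail t' (wt s (dconvs gs)) (\<Prod>g\<leftarrow>gs. L g)" unfolding t'_def using Cons by auto
  have "dtail ((t' - \<rho>) / 2) (dconv (wt s g) (wt s (dconvs gs))) (L g * (\<Prod>g\<leftarrow>gs. L g))"
  proof (rule dtail_dconv[where B = B and \<rho> = \<rho> and t = t'])
   show "dtail t' (wt s g) (L g)" by (rule dtail_weaken[OF Cons.prems(2) t'(2)]) simp
   show "norm (wt s g n) <= B * real n powr (\<rho> - 1)" if "n > 0" for n
    using gr[of "[g]" n] that Cons.prems lenlt by (simp add: wt_def dconv_dunit)
   show "norm (wt s (dconvs gs) n) <= B * real n powr (\<rho> - 1)" if "n > 0" for n
    using gr[of gs n] that Cons.prems lenlt by auto
  qed (use IH t' \<rho> t B in auto)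
  moreover have "t / 4 ^ length (g # gs) <= (t' - \<rho>) / 2"
  proof -
   have "(4::real) * 4 ^ length gs <= 4 ^ K" using lenlt power_increasing[of "Suc (length gs)" K "4::real"] by simp
   then have "\<rho> <= t / (4 * 4 ^ length gs)" unfolding \<rho>_def using t by (intro divide_left_mono) auto
   then have "\<rho> <= t' / 4" by (simp add: t'_def)
   then have "t' / 4 <= (t' - \<rho>) / 2" using t' by simp
   then show ?thesis by (simp add: t'_def)
  qed
  ultimately have "dtail (t / 4 ^ length (g # gs)) (dconv (wt s g) (wt s (dconvs gs))) (L g * (\<Prod>g\<leftarrow>gs. L g))"
   by (rule dtail_weaken)
  then show ?case by (subst dtail_cong[of _ "dconv (wt s g) (wt s (dconvs gs))"]) (auto simp: wt_dconv)
 qed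
qed

text \<open>\<open>z\<close> is the value of the Riemann zeta function at \<beta> between 0 and 1,
  described by the expansion of its partial sums. Its negative sign is the essential point.\<close>

definition zeta_const :: "real => real => bool" where
 "zeta_const \<beta> z \<longleftrightarrow> z < 0 \<and>
  (\<forall>M\<ge>1. \<bar>(\<Sum>b=1..M. real b powr (- \<beta>)) - real M powr (1 - \<beta>) / (1 - \<beta>) - z\<bar> <= real M powr (- \<beta>))"

text \<open>The corrected sums \<open>T M\<close> decrease, while
  \<open>T M - M powr (- \<beta>)\<close> increases, so a number lies between the two sequences. It
  is negative because \<open>T 1 = - \<beta> / (1 - \<beta>)\<close> is.\<close>

lemma zeta_const_exists:
 fixes \<beta> :: real
 assumes \<beta>: "0 < \<beta>" "\<beta> < 1"
 shows "\<exists>z. zeta_const \<beta> z"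
proof -
 define T where "T = (\<lambda>M. (\<Sum>b=1..M. real b powr (- \<beta>)) - real M powr (1 - \<beta>) / (1 - \<beta>))"
 have MVT: "\<exists>z. z > real M \<and> z < real (Suc M) \<and>
   real (Suc M) powr (1 - \<beta>) / (1 - \<beta>) - real M powr (1 - \<beta>) / (1 - \<beta>) = (real (Suc M) - real M) * z powr (- \<beta>)" if "M >= 1" for M
 proof (rule MVT2)
  fix x assume "real M <= x" "x <= real (Suc M)"
  then have "x > 0" using that by linarith
  then show "((\<lambda>x. x powr (1 - \<beta>) / (1 - \<beta>)) has_real_derivative x powr (- \<beta>)) (at x)"
   using \<beta> by (auto intro!: derivative_eq_intros)
 qed simp
 have step: "T (Suc M) <= T M" "T M - real M powr (- \<beta>) <= T (Suc M) - real (Suc M) powr (- \<beta>)" if M: "M >= 1" for M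
 proof -
  obtain x where x: "x > real M" "x < real (Suc M)"
   "real (Suc M) powr (1 - \<beta>) / (1 - \<beta>) - real M powr (1 - \<beta>) / (1 - \<beta>) = x powr (- \<beta>)" using MVT[OF M] by auto
  have "x powr (- \<beta>) <= real M powr (- \<beta>)" "real (Suc M) powr (- \<beta>) <= x powr (- \<beta>)"
   using x M \<beta> by (auto intro!: powr_mono2')
  moreover have "T (Suc M) - T M = real (Suc M) powr (- \<beta>) - x powr (- \<beta>)"
   unfolding T_def x(3)[symmetric] by simp
  ultimately show "T (Suc M) <= T M" "T M - real M powr (- \<beta>) <= T (Suc M) - real (Suc M) powr (- \<beta>)" by linarith+
 qed
 have dec: "T N <= T M" if "1 <= M" "M <= N" for M N
  using that(2) by (induction N rule: dec_induct) (use that step(1) in \<open>auto intro: order_trans\<close>)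
 have inc: "T M - real M powr (- \<beta>) <= T N - real N powr (- \<beta>)" if "1 <= M" "M <= N" for M N
  using that(2) by (induction N rule: dec_induct) (use that step(2) in \<open>auto intro: order_trans\<close>)
 have le: "T M - real M powr (- \<beta>) <= T N" if "1 <= M" "1 <= N" for M N
 proof -
  have "T M - real M powr (- \<beta>) <= T (max M N) - real (max M N) powr (- \<beta>)" using that by (intro inc) auto
  also have "... <= T (max M N)" by simp
  also have "... <= T N" using that by (intro dec) auto
  finally show ?thesis .
 qed
 define z where "z = Sup ((\<lambda>M. T M - real M powr (- \<beta>)) ` {1..})"
 have bdd: "bdd_above ((\<lambda>M. T M - real M powr (- \<beta>)) ` {1..})" using le[of _ 1] by (intro bdd_aboveI[of _ "T 1"]) auto
 have z: "T M - real M powr (- \<beta>) <= z" "z <= T M" if "M >= 1" for M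
 proof -
  show "T M - real M powr (- \<beta>) <= z" unfolding z_def using that by (intro cSup_upper bdd) auto
  show "z <= T M" unfolding z_def using le that by (intro cSup_least) auto
 qed
 show ?thesis
  unfolding zeta_const_def
 proof (intro exI[of _ z] conjI allI impI)
  have "T 1 < 0" using \<beta> by (simp add: T_def)
  then show "z < 0" using z(2)[of 1] by simp
  fix M :: nat assume M: "M >= 1"
  have "\<bar>T M - z\<bar> <= real M powr (- \<beta>)" using z[OF M] by linarith
  then show "\<bar>(\<Sum>b=1..M. real b powr (- \<beta>)) - real M powr (1 - \<beta>) / (1 - \<beta>) - z\<bar> <= real M powr (- \<beta>)"
   by (simp add: T_def)
 qed
qed

lemma wt_one: "wt s (\<lambda>_. 1) n = of_real (real n powr (- s))"
 by (simp add: wt_def)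

text \<open>The two main terms are the contribution of the pole of zeta, with the series of
  \<open>F\<close> at 1, and zeta times the series of \<open>F\<close> at \<beta>, both truncated at
  \<open>U\<close>. The number \<open>D\<close> measures how far the sums of \<open>F\<close> move
  beyond \<open>U\<close>.\<close>

lemma wt_dconv_one_asymptotic:
 fixes F :: "nat => complex" and \<beta> :: real
 assumes \<beta>: "0 < \<beta>" "\<beta> < 1" and z': "zeta_const \<beta> z"
  and U: "1 <= U" "U <= N" and D: "\<And>M. M >= U ==> norm (wsum \<beta> F M - wsum \<beta> F U) <= D"
 shows "norm ((wsum \<beta> (dconv F (\<lambda>_. 1)) N)
    - (of_real (real N powr (1 - \<beta>) / (1 - \<beta>)) * wsum 1 F U + of_real z * wsum \<beta> F U))
   <= 4 * real N powr (- \<beta>) * (\<Sum>n=1..U. norm (F n)) + D * (real N / real U) powr (1 - \<beta>) / (1 - \<beta>)"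
proof -
 have z: "z < 0"
  "\<And>M. M >= 1 ==> \<bar>(\<Sum>b=1..M. real b powr (- \<beta>)) - real M powr (1 - \<beta>) / (1 - \<beta>) - z\<bar> <= real M powr (- \<beta>)"
  using z' by (auto simp: zeta_const_def)
 define Z where "Z = (\<lambda>M. \<Sum>b=1..M. real b powr (- \<beta>))"
 define P where "P = (\<lambda>M. \<Sum>n=1..M. wt \<beta> F n)"
 let ?m = "\<lambda>a::nat. (real N / a) powr (1 - \<beta>) / (1 - \<beta>)"
 let ?e = "(\<Sum>b=1..N div Suc U. of_real (real b powr (- \<beta>)) * (P (N div b) - P U))"
 have D0: "D >= 0" using D[OF order_refl] by simp
 have Zx: "\<bar>Z (N div a) - ?m a - z\<bar> <= 4 * (real N powr (- \<beta>) * real a powr \<beta>)"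
  if a: "a \<in> {1..U}" for a
 proof -
  define M where "M = N div a"
  have M1: "M >= 1" using a U by (simp add: M_def less_eq_div_iff_mult_less_eq)
  have a0: "real a > 0" using a by simp
  have up: "real N / a < real M + 1" using divide_less_of_nat_div[of N a] unfolding M_def by linarith
  have lo: "real M <= real N / a" using of_nat_div_le_of_nat[of N a, where 'a = real] by (simp add: M_def)
  have "\<bar>?m a - real M powr (1 - \<beta>) / (1 - \<beta>)\<bar> <= real M powr (- \<beta>)"
  proof (cases "real M = real N / a")
   case False
   then have lt: "real M < real N / a" using lo by simp
   have "\<exists>x. x > real M \<and> x < real N / a \<and> ?m a - real M powr (1 - \<beta>) / (1 - \<beta>)
     = (real N / a - real M) * x powr (- \<beta>)"
   proof (rule MVT2[OF lt])
    fix x assume "real M <= x"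
    then have "x > 0" using M1 by linarith
    then show "((\<lambda>x. x powr (1 - \<beta>) / (1 - \<beta>)) has_real_derivative x powr (- \<beta>)) (at x)"
     using \<beta> by (auto intro!: derivative_eq_intros)
   qed
   then obtain x where x: "x > real M" "?m a - real M powr (1 - \<beta>) / (1 - \<beta>)
     = (real N / a - real M) * x powr (- \<beta>)" by auto
   have "(real N / a - real M) * x powr (- \<beta>) <= 1 * real M powr (- \<beta>)"
    using x M1 \<beta> up lo by (intro mult_mono powr_mono2') auto
   moreover have "0 <= (real N / a - real M) * x powr (- \<beta>)" using lo by simp
   ultimately show ?thesis unfolding x(2) by simp
  qed simp
  moreover have "\<bar>Z M - real M powr (1 - \<beta>) / (1 - \<beta>) - z\<bar> <= real M powr (- \<beta>)" unfolding Z_def by (rule z(2)[OF M1])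
  ultimately have "\<bar>Z M - ?m a - z\<bar> <= 2 * real M powr (- \<beta>)" by linarith
  also have "real M powr (- \<beta>) <= (real N / a / 2) powr (- \<beta>)"
   using up M1 \<beta> a0 U by (intro powr_mono2') auto
  also have "(real N / a / 2) powr (- \<beta>) = 2 powr \<beta> * (real N powr (- \<beta>) * real a powr \<beta>)"
   using a0 by (simp add: powr_divide powr_minus powr_mult field_simps)
  also have "... <= 2 powr 1 * (real N powr (- \<beta>) * real a powr \<beta>)"
   using \<beta> by (intro mult_right_mono powr_mono) auto
  finally show ?thesis by (simp add: M_def)
 qed
 have main: "(wsum \<beta> (dconv F (\<lambda>_. 1)) N) = (\<Sum>a=1..U. wt \<beta> F a * of_real (Z (N div a)))
   + ?e"
 proof -
  have "(wsum \<beta> (dconv F (\<lambda>_. 1)) N) = (\<Sum>n=1..N. dconv (wt \<beta> F) (wt \<beta> (\<lambda>_. 1)) n)"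
   by (intro sum.cong refl) (simp add: wt_dconv)
  also have "... = (\<Sum>a=1..U. wt \<beta> F a * (\<Sum>b=1..N div a. wt \<beta> (\<lambda>_. 1) b))
   + (\<Sum>b=1..N div Suc U. wt \<beta> (\<lambda>_. 1) b * (P (N div b) - P U))" unfolding P_def by (rule hyperbola)
  finally show ?thesis by (simp only: wt_one Z_def of_real_sum)
 qed
 have mid: "of_real (real N powr (1 - \<beta>) / (1 - \<beta>)) * wsum 1 F U + of_real z * P U
   = (\<Sum>a=1..U. wt \<beta> F a * of_real (?m a + z))"
 proof -
  have "of_real (real N powr (1 - \<beta>) / (1 - \<beta>)) * wt 1 F a + of_real z * wt \<beta> F a
    = wt \<beta> F a * of_real (?m a + z)" if "a \<in> {1..U}" for a
  proof -
   have "real a powr (- \<beta>) * (real N / a) powr (1 - \<beta>) = real N powr (1 - \<beta>) * real a powr (- 1)"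
   proof -
    have "(real N / a) powr (1 - \<beta>) = real N powr (1 - \<beta>) * real a powr (- (1 - \<beta>))"
     using that by (subst powr_minus, subst powr_divide) (simp_all add: divide_inverse)
    then have "real a powr (- \<beta>) * (real N / a) powr (1 - \<beta>) = real N powr (1 - \<beta>) * (real a powr (- \<beta>) * real a powr (- (1 - \<beta>)))" by simp
    also have "real a powr (- \<beta>) * real a powr (- (1 - \<beta>)) = real a powr (- 1)" unfolding powr_add[symmetric] by simp
    finally show ?thesis .
   qed
   then have "complex_of_real (real N powr (1 - \<beta>) / (1 - \<beta>)) * of_real (real a powr (- 1))
     = of_real (real a powr (- \<beta>)) * of_real (?m a)"
    unfolding of_real_mult[symmetric] by simp
   then have "F a * (complex_of_real (real N powr (1 - \<beta>) / (1 - \<beta>)) * of_real (real a powr (- 1)))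
     = F a * (of_real (real a powr (- \<beta>)) * of_real (?m a))" by (rule arg_cong)
   then show ?thesis unfolding wt_def of_real_add distrib_left by (simp only: mult_ac)
  qed
  then show ?thesis unfolding P_def sum_distrib_left sum.distrib[symmetric] by (intro sum.cong refl) auto
 qed
 have e1: "norm (\<Sum>a=1..U. wt \<beta> F a * of_real (Z (N div a) - (?m a + z)))
   <= 4 * real N powr (- \<beta>) * (\<Sum>n=1..U. norm (F n))"
  unfolding sum_distrib_left
 proof (rule sum_norm_le)
  fix a assume a: "a \<in> {1..U}"
  have "norm (wt \<beta> F a * of_real (Z (N div a) - (?m a + z)))
    <= (norm (F a) * real a powr (- \<beta>)) * (4 * (real N powr (- \<beta>) * real a powr \<beta>))"
   unfolding norm_mult norm_of_real wt_def using Zx[OF a] by (intro mult_mono) auto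
  also have "... = 4 * real N powr (- \<beta>) * norm (F a) * (real a powr (- \<beta>) * real a powr \<beta>)" by simp
  also have "real a powr (- \<beta>) * real a powr \<beta> = 1" using a by (simp add: powr_add[symmetric])
  finally show "norm (wt \<beta> F a * of_real (Z (N div a) - (?m a + z)))
    <= 4 * real N powr (- \<beta>) * norm (F a)" by simp
 qed
 have e2: "norm ?e <= D * (real N / real U) powr (1 - \<beta>) / (1 - \<beta>)"
 proof -
  have "norm ?e <= (\<Sum>b=1..N div Suc U. D * real b powr (1 - \<beta> - 1))"
  proof (rule sum_norm_le)
   fix b assume b: "b \<in> {1..N div Suc U}"
   then have "Suc U <= N div b" by (rule le_div_of_le_div_Suc)
   then have "norm (P (N div b) - P U) <= D" using D by (simp add: P_def)
   then have "real b powr (- \<beta>) * norm (P (N div b) - P U) <= real b powr (- \<beta>) * D" by (intro mult_left_mono) auto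
   then show "norm (of_real (real b powr (- \<beta>)) * (P (N div b) - P U)) <= D * real b powr (1 - \<beta> - 1)"
    by (simp add: norm_mult mult.commute)
  qed
  also have "... = D * (\<Sum>b=1..N div Suc U. real b powr (1 - \<beta> - 1))" by (simp only: sum_distrib_left)
  also have "... <= D * (real (N div Suc U) powr (1 - \<beta>) / (1 - \<beta>))" using \<beta> D0 by (intro mult_left_mono sum_powr_le) auto
  also have "... <= D * ((real N / real U) powr (1 - \<beta>) / (1 - \<beta>))"
  proof (intro mult_left_mono divide_right_mono powr_mono2)
   show "real (N div Suc U) <= real N / U" using U by (intro of_nat_div_Suc_le) auto
  qed (use \<beta> D0 in auto)
  finally show ?thesis by simp
 qed
 have "(wsum \<beta> (dconv F (\<lambda>_. 1)) N)
   - (of_real (real N powr (1 - \<beta>) / (1 - \<beta>)) * wsum 1 F U + of_real z * P U)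
   = (\<Sum>a=1..U. wt \<beta> F a * of_real (Z (N div a) - (?m a + z)))
    + ?e"
  unfolding main mid of_real_diff right_diff_distrib sum_subtractf by simp
 also have "norm ... <= 4 * real N powr (- \<beta>) * (\<Sum>n=1..U. norm (F n)) + D * (real N / real U) powr (1 - \<beta>) / (1 - \<beta>)"
  by (intro norm_triangle_mono e1 e2)
 finally show ?thesis by (simp add: P_def)
qed

text \<open>For \<open>a\<close> up to \<open>U\<close> the floor in \<open>N div a\<close> costs at
  most 1 per coefficient; beyond \<open>U\<close> the oscillation of \<open>F\<close> is used. The
  main term contains the truncated value of the series of \<open>F\<close> at 1.\<close>

lemma dconv_one_asymptotic:
 fixes F :: "nat => complex"
 assumes F: "osc C \<delta> U F" and \<delta>: "0 < \<delta>" "\<delta> <= 1" and U: "1 <= U" "U <= N" and C: "C >= 0"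
 shows "norm ((\<Sum>n=1..N. dconv F (\<lambda>_. 1) n) - of_nat N * wsum 1 F U)
  <= (\<Sum>n=1..U. norm (F n)) + 2 * C / \<delta> * real N * real U powr (- \<delta>)"
proof -
 define P where "P = (\<lambda>M. \<Sum>n=1..M. F n)"
 have main: "(\<Sum>n=1..N. dconv F (\<lambda>_. 1) n) = (\<Sum>a=1..U. F a * of_nat (N div a)) + (\<Sum>b=1..N div Suc U. P (N div b) - P U)"
  unfolding hyperbola[of F "\<lambda>_. 1" N U] P_def by simp
 have mid: "of_nat N * wsum 1 F U = (\<Sum>a=1..U. F a * of_real (real N / a))"
  unfolding sum_distrib_left wt_def by (intro sum.cong refl) (simp add: powr_minus divide_simps)
 have e1: "norm (\<Sum>a=1..U. F a * (of_nat (N div a) - of_real (real N / a))) <= (\<Sum>n=1..U. norm (F n))"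
 proof (rule sum_norm_le)
  fix a assume a: "a \<in> {1..U}"
  have "real N / a < real (N div a) + 1" using divide_less_of_nat_div[of N a] by linarith
  moreover have "real (N div a) <= real N / a" using of_nat_div_le_of_nat[of N a, where 'a = real] by simp
  ultimately have "\<bar>real (N div a) - real N / a\<bar> <= 1" by linarith
  then have "norm (of_real (real (N div a) - real N / a) :: complex) <= 1" unfolding norm_of_real .
  then have "norm (F a) * norm (of_real (real (N div a) - real N / a) :: complex) <= norm (F a) * 1" by (intro mult_left_mono) auto
  then show "norm (F a * (of_nat (N div a) - of_real (real N / a))) <= norm (F a)" by (simp add: norm_mult)
 qed
 have e2: "norm (\<Sum>b=1..N div Suc U. P (N div b) - P U) <= 2 * C / \<delta> * real N * real U powr (- \<delta>)"
 proof -
  have "norm (\<Sum>b=1..N div Suc U. P (N div b) - P U) <= (\<Sum>b=1..N div Suc U. 2 * C * real N powr (1 - \<delta>) * real b powr (\<delta> - 1))"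
  proof (rule sum_norm_le)
   fix b assume b: "b \<in> {1..N div Suc U}"
   then have "b * Suc U <= N" by (simp add: less_eq_div_iff_mult_less_eq)
   then have Ub: "U <= N div b" using b by (simp add: less_eq_div_iff_mult_less_eq mult.commute)
   have le: "real (N div b) <= real N / b" using of_nat_div_le_of_nat[of N b, where 'a = real] by simp
   have "norm (P M) <= C * (real N / b) powr (1 - \<delta>)" if "U <= M" "M <= N div b" for M
   proof -
    have "norm (P M) <= C * real M powr (1 - \<delta>)" using F that by (simp add: osc_def P_def)
    also have "... <= C * (real N / b) powr (1 - \<delta>)"
     using that le \<delta> C by (intro mult_left_mono powr_mono2) (auto intro: order_trans[of _ "real (N div b)"])
    finally show ?thesis .
   qed
   from this[OF Ub] this[of U] Ub have "norm (P (N div b) - P U) <= 2 * (C * (real N / b) powr (1 - \<delta>))"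
    using norm_triangle_ineq4[of "P (N div b)" "P U"] by fastforce
   also have "(real N / b) powr (1 - \<delta>) = real N powr (1 - \<delta>) * real b powr (- (1 - \<delta>))"
    using b by (subst powr_minus, subst powr_divide) (simp_all add: divide_inverse)
   finally show "norm (P (N div b) - P U) <= 2 * C * real N powr (1 - \<delta>) * real b powr (\<delta> - 1)" by simp
  qed
  also have "... = 2 * C * real N powr (1 - \<delta>) * (\<Sum>b=1..N div Suc U. real b powr (\<delta> - 1))" by (simp only: sum_distrib_left)
  also have "... <= 2 * C * real N powr (1 - \<delta>) * (real (N div Suc U) powr \<delta> / \<delta>)"
   using \<delta> C by (intro mult_left_mono sum_powr_le) auto
  also have "... <= 2 * C * real N powr (1 - \<delta>) * ((real N / real U) powr \<delta> / \<delta>)"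
  proof (intro mult_left_mono divide_right_mono powr_mono2)
   show "real (N div Suc U) <= real N / U" using U by (intro of_nat_div_Suc_le) auto
  qed (use \<delta> C in auto)
  also have "... = 2 * C / \<delta> * (real N powr (1 - \<delta>) * real N powr \<delta>) * real U powr (- \<delta>)"
   using U by (subst powr_minus, subst powr_divide) (simp_all add: divide_inverse)
  also have "real N powr (1 - \<delta>) * real N powr \<delta> = real N" using U by (simp add: powr_add[symmetric])
  finally show ?thesis .
 qed
 have "(\<Sum>n=1..N. dconv F (\<lambda>_. 1) n) - of_nat N * (wsum 1 F U)
   = (\<Sum>a=1..U. F a * (of_nat (N div a) - of_real (real N / a))) + (\<Sum>b=1..N div Suc U. P (N div b) - P U)"
  unfolding main mid right_diff_distrib sum_subtractf by simp
 also have "norm ... <= (\<Sum>n=1..U. norm (F n)) + 2 * C / \<delta> * real N * real U powr (- \<delta>)"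
  by (intro norm_triangle_mono e1 e2)
 finally show ?thesis .
qed

section \<open>Logarithmic derivatives and positivity\<close>

definition cmult :: "(nat => complex) => bool" where
 "cmult g \<longleftrightarrow> g 1 = 1 \<and> (\<forall>a b. g (a * b) = g a * g b)"

lemma dconv_add_left: "dconv (\<lambda>n. g n + g' n) h n = dconv g h n + dconv g' h n"
 by (simp add: dconv_def sum.distrib distrib_right)

text \<open>Multiplication by the logarithm is a derivation of Dirichlet convolution.\<close>

lemma dconv_times_ln:
 assumes "n > 0"
 shows "dconv g h n * of_real (ln (real n)) = dconv (\<lambda>n. g n * of_real (ln (real n))) h n + dconv g (\<lambda>n. h n * of_real (ln (real n))) n"
 unfolding dconv_def sum_distrib_right sum.distrib[symmetric]
proof (intro sum.cong refl)
 fix d assume "d \<in> {d. d dvd n}"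
 then obtain m where m: "n = d * m" by auto
 with assms have "d > 0" "m > 0" by auto
 then have "ln (real n) = ln (real d) + ln (real m)" "n div d = m" by (simp_all add: m ln_mult)
 then show "g d * h (n div d) * complex_of_real (ln (real n)) =
   g d * complex_of_real (ln (real d)) * h (n div d) + g d * (h (n div d) * complex_of_real (ln (real (n div d))))"
  by (simp add: algebra_simps)
qed

text \<open>The logarithmic derivative of a completely multiplicative \<open>g\<close> is
  \<open>mangoldt\<close> twisted by \<open>g\<close>, since \<open>g\<close> factors out of the sum
  over the divisors.\<close>

lemma cmult_times_ln:
 assumes "cmult g" "n > 0"
 shows "g n * of_real (ln (real n)) = dconv (\<lambda>d. mangoldt d * g d) g n"
proof -
 have "dconv (\<lambda>d. mangoldt d * g d) g n = (\<Sum>d | d dvd n. mangoldt d * g n)"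
  unfolding dconv_def
 proof (intro sum.cong refl)
  fix d assume "d \<in> {d. d dvd n}"
  then have "n = d * (n div d)" by simp
  then have "g n = g d * g (n div d)" using assms(1) unfolding cmult_def by metis
  then show "mangoldt d * g d * g (n div d) = mangoldt d * g n" by simp
 qed
 also have "... = g n * of_real (ln (real n))"
  using assms(2) by (simp add: sum_distrib_right[symmetric] mangoldt_sum mult.commute)
 finally show ?thesis by simp
qed

text \<open>By the product rule the logarithmic derivatives of the factors add up; only the sum of
  the values of the factors enters, which orthogonality evaluates for a group of characters.\<close>

lemma dconvs_times_ln:
 assumes "\<And>g. g \<in> set gs ==> cmult g" "n > 0"
 shows "dconvs gs n * of_real (ln (real n)) = dconv (\<lambda>d. mangoldt d * (\<Sum>g\<leftarrow>gs. g d)) (dconvs gs) n"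
 using assms
proof (induction gs arbitrary: n)
 case Nil
 then show ?case by (simp add: dunit_def dconv_def)
next
 case (Cons g gs)
 let ?S = "\<lambda>d. mangoldt d * (\<Sum>g\<leftarrow>gs. g d)" and ?h = "dconvs gs"
 note n = Cons.prems(2)
 have "dconvs (g # gs) n * of_real (ln (real n))
   = dconv (\<lambda>n. g n * of_real (ln (real n))) ?h n + dconv g (\<lambda>n. ?h n * of_real (ln (real n))) n"
  by (simp add: dconv_times_ln n)
 also have "dconv (\<lambda>n. g n * of_real (ln (real n))) ?h n = dconv (dconv (\<lambda>d. mangoldt d * g d) g) ?h n"
  by (intro dconv_cong n refl cmult_times_ln Cons.prems(1)) auto
 also have "... = dconv (\<lambda>d. mangoldt d * g d) (dconv g ?h) n" by (rule dconv_assoc[OF n])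
 also have "dconv g (\<lambda>n. ?h n * of_real (ln (real n))) n = dconv g (dconv ?S ?h) n"
  using Cons by (intro dconv_cong n refl) auto
 also have "... = dconv (dconv ?S ?h) g n" by (rule dconv_commute[OF n])
 also have "... = dconv ?S (dconv ?h g) n" by (rule dconv_assoc[OF n])
 also have "... = dconv ?S (dconv g ?h) n" by (intro dconv_cong n refl dconv_commute)
 finally show ?case by (simp add: dconv_add_left[symmetric] distrib_left)
qed

lemma dconvs_1: "(\<And>g. g \<in> set gs ==> cmult g) ==> dconvs gs (Suc 0) = 1"
 by (induction gs) (auto simp: dunit_def dconv_def cmult_def)

lemma mangoldt_nonneg_Reals: "(mangoldt d :: complex) \<in> \<real>\<^sub>\<ge>\<^sub>0"
 by (metis mangoldt_nonneg nonneg_Reals_of_real_iff of_real_mangoldt)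

lemma nonneg_Reals_sum: "(\<And>x. x \<in> A ==> f x \<in> \<real>\<^sub>\<ge>\<^sub>0) ==> sum f A \<in> (\<real>\<^sub>\<ge>\<^sub>0 :: complex set)"
 by (induction A rule: infinite_finite_induct) auto

text \<open>Strong induction through the logarithmic identity: \<open>ln n\<close> is positive for
  \<open>n > 1\<close>, and all terms on the other side involve the convolution at smaller
  arguments, because \<open>d = 1\<close> drops out with \<open>mangoldt\<close>.\<close>

lemma dconvs_nonneg:
 assumes gs: "\<And>g. g \<in> set gs ==> cmult g" "\<And>d. d > 0 ==> (\<Sum>g\<leftarrow>gs. g d) \<in> \<real>\<^sub>\<ge>\<^sub>0" and n: "n > 0"
 shows "dconvs gs n \<in> \<real>\<^sub>\<ge>\<^sub>0"
 using n
proof (induction n rule: less_induct)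
 case (less n)
 show ?case
 proof (cases "n = 1")
  case True
  then show ?thesis using dconvs_1[of gs] gs by simp
 next
  case False
  then have n: "n > 1" using less.prems by simp
  have e: "dconvs gs n * of_real (ln (real n)) = dconv (\<lambda>d. mangoldt d * (\<Sum>g\<leftarrow>gs. g d)) (dconvs gs) n"
   by (rule dconvs_times_ln) (use gs less.prems in auto)
  have "dconvs gs n * of_real (ln (real n)) \<in> \<real>\<^sub>\<ge>\<^sub>0"
   unfolding e dconv_def
  proof (intro nonneg_Reals_sum)
   fix d assume "d \<in> {d. d dvd n}"
   then obtain m where m: "n = d * m" by auto
   show "mangoldt d * (\<Sum>g\<leftarrow>gs. g d) * dconvs gs (n div d) \<in> \<real>\<^sub>\<ge>\<^sub>0"
   proof (cases "d = 1")
    case False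
    have dm: "d > 0" "m > 0" using m n by (auto intro!: Nat.gr0I)
    then have "d > 1" using False by simp
    then have "m < n" using dm by (simp add: m)
    then have "dconvs gs m \<in> \<real>\<^sub>\<ge>\<^sub>0" using less.IH dm by simp
    then show ?thesis using dm gs(2)[of d] mangoldt_nonneg_Reals by (simp add: m)
   qed simp
  qed
  then have "dconvs gs n * of_real (ln (real n)) / of_real (ln (real n)) \<in> \<real>\<^sub>\<ge>\<^sub>0"
   by (rule nonneg_Reals_divide_I) (use n in simp)
  then show ?thesis using n by simp
 qed
qed

text \<open>In the logarithmic identity a prime power \<open>d\<close> divisible by \<open>p\<close>
  can only be \<open>p\<close> itself, where the coefficient vanishes. For any other
  \<open>d\<close> the quotient is still divisible by \<open>p\<close> exactly once, so induction
  applies.\<close>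

lemma dconvs_eq_0_if_prime_exactly_divides:
 assumes gs: "\<And>g. g \<in> set gs ==> cmult g" and p: "prime p" "(\<Sum>g\<leftarrow>gs. g p) = 0"
  and n: "n > 0" "p dvd n" "\<not> p ^ 2 dvd n"
 shows "dconvs gs n = 0"
 using n
proof (induction n rule: less_induct)
 case (less n)
 have p1: "p > 1" using p(1) by (rule prime_gt_1_nat)
 have n1: "n > 1" using dvd_imp_le[OF less.prems(2,1)] p1 by simp
 have e: "dconvs gs n * of_real (ln (real n)) = dconv (\<lambda>d. mangoldt d * (\<Sum>g\<leftarrow>gs. g d)) (dconvs gs) n"
  by (rule dconvs_times_ln) (use gs less.prems in auto)
 have "dconvs gs n * of_real (ln (real n)) = 0"
  unfolding e dconv_def
 proof (intro sum.neutral ballI)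
  fix d assume "d \<in> {d. d dvd n}"
  then obtain m where m: "n = d * m" by auto
  have dm: "d > 0" "m > 0" using m less.prems by auto
  show "mangoldt d * (\<Sum>g\<leftarrow>gs. g d) * dconvs gs (n div d) = 0"
  proof (cases "p dvd d")
   case True
   show ?thesis
   proof (cases "primepow d")
    case pp: True
    then obtain r k where rk: "prime r" "k > 0" "d = r ^ k" by (auto simp: primepow_def)
    then have "p = r" using True p(1) by (metis prime_dvd_power primes_dvd_imp_eq)
    have "k < 2"
    proof (rule ccontr)
     assume "\<not> k < 2"
     then have "p ^ 2 dvd p ^ k" by (intro le_imp_power_dvd) simp
     then have "p ^ 2 dvd n" using rk \<open>p = r\<close> m by simp
     then show False using less.prems by simp
    qed
    then have "d = p" using rk \<open>p = r\<close> by (simp add: less_2_cases_iff)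
    then show ?thesis using p(2) by simp
   qed (simp add: mangoldt_def)
  next
   case False
   then have pm: "p dvd m" using less.prems(2) p(1) by (simp add: m prime_dvd_mult_iff)
   show ?thesis
   proof (cases "d = 1")
    case d1: False
    then have "m < n" using dm by (simp add: m)
    moreover have "\<not> p ^ 2 dvd m" using less.prems(3) by (auto simp: m)
    ultimately have "dconvs gs m = 0" using less.IH[of m] dm pm by simp
    then show ?thesis using dm by (simp add: m)
   qed simp
  qed
 qed
 then show ?case using n1 by simp
qed

text \<open>The term \<open>d = n\<close> can be solved for recursively. For a group of characters
  the convolution with 1 is visibly real, whereas the single factors are complex.\<close>

lemma Reals_of_dconv_one:
 assumes "\<And>n. n > 0 ==> dconv F (\<lambda>_. 1) n \<in> \<real>" "n > 0"
 shows "F n \<in> \<real>"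
 using assms(2)
proof (induction n rule: less_induct)
 case (less n)
 have "dconv F (\<lambda>_. 1) n = F n + (\<Sum>d\<in>{d. d dvd n} - {n}. F d)"
  unfolding dconv_def using less.prems by (subst sum.remove[of _ n]) (auto simp: finite_divisors_nat)
 moreover have "(\<Sum>d\<in>{d. d dvd n} - {n}. F d) \<in> \<real>"
 proof (rule sum_in_Reals)
  fix d assume d: "d \<in> {d. d dvd n} - {n}"
  then have "d < n" "d > 0" using less.prems by (auto simp: nat_dvd_not_less intro!: Nat.gr0I le_neq_implies_less dvd_imp_le)
  then show "F d \<in> \<real>" by (rule less.IH)
 qed
 ultimately have "F n = dconv F (\<lambda>_. 1) n - (\<Sum>d\<in>{d. d dvd n} - {n}. F d)"
  "dconv F (\<lambda>_. 1) n \<in> \<real>" "(\<Sum>d\<in>{d. d dvd n} - {n}. F d) \<in> \<real>" using assms(1)[OF less.prems] by simp_all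
 then show ?case by (simp add: Reals_diff)
qed

text \<open>In the logarithmic identity at \<open>m ^ 2\<close> only the square divisors
  \<open>d ^ 2\<close> are kept. There \<open>1 + g\<close> equals 2 and the induction hypothesis
  applies to the quotient, so the sum is at least \<open>2 * ln m\<close>, the logarithm of the
  argument.\<close>

lemma sum_even_squares_lower:
 assumes g: "cmult g" and m: "m > 0" "\<And>d. d dvd m ==> g (d ^ 2) = 1" and re: "\<And>d. d > 0 ==> 1 + g d \<in> \<real>\<^sub>\<ge>\<^sub>0"
 shows "Re (dconvs [\<lambda>_. 1, g] (m ^ 2)) >= 1"
 using m
proof (induction m rule: less_induct)
 case (less m)
 let ?gs = "[\<lambda>_. 1, g]"
 have cm: "cmult g'" if "g' \<in> set ?gs" for g' using that g by (auto simp: cmult_def)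
 have nn: "dconvs ?gs n \<in> \<real>\<^sub>\<ge>\<^sub>0" if "n > 0" for n using that re by (intro dconvs_nonneg cm) auto
 show ?case
 proof (cases "m = 1")
  case True
  then show ?thesis using dconvs_1[of ?gs, OF cm] by simp
 next
  case False
  then have m1: "m > 1" using less.prems by simp
  define T where "T = (\<lambda>d. mangoldt d * (1 + g d) * dconvs ?gs (m ^ 2 div d))"
  have Tnn: "T d \<in> \<real>\<^sub>\<ge>\<^sub>0" if "d dvd m ^ 2" for d
  proof -
   from that obtain k where k: "m ^ 2 = d * k" by (elim dvdE)
   have "d * k > 0" using m1 by (simp flip: k)
   then have "d > 0" "k > 0" by auto
   then show ?thesis unfolding T_def k using nn re mangoldt_nonneg_Reals by simp
  qed
  have "2 * ln (real m) = (\<Sum>d | d dvd m. 2 * mangoldt d)"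
   using less.prems mangoldt_sum[of m, where 'a = real] by (simp add: sum_distrib_left[symmetric])
  also have "... <= (\<Sum>d | d dvd m. Re (T (d ^ 2)))"
  proof (rule sum_mono)
   fix d assume "d \<in> {d. d dvd m}"
   then obtain k where k: "m = d * k" by auto
   have dk: "d > 0" "k > 0" using k m1 by (auto intro!: Nat.gr0I)
   have g2: "g (d ^ 2) = 1" using less.prems(2)[of d] k by simp
   show "2 * mangoldt d <= Re (T (d ^ 2))"
   proof (cases "d = 1")
    case False
    then have "k < m" using dk by (simp add: k)
    then have IH: "Re (dconvs ?gs (k ^ 2)) >= 1" using less.IH[of k] less.prems dk k by auto
    have md: "mangoldt (d ^ 2) = (mangoldt d :: complex)"
     by (simp add: mangoldt_def primepow_power_iff_nat[OF dk(1)] aprimedivisor_primepow_power)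
    have "m ^ 2 div d ^ 2 = k ^ 2" using dk by (simp add: k power_mult_distrib)
    then have "T (d ^ 2) = of_real (2 * mangoldt d) * dconvs ?gs (k ^ 2)" using g2 md by (simp add: T_def)
    then have "Re (T (d ^ 2)) = 2 * mangoldt d * Re (dconvs ?gs (k ^ 2))" by (simp del: of_real_mult of_real_mangoldt of_real_numeral)
    then show ?thesis using mult_left_mono[OF IH, of "2 * mangoldt d"] mangoldt_nonneg[of d] by simp
   qed (simp add: T_def)
  qed
  also have "... = (\<Sum>e\<in>(\<lambda>d. d ^ 2) ` {d. d dvd m}. Re (T e))"
   by (subst sum.reindex) (auto simp: inj_on_def)
  also have "... <= (\<Sum>e | e dvd m ^ 2. Re (T e))"
  proof (rule sum_mono2)
   show "finite {e. e dvd m ^ 2}" using m1 by (intro finite_divisors_nat) simp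
   fix e assume "e \<in> {e. e dvd m ^ 2} - (\<lambda>d. d ^ 2) ` {d. d dvd m}"
   then have "T e \<in> \<real>\<^sub>\<ge>\<^sub>0" using Tnn by simp
   then show "0 <= Re (T e)" by (simp add: complex_nonneg_Reals_iff)
  qed auto
  also have "... = Re (dconvs ?gs (m ^ 2) * of_real (ln (real (m ^ 2))))"
   using dconvs_times_ln[of ?gs "m ^ 2", OF cm] m1 unfolding dconv_def T_def by simp
  also have "... = 2 * ln (real m) * Re (dconvs ?gs (m ^ 2))"
   using m1 by (simp add: ln_realpow)
  finally have "2 * ln (real m) * 1 <= 2 * ln (real m) * Re (dconvs ?gs (m ^ 2))" by simp
  then show ?thesis using m1 by (subst (asm) mult_le_cancel_left_pos) auto
 qed
qed

section \<open>Finite groups of characters\<close>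

definition princ :: "nat => int => complex" where
 "princ Q a = of_bool (coprime a (int Q))"

text \<open>Closure under products is enough for a group: the set is finite and multiplication by a
  member is injective, so inverses, here the conjugates, are obtained from
  \<open>char_group_mult_bij\<close>.\<close>

definition char_group :: "nat => (int => complex) set => bool" where
 "char_group Q X \<longleftrightarrow> finite X \<and> princ Q \<in> X \<and> (\<forall>\<xi>\<in>X. dchar Q \<xi>) \<and>
   (\<forall>\<xi>\<in>X. \<forall>\<psi>\<in>X. (\<lambda>a. \<xi> a * \<psi> a) \<in> X)"

lemma trivial_char_iff: "dchar Q \<xi> ==> trivial_char Q \<xi> \<longleftrightarrow> \<xi> = princ Q"
 by (auto simp: trivial_char_def princ_def fun_eq_iff dchar_eq_0_iff)

lemma dchar_princ: "dchar Q (princ Q)"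
proof -
 have "coprime a (int Q) \<longleftrightarrow> coprime b (int Q)" if "[a = b] (mod int Q)" for a b
  using that by (meson cong_imp_coprime cong_sym)
 then show ?thesis by (auto simp: dchar_def princ_def)
qed

lemma char_group_mult_bij:
 assumes X: "char_group Q X" and \<xi>: "\<xi> \<in> X"
 shows "bij_betw (\<lambda>\<psi> a. \<xi> a * \<psi> a) X X"
proof -
 have "inj_on (\<lambda>\<psi> a. \<xi> a * \<psi> a) X"
 proof (rule inj_onI, rule ext)
  fix \<psi>1 \<psi>2 a assume *: "\<psi>1 \<in> X" "\<psi>2 \<in> X" "(\<lambda>a. \<xi> a * \<psi>1 a) = (\<lambda>a. \<xi> a * \<psi>2 a)"
  then have d: "dchar Q \<psi>1" "dchar Q \<psi>2" "dchar Q \<xi>" using X \<xi> by (auto simp: char_group_def)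
  show "\<psi>1 a = \<psi>2 a"
  proof (cases "coprime a (int Q)")
   case True
   then show ?thesis using fun_cong[OF *(3), of a] dchar_eq_0_iff[OF d(3), of a] by simp
  next
   case False
   then show ?thesis using dchar_eq_0_iff[OF d(1), of a] dchar_eq_0_iff[OF d(2), of a] by simp
  qed
 qed
 moreover have "(\<lambda>\<psi> a. \<xi> a * \<psi> a) ` X \<subseteq> X" using X \<xi> by (auto simp: char_group_def)
 ultimately show ?thesis using X by (auto simp: bij_betw_def char_group_def endo_inj_surj)
qed

lemma char_group_sum:
 assumes X: "char_group Q X" and a: "coprime a (int Q)"
 shows "(\<Sum>\<xi>\<in>X. \<xi> a) = (if \<exists>\<xi>\<in>X. \<xi> a \<noteq> 1 then 0 else of_nat (card X))"
proof (cases "\<exists>\<xi>\<in>X. \<xi> a \<noteq> 1")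
 case True
 then obtain \<xi> where \<xi>: "\<xi> \<in> X" "\<xi> a \<noteq> 1" by blast
 have "(\<Sum>\<psi>\<in>X. \<psi> a) = \<xi> a * (\<Sum>\<psi>\<in>X. \<psi> a)"
  using sum.reindex_bij_betw[OF char_group_mult_bij[OF X \<xi>(1)], of "\<lambda>\<psi>. \<psi> a"] by (simp add: sum_distrib_left)
 then have "(\<Sum>\<psi>\<in>X. \<psi> a) = 0" using \<xi>(2) by (metis mult_cancel_right1)
 then show ?thesis using True by simp
next
 case False
 then have "(\<Sum>\<xi>\<in>X. \<xi> a) = (\<Sum>\<xi>\<in>X. 1)" by (intro sum.cong) auto
 then show ?thesis using False by simp
qed

lemma char_group_cnj:
 assumes X: "char_group Q X" and \<xi>: "\<xi> \<in> X" and Q: "Q > 0"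
 shows "(\<lambda>a. cnj (\<xi> a)) \<in> X"
proof -
 have "princ Q \<in> (\<lambda>\<psi> a. \<xi> a * \<psi> a) ` X"
  using char_group_mult_bij[OF X \<xi>] X by (simp add: bij_betw_def char_group_def)
 then obtain \<psi> where \<psi>: "\<psi> \<in> X" "princ Q = (\<lambda>a. \<xi> a * \<psi> a)" by auto
 have d: "dchar Q \<psi>" "dchar Q \<xi>" using X \<xi> \<psi> by (auto simp: char_group_def)
 have "\<psi> a = cnj (\<xi> a)" for a
 proof (cases "coprime a (int Q)")
  case True
  have "\<xi> a * \<psi> a = 1" using fun_cong[OF \<psi>(2), of a] True by (simp add: princ_def)
  moreover have "\<xi> a * cnj (\<xi> a) = 1" using dchar_norm[OF d(2) True Q] by (simp add: complex_norm_square[symmetric])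
  moreover have "\<xi> a \<noteq> 0" using True dchar_eq_0_iff[OF d(2), of a] by simp
  ultimately show ?thesis by (metis mult_left_cancel)
 next
  case False
  then show ?thesis using dchar_eq_0_iff[OF d(1), of a] dchar_eq_0_iff[OF d(2), of a] by simp
 qed
 then have "\<psi> = (\<lambda>a. cnj (\<xi> a))" by (rule ext)
 then show ?thesis using \<psi> by simp
qed

text \<open>A list, since \<open>dconvs\<close> folds over one. The enumeration is arbitrary, and
  the properties recorded in the next lemma do not depend on it.\<close>

definition nontriv :: "nat => (int => complex) set => (nat => complex) list" where
 "nontriv Q X = map (\<lambda>\<xi> n. \<xi> (int n)) (SOME xs. set xs = X - {princ Q} \<and> distinct xs)"

lemma nontriv:
 assumes "finite X"
 shows "set (nontriv Q X) = (\<lambda>\<xi> n. \<xi> (int n)) ` (X - {princ Q})"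
  "length (nontriv Q X) = card (X - {princ Q})"
  "(\<Sum>g\<leftarrow>nontriv Q X. h g) = (\<Sum>\<xi>\<in>X - {princ Q}. h (\<lambda>n. \<xi> (int n)) :: complex)"
  "(\<Prod>g\<leftarrow>nontriv Q X. h g) = (\<Prod>\<xi>\<in>X - {princ Q}. h (\<lambda>n. \<xi> (int n)) :: complex)"
proof -
 define xs where "xs = (SOME xs. set xs = X - {princ Q} \<and> distinct xs)"
 have "\<exists>xs. set xs = X - {princ Q} \<and> distinct xs" using assms by (intro finite_distinct_list) auto
 then have xs: "set xs = X - {princ Q}" "distinct xs" unfolding xs_def by (rule someI2_ex; blast)+
 have n: "nontriv Q X = map (\<lambda>\<xi> n. \<xi> (int n)) xs" by (simp add: nontriv_def xs_def)
 show "set (nontriv Q X) = (\<lambda>\<xi> n. \<xi> (int n)) ` (X - {princ Q})"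
  "length (nontriv Q X) = card (X - {princ Q})"
  "(\<Sum>g\<leftarrow>nontriv Q X. h g) = (\<Sum>\<xi>\<in>X - {princ Q}. h (\<lambda>n. \<xi> (int n)) :: complex)"
  "(\<Prod>g\<leftarrow>nontriv Q X. h g) = (\<Prod>\<xi>\<in>X - {princ Q}. h (\<lambda>n. \<xi> (int n)) :: complex)"
  using xs distinct_card[of xs] by (simp_all add: n o_def sum_list_distinct_conv_sum_set prod.distinct_set_conv_list[symmetric])
qed

definition famF :: "nat => (int => complex) set => nat => complex" where
 "famF Q X = dconvs (nontriv Q X)"

text \<open>Defined as a product of single values; \<open>famF_tendsto\<close> identifies it with
  the sum of the series of \<open>famF\<close> for \<open>s\<close> close to 1 or larger.\<close>

definition famL :: "nat => (int => complex) set => real => complex" where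
 "famL Q X s = (\<Prod>\<xi>\<in>X - {princ Q}. Lval (\<lambda>n. \<xi> (int n)) s)"

section \<open>Convolution families attached to a group of characters\<close>

locale char_fam =
 fixes Q :: nat and X :: "(int => complex) set"
 assumes X: "char_group Q X" and Q0: "Q > 0"
begin

lemma fin: "finite X" and princ_in: "princ Q \<in> X" and dch: "\<xi> \<in> X ==> dchar Q \<xi>"
 using X by (auto simp: char_group_def)

lemma cmult_fam: "\<xi> \<in> X ==> cmult (\<lambda>n. \<xi> (int n))"
 using dch[of \<xi>] by (simp add: cmult_def dchar_1 dchar_mult)

lemma cmult_nontriv: "g \<in> set (nontriv Q X) ==> cmult g"
 by (auto simp: nontriv(1)[OF fin] intro: cmult_fam)

lemma norm_nontriv: "g \<in> set (nontriv Q X) ==> norm (g n) <= 1"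
 using dchar_norm_le[OF dch Q0] by (auto simp: nontriv(1)[OF fin])

lemma partial_nontriv: "g \<in> set (nontriv Q X) ==> norm (\<Sum>k=1..n. g k) <= real Q"
 using dchar_partial_sum_le[OF dch _ Q0] trivial_char_iff[OF dch] by (auto simp: nontriv(1)[OF fin])

lemma length_nontriv: "length (nontriv Q X) = card X - 1"
 using fin princ_in by (simp add: nontriv(2))

lemma card_pos: "card X > 0"
 using fin princ_in by (auto simp: card_gt_0_iff)

text \<open>The list begins with the constant function 1 and not with the principal character, so at
  integers sharing a factor with \<open>Q\<close> the sum is 1 instead of 0. In all three cases it
  is nonnegative, which is what \<open>famf_nonneg\<close> needs.\<close>

lemma fam_sum:
 assumes "d > 0"
 shows "(\<Sum>g\<leftarrow>(\<lambda>_. 1) # nontriv Q X. g d) = (if coprime d Q \<and> (\<exists>\<xi>\<in>X. \<xi> (int d) \<noteq> 1) then 0 else if coprime d Q then of_nat (card X) else 1)"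
proof -
 have s: "(\<Sum>g\<leftarrow>(\<lambda>_. 1) # nontriv Q X. g d) = 1 + (\<Sum>\<xi>\<in>X - {princ Q}. \<xi> (int d))"
  by (simp add: nontriv(3)[OF fin])
 show ?thesis
 proof (cases "coprime d Q")
  case True
  then have c: "coprime (int d) (int Q)" by simp
  have "(\<Sum>\<xi>\<in>X. \<xi> (int d)) = princ Q (int d) + (\<Sum>\<xi>\<in>X - {princ Q}. \<xi> (int d))"
   by (rule sum.remove[OF fin princ_in])
  then show ?thesis unfolding s using char_group_sum[OF X c] True c
   by (cases "\<exists>\<xi>\<in>X. \<xi> (int d) \<noteq> 1") (simp_all add: princ_def)
 next
  case False
  then have "\<xi> (int d) = 0" if "\<xi> \<in> X" for \<xi> using dchar_eq_0_iff[OF dch[OF that], of "int d"] by simp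
  then have "(\<Sum>\<xi>\<in>X - {princ Q}. \<xi> (int d)) = 0" by (intro sum.neutral) auto
  then show ?thesis unfolding s using False by simp
 qed
qed

lemma famf_conv: "n > 0 ==> dconv (famF Q X) (\<lambda>_. 1) n = dconvs ((\<lambda>_. 1) # nontriv Q X) n"
 by (simp add: famF_def dconv_commute)

lemma cmult_all: "g \<in> set ((\<lambda>_. 1) # nontriv Q X) ==> cmult g"
 using cmult_nontriv by (auto simp: cmult_def)

lemma famf_nonneg: "n > 0 ==> dconv (famF Q X) (\<lambda>_. 1) n \<in> \<real>\<^sub>\<ge>\<^sub>0"
 unfolding famf_conv by (rule dconvs_nonneg[OF cmult_all]) (auto simp only: fam_sum split: if_splits intro: nonneg_Reals_zero_I nonneg_Reals_of_nat_I nonneg_Reals_one_I)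

lemma famf_1: "dconv (famF Q X) (\<lambda>_. 1) (Suc 0) = 1"
 using dconvs_1[of "(\<lambda>_. 1) # nontriv Q X", OF cmult_all] by (simp add: famf_conv del: dconvs.simps)

lemma famf_eq_0:
 assumes "prime p" "coprime p Q" "\<exists>\<xi>\<in>X. \<xi> (int p) \<noteq> 1" "n > 0" "p dvd n" "\<not> p ^ 2 dvd n"
 shows "dconv (famF Q X) (\<lambda>_. 1) n = 0"
 unfolding famf_conv[OF assms(4)]
 by (rule dconvs_eq_0_if_prime_exactly_divides[OF cmult_all assms(1) _ assms(4-6)])
   (use assms prime_gt_0_nat in \<open>simp_all only: fam_sum, simp\<close>)

lemma famF_real: "n > 0 ==> famF Q X n \<in> \<real>"
 using famf_nonneg by (intro Reals_of_dconv_one[of "famF Q X"]) auto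

lemma Lval_tail:
 assumes "g \<in> set (nontriv Q X)" "s > 0" "N >= 1"
 shows "norm (wsum s g N - Lval g s) <= real Q * (3 + s) * real N powr (- s)"
 by (rule Lval_bounded(2)[OF partial_nontriv[OF assms(1)] assms(2,3)])

lemma famL_eq: "famL Q X s = (\<Prod>g\<leftarrow>nontriv Q X. Lval g s)"
 by (simp add: famL_def nontriv(4)[OF fin])

lemma dtail_Lval:
 assumes "g \<in> set (nontriv Q X)" "s > 0" "t <= s"
 shows "dtail t (wt s g) (Lval g s)"
proof -
 have "dtail s (wt s g) (Lval g s)"
  unfolding dtail_def using Lval_tail[OF assms(1,2)] by blast
 then show ?thesis using assms(3) by (rule dtail_weaken)
qed

lemma famF_tendsto:
 assumes s: "1 - s < (1 / 2) / 4 ^ card X"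
 shows "(\<lambda>N. \<Sum>n=1..N. wt s (famF Q X) n) \<longlonglongrightarrow> famL Q X s"
proof -
 have "(1 / 2) / 4 ^ card X <= (1 / 2 :: real)" by (simp add: divide_le_eq)
 then have s2: "s > 1 / 2" using s by linarith
 have "dtail ((1 / 2) / 4 ^ length (nontriv Q X)) (wt s (famF Q X)) (famL Q X s)"
  unfolding famF_def famL_eq
  by (rule dtail_dconvs[of "1 / 2" s "card X"]) (use s s2 dtail_Lval norm_nontriv in \<open>auto simp: length_nontriv\<close>)
 then show ?thesis by (rule dtail_tendsto) simp
qed

text \<open>The factors may be complex, but the coefficients of \<open>famF\<close> are real and the
  reals are closed under limits.\<close>

lemma famL_real:
 assumes "1 - s < (1 / 2) / 4 ^ card X"
 shows "famL Q X s \<in> \<real>"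
proof (rule closed_sequentially[OF closed_complex_Reals _ famF_tendsto[OF assms]])
 show "wsum s (famF Q X) N \<in> \<real>" for N
  by (intro sum_in_Reals) (auto simp: wt_def intro!: Reals_mult famF_real)
qed

lemma zeta_dtail:
 assumes s: "s > 1"
 obtains z :: real where "dtail (s - 1) (wt s (\<lambda>_. 1)) (of_real z)" "0 < z" "z <= s / (s - 1)"
proof -
 define T where "T = (\<lambda>N. \<Sum>n=1..N. real n powr (- s))"
 have tl: "T M - T N <= real N powr (- (s - 1)) / (s - 1)" if "N >= 1" "N <= M" for M N
 proof -
  have "{1..M} = {1..N} \<union> {Suc N..M}" using that by auto
  then have "T M = T N + (\<Sum>n=Suc N..M. real n powr (- s))"
   unfolding T_def by (simp only:) (rule sum.union_disjoint, auto)
  also have "(\<Sum>n=Suc N..M. real n powr (- s)) <= (real N powr (- (s - 1)) - real M powr (- (s - 1))) / (s - 1)"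
   using sum_neg_powr_tail[of "s - 1" N M] s that by simp
  also have "... <= real N powr (- (s - 1)) / (s - 1)" using s by (intro divide_right_mono) auto
  finally show ?thesis by simp
 qed
 have mono: "T N <= T M" if "N <= M" for M N unfolding T_def using that by (intro sum_mono2) auto
 have T1: "T 1 = 1" by (simp add: T_def)
 have ub: "T M <= s / (s - 1)" for M
 proof -
  have "T M <= T (max 1 M)" by (intro mono) simp
  also have "... <= 1 + 1 / (s - 1)" using tl[of 1 "max 1 M"] T1 by simp
  also have "... = s / (s - 1)" using s by (simp add: field_simps)
  finally show ?thesis .
 qed
 obtain z where z: "T \<longlonglongrightarrow> z" "\<And>N. T N <= z"
  using incseq_convergent[of T "s / (s - 1)"] mono ub by (auto simp: incseq_def)
 show ?thesis
 proof (rule that)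
  show "0 < z" using z(2)[of 1] T1 by simp
  show "z <= s / (s - 1)" using z(1) ub by (intro LIMSEQ_le_const2) auto
  have "norm (wsum s (\<lambda>_. 1) N - of_real z) <= 1 / (s - 1) * real N powr (- (s - 1))" if N: "N >= 1" for N
  proof -
   have "z <= T N + real N powr (- (s - 1)) / (s - 1)"
    using tl[OF N] by (intro LIMSEQ_le_const2[OF z(1)]) (auto intro!: exI[of _ N] simp: algebra_simps)
   then have "\<bar>T N - z\<bar> <= real N powr (- (s - 1)) / (s - 1)" using z(2)[of N] by simp
   moreover have "wsum s (\<lambda>_. 1) N - of_real z = of_real (T N - z)" by (simp add: wt_one T_def)
   ultimately show ?thesis by (simp only: norm_of_real) simp
  qed
  then show "dtail (s - 1) (wt s (\<lambda>_. 1)) (of_real z)" unfolding dtail_def by blast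
 qed
qed

text \<open>To the right of 1 the product with zeta is a series with nonnegative terms and first
  term 1, hence at least 1, and zeta is at most \<open>s / (s - 1)\<close> there.\<close>

lemma famL_lower_right:
 assumes s: "s > 1"
 shows "Re (famL Q X s) >= (s - 1) / s"
proof -
 obtain z :: real where z: "dtail (s - 1) (wt s (\<lambda>_. 1)) (of_real z)" "0 < z" "z <= s / (s - 1)"
  using zeta_dtail[OF s] by metis
 define t where "t = min (1 / 2) (s - 1)"
 have t: "0 < t" "t <= 1 / 2" "t <= s - 1"
  unfolding t_def by (use s in simp) (rule min.cobounded1 min.cobounded2)+
 let ?gs = "(\<lambda>_. 1) # nontriv Q X"
 define L where "L = (\<lambda>g. if g = (\<lambda>_. 1) then of_real z else Lval g s)"
 \<comment> \<open>The constant function 1 has unbounded partial sums and so is none of the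
   nontrivial characters; the case distinction in \<open>L\<close> therefore assigns the zeta value
   to the first factor only.\<close>
 have one: "(\<lambda>_. 1) \<notin> set (nontriv Q X)"
 proof
  assume "(\<lambda>_. 1) \<in> set (nontriv Q X)"
  from partial_nontriv[OF this, of "Suc Q"] show False by (simp del: of_nat_Suc)
 qed
 have "dtail (t / 4 ^ length ?gs) (wt s (dconvs ?gs)) (\<Prod>g\<leftarrow>?gs. L g)"
 proof (rule dtail_dconvs[OF t(1,2) _ order_refl])
  have "0 < t / 4 ^ length ?gs" using t by simp
  then show "1 - s < t / 4 ^ length ?gs" using s by linarith
  show "dtail t (wt s g) (L g)" if "g \<in> set ?gs" for g
   using that one dtail_weaken[OF z(1) t(3)] dtail_Lval[of g s t] s t by (auto simp: L_def)
  show "norm (g n) <= 1" if "g \<in> set ?gs" for g n using that norm_nontriv by auto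
 qed
 moreover have "(\<Prod>g\<leftarrow>?gs. L g) = of_real z * famL Q X s"
 proof -
  have "map L (nontriv Q X) = map (\<lambda>g. Lval g s) (nontriv Q X)"
   using one by (intro map_cong refl) (auto simp: L_def)
  moreover have "(\<Prod>g\<leftarrow>?gs. L g) = of_real z * prod_list (map L (nontriv Q X))" by (simp add: L_def)
  ultimately show ?thesis unfolding famL_eq by (simp only:)
 qed
 ultimately have lim: "(\<lambda>N. \<Sum>n=1..N. wt s (dconvs ?gs) n) \<longlonglongrightarrow> of_real z * famL Q X s"
  using dtail_tendsto[of "t / 4 ^ length ?gs"] t by simp
 have "1 <= Re (of_real z * famL Q X s)"
 proof (rule LIMSEQ_le_const[OF tendsto_Re[OF lim]], intro exI[of _ 1] allI impI)
  fix N :: nat assume N: "1 <= N"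
  have nn: "0 <= Re (wt s (dconvs ?gs) n)" if "n >= 1" for n
   using famf_nonneg[of n] that famf_conv[of n] by (simp add: wt_def complex_nonneg_Reals_iff)
  have "1 = Re (wt s (dconvs ?gs) 1)" using famf_1 famf_conv[of 1] by (simp add: wt_def)
  also have "... = (\<Sum>n\<in>{1}. Re (wt s (dconvs ?gs) n))" by simp
  also have "... <= (\<Sum>n=1..N. Re (wt s (dconvs ?gs) n))" using N nn by (intro sum_mono2) auto
  finally show "1 <= Re (wsum s (dconvs ?gs) N)" by simp
 qed
 then have "1 <= z * Re (famL Q X s)" by simp
 then have "1 / z <= Re (famL Q X s)" using z(2) by (simp add: divide_le_eq mult.commute)
 moreover have "(s - 1) / s <= 1 / z" using z(2,3) s by (simp add: field_simps)
 ultimately show ?thesis by linarith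
qed

lemma Lval_bound:
 assumes g: "g \<in> set (nontriv Q X)" and s: "1 / 2 <= s" "s <= 2"
 shows "norm (Lval g s) <= 1 + 5 * real Q"
proof -
 have "norm (wsum s g 1 - Lval g s) <= real Q * (3 + s) * real 1 powr (- s)"
  using g s by (intro Lval_tail) auto
 also have "... <= real Q * 5" using s by (simp add: mult_left_mono)
 finally have "norm (wt s g 1 - Lval g s) <= real Q * 5" by simp
 moreover have "norm (wt s g 1) <= 1" using norm_nontriv[OF g, of 1] by (simp add: wt_def)
 moreover have "norm (Lval g s) <= norm (wt s g 1) + norm (wt s g 1 - Lval g s)"
  by (metis norm_minus_commute norm_triangle_sub)
 ultimately show ?thesis by linarith
qed

lemma Lval_continuous:
 assumes g: "g \<in> set (nontriv Q X)"
 shows "continuous_on {1 / 2..2} (Lval g)"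
proof (rule uniform_limit_theorem[where F = sequentially and f = "\<lambda>N s. \<Sum>n=1..N. wt s g n"])
 show "\<forall>\<^sub>F N in sequentially. continuous_on {1 / 2..2} (\<lambda>s. \<Sum>n=1..N. wt s g n)"
  unfolding wt_def by (intro always_eventually allI continuous_intros) auto
 show "uniform_limit {1 / 2..2} (\<lambda>N s. \<Sum>n=1..N. wt s g n) (Lval g) sequentially"
 proof (rule uniform_limitI)
  fix e :: real assume e: "e > 0"
  have "(\<lambda>N. real Q * 5 * real N powr (- (1 / 2))) \<longlonglongrightarrow> 0" by (rule powr_neg_tendsto_0) simp
  then have "\<forall>\<^sub>F N in sequentially. real Q * 5 * real N powr (- (1 / 2)) < e" using e by (rule order_tendstoD)
  moreover have "\<forall>\<^sub>F N in sequentially. N >= (1::nat)" by (rule eventually_ge_at_top)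
  ultimately show "\<forall>\<^sub>F N in sequentially. \<forall>s\<in>{1 / 2..2}. dist (wsum s g N) (Lval g s) < e"
  proof eventually_elim
   case (elim N)
   show ?case
   proof
    fix s :: real assume s: "s \<in> {1 / 2..2}"
    then have "dist (wsum s g N) (Lval g s) <= real Q * (3 + s) * real N powr (- s)"
     unfolding dist_norm using g elim by (intro Lval_tail) auto
    also have "... <= real Q * 5 * real N powr (- (1 / 2))"
     using s elim by (intro mult_mono powr_mono) auto
    finally show "dist (wsum s g N) (Lval g s) < e" using elim by linarith
   qed
  qed
 qed
qed simp

lemma famL_continuous: "continuous_on {1 / 2..2} (famL Q X)"
 unfolding famL_def by (intro continuous_on_prod) (auto intro!: Lval_continuous simp: nontriv(1)[OF fin])

end

section \<open>Removing Euler factors\<close>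

lemma coprime_Suc_mult: "coprime (j * Q + 1) (Q :: nat)"
proof (rule coprimeI)
 fix c assume "c dvd j * Q + 1" "c dvd Q"
 then show "c dvd 1" by (metis dvd_add_right_iff dvd_mult)
qed

lemma frac_le_cross:
 fixes a b c d :: real
 shows "a * d <= c * b ==> b > 0 ==> d > 0 ==> a / b <= c / d"
 by (simp add: divide_le_eq le_divide_eq)

text \<open>On partial sums, removing the multiples of \<open>p\<close> subtracts
  \<open>g p * p powr (- s)\<close> times the sum up to \<open>N div p\<close>. The limit acquires
  the Euler factor at \<open>p\<close> without any appeal to absolute convergence.\<close>

lemma drop_prime_tendsto:
 assumes p: "prime p" and g: "cmult g" and L: "(\<lambda>N. \<Sum>n=1..N. wt s g n) \<longlonglongrightarrow> L"
 shows "(\<lambda>N. \<Sum>n=1..N. wt s (\<lambda>n. if p dvd n then 0 else g n) n) \<longlonglongrightarrow> L * (1 - g p * of_real (real p powr (- s)))"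
proof -
 have p0: "p > 0" using p prime_gt_0_nat by blast
 define T where "T = (\<lambda>N. \<Sum>n=1..N. wt s g n)"
 have eq: "wsum s (\<lambda>n. if p dvd n then 0 else g n) N = T N - g p * of_real (real p powr (- s)) * T (N div p)" for N
 proof -
  have "T N = wsum s (\<lambda>n. if p dvd n then 0 else g n) N + (\<Sum>n=1..N. if p dvd n then wt s g n else 0)"
   unfolding T_def sum.distrib[symmetric] by (intro sum.cong refl) (auto simp: wt_def)
  also have "(\<Sum>n=1..N. if p dvd n then wt s g n else 0) = (\<Sum>n\<in>{n\<in>{1..N}. p dvd n}. wt s g n)"
   by (rule sum.inter_filter[symmetric]) simp
  also have "... = (\<Sum>m=1..N div p. wt s g (p * m))"
   by (rule sum.reindex_bij_witness[of _ "\<lambda>m. p * m" "\<lambda>n. n div p"])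
     (use p0 in \<open>auto simp: less_eq_div_iff_mult_less_eq mult.commute div_le_mono elim!: dvdE\<close>)
  also have "... = g p * of_real (real p powr (- s)) * T (N div p)"
   unfolding T_def sum_distrib_left using g
   by (intro sum.cong refl) (simp add: wt_def cmult_def powr_mult mult_ac)
  finally show ?thesis by simp
 qed
 have "filterlim (\<lambda>N. N div p) sequentially sequentially"
  using filterlim_at_top_div_const_nat[OF p0] .
 then have "(\<lambda>N. T (N div p)) \<longlonglongrightarrow> L" using L unfolding T_def by (rule filterlim_compose[rotated])
 then have "(\<lambda>N. T N - g p * of_real (real p powr (- s)) * T (N div p)) \<longlonglongrightarrow> L - g p * of_real (real p powr (- s)) * L"
  using L unfolding T_def by (intro tendsto_intros)
 then show ?thesis unfolding eq by (simp add: algebra_simps)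
qed

lemma drop_primes_tendsto:
 assumes P: "finite P" "\<And>p. p \<in> P ==> prime p" and g: "cmult g" and L: "(\<lambda>N. \<Sum>n=1..N. wt s g n) \<longlonglongrightarrow> L"
 shows "(\<lambda>N. \<Sum>n=1..N. wt s (\<lambda>n. if \<exists>p\<in>P. p dvd n then 0 else g n) n)
   \<longlonglongrightarrow> L * (\<Prod>p\<in>P. 1 - g p * of_real (real p powr (- s)))"
 using P
proof (induction P rule: finite_induct)
 case empty
 then show ?case using L by simp
next
 case (insert q P)
 define h where "h = (\<lambda>n. if \<exists>p\<in>P. p dvd n then 0 else g n)"
 have "p dvd a * b \<longleftrightarrow> p dvd a \<or> p dvd b" if "p \<in> P" for p a b
  using insert.prems that by (intro prime_dvd_mult_iff) auto
 moreover have "\<not> p dvd 1" if "p \<in> P" for p using insert.prems[of p] that by (auto simp: prime_nat_iff)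
 ultimately have h: "cmult h" using g by (auto simp: cmult_def h_def)
 have lim: "(\<lambda>N. \<Sum>n=1..N. wt s h n) \<longlonglongrightarrow> L * (\<Prod>p\<in>P. 1 - g p * of_real (real p powr (- s)))"
  unfolding h_def using insert by auto
 have "h q = g q"
  using insert by (auto simp: h_def) (metis insertI1 insertI2 primes_dvd_imp_eq)
 moreover have "(\<lambda>n. if q dvd n then 0 else h n) = (\<lambda>n. if \<exists>p\<in>insert q P. p dvd n then 0 else g n)"
  by (auto simp: h_def)
 ultimately show ?case
  using drop_prime_tendsto[OF insert.prems[OF insertI1] h lim] insert.hyps by (simp add: mult_ac)
qed

text \<open>\<open>E\<close> is the finite Euler product over the primes dividing \<open>m\<close>;
  each of its factors has norm at most 2. The bound is crude but depends on \<open>m\<close> alone,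
  and \<open>m\<close> will be the modulus of the fixed exceptional group.\<close>

lemma Lval_lift:
 assumes \<xi>: "dchar Q \<xi>" "\<xi> \<noteq> princ Q" and Q: "Q > 0" and m: "m > 0" and s: "s > 0"
 obtains E :: complex where "norm E <= 2 ^ m"
  "Lval (\<lambda>n. \<xi> (int n) * princ m (int n)) s = Lval (\<lambda>n. \<xi> (int n)) s * E"
proof -
 let ?P = "prime_factors m" and ?g = "\<lambda>n. \<xi> (int n)"
 have cm: "cmult ?g" using \<xi>(1) by (simp add: cmult_def dchar_1 dchar_mult)
 have nt: "\<not> trivial_char Q \<xi>" using \<xi> trivial_char_iff by blast
 have lim: "(\<lambda>N. \<Sum>n=1..N. wt s ?g n) \<longlonglongrightarrow> Lval ?g s"
  by (rule Lval_bounded(1)[OF dchar_partial_sum_le[OF \<xi>(1) nt Q] s order_refl])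
 have eq: "(\<lambda>n. if \<exists>p\<in>?P. p dvd n then 0 else ?g n) n = ?g n * princ m (int n)" if "n > 0" for n
 proof -
  have "coprime n m \<longleftrightarrow> \<not> (\<exists>p\<in>?P. p dvd n)"
  proof
   assume c: "coprime n m"
   show "\<not> (\<exists>p\<in>?P. p dvd n)"
   proof
    assume "\<exists>p\<in>?P. p dvd n"
    then obtain p where p: "prime p" "p dvd m" "p dvd n" by (auto simp: in_prime_factors_iff)
    have "p = 1" using coprime_common_divisor_nat[OF c p(3,2)] by simp
    then show False using p(1) by simp
   qed
  next
   assume np: "\<not> (\<exists>p\<in>?P. p dvd n)"
   show "coprime n m"
   proof (rule ccontr)
    assume "\<not> coprime n m"
    then have "gcd n m \<noteq> 1" using coprime_iff_gcd_eq_1 by blast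
    then obtain p where "prime p" "p dvd gcd n m" using prime_factor_nat by blast
    then show False using np m by (auto simp: in_prime_factors_iff)
   qed
  qed
  then show ?thesis by (simp add: princ_def)
 qed
 define E where "E = (\<Prod>p\<in>?P. 1 - ?g p * of_real (real p powr (- s)))"
 have "(\<lambda>N. \<Sum>n=1..N. wt s (\<lambda>n. if \<exists>p\<in>?P. p dvd n then 0 else ?g n) n) \<longlonglongrightarrow> Lval ?g s * E"
  unfolding E_def by (rule drop_primes_tendsto[OF _ _ cm lim]) (auto simp: in_prime_factors_iff)
 moreover have "(wsum s (\<lambda>n. if \<exists>p\<in>?P. p dvd n then 0 else ?g n) N)
   = (wsum s (\<lambda>n. ?g n * princ m (int n)) N)" for N
  unfolding wt_def using eq by (intro sum.cong refl) simp
 ultimately have "(\<lambda>N. \<Sum>n=1..N. wt s (\<lambda>n. ?g n * princ m (int n)) n) \<longlonglongrightarrow> Lval ?g s * E" by simp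
 then have 1: "Lval (\<lambda>n. ?g n * princ m (int n)) s = Lval ?g s * E" unfolding Lval_def by (rule limI)
 have "norm E <= (\<Prod>p\<in>?P. 2)"
  unfolding E_def prod_norm[symmetric]
 proof (intro prod_mono conjI norm_ge_zero)
  fix p assume p: "p \<in> ?P"
  then have "p >= 1" using prime_ge_1_nat[of p] by (simp add: in_prime_factors_iff)
  then have "real p powr (- s) <= real p powr 0" using s by (intro powr_mono) auto
  also have "... <= 1" by simp
  finally have "norm (?g p) * real p powr (- s) <= 1 * 1" using dchar_norm_le[OF \<xi>(1) Q] by (intro mult_mono) auto
  then have "norm (?g p * of_real (real p powr (- s))) <= 1" by (simp add: norm_mult)
  then show "norm (1 - ?g p * of_real (real p powr (- s))) <= 2"
   using norm_triangle_ineq4[of 1 "?g p * of_real (real p powr (- s))"] by simp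
 qed
 also have "... = 2 ^ card ?P" by simp
 also have "... <= 2 ^ m"
 proof (rule power_increasing)
  have "?P \<subseteq> {1..m}"
  proof
   fix p assume "p \<in> ?P"
   then have "prime p" "p dvd m" by (auto simp: in_prime_factors_iff)
   then show "p \<in> {1..m}" using prime_ge_1_nat[of p] dvd_imp_le[of p m] m by simp
  qed
  then show "card ?P <= m" using card_mono[of "{1..m}" ?P] by simp
 qed simp
 finally have 2: "norm E <= 2 ^ m" .
 show ?thesis by (rule that[OF 2 1])
qed

section \<open>Nonvanishing at 1\<close>

context char_fam begin

text \<open>If the value at 1 is 0, the partial sums of the series at 1 are themselves tails, of
  size \<open>1 / n\<close>. A second partial summation with weights
  \<open>n powr (- \<sigma>)\<close> then gains the factor \<sigma>.\<close>

lemma vanishing_imp_small: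
 assumes g: "g \<in> set (nontriv Q X)" and L: "Lval g 1 = 0" and \<sigma>: "0 < \<sigma>"
 shows "norm (Lval g (1 + \<sigma>)) <= 8 * real Q * \<sigma>"
proof -
 define T where "T = (\<lambda>N. \<Sum>n=1..N. wt 1 g n)"
 have T: "norm (T n) <= 4 * real Q * real n powr (- 1)" if "n >= 1" for n
  using Lval_tail[OF g _ that, of 1] L by (simp add: T_def mult.commute)
 have wt2: "wt (1 + \<sigma>) g n = wt \<sigma> (wt 1 g) n" for n
 proof -
  have "real n powr (- (1 + \<sigma>)) = real n powr (- 1) * real n powr (- \<sigma>)"
   unfolding powr_add[symmetric] by (rule arg_cong[where f = "(powr) (real n)"]) simp
  then show ?thesis by (simp add: wt_def)
 qed
 have "norm (wsum (1 + \<sigma>) g M) <= 8 * real Q * \<sigma> + 4 * real Q * real M powr (- 1)" if M: "M >= 1" for M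
 proof -
  let ?d = "\<lambda>n. T n * of_real (real n powr (- \<sigma>) - real (Suc n) powr (- \<sigma>))"
  have "real M powr (- \<sigma>) <= real M powr 0" using M \<sigma> by (intro powr_mono) auto
  then have "norm (T M) * real M powr (- \<sigma>) <= norm (T M) * 1" using M by (intro mult_left_mono) auto
  then have 1: "norm (T M * of_real (real M powr (- \<sigma>))) <= 4 * real Q * real M powr (- 1)"
   using T[OF M] by (simp add: norm_mult)
  have "norm (\<Sum>n=1..<M. ?d n) <= (\<Sum>n=1..<M. 4 * real Q * \<sigma> * real n powr (- 2))"
  proof (rule sum_norm_le)
   fix n assume n: "n \<in> {1..<M}"
   have "real (Suc n) powr (- \<sigma>) <= real n powr (- \<sigma>)" using n \<sigma> by (intro powr_mono2') auto
   then have "\<bar>real n powr (- \<sigma>) - real (Suc n) powr (- \<sigma>)\<bar> <= \<sigma> * real n powr (- \<sigma> - 1)"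
    using powr_neg_diff(1)[of \<sigma> "real n"] n \<sigma> by (simp add: add.commute)
   also have "... <= \<sigma> * real n powr (- 1)" using n \<sigma> by (intro mult_left_mono powr_mono) auto
   finally have "norm (?d n) <= (4 * real Q * real n powr (- 1)) * (\<sigma> * real n powr (- 1))"
    unfolding norm_mult norm_of_real using T[of n] n by (intro mult_mono) auto
   also have "... = 4 * real Q * \<sigma> * (real n powr (- 1) * real n powr (- 1))" by (simp only: mult_ac)
   also have "real n powr (- 1) * real n powr (- 1) = real n powr (- 2)" unfolding powr_add[symmetric] by simp
   finally show "norm (?d n) <= 4 * real Q * \<sigma> * real n powr (- 2)" .
  qed
  also have "... <= (\<Sum>n=1..M. 4 * real Q * \<sigma> * real n powr (- 2))" using \<sigma> by (intro sum_mono2) auto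
  also have "... = 4 * real Q * \<sigma> * (1 + (\<Sum>n=Suc 1..M. real n powr (- 1 - 1)))"
   using M by (simp add: sum_distrib_left[symmetric] sum.atLeast_Suc_atMost)
  also have "... <= 4 * real Q * \<sigma> * 2"
  proof (rule mult_left_mono)
   have "(\<Sum>n=Suc 1..M. real n powr (- 1 - 1)) <= 1"
    by (rule order_trans[OF sum_neg_powr_tail[of 1 1 M]]) (use M in simp_all)
   then show "1 + (\<Sum>n=Suc 1..M. real n powr (- 1 - 1)) <= 2" by linarith
  qed (use \<sigma> in simp)
  finally have 2: "norm (\<Sum>n=1..<M. ?d n) <= 8 * real Q * \<sigma>" by simp
  have "wsum (1 + \<sigma>) g M = T M * of_real (real M powr (- \<sigma>)) + (\<Sum>n=1..<M. ?d n)"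
  proof -
   have "wt \<sigma> (wt 1 g) (Suc 0) = wt 1 g (Suc 0)" by (simp add: wt_def)
   then show ?thesis using wt_summation_by_parts[OF M, of \<sigma> "wt 1 g"] by (simp add: wt2 T_def)
  qed
  then show ?thesis using norm_triangle_mono[OF 1 2] by (simp only: add.commute)
 qed
 moreover have "(\<lambda>M. 8 * real Q * \<sigma> + 4 * real Q * real M powr (- 1)) \<longlonglongrightarrow> 8 * real Q * \<sigma> + 0"
  by (intro tendsto_intros powr_neg_tendsto_0) simp
 moreover have "(\<lambda>M. norm (wsum (1 + \<sigma>) g M)) \<longlonglongrightarrow> norm (Lval g (1 + \<sigma>))"
  using \<sigma> by (intro tendsto_norm Lval_bounded(1)[OF partial_nontriv[OF g] _ order_refl]) simp
 ultimately show ?thesis by (intro LIMSEQ_le[of _ _ _ "8 * real Q * \<sigma> + 0", simplified]) auto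
qed

lemma in_nontriv: "\<xi> \<in> X - {princ Q} ==> (\<lambda>n. \<xi> (int n)) \<in> set (nontriv Q X)"
 by (auto simp: nontriv(1)[OF fin])

lemma Lval_nontriv_tendsto: "g \<in> set (nontriv Q X) ==> s > 0 ==> (\<lambda>N. \<Sum>n=1..N. wt s g n) \<longlonglongrightarrow> Lval g s"
 by (rule Lval_bounded(1)[OF partial_nontriv _ order_refl])

text \<open>The value at the conjugate character is the conjugate value, so a character that is not
  real produces two vanishing factors in \<open>famL\<close>. This makes the product of order
  \<sigma>\<open>^ 2\<close> at 1 + \<sigma>, against the lower bound of order \<sigma>.\<close>

lemma vanishing_imp_real:
 assumes \<xi>: "\<xi> \<in> X - {princ Q}" and L: "Lval (\<lambda>n. \<xi> (int n)) 1 = 0"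
 shows "cnj (\<xi> a) = \<xi> a"
proof (rule ccontr)
 assume "cnj (\<xi> a) \<noteq> \<xi> a"
 define \<psi> where "\<psi> = (\<lambda>a. cnj (\<xi> a))"
 have ne: "\<psi> \<noteq> \<xi>"
 proof
  assume "\<psi> = \<xi>"
  from fun_cong[OF this, of a] show False using \<open>cnj (\<xi> a) \<noteq> \<xi> a\<close> by (simp add: \<psi>_def)
 qed
 have "\<psi> \<noteq> princ Q"
 proof
  assume "\<psi> = princ Q"
  have "\<xi> x = princ Q x" for x
  proof -
   have "cnj (\<xi> x) = princ Q x" using fun_cong[OF \<open>\<psi> = princ Q\<close>, of x] by (simp add: \<psi>_def)
   then have "cnj (cnj (\<xi> x)) = cnj (princ Q x)" by (rule arg_cong)
   then show ?thesis by (simp add: princ_def)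
  qed
  then show False using \<xi> by blast
 qed
 then have \<psi>: "\<psi> \<in> X - {princ Q}" unfolding \<psi>_def using char_group_cnj[OF X _ Q0] \<xi> by auto
 have "(\<lambda>N. \<Sum>n=1..N. wt 1 (\<lambda>n. \<psi> (int n)) n) \<longlonglongrightarrow> Lval (\<lambda>n. \<psi> (int n)) 1"
  by (intro Lval_nontriv_tendsto in_nontriv \<psi>) simp
 moreover have "(\<lambda>N. cnj (wsum 1 (\<lambda>n. \<xi> (int n)) N)) \<longlonglongrightarrow> cnj (Lval (\<lambda>n. \<xi> (int n)) 1)"
  by (intro tendsto_cnj Lval_nontriv_tendsto in_nontriv \<xi>) simp
 moreover have "cnj (wsum 1 (\<lambda>n. \<xi> (int n)) N) = (wsum 1 (\<lambda>n. \<psi> (int n)) N)" for N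
  by (simp add: wt_def \<psi>_def)
 ultimately have L2: "Lval (\<lambda>n. \<psi> (int n)) 1 = 0" using L by (simp add: LIMSEQ_unique)
 define D where "D = (8 * real Q) ^ 2 * (1 + 5 * real Q) ^ card X"
 have D1: "D >= 1"
 proof -
  have "1 * 1 <= D" unfolding D_def using Q0 by (intro mult_mono one_le_power) auto
  then show ?thesis by simp
 qed
 \<comment> \<open>The lower bound is then at least \<sigma>\<open>/ 2\<close>, while the double
   zero gives at most \<open>D * \<sigma> * \<sigma> = \<sigma> / 3\<close>.\<close>
 define \<sigma> where "\<sigma> = 1 / (3 * D)"
 have \<sigma>: "0 < \<sigma>" "\<sigma> <= 1" using D1 by (auto simp: \<sigma>_def)
 have "\<sigma> / 2 <= \<sigma> / (1 + \<sigma>)" using \<sigma> by (intro frac_le) auto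
 also have "... = (1 + \<sigma> - 1) / (1 + \<sigma>)" by simp
 also have "... <= Re (famL Q X (1 + \<sigma>))" by (rule famL_lower_right) (use \<sigma> in simp)
 also have "... <= norm (famL Q X (1 + \<sigma>))" by (rule complex_Re_le_cmod)
 also have "... <= D * (\<sigma> * \<sigma>)"
 proof -
  let ?L = "\<lambda>\<xi>. Lval (\<lambda>n. \<xi> (int n)) (1 + \<sigma>)"
  have fin': "finite (X - {princ Q})" "finite (X - {princ Q} - {\<xi>})" using fin by auto
  have "famL Q X (1 + \<sigma>) = ?L \<xi> * (?L \<psi> * (\<Prod>\<phi>\<in>X - {princ Q} - {\<xi>} - {\<psi>}. ?L \<phi>))"
   unfolding famL_def using fin' \<xi> \<psi> ne
   by (subst prod.remove[of _ \<xi>], simp, simp, subst prod.remove[of _ \<psi>]) auto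
  then have "norm (famL Q X (1 + \<sigma>)) = norm (?L \<xi>) * (norm (?L \<psi>) * (\<Prod>\<phi>\<in>X - {princ Q} - {\<xi>} - {\<psi>}. norm (?L \<phi>)))"
   by (simp add: norm_mult prod_norm)
  also have "... <= (8 * real Q * \<sigma>) * ((8 * real Q * \<sigma>) * (1 + 5 * real Q) ^ card X)"
  proof (rule mult_mono[OF _ mult_mono])
   show "norm (?L \<xi>) <= 8 * real Q * \<sigma>"
    by (rule vanishing_imp_small[OF in_nontriv[OF \<xi>] L \<sigma>(1)])
   show "norm (?L \<psi>) <= 8 * real Q * \<sigma>"
    by (rule vanishing_imp_small[OF in_nontriv[OF \<psi>] L2 \<sigma>(1)])
   have "(\<Prod>\<phi>\<in>X - {princ Q} - {\<xi>} - {\<psi>}. norm (?L \<phi>)) <= (\<Prod>\<phi>\<in>X - {princ Q} - {\<xi>} - {\<psi>}. 1 + 5 * real Q)"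
    using \<sigma> by (intro prod_mono conjI norm_ge_zero Lval_bound in_nontriv) auto
   also have "... = (1 + 5 * real Q) ^ card (X - {princ Q} - {\<xi>} - {\<psi>})" by simp
   also have "... <= (1 + 5 * real Q) ^ card X" using fin by (intro power_increasing card_mono) auto
   finally show "(\<Prod>\<phi>\<in>X - {princ Q} - {\<xi>} - {\<psi>}. norm (?L \<phi>)) <= (1 + 5 * real Q) ^ card X" .
  qed (use \<sigma> in \<open>auto intro!: mult_nonneg_nonneg prod_nonneg\<close>)
  also have "... = D * (\<sigma> * \<sigma>)" by (simp only: D_def power2_eq_square mult_ac)
  finally show ?thesis .
 qed
 also have "D * (\<sigma> * \<sigma>) = \<sigma> / 3" using D1 by (simp add: \<sigma>_def)
 finally show False using \<sigma> by simp
qed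

text \<open>For a real character \<open>g\<close> the convolution \<open>f\<close> with 1 is
  nonnegative and at least 1 at squares coprime to \<open>Q\<close>, so the sums of
  \<open>f n / sqrt n\<close> grow at least like a logarithm. A zero at 1 would cancel the main term
  and keep these sums bounded.\<close>

lemma real_nonvanishing:
 assumes \<xi>: "\<xi> \<in> X - {princ Q}" and re: "\<And>a. cnj (\<xi> a) = \<xi> a"
 shows "Lval (\<lambda>n. \<xi> (int n)) 1 \<noteq> 0"
proof
 define g where "g = (\<lambda>n. \<xi> (int n))"
 assume "Lval (\<lambda>n. \<xi> (int n)) 1 = 0"
 then have L: "Lval g 1 = 0" by (simp add: g_def)
 have g: "g \<in> set (nontriv Q X)" unfolding g_def by (rule in_nontriv[OF \<xi>])
 have d: "dchar Q \<xi>" using dch \<xi> by auto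
 have sq: "g (m ^ 2) = 1" if "coprime m Q" for m
 proof -
  have "g (m ^ 2) = \<xi> (int m) * cnj (\<xi> (int m))" unfolding g_def re by (simp add: power2_eq_square dchar_mult[OF d])
  also have "... = 1" using dchar_norm[OF d _ Q0, of "int m"] that by (simp add: complex_norm_square[symmetric])
  finally show ?thesis .
 qed
 have pos: "1 + g n \<in> \<real>\<^sub>\<ge>\<^sub>0" for n
 proof -
  have "g n \<in> \<real>" unfolding g_def using re by (simp add: Reals_cnj_iff)
  then obtain r where r: "g n = of_real r" by (auto elim: Reals_cases)
  then have "\<bar>r\<bar> <= 1" using norm_nontriv[OF g, of n] by simp
  then have "1 + r >= 0" by linarith
  moreover have "1 + g n = of_real (1 + r)" by (simp add: r)
  ultimately show ?thesis by (simp only: nonneg_Reals_of_real_iff)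
 qed
 have cm: "cmult g" using cmult_nontriv[OF g] .
 define f where "f = dconv g (\<lambda>_. 1)"
 have f: "f n = dconvs [\<lambda>_. 1, g] n" if "n > 0" for n
 proof -
  have "dconvs [\<lambda>_. 1, g] n = dconv (\<lambda>_. 1) g n" using that by (auto intro!: dconv_cong dconv_dunit)
  then show ?thesis using that by (simp add: f_def dconv_commute)
 qed
 have fnn: "Re (f n) >= 0" if "n > 0" for n
 proof -
  have "dconvs [\<lambda>_. 1, g] n \<in> \<real>\<^sub>\<ge>\<^sub>0"
   by (rule dconvs_nonneg) (use cm pos that in \<open>auto simp: cmult_def\<close>)
  then show ?thesis using f[OF that] by (simp add: complex_nonneg_Reals_iff)
 qed
 have fsq: "Re (f (m ^ 2)) >= 1" if "m > 0" "coprime m Q" for m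
 proof -
  have "Re (dconvs [\<lambda>_. 1, g] (m ^ 2)) >= 1"
   by (rule sum_even_squares_lower[OF cm that(1)]) (use pos sq that coprime_divisors[of _ m Q Q] in auto)
  then show ?thesis using f[of "m ^ 2"] that by simp
 qed
 obtain z where z: "zeta_const (1 / 2) z" using zeta_const_exists[of "1 / 2"] by auto
 define M where "M = 4 + 24 * real Q + \<bar>z\<bar> * (1 + 9 * real Q)"
 \<comment> \<open>At exponent 1/2 and length \<open>U ^ 2\<close> the first main term is
   \<open>2 * U\<close> times the truncated series at 1. If that series has sum 0, the truncation is
   of size \<open>1 / U\<close>, and the term stays bounded.\<close>
 have up: "Re (wsum (1 / 2) f (U ^ 2)) <= M" if U: "U >= 1" for U
 proof -
  have Uh: "real U powr (- (1 / 2)) <= 1" using U powr_mono[of "- (1 / 2)" 0 "real U"] by simp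
  let ?O = "wsum 1 g U"
  let ?P = "wsum (1 / 2) g U"
  let ?S = "wsum (1 / 2) f (U ^ 2)"
  have UU: "real (U ^ 2) powr (1 / 2) = real U" "real (U ^ 2) powr (- (1 / 2)) = 1 / real U"
   using U by (simp_all add: powr_half_sqrt powr_minus_divide)
  have tl: "norm (wsum (1 / 2) g K - Lval g (1 / 2)) <= 4 * real Q * real U powr (- (1 / 2))" if "K >= U" for K
  proof -
   have "norm (wsum (1 / 2) g K - Lval g (1 / 2)) <= real Q * (3 + 1 / 2) * real K powr (- (1 / 2))"
    using that U by (intro Lval_tail g) auto
   also have "... <= real Q * 4 * real U powr (- (1 / 2))" using that U by (intro mult_mono powr_mono2') auto
   finally show ?thesis by simp
  qed
  have D: "norm (wsum (1 / 2) g K - ?P) <= 8 * real Q * real U powr (- (1 / 2))" if "K >= U" for K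
  proof -
   from tl[OF that] tl[OF order_refl]
   show ?thesis
    using norm_triangle_ineq4[of "wsum (1 / 2) g K - Lval g (1 / 2)" "?P - Lval g (1 / 2)"] by simp
  qed
  let ?M = "of_real (real (U ^ 2) powr (1 - 1 / 2) / (1 - 1 / 2)) * ?O + of_real z * ?P"
  have "norm (?S - ?M)
    <= 4 * real (U ^ 2) powr (- (1 / 2)) * (\<Sum>n=1..U. norm (g n)) + 8 * real Q * real U powr (- (1 / 2)) * (real (U ^ 2) / real U) powr (1 - 1 / 2) / (1 - 1 / 2)"
   unfolding f_def by (rule wt_dconv_one_asymptotic[OF _ _ z U _ D]) (use U in \<open>simp_all add: power2_eq_square\<close>)
  also have "real (U ^ 2) / real U = real U" using U by (simp add: power2_eq_square)
  also have "8 * real Q * real U powr (- (1 / 2)) * real U powr (1 - 1 / 2) / (1 - 1 / 2) = 16 * real Q * (real U powr (- (1 / 2)) * real U powr (1 / 2))" by simp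
  also have "real U powr (- (1 / 2)) * real U powr (1 / 2) = 1" using U by (simp add: powr_add[symmetric])
  also have "4 * real (U ^ 2) powr (- (1 / 2)) * (\<Sum>n=1..U. norm (g n)) <= 4 * (1 / real U) * (\<Sum>n=1..U. 1)"
   unfolding UU(2) using norm_nontriv[OF g] by (intro mult_left_mono sum_mono) auto
  also have "... = 4" using U by simp
  finally have 1: "norm (?S - ?M) <= 4 + 16 * real Q" by simp
  have "norm ?O <= real Q * 4 * real U powr (- 1)"
   using Lval_tail[OF g, of 1 U] L U by simp
  then have "(2 * real U) * norm ?O <= (2 * real U) * (real Q * 4 * real U powr (- 1))" by (intro mult_left_mono) auto
  also have "... = 8 * real Q" using U by (simp add: powr_minus_divide)
  finally have 2: "(2 * real U) * norm ?O <= 8 * real Q" .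
  have 3: "norm ?P <= 1 + 9 * real Q"
  proof -
   have "4 * real Q * real U powr (- (1 / 2)) <= 4 * real Q * 1" using Uh by (intro mult_left_mono) auto
   then have "norm (?P - Lval g (1 / 2)) <= 4 * real Q" using tl[OF order_refl] by linarith
   moreover have "norm (Lval g (1 / 2)) <= 1 + 5 * real Q" using g by (intro Lval_bound) auto
   moreover have "norm ?P <= norm (?P - Lval g (1 / 2)) + norm (Lval g (1 / 2))"
    using norm_triangle_ineq[of "?P - Lval g (1 / 2)" "Lval g (1 / 2)"] by simp
   ultimately show ?thesis by linarith
  qed
  have "norm ?M <= (2 * real U) * norm ?O + \<bar>z\<bar> * norm ?P"
  proof -
   have "1 - 1 / 2 = (1 / 2 :: real)" by simp
   then have "real (U ^ 2) powr (1 - 1 / 2) / (1 - 1 / 2) = 2 * real U" by (simp only: UU(1)) simp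
   then show ?thesis by (simp only:) (rule order_trans[OF norm_triangle_ineq], simp add: norm_mult)
  qed
  also have "... <= 8 * real Q + \<bar>z\<bar> * (1 + 9 * real Q)" using 2 3 by (intro add_mono mult_left_mono) auto
  finally have "norm ?M <= 8 * real Q + \<bar>z\<bar> * (1 + 9 * real Q)" .
  moreover have "norm ?S <= norm (?S - ?M) + norm ?M"
   using norm_triangle_ineq[of "?S - ?M" ?M] by (simp only: diff_add_cancel)
  ultimately have "norm ?S <= (4 + 16 * real Q) + (8 * real Q + \<bar>z\<bar> * (1 + 9 * real Q))" using 1 by linarith
  then have "norm ?S <= M" by (simp add: M_def)
  then show ?thesis using complex_Re_le_cmod order_trans by blast
 qed
 \<comment> \<open>The integers \<open>j * Q + 1\<close> are coprime to \<open>Q\<close>, so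
   \<open>f\<close> is at least 1 at their squares; the terms there dominate
   \<open>1 / (2 * Q * j)\<close>, a harmonic series.\<close>
 have lo: "ln (real J + 1) <= 2 * real Q * M" for J
 proof -
  define U where "U = J * Q + 1"
  let ?m = "\<lambda>j. j * Q + 1"
  have inj: "inj_on (\<lambda>j. (?m j) ^ 2) {1..J}" using Q0 by (auto simp: inj_on_def)
  have "ln (real J + 1) <= harm J" by (rule ln_le_harm)
  also have "... = (\<Sum>j=1..J. 1 / real j)" by (simp add: harm_def divide_inverse)
  also have "... <= (\<Sum>j=1..J. 2 * real Q * Re (wt (1 / 2) f ((?m j) ^ 2)))"
  proof (rule sum_mono)
   fix j assume j: "j \<in> {1..J}"
   have "coprime (?m j) Q" by (rule coprime_Suc_mult)
   then have f1: "Re (f ((?m j) ^ 2)) >= 1" by (intro fsq) auto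
   have h: "real ((?m j) ^ 2) powr (- (1 / 2)) = 1 / real (?m j)"
    by (simp add: powr_half_sqrt powr_minus_divide real_sqrt_abs del: of_nat_add of_nat_mult)
   have "1 * 1 <= j * Q" using j Q0 by (intro mult_le_mono) auto
   then have "?m j <= 2 * Q * j" by (simp add: mult.commute)
   then have "real (?m j) <= real (2 * Q * j)" by (rule of_nat_mono)
   then have "1 * real (?m j) <= (2 * real Q) * real j" by simp
   then have "1 / real j <= 2 * real Q / real (?m j)" using j by (intro frac_le_cross) (auto intro: add_pos_nonneg)
   then have "1 / real j <= 2 * real Q * (1 / real (?m j))" by simp
   also have "... <= 2 * real Q * Re (wt (1 / 2) f ((?m j) ^ 2))"
   proof (rule mult_left_mono)
    have "1 * (1 / real (?m j)) <= Re (f ((?m j) ^ 2)) * (1 / real (?m j))" using f1 by (intro mult_right_mono) auto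
    then show "1 / real (?m j) <= Re (wt (1 / 2) f ((?m j) ^ 2))" unfolding wt_def h by simp
   qed simp
   finally show "1 / real j <= 2 * real Q * Re (wt (1 / 2) f ((?m j) ^ 2))" .
  qed
  also have "... = 2 * real Q * (\<Sum>n\<in>(\<lambda>j. (?m j) ^ 2) ` {1..J}. Re (wt (1 / 2) f n))"
   by (simp only: sum.reindex[OF inj] o_def sum_distrib_left)
  also have "... <= 2 * real Q * (\<Sum>n=1..U ^ 2. Re (wt (1 / 2) f n))"
  proof (intro mult_left_mono sum_mono2)
   show "(\<lambda>j. (?m j) ^ 2) ` {1..J} \<subseteq> {1..U ^ 2}" by (auto simp: U_def intro!: power_mono)
   show "0 <= Re (wt (1 / 2) f n)" if "n \<in> {1..U ^ 2} - (\<lambda>j. (?m j) ^ 2) ` {1..J}" for n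
    using fnn[of n] that by (simp add: wt_def)
  qed auto
  also have "... = 2 * real Q * Re (wsum (1 / 2) f (U ^ 2))" by simp
  also have "... <= 2 * real Q * M" using up[of U] by (intro mult_left_mono) (auto simp: U_def)
  finally show ?thesis .
 qed
 define B where "B = 2 * real Q * M"
 define n where "n = nat \<lceil>exp (B + 1)\<rceil>"
 have "exp (B + 1) <= real n + 1" unfolding n_def by linarith
 then have "B + 1 <= ln (real n + 1)" by (subst ln_ge_iff) auto
 then show False using lo[of n] by (simp add: B_def)
qed

lemma famL_1_nonzero: "famL Q X 1 \<noteq> 0"
proof
 assume "famL Q X 1 = 0"
 then obtain \<xi> where \<xi>: "\<xi> \<in> X - {princ Q}" "Lval (\<lambda>n. \<xi> (int n)) 1 = 0"
  unfolding famL_def using fin by (auto simp: prod_zero_iff)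
 show False using real_nonvanishing[OF \<xi>(1) vanishing_imp_real[OF \<xi>]] \<xi>(2) by simp
qed

text \<open>Continuity from the right transfers the sign of the lower bound, the value is real, and
  it is not 0.\<close>

lemma famL_1_pos: "Re (famL Q X 1) > 0"
proof -
 have "(\<lambda>N. 1 + 1 / (real N + 1)) \<longlonglongrightarrow> 1 + 0"
  using tendsto_add[OF tendsto_const[of "1 :: real"] LIMSEQ_inverse_real_of_nat] by (simp add: divide_inverse add.commute)
 moreover have "isCont (famL Q X) 1"
  by (rule continuous_on_interior[OF famL_continuous]) simp
 ultimately have "(\<lambda>N. famL Q X (1 + 1 / (real N + 1))) \<longlonglongrightarrow> famL Q X 1"
  using isCont_tendsto_compose[of 1 "famL Q X"] by simp
 then have "(\<lambda>N. Re (famL Q X (1 + 1 / (real N + 1)))) \<longlonglongrightarrow> Re (famL Q X 1)" by (rule tendsto_Re)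
 moreover have "0 <= Re (famL Q X (1 + 1 / (real N + 1)))" for N
 proof -
  have "0 <= (1 + 1 / (real N + 1) - 1) / (1 + 1 / (real N + 1))" by simp
  also have "... <= Re (famL Q X (1 + 1 / (real N + 1)))" by (intro famL_lower_right) simp
  finally show ?thesis .
 qed
 ultimately have "Re (famL Q X 1) >= 0" by (intro LIMSEQ_le_const) auto
 moreover have "famL Q X 1 \<in> \<real>" by (rule famL_real) simp
 then have "famL Q X 1 = of_real (Re (famL Q X 1))" by simp
 then have "Re (famL Q X 1) \<noteq> 0" using famL_1_nonzero by (metis of_real_0)
 ultimately show ?thesis by simp
qed

end

section \<open>Siegel's theorem\<close>

text \<open>With \<open>t\<close> the product of the primes of \<open>m\<close> that do not divide
  \<open>a\<close>, every prime of \<open>m\<close> divides exactly one of the summands of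
  \<open>a + Q * t\<close>.\<close>

lemma coprime_representative:
 fixes a :: int
 assumes "coprime a (int Q)" "m > 0"
 shows "\<exists>a'. [a' = a] (mod int Q) \<and> coprime a' (int m)"
proof -
 define T where "T = {p \<in> prime_factors m. \<not> int p dvd a}"
 define t where "t = \<Prod>T"
 have T: "finite T" "\<And>p. p \<in> T ==> prime p" by (auto simp: T_def in_prime_factors_iff)
 have "coprime (a + int Q * int t) (int m)"
 proof (rule ccontr)
  assume "\<not> coprime (a + int Q * int t) (int m)"
  then have "gcd (a + int Q * int t) (int m) \<noteq> 1" using coprime_iff_gcd_eq_1 by blast
  then have "nat (gcd (a + int Q * int t) (int m)) \<noteq> 1" by simp
  then obtain p where p0: "prime p" "p dvd nat (gcd (a + int Q * int t) (int m))" using prime_factor_nat by blast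
  have "int p dvd int (nat (gcd (a + int Q * int t) (int m)))" using p0(2) by (simp only: int_dvd_int_iff)
  then have pg: "int p dvd gcd (a + int Q * int t) (int m)" by simp
  have pd: "int p dvd a + int Q * int t" using dvd_trans[OF pg gcd_dvd1] .
  have "int p dvd int m" using dvd_trans[OF pg gcd_dvd2] .
  then have p: "prime p" "p dvd m" using p0(1) by (simp_all only: int_dvd_int_iff)
  have pm: "p \<in> prime_factors m" using p assms by (simp add: in_prime_factors_iff)
  show False
  proof (cases "int p dvd a")
   case True
   then have "int p dvd int Q * int t" using pd by (simp add: dvd_add_right_iff)
   then have "p dvd Q * t" by (simp flip: of_nat_mult)
   moreover have "\<not> p dvd Q"
   proof
    assume "p dvd Q"
    then have "int p dvd int Q" by simp
    then have "is_unit (int p)" using coprime_common_divisor[OF assms(1) True] by blast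
    then have "p = 1" by simp
    then show False using p(1) by simp
   qed
   ultimately have "p dvd t" using p(1) by (simp add: prime_dvd_mult_iff)
   then obtain r where r: "r \<in> T" "p dvd r" unfolding t_def using prime_dvd_prod_iff[OF T(1), of p "\<lambda>x. x"] p(1) by auto
   then have "p = r" using primes_dvd_imp_eq[OF p(1) T(2)] by blast
   then show False using r(1) True by (simp add: T_def)
  next
   case False
   then have "p \<in> T" using pm by (simp add: T_def)
   then have "p dvd t" unfolding t_def using T(1) dvd_prodI[of T p "\<lambda>x. x"] by simp
   then have "int p dvd int Q * int t" by simp
   then show False using False pd by (simp add: dvd_add_left_iff)
  qed
 qed
 moreover have "[a + int Q * int t = a] (mod int Q)" by (simp add: cong_def)
 ultimately show ?thesis by blast
qed

text \<open>Each unit class modulo \<open>Q\<close> contains an integer coprime to \<open>m\<close>,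
  where the lift keeps the value, so nothing is lost by enlarging the modulus.\<close>

lemma lift_inj:
 assumes "dchar Q \<psi>" "dchar Q \<psi>'" "m > 0" and eq: "\<And>a. \<psi> a * princ m a = \<psi>' a * princ m a"
 shows "\<psi> = \<psi>'"
proof
 fix a
 show "\<psi> a = \<psi>' a"
 proof (cases "coprime a (int Q)")
  case True
  then obtain a' where a': "[a' = a] (mod int Q)" "coprime a' (int m)" using coprime_representative assms(3) by blast
  then have "\<psi> a' = \<psi>' a'" using eq[of a'] by (simp add: princ_def)
  then show ?thesis using dchar_cong[OF assms(1) a'(1)] dchar_cong[OF assms(2) a'(1)] by simp
 next
  case False
  then show ?thesis using dchar_eq_0_iff assms(1,2) by metis
 qed
qed

lemma princ_mult: "princ (Q * m) a = princ Q a * princ m a"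
 by (simp add: princ_def)

lemma char_group_product:
 assumes X: "char_group Q X" and X1: "char_group m X1"
 defines "X3 \<equiv> (\<lambda>(\<psi>, \<xi>) a. \<psi> a * \<xi> a) ` (X \<times> X1)"
 shows "char_group (Q * m) X3" "card X3 <= card X * card X1"
proof -
 have fin: "finite X" "finite X1" using X X1 by (auto simp: char_group_def)
 show "card X3 <= card X * card X1"
  unfolding X3_def using card_image_le[of "X \<times> X1"] fin by (simp add: card_cartesian_product)
 show "char_group (Q * m) X3"
  unfolding char_group_def
 proof (intro conjI ballI)
  show "finite X3" unfolding X3_def using fin by simp
  have "princ (Q * m) = (\<lambda>(\<psi>, \<xi>) a. \<psi> a * \<xi> a) (princ Q, princ m)" by (auto simp: princ_mult)
  then show "princ (Q * m) \<in> X3" unfolding X3_def using X X1 by (intro image_eqI[of _ _ "(princ Q, princ m)"]) (auto simp: char_group_def)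
 next
  fix \<phi> assume "\<phi> \<in> X3"
  then show "dchar (Q * m) \<phi>" using X X1 by (auto simp: X3_def char_group_def intro!: dchar_product)
 next
  fix \<phi> \<phi>' assume "\<phi> \<in> X3" "\<phi>' \<in> X3"
  then obtain \<psi> \<xi> \<psi>' \<xi>' where *: "\<psi> \<in> X" "\<psi>' \<in> X" "\<xi> \<in> X1" "\<xi>' \<in> X1"
   "\<phi> = (\<lambda>a. \<psi> a * \<xi> a)" "\<phi>' = (\<lambda>a. \<psi>' a * \<xi>' a)" by (auto simp: X3_def)
  have "(\<lambda>a. \<psi> a * \<psi>' a) \<in> X" "(\<lambda>a. \<xi> a * \<xi>' a) \<in> X1" using X X1 * by (auto simp: char_group_def)
  then show "(\<lambda>a. \<phi> a * \<phi>' a) \<in> X3"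
   unfolding X3_def by (intro image_eqI[of _ _ "(\<lambda>a. \<psi> a * \<psi>' a, \<lambda>a. \<xi> a * \<xi>' a)"]) (auto simp: * mult_ac)
 qed
qed

text \<open>Savings and constants depend on the number of factors; minimum and maximum over all
  sizes up to \<open>K\<close> make them uniform. The trivial group has the empty convolution and is
  treated separately.\<close>

lemma family_osc:
 fixes \<delta> C \<theta> \<gamma> :: real
 assumes "\<delta> > 0" "\<delta> <= 1 / 2" "C >= 1" "\<theta> > 0" "\<gamma> > 0"
 shows "\<exists>\<kappa> A. 0 < \<kappa> \<and> \<kappa> <= 1 / 2 \<and> A >= 1 \<and> (\<forall>Q X. char_fam Q X --> 4 <= real Q powr \<gamma> --> card X <= K -->
   (\<forall>g\<in>set (nontriv Q X). osc C \<delta> (real Q powr \<theta>) g) -->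
   osc A \<kappa> (real Q powr ((card X - 1) * (\<theta> + \<gamma>))) (famF Q X))"
proof -
 define P where "P = (\<lambda>k \<delta>' C'. 0 < \<delta>' \<and> \<delta>' <= 1 / 2 \<and> C' >= 1 \<and> (\<forall>q gs. q >= 1 --> 4 <= q powr \<gamma> --> length gs = Suc k -->
   (\<forall>g\<in>set gs. osc C \<delta> (q powr \<theta>) g \<and> (\<forall>n. norm (g n) <= 1)) -->
   osc C' \<delta>' (q powr (Suc k * (\<theta> + \<gamma>))) (dconvs gs)))"
 have "\<exists>\<delta>' C'. P k \<delta>' C'" for k unfolding P_def by (rule osc_dconvs[OF assms])
 then obtain d c where P: "\<And>k. P k (d k) (c k)" by metis
 note dc = P[unfolded P_def, THEN conjunct1] P[unfolded P_def, THEN conjunct2, THEN conjunct1]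
  P[unfolded P_def, THEN conjunct2, THEN conjunct2, THEN conjunct1]
 have oc: "osc (c k) (d k) (q powr (Suc k * (\<theta> + \<gamma>))) (dconvs gs)"
  if "q >= 1" "4 <= q powr \<gamma>" "length gs = Suc k" "\<And>g. g \<in> set gs ==> osc C \<delta> (q powr \<theta>) g" "\<And>g n. g \<in> set gs ==> norm (g n) <= 1" for q gs k
  by (rule P[of k, unfolded P_def, THEN conjunct2, THEN conjunct2, THEN conjunct2, rule_format]) (use that in auto)
 define \<kappa> where "\<kappa> = Min (insert (1 / 2) (d ` {..K}))"
 define A where "A = Max (insert 1 (c ` {..K}))"
 have "0 < \<kappa>" unfolding \<kappa>_def using dc by (subst Min_gr_iff) auto
 moreover have "\<kappa> <= 1 / 2" unfolding \<kappa>_def by (intro Min_le) auto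
 moreover have "A >= 1" unfolding A_def by (intro Max_ge) auto
 moreover have "osc A \<kappa> (real Q powr ((card X - 1) * (\<theta> + \<gamma>))) (famF Q X)"
  if H: "char_fam Q X" "4 <= real Q powr \<gamma>" "card X <= K" "\<forall>g\<in>set (nontriv Q X). osc C \<delta> (real Q powr \<theta>) g" for Q X
 proof -
  interpret char_fam Q X by fact
  have Q1: "real Q >= 1" using Q0 by simp
  show ?thesis
  proof (cases "card X = 1")
   case True
   then have F: "famF Q X = dunit" using length_nontriv by (simp add: famF_def)
   show ?thesis
    unfolding osc_def F
   proof (intro allI impI)
    fix N assume "real Q powr ((card X - 1) * (\<theta> + \<gamma>)) <= real N"
    then have N: "real N >= 1" using True Q1 by simp
    have "(\<Sum>n=1..N. dunit n) = (\<Sum>n\<in>{1}. dunit n)" using N by (intro sum.mono_neutral_right) (auto simp: dunit_def)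
    then have "norm (\<Sum>n=1..N. dunit n) = 1 * 1" by (simp add: dunit_def)
    also have "... <= A * real N powr (1 - \<kappa>)"
     using N \<open>A >= 1\<close> \<open>\<kappa> <= 1 / 2\<close> by (intro mult_mono ge_one_powr_ge_zero) auto
    finally show "norm (\<Sum>n=1..N. dunit n) <= A * real N powr (1 - \<kappa>)" .
   qed
  next
   case False
   define k where "k = card X - 2"
   have k: "card X - 1 = Suc k" "k \<in> {..K}" using False card_pos H(3) by (auto simp: k_def)
   have 1: "osc (c k) (d k) (real Q powr (Suc k * (\<theta> + \<gamma>))) (famF Q X)"
    unfolding famF_def using Q1 H(2,4) length_nontriv k norm_nontriv by (intro oc) auto
   have 2: "c k <= A" unfolding A_def using k by (intro Max_ge) auto
   have 3: "\<kappa> <= d k" unfolding \<kappa>_def using k by (intro Min_le) auto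
   have 4: "0 <= c k" using dc(3)[of k] by linarith
   have "1 <= real Q powr (Suc k * (\<theta> + \<gamma>))" using Q1 assms by (intro ge_one_powr_ge_zero) auto
   then show ?thesis unfolding k(1) by (rule osc_mono[OF 1 2 4 3 order_refl])
  qed
 qed
 ultimately show ?thesis by blast
qed

text \<open>A nontrivial character has partial sums at most \<open>Q\<close>, a square root saving
  from \<open>Q ^ 2\<close> on. With threshold exponent 2 and slack 1 per factor this gives
  \<open>3 * K\<close>; any fixed exponent suffices for Siegel's bound, so Burgess's is not called
  upon.\<close>

lemma family_osc_trivial:
 "\<exists>\<kappa> A. 0 < \<kappa> \<and> \<kappa> <= 1 / 2 \<and> A >= 1 \<and> (\<forall>Q X. char_fam Q X --> Q >= 4 --> card X <= K -->
   osc A \<kappa> (real Q powr (3 * K)) (famF Q X))"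
proof -
 have "\<exists>\<kappa> A. 0 < \<kappa> \<and> \<kappa> <= 1 / 2 \<and> A >= 1 \<and> (\<forall>Q X. char_fam Q X --> 4 <= real Q powr 1 --> card X <= K -->
   (\<forall>g\<in>set (nontriv Q X). osc 1 (1 / 2) (real Q powr 2) g) -->
   osc A \<kappa> (real Q powr (real (card X - 1) * (2 + 1))) (famF Q X))"
  by (rule family_osc) simp_all
 then obtain \<kappa> A where fo: "0 < \<kappa> \<and> \<kappa> <= 1 / 2 \<and> A >= 1 \<and> (\<forall>Q X. char_fam Q X --> 4 <= real Q powr 1 --> card X <= K -->
   (\<forall>g\<in>set (nontriv Q X). osc 1 (1 / 2) (real Q powr 2) g) -->
   osc A \<kappa> (real Q powr (real (card X - 1) * (2 + 1))) (famF Q X))" by (elim exE)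
 note * = fo[THEN conjunct1] fo[THEN conjunct2, THEN conjunct1] fo[THEN conjunct2, THEN conjunct2, THEN conjunct1]
 note o = fo[THEN conjunct2, THEN conjunct2, THEN conjunct2, rule_format]
 have "osc A \<kappa> (real Q powr (3 * K)) (famF Q X)" if H: "char_fam Q X" "Q >= 4" "card X <= K" for Q X
 proof -
  interpret char_fam Q X by fact
  have "osc 1 (1 / 2) (real Q powr 2) g" if g: "g \<in> set (nontriv Q X)" for g
   unfolding osc_def
  proof (intro allI impI)
   fix N assume N: "real Q powr 2 <= real N"
   have "norm (\<Sum>n=1..N. g n) <= (real Q powr 2) powr (1 / 2)" using partial_nontriv[OF g] Q0 by (simp add: powr_powr)
   also have "... <= real N powr (1 / 2)" using N by (intro powr_mono2) auto
   finally show "norm (\<Sum>n=1..N. g n) <= 1 * real N powr (1 - 1 / 2)" by simp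
  qed
  then have 1: "osc A \<kappa> (real Q powr (real (card X - 1) * (2 + 1))) (famF Q X)" using H by (intro o) auto
  have "real (card X - 1) * (2 + 1) <= real (3 * K)" using H(3) by simp
  then have 2: "real Q powr (real (card X - 1) * (2 + 1)) <= real Q powr (3 * K)" using H by (intro powr_mono) auto
  have 3: "1 <= real Q powr (3 * K)" using H by (intro ge_one_powr_ge_zero) auto
  show ?thesis using *(3) by (intro osc_mono[OF 1 order_refl _ order_refl 2 3]) auto
 qed
 then show ?thesis using * by blast
qed

lemma (in char_fam) famL_sum_approx:
 assumes F: "osc A \<kappa> (real U) (famF Q X)" and A: "A >= 0" and U: "U >= 1" and \<kappa>: "0 < \<kappa>"
  and s: "0 < s" "s <= 1" "1 - s <= \<kappa> / 2" "1 - s < (1 / 2) / 4 ^ card X"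
 shows "M >= U ==> norm (wsum s (famF Q X) M - wsum s (famF Q X) U) <= A * (3 + 2 / \<kappa>) * real U powr (1 - s - \<kappa>)"
  "norm (wsum s (famF Q X) U - famL Q X s) <= A * (3 + 2 / \<kappa>) * real U powr (1 - s - \<kappa>)"
proof -
 have 1: "norm (wsum s (famF Q X) M - wsum s (famF Q X) U) <= A * (3 + 2 / \<kappa>) * real U powr (1 - s - \<kappa>)"
  if "M >= U" for M
 proof -
  have "norm (wsum s (famF Q X) M - wsum s (famF Q X) U)
    <= A * (2 + s + s / (s + \<kappa> - 1)) * real U powr (- (s + \<kappa> - 1))"
   using F A s \<kappa> by (intro wt_tail U that) (auto simp: osc_def)
  also have "... <= A * (3 + 2 / \<kappa>) * real U powr (- (s + \<kappa> - 1))"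
  proof (intro mult_right_mono mult_left_mono)
   have "s / (s + \<kappa> - 1) <= 1 / (\<kappa> / 2)" using s \<kappa> by (intro frac_le) auto
   then show "2 + s + s / (s + \<kappa> - 1) <= 3 + 2 / \<kappa>" using s by simp
  qed (use A in auto)
  finally show ?thesis by (simp add: algebra_simps)
 qed
 then show "M >= U ==> norm (wsum s (famF Q X) M - wsum s (famF Q X) U) <= A * (3 + 2 / \<kappa>) * real U powr (1 - s - \<kappa>)" by blast
 have "(\<lambda>M. norm (wsum s (famF Q X) M - wsum s (famF Q X) U)) \<longlonglongrightarrow> norm (famL Q X s - wsum s (famF Q X) U)"
  by (intro tendsto_intros famF_tendsto s)
 then have "norm (famL Q X s - wsum s (famF Q X) U) <= A * (3 + 2 / \<kappa>) * real U powr (1 - s - \<kappa>)"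
  using 1 by (intro LIMSEQ_le_const2) auto
 then show "norm (wsum s (famF Q X) U - famL Q X s) <= A * (3 + 2 / \<kappa>) * real U powr (1 - s - \<kappa>)"
  by (simp add: norm_minus_commute)
qed

lemma famF_powr_bound:
 assumes "e > 0"
 shows "\<exists>B\<ge>1. \<forall>Q X n. char_fam Q X --> card X <= K --> n > 0 -->
  norm (famF Q X n) <= B * real n powr e \<and> norm (dconv (famF Q X) (\<lambda>_. 1) n) <= B * real n powr e"
proof -
 obtain B where B: "B >= 1" "\<And>gs n. length gs <= K ==> (\<And>g n. g \<in> set gs ==> norm (g n) <= 1) ==>
   n > 0 ==> norm (dconvs gs n) <= B * real n powr e"
  using dconvs_powr_bound[OF assms, of K] by auto
 have "norm (famF Q X n) <= B * real n powr e \<and> norm (dconv (famF Q X) (\<lambda>_. 1) n) <= B * real n powr e"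
  if H: "char_fam Q X" "card X <= K" "n > 0" for Q X n
 proof -
  interpret char_fam Q X by fact
  have "norm (famF Q X n) <= B * real n powr e"
   unfolding famF_def by (rule B(2)) (use H norm_nontriv length_nontriv in auto)
  moreover have "norm (dconv (famF Q X) (\<lambda>_. 1) n) <= B * real n powr e"
   unfolding famf_conv[OF H(3)] by (rule B(2)) (use H norm_nontriv length_nontriv card_pos in auto)
  ultimately show ?thesis by blast
 qed
 then show ?thesis using B(1) by blast
qed

text \<open>The exponent comes from the length at which the comparison is made: \<open>U\<close> is
  of size \<open>Q powr (3 * K)\<close> and \<open>N = U ^ 2\<close>, so the coefficient
  \<open>N powr (1 - \<beta>)\<close> of the value at 1 is a constant times
  \<open>Q powr (6 * K * (1 - \<beta>))\<close>.\<close>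

lemma siegel_zero_repulsion:
 fixes K :: nat
 shows "\<exists>\<kappa>>0. \<forall>\<beta>::real. 1 - \<kappa> < \<beta> --> \<beta> < 1 --> (\<exists>c>0. \<forall>Q X. char_fam Q X --> Q >= 4 --> card X <= K -->
   Re (famL Q X \<beta>) >= 0 --> Re (famL Q X 1) >= c * real Q powr (- (6 * K * (1 - \<beta>))))"
proof -
 obtain \<kappa> A where fo: "0 < \<kappa> \<and> \<kappa> <= 1 / 2 \<and> A >= 1 \<and> (\<forall>Q X. char_fam Q X --> Q >= 4 --> card X <= K -->
   osc A \<kappa> (real Q powr (3 * K)) (famF Q X))" using family_osc_trivial[of K] by (elim exE)
 note \<kappa> = fo[THEN conjunct1] fo[THEN conjunct2, THEN conjunct1]
 note A = fo[THEN conjunct2, THEN conjunct2, THEN conjunct1]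
 note o = fo[THEN conjunct2, THEN conjunct2, THEN conjunct2, rule_format]
 obtain B where B: "B >= 1" "\<And>Q X n. char_fam Q X ==> card X <= K ==> n > 0 ==> norm (famF Q X n) <= B * real n powr (1 / 4)"
  using famF_powr_bound[of "1 / 4" K] by auto
 define \<kappa>' where "\<kappa>' = min (\<kappa> / 4) ((1 / 2) / 4 ^ K)"
 have \<kappa>': "0 < \<kappa>'" "\<kappa>' <= \<kappa> / 4" "\<kappa>' <= (1 / 2) / 4 ^ K" using \<kappa> by (auto simp: \<kappa>'_def)
 define A1 where "A1 = A * (3 + 2 / \<kappa>)"
 have A1: "A1 >= 0" using A \<kappa> by (simp add: A1_def)
 show ?thesis
 proof (rule exI[of _ \<kappa>'], intro conjI allI impI)
  fix \<beta> :: real assume b: "1 - \<kappa>' < \<beta>" "\<beta> < 1"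
  define \<eta> where "\<eta> = 1 - \<beta>"
  have \<eta>: "0 < \<eta>" "\<eta> < \<kappa> / 4" "\<eta> < (1 / 2) / 4 ^ K" using b \<kappa>' by (auto simp: \<eta>_def)
  have \<beta>: "0 < \<beta>" "\<beta> < 1" "\<beta> = 1 - \<eta>" using \<eta> \<kappa> b by (auto simp: \<eta>_def)
  obtain z where z: "zeta_const \<beta> z" using zeta_const_exists[OF \<beta>(1,2)] by blast
  have z0: "z < 0" using z by (simp add: zeta_const_def)
  \<comment> \<open>The sum of the four error constants: two of size \<open>A1 / \<eta>\<close> from
    the hyperbola and from truncating the series at 1, one from truncating at \<beta>, and one from
    the floor function.\<close>
  define E where "E = 2 * A1 / \<eta> + \<bar>z\<bar> * A1 + 4 * B"
  have "0 <= 2 * A1 / \<eta>" "0 <= \<bar>z\<bar> * A1" using A1 \<eta> by simp_all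
  then have E1: "E >= 1" unfolding E_def using B(1) by linarith
  \<comment> \<open>Makes the total error \<open>E * U powr (- (\<kappa> / 2))\<close> at most 1/2,
    half of the contribution of the term \<open>n = 1\<close>.\<close>
  define U1 where "U1 = (2 * E) powr (2 / \<kappa>)"
  have U1: "U1 >= 1" unfolding U1_def using E1 \<kappa> by (intro ge_one_powr_ge_zero) auto
  define c where "c = \<eta> / 2 * (2 * U1) powr (- (2 * \<eta>))"
  show "\<exists>c>0. \<forall>Q X. char_fam Q X --> Q >= 4 --> card X <= K -->
   Re (famL Q X \<beta>) >= 0 --> Re (famL Q X 1) >= c * real Q powr (- (6 * K * (1 - \<beta>)))"
  proof (rule exI[of _ c], intro conjI allI impI)
   show "c > 0" using \<eta> U1 by (simp add: c_def)
   fix Q X assume H: "char_fam Q X" "Q >= 4" "card X <= K" and pos: "Re (famL Q X \<beta>) >= 0"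
   interpret char_fam Q X by fact
   define Z where "Z = U1 * real Q powr (3 * K)"
   have Q1: "real Q powr (3 * K) >= 1" using H(2) by (intro ge_one_powr_ge_zero) auto
   have Z1: "Z >= U1" "Z >= real Q powr (3 * K)" "Z >= 1"
    using mult_mono[of 1 U1 "real Q powr (3 * K)" "real Q powr (3 * K)"] mult_mono[of U1 U1 1 "real Q powr (3 * K)"] U1 Q1
    by (auto simp: Z_def)
   define U where "U = nat \<lceil>Z\<rceil>"
   have U: "Z <= real U" "real U <= 2 * Z" "U >= 1" using Z1 unfolding U_def by linarith+
   have U0: "real U >= 1" using U by simp
   let ?w = "real U powr (\<eta> - \<kappa>)"
   let ?u = "real U powr (- (\<kappa> / 2))"
   have oF: "osc A \<kappa> (real U) (famF Q X)"
    by (rule osc_mono[OF o[OF H]]) (use A Z1 U in auto)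
   have "(4::real) ^ card X <= 4 ^ K" using H(3) by (intro power_increasing) auto
   then have "(1 / 2) / 4 ^ K <= (1 / 2) / (4::real) ^ card X" by (intro divide_left_mono) auto
   then have \<eta>X: "\<eta> < (1 / 2) / 4 ^ card X" using \<eta> by linarith
   let ?P = "\<lambda>s. \<Sum>n=1..U. wt s (famF Q X) n"
   have t1: "norm (?P 1 - famL Q X 1) <= A1 * real U powr (- \<kappa>)"
    using famL_sum_approx(2)[OF oF, of 1] A U \<kappa> by (simp add: A1_def)
   have t2: "norm (?P \<beta> - famL Q X \<beta>) <= A1 * ?w"
    using famL_sum_approx(2)[OF oF, of \<beta>] A U \<kappa> \<beta> \<eta> \<eta>X by (simp add: A1_def)
   have t3: "norm (wsum \<beta> (famF Q X) M - ?P \<beta>) <= A1 * ?w" if "M >= U" for M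
    using famL_sum_approx(1)[OF oF, of \<beta> M] A U \<kappa> \<beta> \<eta> \<eta>X that by (simp add: A1_def)
   \<comment> \<open>The square is long enough for the error \<open>N powr (- \<beta>)\<close> to
     beat the trivial sum of the coefficients up to \<open>U\<close>.\<close>
   define N where "N = U ^ 2"
   have N: "U <= N" using U by (simp add: N_def power2_eq_square)
   have NU: "real N = real U powr 2" "real N / real U = real U" using U0 by (simp_all add: N_def power2_eq_square powr_numeral)
   let ?f = "dconv (famF Q X) (\<lambda>_. 1)"
   let ?S = "\<Sum>n=1..N. wt \<beta> ?f n"
   have main: "norm (?S - (of_real (real N powr (1 - \<beta>) / (1 - \<beta>)) * ?P 1 + of_real z * ?P \<beta>))
     <= 4 * real N powr (- \<beta>) * (\<Sum>n=1..U. norm (famF Q X n)) + A1 * ?w * (real N / real U) powr (1 - \<beta>) / (1 - \<beta>)"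
    by (rule wt_dconv_one_asymptotic[OF \<beta>(1,2) z U(3) N t3])
   have NE: "real N powr (1 - \<beta>) = real U powr (2 * \<eta>)" "real N powr (- \<beta>) = real U powr (2 * \<eta> - 2)"
    unfolding NU powr_powr by (simp_all add: \<beta>(3) algebra_simps)
   have small: "E * ?u <= 1 / 2"
   proof -
    have "?u <= U1 powr (- (\<kappa> / 2))" using U Z1 U1 \<kappa> by (intro powr_mono2') auto
    also have "... = 1 / (2 * E)" unfolding U1_def powr_powr using E1 \<kappa> by (simp add: powr_minus_divide)
    finally have "E * ?u <= E * (1 / (2 * E))" using E1 by (intro mult_left_mono) auto
    then show ?thesis using E1 by simp
   qed
   have e1: "4 * real N powr (- \<beta>) * (\<Sum>n=1..U. norm (famF Q X n)) <= 4 * B * ?u"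
   proof -
    have "(\<Sum>n=1..U. norm (famF Q X n)) <= (\<Sum>n=1..U. B * real U powr (1 / 4))"
    proof (rule sum_mono)
     fix n assume n: "n \<in> {1..U}"
     have "norm (famF Q X n) <= B * real n powr (1 / 4)" using n by (intro B(2) H) auto
     also have "... <= B * real U powr (1 / 4)" using n B(1) by (intro mult_left_mono powr_mono2) auto
     finally show "norm (famF Q X n) <= B * real U powr (1 / 4)" .
    qed
    also have "... = B * (real U powr 1 * real U powr (1 / 4))" using U0 by simp
    also have "real U powr 1 * real U powr (1 / 4) = real U powr (5 / 4)" unfolding powr_add[symmetric] by simp
    finally have "4 * real N powr (- \<beta>) * (\<Sum>n=1..U. norm (famF Q X n)) <= 4 * real U powr (2 * \<eta> - 2) * (B * real U powr (5 / 4))"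
     unfolding NE by (intro mult_left_mono) auto
    also have "... = 4 * B * (real U powr (2 * \<eta> - 2) * real U powr (5 / 4))" by simp
    also have "real U powr (2 * \<eta> - 2) * real U powr (5 / 4) = real U powr (2 * \<eta> - 2 + 5 / 4)" by (rule powr_add[symmetric])
    also have "... <= ?u" using \<eta> \<kappa> U0 by (intro powr_mono) auto
    finally show ?thesis using B(1) by simp
   qed
   have e2: "A1 * ?w * (real N / real U) powr (1 - \<beta>) / (1 - \<beta>) <= A1 / \<eta> * ?u"
   proof -
    have "A1 * ?w * (real N / real U) powr (1 - \<beta>) / (1 - \<beta>) = A1 / \<eta> * (?w * real U powr \<eta>)"
     unfolding NU(2) by (simp add: \<beta>(3))
    also have "?w * real U powr \<eta> = real U powr (\<eta> - \<kappa> + \<eta>)" by (rule powr_add[symmetric])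
    also have "A1 / \<eta> * ... <= A1 / \<eta> * ?u"
     using \<eta> \<kappa> U0 A1 by (intro mult_left_mono powr_mono) auto
    finally show ?thesis .
   qed
   have e3: "real U powr (2 * \<eta>) / \<eta> * norm (?P 1 - famL Q X 1) <= A1 / \<eta> * ?u"
   proof -
    have "real U powr (2 * \<eta>) / \<eta> * norm (?P 1 - famL Q X 1) <= real U powr (2 * \<eta>) / \<eta> * (A1 * real U powr (- \<kappa>))"
     using t1 \<eta> by (intro mult_left_mono) auto
    also have "... = A1 / \<eta> * (real U powr (2 * \<eta>) * real U powr (- \<kappa>))" by simp
    also have "real U powr (2 * \<eta>) * real U powr (- \<kappa>) = real U powr (2 * \<eta> + - \<kappa>)" by (rule powr_add[symmetric])
    also have "A1 / \<eta> * ... <= A1 / \<eta> * ?u"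
     using \<eta> \<kappa> U0 A1 by (intro mult_left_mono powr_mono) auto
    finally show ?thesis .
   qed
   have e4: "\<bar>z\<bar> * norm (?P \<beta> - famL Q X \<beta>) <= \<bar>z\<bar> * A1 * ?u"
   proof -
    have "\<bar>z\<bar> * norm (?P \<beta> - famL Q X \<beta>) <= \<bar>z\<bar> * (A1 * ?w)" using t2 by (intro mult_left_mono) auto
    also have "... <= \<bar>z\<bar> * (A1 * ?u)" using \<eta> \<kappa> U0 A1 by (intro mult_left_mono powr_mono) auto
    finally show ?thesis by simp
   qed
   have S1: "1 <= Re ?S"
   proof -
    have nn: "0 <= Re (wt \<beta> ?f n)" if "n >= 1" for n
     using famf_nonneg[of n] that by (simp add: wt_def complex_nonneg_Reals_iff)
    have "1 = (\<Sum>n\<in>{1}. Re (wt \<beta> ?f n))" using famf_1 by (simp add: wt_def)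
    also have "... <= (\<Sum>n=1..N. Re (wt \<beta> ?f n))" using N U nn by (intro sum_mono2) auto
    finally show ?thesis by simp
   qed
   define a where "a = real U powr (2 * \<eta>) / \<eta>"
   have a0: "a > 0" using \<eta> U0 by (simp add: a_def)
   define M where "M = of_real a * ?P 1 + of_real z * ?P \<beta>"
   have "norm (?S - M) <= 4 * B * ?u + A1 / \<eta> * ?u"
    using main e1 e2 unfolding M_def a_def NE(1) \<eta>_def by linarith
   moreover have "Re ?S - Re M <= norm (?S - M)" using complex_Re_le_cmod[of "?S - M"] by simp
   moreover have "Re M <= a * Re (famL Q X 1) + a * norm (?P 1 - famL Q X 1) + \<bar>z\<bar> * norm (?P \<beta> - famL Q X \<beta>)"
   proof -
    have "Re (?P 1) <= Re (famL Q X 1) + norm (?P 1 - famL Q X 1)" using complex_Re_le_cmod[of "?P 1 - famL Q X 1"] by simp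
    then have "a * Re (?P 1) <= a * (Re (famL Q X 1) + norm (?P 1 - famL Q X 1))" using a0 by (intro mult_left_mono) auto
    moreover have "- Re (?P \<beta>) <= norm (?P \<beta> - famL Q X \<beta>)"
     using abs_Re_le_cmod[of "?P \<beta> - famL Q X \<beta>"] pos by simp
    then have "\<bar>z\<bar> * - Re (?P \<beta>) <= \<bar>z\<bar> * norm (?P \<beta> - famL Q X \<beta>)" by (intro mult_left_mono) auto
    then have "z * Re (?P \<beta>) <= \<bar>z\<bar> * norm (?P \<beta> - famL Q X \<beta>)" using z0 by simp
    moreover have "Re M = a * Re (?P 1) + z * Re (?P \<beta>)" by (simp add: M_def)
    ultimately show ?thesis by (simp add: algebra_simps)
   qed
   ultimately have "1 <= a * Re (famL Q X 1) + (4 * B * ?u + A1 / \<eta> * ?u + A1 / \<eta> * ?u + \<bar>z\<bar> * A1 * ?u)"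
    using S1 e3 e4 unfolding a_def by linarith
   also have "4 * B * ?u + A1 / \<eta> * ?u + A1 / \<eta> * ?u + \<bar>z\<bar> * A1 * ?u = E * ?u"
    by (simp add: E_def algebra_simps)
   finally have "1 / 2 <= a * Re (famL Q X 1)" using small by linarith
   then have "1 / (2 * a) <= Re (famL Q X 1)" using a0 by (simp add: divide_le_eq mult_ac)
   moreover have "c * real Q powr (- (6 * K * (1 - \<beta>))) <= 1 / (2 * a)"
   proof -
    have "c * real Q powr (- (6 * K * (1 - \<beta>))) = \<eta> / 2 * ((2 * U1) powr (- (2 * \<eta>)) * (real Q powr (3 * K)) powr (- (2 * \<eta>)))"
     unfolding c_def powr_powr by (simp add: \<beta>(3) algebra_simps)
    also have "(2 * U1) powr (- (2 * \<eta>)) * (real Q powr (3 * K)) powr (- (2 * \<eta>)) = (2 * Z) powr (- (2 * \<eta>))"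
     unfolding Z_def using U1 by (simp add: powr_mult[symmetric] mult.assoc)
    also have "... <= real U powr (- (2 * \<eta>))" using U U0 \<eta> by (intro powr_mono2') auto
    also have "\<eta> / 2 * ... = 1 / (2 * a)" unfolding a_def using \<eta> by (simp add: powr_minus_divide)
    finally show ?thesis using \<eta> by simp
   qed
   ultimately show "Re (famL Q X 1) >= c * real Q powr (- (6 * K * (1 - \<beta>)))" by linarith
  qed
 qed (use \<kappa>' in auto)
qed

lemma (in char_fam) Lval_1_upper:
 assumes g: "g \<in> set (nontriv Q X)" and e: "0 < e" "e <= 1"
 shows "norm (Lval g 1) <= (1 / e + 4) * real Q powr e"
proof -
 have "norm (wsum 1 g Q) <= (\<Sum>n=1..Q. real n powr (e - 1))"
 proof (rule sum_norm_le)
  fix n assume n: "n \<in> {1..Q}"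
  have "norm (wt 1 g n) <= 1 * real n powr (- 1)"
   unfolding wt_def norm_mult norm_of_real using norm_nontriv[OF g] by (intro mult_mono) auto
  also have "... <= real n powr (e - 1)" using n e by (simp only: mult_1) (intro powr_mono, auto)
  finally show "norm (wt 1 g n) <= real n powr (e - 1)" .
 qed
 also have "... <= real Q powr e / e" using e by (rule sum_powr_le)
 finally have 1: "norm (wsum 1 g Q) <= real Q powr e / e" .
 have "norm (wsum 1 g Q - Lval g 1) <= real Q * (3 + 1) * real Q powr (- 1)"
  using Q0 by (intro Lval_tail g) auto
 also have "... = 4" using Q0 by (simp add: powr_minus_divide)
 also have "4 <= 4 * real Q powr e" using Q0 e ge_one_powr_ge_zero[of "real Q" e] by simp
 finally have "norm (Lval g 1) <= real Q powr e / e + 4 * real Q powr e"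
  using 1 norm_triangle_ineq4[of "\<Sum>n=1..Q. wt 1 g n" "wsum 1 g Q - Lval g 1"] by simp
 then show ?thesis by (simp add: algebra_simps)
qed

text \<open>The vanishing factor of the second group reappears, multiplied by a finite Euler
  product, as the value of its lift; \<open>lift_inj\<close> ensures that the lift is not principal
  and so occurs in the product.\<close>

lemma famL_product_zero:
 assumes X: "char_fam Q X" and X1: "char_fam m X1" and s: "s > 0" and zero: "famL m X1 s = 0"
 shows "famL (Q * m) ((\<lambda>(\<psi>, \<xi>) a. \<psi> a * \<xi> a) ` (X \<times> X1)) s = 0"
proof -
 interpret X: char_fam Q X by fact
 interpret X1: char_fam m X1 by fact
 obtain \<xi> where \<xi>: "\<xi> \<in> X1" "\<xi> \<noteq> princ m" "Lval (\<lambda>n. \<xi> (int n)) s = 0"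
  using zero X1.fin by (auto simp: famL_def prod_zero_iff)
 obtain E where E: "Lval (\<lambda>n. \<xi> (int n) * princ Q (int n)) s = Lval (\<lambda>n. \<xi> (int n)) s * E"
  using Lval_lift[OF X1.dch[OF \<xi>(1)] \<xi>(2) X1.Q0 X.Q0 s] by metis
 let ?\<phi> = "\<lambda>a. princ Q a * \<xi> a" and ?X = "(\<lambda>(\<psi>, \<xi>) a. \<psi> a * \<xi> a) ` (X \<times> X1)"
 have "?\<phi> \<in> ?X" using X.princ_in \<xi>(1) by force
 moreover have "?\<phi> \<noteq> princ (Q * m)"
 proof
  assume "?\<phi> = princ (Q * m)"
  then have "\<xi> a * princ Q a = princ m a * princ Q a" for a
   using fun_cong[of _ _ a] by (metis princ_mult mult.commute)
  then show False using lift_inj[OF X1.dch[OF \<xi>(1)] dchar_princ X.Q0] \<xi>(2) by blast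
 qed
 moreover have "Lval (\<lambda>n. ?\<phi> (int n)) s = 0" using E \<xi>(3) by (simp add: mult.commute)
 moreover have "finite ?X" using X.fin X1.fin by simp
 ultimately show ?thesis unfolding famL_def by (intro prod_zero bexI[of _ ?\<phi>]) auto
qed

text \<open>The lifts of the members of \<open>X\<close> contribute \<open>famL Q X 1\<close> up to
  Euler factors at primes of \<open>m\<close>. All remaining members of the product group are
  bounded individually by a small power of the modulus.\<close>

lemma famL_product_upper:
 assumes X: "char_fam Q X" and X1: "char_fam m X1" and e: "0 < e" "e <= 1" and K: "card X <= K" "card X1 <= K"
 shows "norm (famL (Q * m) ((\<lambda>(\<psi>, \<xi>) a. \<psi> a * \<xi> a) ` (X \<times> X1)) 1)
  <= norm (famL Q X 1) * 2 ^ (m * K) * ((1 / e + 4) * real (Q * m) powr e) ^ (K * K)"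
proof -
 interpret X: char_fam Q X by fact
 interpret X1: char_fam m X1 by fact
 define X3 where "X3 = (\<lambda>(\<psi>, \<xi>) a. \<psi> a * \<xi> a) ` (X \<times> X1)"
 have g3: "char_group (Q * m) X3" "card X3 <= card X * card X1" unfolding X3_def by (rule char_group_product[OF X.X X1.X])+
 interpret X3: char_fam "Q * m" X3 using g3 X.Q0 X1.Q0 by unfold_locales auto
 have "card X * card X1 <= K * K" using K by (intro mult_le_mono)
 then have c3: "card X3 <= K * K" using g3 by linarith
 define j where "j = (\<lambda>\<psi> a. \<psi> a * princ m a)"
 define J where "J = j ` (X - {princ Q})"
 have inj: "inj_on j X"
 proof (rule inj_onI)
  fix \<psi> \<psi>' assume *: "\<psi> \<in> X" "\<psi>' \<in> X" "j \<psi> = j \<psi>'"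
  show "\<psi> = \<psi>'" by (rule lift_inj[OF X.dch[OF *(1)] X.dch[OF *(2)] X1.Q0]) (use fun_cong[OF *(3)] in \<open>simp add: j_def\<close>)
 qed
 have jp: "j (princ Q) = princ (Q * m)" by (auto simp: j_def princ_mult)
 have J: "J \<subseteq> X3 - {princ (Q * m)}"
 proof
  fix \<phi> assume "\<phi> \<in> J"
  then obtain \<psi> where \<psi>: "\<psi> \<in> X" "\<psi> \<noteq> princ Q" "\<phi> = j \<psi>" by (auto simp: J_def)
  have "\<phi> \<in> X3" unfolding X3_def \<psi>(3) j_def using \<psi>(1) X1.princ_in by force
  moreover have "\<phi> \<noteq> princ (Q * m)" using \<psi> inj X.princ_in unfolding jp[symmetric] by (auto dest: inj_onD)
  ultimately show "\<phi> \<in> X3 - {princ (Q * m)}" by simp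
 qed
 let ?L = "\<lambda>\<phi>. Lval (\<lambda>n. \<phi> (int n)) 1" and ?C = "(1 / e + 4) * real (Q * m) powr e"
 have C1: "?C >= 1"
 proof -
  have "1 * 1 <= ?C" using e X.Q0 X1.Q0 by (intro mult_mono ge_one_powr_ge_zero) (auto simp flip: of_nat_mult)
  then show ?thesis by simp
 qed
 have "norm (famL (Q * m) X3 1) = (\<Prod>\<phi>\<in>X3 - {princ (Q * m)}. norm (?L \<phi>))" by (simp add: famL_def prod_norm)
 also have "... = (\<Prod>\<phi>\<in>X3 - {princ (Q * m)} - J. norm (?L \<phi>)) * (\<Prod>\<phi>\<in>J. norm (?L \<phi>))"
  using X3.fin J by (intro prod.subset_diff) auto
 also have "... <= ?C ^ (K * K) * (norm (famL Q X 1) * 2 ^ (m * K))"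
 proof (rule mult_mono)
  have "(\<Prod>\<phi>\<in>X3 - {princ (Q * m)} - J. norm (?L \<phi>)) <= (\<Prod>\<phi>\<in>X3 - {princ (Q * m)} - J. ?C)"
   by (intro prod_mono conjI norm_ge_zero X3.Lval_1_upper X3.in_nontriv e) auto
  also have "... = ?C ^ card (X3 - {princ (Q * m)} - J)" by simp
  also have "... <= ?C ^ (K * K)"
  proof (rule power_increasing[OF _ C1])
   have "card (X3 - {princ (Q * m)} - J) <= card X3" using X3.fin by (intro card_mono) auto
   then show "card (X3 - {princ (Q * m)} - J) <= K * K" using c3 by linarith
  qed
  finally show "(\<Prod>\<phi>\<in>X3 - {princ (Q * m)} - J. norm (?L \<phi>)) <= ?C ^ (K * K)" .
  have "(\<Prod>\<phi>\<in>J. norm (?L \<phi>)) = (\<Prod>\<psi>\<in>X - {princ Q}. norm (?L (j \<psi>)))"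
   unfolding J_def using inj by (subst prod.reindex) (auto intro: inj_on_subset)
  also have "... <= (\<Prod>\<psi>\<in>X - {princ Q}. norm (?L \<psi>) * 2 ^ m)"
  proof (intro prod_mono conjI norm_ge_zero)
   fix \<psi> assume \<psi>: "\<psi> \<in> X - {princ Q}"
   obtain E where E: "norm E <= 2 ^ m" "Lval (\<lambda>n. \<psi> (int n) * princ m (int n)) 1 = ?L \<psi> * E"
    using Lval_lift[of Q \<psi> m 1] X.dch[of \<psi>] \<psi> X.Q0 X1.Q0 by auto
   show "norm (?L (j \<psi>)) <= norm (?L \<psi>) * 2 ^ m"
    unfolding j_def E(2) norm_mult using E(1) by (intro mult_left_mono) auto
  qed
  also have "... = norm (famL Q X 1) * (2 ^ m) ^ card (X - {princ Q})"
   by (simp add: prod.distrib famL_def prod_norm)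
  also have "... <= norm (famL Q X 1) * (2 ^ m) ^ K"
  proof (intro mult_left_mono power_increasing)
   have "card (X - {princ Q}) <= card X" using X.fin by (intro card_mono) auto
   then show "card (X - {princ Q}) <= K" using K by linarith
  qed auto
  finally show "(\<Prod>\<phi>\<in>J. norm (?L \<phi>)) <= norm (famL Q X 1) * 2 ^ (m * K)" by (simp add: power_mult)
 qed (use C1 in \<open>auto intro!: prod_nonneg zero_le_power\<close>)
 finally show ?thesis by (simp add: X3_def mult_ac)
qed

text \<open>In the exceptional case a lower bound for the product group, whose zero \<beta>1 does
  not move with \<open>X\<close>, is divided by the upper bound for the factors outside
  \<open>X\<close>. The constant then depends on the exceptional group; it is obtained by a case
  distinction and is not effective.\<close>

theorem siegel:
 fixes K :: nat
 assumes e: "e > 0"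
 shows "\<exists>c>0. \<forall>Q X. char_fam Q X --> Q >= 4 --> card X <= K --> Re (famL Q X 1) >= c * real Q powr (- e)"
proof -
 \<comment> \<open>Product groups have up to \<open>K * K\<close> members, so the repulsion lemma is
   used at that size.\<close>
 define K2 where "K2 = max 1 (K * K)"
 have K2: "K2 >= 1" "K * K <= K2" "K <= K2" by (auto simp: K2_def) (metis le_square max.coboundedI2)
 obtain \<kappa> where \<kappa>: "\<kappa> > 0" "\<And>\<beta>::real. 1 - \<kappa> < \<beta> ==> \<beta> < 1 ==> (\<exists>c>0. \<forall>Q X. char_fam Q X --> Q >= 4 --> card X <= K2 -->
   Re (famL Q X \<beta>) >= 0 --> Re (famL Q X 1) >= c * real Q powr (- (6 * K2 * (1 - \<beta>))))"
  using siegel_zero_repulsion[of K2] by blast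
 \<comment> \<open>Within distance \<eta> of 1 the repulsion lemma applies, its loss
   \<open>6 * K2 * \<eta>\<close> is at most \<open>e / 2\<close>, and the series of groups of size
   up to \<open>K2\<close> converge.\<close>
 define \<eta> where "\<eta> = min (min (\<kappa> / 2) (e / (12 * K2))) ((1 / 4) / 4 ^ K2)"
 have \<eta>: "0 < \<eta>" "\<eta> < \<kappa>" "12 * K2 * \<eta> <= e" "\<eta> < (1 / 2) / 4 ^ K2" "\<eta> <= 1 / 4"
 proof -
  show "0 < \<eta>" using \<kappa>(1) e K2 by (simp add: \<eta>_def)
  have le: "\<eta> <= \<kappa> / 2" "\<eta> <= e / (12 * K2)" "\<eta> <= (1 / 4) / 4 ^ K2" by (auto simp: \<eta>_def)
  have "(1 / 4) / 4 ^ K2 < (1 / 2 :: real) / 4 ^ K2" by (intro divide_strict_right_mono) auto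
  then show "\<eta> < (1 / 2) / 4 ^ K2" using le by linarith
  have "(1 / 4) / 4 ^ K2 <= (1 / 4 :: real)" by (simp add: divide_le_eq)
  then show "\<eta> <= 1 / 4" using le by linarith
  show "\<eta> < \<kappa>" using le \<kappa>(1) by linarith
  show "12 * K2 * \<eta> <= e" using le(2) K2 by (simp add: pos_le_divide_eq mult.commute)
 qed
 define \<beta>0 where "\<beta>0 = 1 - \<eta>"
 have fp: "real Q powr (- e) <= real Q powr (- (6 * K2 * (1 - \<beta>)))" if "Q >= 4" "\<beta>0 <= \<beta>" "\<beta> <= 1" for Q :: nat and \<beta> :: real
 proof (rule powr_mono)
  have "6 * K2 * (1 - \<beta>) <= 12 * K2 * \<eta>" using that \<eta> by (intro mult_mono) (auto simp: \<beta>0_def)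
  then show "- e <= - (6 * K2 * (1 - \<beta>))" using \<eta> by linarith
 qed (use that in auto)
 show ?thesis
 proof (cases "\<exists>m X1. char_fam m X1 \<and> m >= 4 \<and> card X1 <= K \<and> Re (famL m X1 \<beta>0) < 0")
  case False
  obtain c where c: "c > 0" "\<And>Q X. char_fam Q X ==> Q >= 4 ==> card X <= K2 ==>
   Re (famL Q X \<beta>0) >= 0 ==> Re (famL Q X 1) >= c * real Q powr (- (6 * K2 * (1 - \<beta>0)))"
   using \<kappa>(2)[of \<beta>0] \<eta> by (auto simp: \<beta>0_def)
  show ?thesis
  proof (rule exI[of _ c], intro conjI allI impI c(1))
   fix Q X assume X: "char_fam Q X" "Q >= 4" "card X <= K"
   have "c * real Q powr (- e) <= c * real Q powr (- (6 * K2 * (1 - \<beta>0)))"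
    using c(1) X \<eta> by (intro mult_left_mono fp) (auto simp: \<beta>0_def)
   also have "... <= Re (famL Q X 1)" using X K2 False by (intro c(2)) force+
   finally show "c * real Q powr (- e) <= Re (famL Q X 1)" .
  qed
 next
  case True
  then obtain m X1 where X1: "char_fam m X1" "m >= 4" "card X1 <= K" "Re (famL m X1 \<beta>0) < 0" by blast
  interpret X1: char_fam m X1 by fact
  have cont: "continuous_on {\<beta>0..1} (\<lambda>s. Re (famL m X1 s))"
   by (intro continuous_on_Re continuous_on_subset[OF X1.famL_continuous]) (use \<eta> in \<open>auto simp: \<beta>0_def\<close>)
  \<comment> \<open>The product is negative at \<beta>0 and positive at 1, so it has a real zero
    between; realness of \<open>famL\<close> makes the whole value vanish there, and not only its
    real part.\<close>
  obtain \<beta>1 where \<beta>1: "\<beta>0 <= \<beta>1" "\<beta>1 <= 1" "Re (famL m X1 \<beta>1) = 0"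
   using IVT'[of "\<lambda>s. Re (famL m X1 s)" \<beta>0 0 1] X1(4) X1.famL_1_pos \<eta> cont by (auto simp: \<beta>0_def)
  have \<beta>1': "\<beta>0 < \<beta>1" "\<beta>1 < 1"
   using \<beta>1 X1(4) X1.famL_1_pos by (auto simp: less_le)
  have "(4::real) ^ card X1 <= 4 ^ K2" using X1(3) K2 by (intro power_increasing) auto
  then have "(1 / 2) / 4 ^ K2 <= (1 / 2) / (4::real) ^ card X1" by (intro divide_left_mono) auto
  then have "1 - \<beta>1 < (1 / 2) / 4 ^ card X1" using \<beta>1' \<eta> by (simp add: \<beta>0_def)
  then have "famL m X1 \<beta>1 \<in> \<real>" by (rule X1.famL_real)
  then have zero: "famL m X1 \<beta>1 = 0" using \<beta>1(3) by (auto simp: complex_is_Real_iff complex_eq_iff)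
  obtain c where c: "c > 0" "\<And>Q X. char_fam Q X ==> Q >= 4 ==> card X <= K2 ==>
   Re (famL Q X \<beta>1) >= 0 ==> Re (famL Q X 1) >= c * real Q powr (- (6 * K2 * (1 - \<beta>1)))"
   using \<kappa>(2)[of \<beta>1] \<eta> \<beta>1' by (auto simp: \<beta>0_def)
  \<comment> \<open>Up to \<open>K * K\<close> extra factors, each at most a constant times the
    modulus to the power \<open>u\<close>, lose at most the power \<open>e / 2\<close>; the
    repulsion bound accounts for the other half.\<close>
  define u where "u = min 1 (e / (2 * K2))"
  have u: "0 < u" "u <= 1" "u * K2 <= e / 2"
  proof -
   show "0 < u" "u <= 1" using e K2 by (auto simp: u_def)
   have "u * K2 <= e / (2 * K2) * K2" by (intro mult_right_mono) (auto simp: u_def)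
   then show "u * K2 <= e / 2" using K2 by simp
  qed
  define D where "D = 2 ^ (m * K) * (1 / u + 4) ^ (K * K)"
  have D: "D > 0" using u by (simp add: D_def add_pos_pos)
  show ?thesis
  proof (rule exI[of _ "c * real m powr (- e) / D"], intro conjI allI impI)
   show "c * real m powr (- e) / D > 0" using c(1) D X1(2) by simp
   fix Q X assume X: "char_fam Q X" "Q >= 4" "card X <= K"
   interpret X: char_fam Q X by fact
   define X3 where "X3 = (\<lambda>(\<psi>, \<xi>) a. \<psi> a * \<xi> a) ` (X \<times> X1)"
   have g3: "char_group (Q * m) X3" "card X3 <= card X * card X1" unfolding X3_def by (rule char_group_product[OF X.X X1.X])+
   interpret X3: char_fam "Q * m" X3 using g3 X.Q0 X1.Q0 by unfold_locales auto
   have "card X * card X1 <= K * K" using X(3) X1(3) by (intro mult_le_mono)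
   then have c3: "card X3 <= K2" using g3 K2 by linarith
   have Qm: "Q * m >= 4" using mult_le_mono[of 4 Q 1 m] X(2) X1(2) by simp
   have z3: "famL (Q * m) X3 \<beta>1 = 0"
    unfolding X3_def by (rule famL_product_zero[OF X(1) X1(1) _ zero]) (use \<beta>1' \<eta> in \<open>simp add: \<beta>0_def\<close>)
   have QmR: "real (Q * m) > 0" and Qm1: "1 <= real (Q * m)" using Qm by linarith+
   have "c * real (Q * m) powr (- (e / 2)) <= c * real (Q * m) powr (- (6 * K2 * (1 - \<beta>1)))"
   proof (intro mult_left_mono powr_mono)
    have "6 * K2 * (1 - \<beta>1) <= 6 * K2 * \<eta>" using \<beta>1' by (intro mult_left_mono) (auto simp: \<beta>0_def)
    then show "- (e / 2) <= - (6 * K2 * (1 - \<beta>1))" using \<eta>(3) by simp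
   qed (use c(1) Qm1 in auto)
   also have "... <= Re (famL (Q * m) X3 1)" by (rule c(2)) (use X3.char_fam_axioms Qm c3 z3 in auto)
   also have "... <= norm (famL (Q * m) X3 1)" by (rule complex_Re_le_cmod)
   also have "... <= norm (famL Q X 1) * 2 ^ (m * K) * ((1 / u + 4) * real (Q * m) powr u) ^ (K * K)"
    unfolding X3_def by (rule famL_product_upper[OF X(1) X1(1) u(1,2) X(3) X1(3)])
   also have "... = norm (famL Q X 1) * D * (real (Q * m) powr u) ^ (K * K)" by (simp add: D_def power_mult_distrib)
   also have "(real (Q * m) powr u) ^ (K * K) = real (Q * m) powr (u * (K * K))"
    using QmR by (simp only: powr_power) (simp add: mult.commute)
   also have "... <= real (Q * m) powr (e / 2)"
   proof (rule powr_mono)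
    have "u * real (K * K) <= u * real K2" using K2 u by (intro mult_left_mono) (auto simp del: of_nat_mult)
    then show "u * real (K * K) <= e / 2" using u by linarith
   qed (use Qm in linarith)
   finally have "c * real (Q * m) powr (- (e / 2)) <= norm (famL Q X 1) * D * real (Q * m) powr (e / 2)"
    using D by (simp add: mult_left_mono)
   then have "c * real (Q * m) powr (- (e / 2)) * real (Q * m) powr (- (e / 2)) <= norm (famL Q X 1) * D * real (Q * m) powr (e / 2) * real (Q * m) powr (- (e / 2))"
    by (rule mult_right_mono) simp
   also have "c * real (Q * m) powr (- (e / 2)) * real (Q * m) powr (- (e / 2)) = c * (real (Q * m) powr (- (e / 2)) * real (Q * m) powr (- (e / 2)))" by (rule mult.assoc)
   also have "real (Q * m) powr (- (e / 2)) * real (Q * m) powr (- (e / 2)) = real (Q * m) powr (- e)" unfolding powr_add[symmetric] by simp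
   also have "norm (famL Q X 1) * D * real (Q * m) powr (e / 2) * real (Q * m) powr (- (e / 2)) = norm (famL Q X 1) * D * (real (Q * m) powr (e / 2) * real (Q * m) powr (- (e / 2)))" by (rule mult.assoc)
   also have "real (Q * m) powr (e / 2) * real (Q * m) powr (- (e / 2)) = 1" unfolding powr_add[symmetric] using X.Q0 X1.Q0 by simp
   finally have "c * real (Q * m) powr (- e) <= norm (famL Q X 1) * D" by simp
   then have "c * (real m powr (- e) * real Q powr (- e)) / D <= norm (famL Q X 1)"
    using D by (simp add: divide_le_eq powr_mult mult_ac)
   moreover have "norm (famL Q X 1) = Re (famL Q X 1)"
   proof -
    have "famL Q X 1 \<in> \<real>" by (rule X.famL_real) simp
    then have "famL Q X 1 = of_real (Re (famL Q X 1))" by simp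
    then show ?thesis using X.famL_1_pos by (metis abs_of_pos norm_of_real)
   qed
   ultimately show "c * real m powr (- e) / D * real Q powr (- e) <= Re (famL Q X 1)" by (simp add: mult_ac)
  qed
 qed
qed

section \<open>Characters trivial on a subgroup\<close>

text \<open>A character of a subgroup. The function is total with arbitrary values outside
  \<open>M\<close>, so extensions do not change its type.\<close>

definition (in group) partial_char :: "'a set => ('a => complex) => bool" where
 "partial_char M \<psi> \<longleftrightarrow> subgroup M G \<and> \<psi> \<one> = 1 \<and> (\<forall>x\<in>M. \<forall>y\<in>M. \<psi> (x \<otimes> y) = \<psi> x * \<psi> y)"

text \<open>One step of extending characters: \<open>m \<otimes> x [^] j\<close> is sent to
  \<open>\<psi> m * w ^ j\<close>, where \<open>k\<close> is the order of \<open>x\<close> modulo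
  \<open>M\<close> and \<open>w\<close> is any root of order \<open>k\<close> of the prescribed
  value. The freedom in \<open>w\<close> is what allows separation of points.\<close>

lemma (in comm_group) partial_char_extend:
 assumes fin: "finite (carrier G)" and \<psi>: "partial_char M \<psi>" and x: "x \<in> carrier G"
  and k: "k > 0" "x [^] (k::nat) \<in> M" "\<And>j. 0 < j ==> j < k ==> x [^] j \<notin> M" and w: "w ^ k = \<psi> (x [^] k)"
 shows "\<exists>M' \<psi>'. partial_char M' \<psi>' \<and> M \<subseteq> M' \<and> x \<in> M' \<and> (\<forall>m\<in>M. \<psi>' m = \<psi> m) \<and> \<psi>' x = w"
proof -
 have M: "subgroup M G" using \<psi> by (simp add: partial_char_def)
 have mc: "m \<in> carrier G" if "m \<in> M" for m using that M by (rule subgroup.mem_carrier[rotated])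
 have \<psi>m: "\<psi> (a \<otimes> b) = \<psi> a * \<psi> b" if "a \<in> M" "b \<in> M" for a b using \<psi> that by (simp add: partial_char_def)
 have \<psi>1: "\<psi> \<one> = 1" using \<psi> by (simp add: partial_char_def)
 have M1: "\<one> \<in> M" using M by (rule subgroup.one_closed)
 have Mm: "a \<otimes> b \<in> M" if "a \<in> M" "b \<in> M" for a b using subgroup.m_closed[OF M that] .
 have Mi: "inv a \<in> M" if "a \<in> M" for a using subgroup.m_inv_closed[OF M that] .
 have pk: "(x [^] k) [^] (t::nat) \<in> M \<and> \<psi> ((x [^] k) [^] t) = w ^ (k * t)" for t
  by (induction t) (auto simp: M1 \<psi>1 Mm \<psi>m k(2) w[symmetric] power_add mult.commute)
 \<comment> \<open>Minimality of \<open>k\<close> forces every exponent that leads into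
   \<open>M\<close> to be a multiple of \<open>k\<close>; this makes the extension independent of
   the representation.\<close>
 have dvd: "k dvd d \<and> \<psi> (x [^] d) = w ^ d" if d: "x [^] (d::nat) \<in> M" for d
 proof -
  have e: "x [^] d = (x [^] k) [^] (d div k) \<otimes> x [^] (d mod k)"
   using x by (simp add: nat_pow_pow nat_pow_mult)
  have "x [^] (d mod k) = inv ((x [^] k) [^] (d div k)) \<otimes> x [^] d"
   unfolding e using x by (simp add: m_assoc[symmetric])
  also have "... \<in> M" using pk d by (intro Mm Mi) auto
  finally have "d mod k = 0" using k(1) k(3)[of "d mod k"] by (cases "d mod k = 0") auto
  then have dk: "k dvd d" by auto
  then have "x [^] d = (x [^] k) [^] (d div k)" using x by (simp add: nat_pow_pow)
  then show ?thesis using dk pk[of "d div k"] by simp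
 qed
 have wd0: "\<psi> m * w ^ i = \<psi> m' * w ^ j"
  if "m \<in> M" "m' \<in> M" and eq: "m \<otimes> x [^] i = m' \<otimes> x [^] j" and ij: "i <= j" for m m' and i j :: nat
 proof -
  have "x [^] j = x [^] (j - i) \<otimes> x [^] i" using x ij by (simp add: nat_pow_mult)
  then have "m \<otimes> x [^] i = (m' \<otimes> x [^] (j - i)) \<otimes> x [^] i" using eq x mc[OF that(2)] by (simp add: m_assoc)
  then have m: "m = m' \<otimes> x [^] (j - i)" using x mc[OF that(1)] mc[OF that(2)] by simp
  have "x [^] (j - i) = inv m' \<otimes> m" unfolding m using x mc[OF that(2)] by (simp add: m_assoc[symmetric])
  also have "... \<in> M" using that by (intro Mm Mi)
  finally have in_M: "x [^] (j - i) \<in> M" .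
  have "\<psi> m = \<psi> m' * w ^ (j - i)" unfolding m using \<psi>m[OF that(2) in_M] dvd[OF in_M] by simp
  then show ?thesis using ij by (simp add: mult.assoc power_add[symmetric])
 qed
 have wd: "\<psi> m * w ^ i = \<psi> m' * w ^ j"
  if "m \<in> M" "m' \<in> M" "m \<otimes> x [^] i = m' \<otimes> x [^] j" for m m' and i j :: nat
  using wd0[of m m' i j] wd0[of m' m j i] that by (cases "i <= j") auto
 define M' where "M' = {m \<otimes> x [^] (j::nat) | m j. m \<in> M}"
 define P where "P = (\<lambda>y v. \<exists>m j. m \<in> M \<and> y = m \<otimes> x [^] (j::nat) \<and> v = \<psi> m * w ^ j)"
 define \<psi>' where "\<psi>' = (\<lambda>y. SOME v. P y v)"
 have val: "\<psi>' (m \<otimes> x [^] j) = \<psi> m * w ^ j" if "m \<in> M" for m and j :: nat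
  unfolding \<psi>'_def
 proof (rule some_equality)
  show "P (m \<otimes> x [^] j) (\<psi> m * w ^ j)" unfolding P_def using that by blast
  show "v = \<psi> m * w ^ j" if "P (m \<otimes> x [^] j) v" for v
   using that wd[OF \<open>m \<in> M\<close>] unfolding P_def by metis
 qed
 have mult: "(m \<otimes> x [^] i) \<otimes> (m' \<otimes> x [^] j) = (m \<otimes> m') \<otimes> x [^] (i + j)" if "m \<in> M" "m' \<in> M" for m m' and i j :: nat
  using mc[OF that(1)] mc[OF that(2)] x by (simp add: m_ac nat_pow_mult[symmetric])
 have sub: "subgroup M' G"
 proof (rule subgroupI)
  show "M' \<subseteq> carrier G" using mc x by (auto simp: M'_def)
  show "M' \<noteq> {}" using M1 by (auto simp: M'_def)
  show "a \<otimes> b \<in> M'" if "a \<in> M'" "b \<in> M'" for a b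
  proof -
   from that obtain m i m' j where *: "m \<in> M" "m' \<in> M" "a = m \<otimes> x [^] (i::nat)" "b = m' \<otimes> x [^] (j::nat)"
    unfolding M'_def by blast
   then have "a \<otimes> b = (m \<otimes> m') \<otimes> x [^] (i + j)" using mult by simp
   then show ?thesis unfolding M'_def using Mm[OF *(1,2)] by blast
  qed
  show "inv a \<in> M'" if "a \<in> M'" for a
  proof -
   from that obtain m j where *: "m \<in> M" "a = m \<otimes> x [^] (j::nat)" unfolding M'_def by blast
   \<comment> \<open>Only natural exponents are used, so the inverse of a power of \<open>x\<close>
     is written with the help of the group order.\<close>
   define n where "n = Coset.order G"
   have n: "n > 0" "x [^] n = \<one>" using fin x pow_order_eq_1 order_gt_0_iff_finite by (auto simp: n_def)
   have "(n - 1) * j + j = n * j" using n(1) by (cases n) auto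
   then have "x [^] ((n - 1) * j) \<otimes> x [^] j = x [^] (n * j)" using x by (simp add: nat_pow_mult)
   also have "... = \<one>" using x n(2) by (simp add: nat_pow_pow[symmetric])
   finally have "inv (x [^] j) = x [^] ((n - 1) * j)" using x by (intro inv_equality) auto
   then have "inv a = inv m \<otimes> x [^] ((n - 1) * j)" using * mc[OF *(1)] x by (simp add: inv_mult)
   then show ?thesis unfolding M'_def using Mi[OF *(1)] by blast
  qed
 qed
 have sm: "m = m \<otimes> x [^] (0::nat)" if "m \<in> M" for m using mc[OF that] by simp
 have vm: "\<psi>' m = \<psi> m" if "m \<in> M" for m using val[OF that, of 0] mc[OF that] by simp
 have x1: "x = \<one> \<otimes> x [^] (1::nat)" using x by simp
 show ?thesis
 proof (intro exI conjI)
  show "partial_char M' \<psi>'"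
   unfolding partial_char_def
  proof (intro conjI ballI sub)
   show "\<psi>' \<one> = 1" using vm[OF M1] \<psi>1 by simp
   fix a b assume "a \<in> M'" "b \<in> M'"
   then obtain m i m' j where *: "m \<in> M" "m' \<in> M" "a = m \<otimes> x [^] (i::nat)" "b = m' \<otimes> x [^] (j::nat)"
    unfolding M'_def by blast
   have "\<psi>' (a \<otimes> b) = \<psi> (m \<otimes> m') * w ^ (i + j)" unfolding * mult[OF *(1,2)] by (rule val[OF Mm[OF *(1,2)]])
   then show "\<psi>' (a \<otimes> b) = \<psi>' a * \<psi>' b" unfolding * val[OF *(1)] val[OF *(2)] \<psi>m[OF *(1,2)] by (simp add: power_add)
  qed
  show "M \<subseteq> M'" unfolding M'_def using sm by blast
  show "x \<in> M'" unfolding M'_def using x1 M1 by blast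
  show "\<forall>m\<in>M. \<psi>' m = \<psi> m" using vm by blast
  show "\<psi>' x = w" using val[OF M1, of 1] x \<psi>1 by simp
 qed
qed

lemma (in comm_group) least_power_in_subgroup:
 assumes "finite (carrier G)" "subgroup M G" "x \<in> carrier G"
 obtains k :: nat where "k > 0" "x [^] k \<in> M" "\<And>j. 0 < j ==> j < k ==> x [^] j \<notin> M"
proof -
 define P where "P = (\<lambda>k::nat. k > 0 \<and> x [^] k \<in> M)"
 have "P (Coset.order G)"
  unfolding P_def using assms pow_order_eq_1[of x] order_gt_0_iff_finite subgroup.one_closed[OF assms(2)] by simp
 then have "P (LEAST k. P k)" by (rule LeastI)
 moreover have "\<not> P j" if "j < (LEAST k. P k)" for j using not_less_Least[OF that] .
 ultimately show ?thesis by (intro that[of "LEAST k. P k"]) (auto simp: P_def)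
qed

lemma (in comm_group) partial_char_total:
 assumes fin: "finite (carrier G)" and "partial_char M \<psi>"
 shows "\<exists>\<psi>'. partial_char (carrier G) \<psi>' \<and> (\<forall>m\<in>M. \<psi>' m = \<psi> m)"
 using assms(2)
proof (induction "card (carrier G) - card M" arbitrary: M \<psi> rule: less_induct)
 case less
 have M: "subgroup M G" using less.prems by (simp add: partial_char_def)
 then have Mc: "M \<subseteq> carrier G" by (rule subgroup.subset)
 show ?case
 proof (cases "M = carrier G")
  case False
  then obtain x where x: "x \<in> carrier G" "x \<notin> M" using Mc by blast
  obtain k :: nat where k: "k > 0" "x [^] k \<in> M" "\<And>j. 0 < j ==> j < k ==> x [^] j \<notin> M"
   using least_power_in_subgroup[OF fin M x(1)] by blast
  have "\<psi> (x [^] k) * \<psi> (inv (x [^] k)) = \<psi> (x [^] k \<otimes> inv (x [^] k))"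
   using less.prems k(2) subgroup.m_inv_closed[OF M k(2)] by (simp add: partial_char_def)
  also have "... = 1" using x less.prems by (simp add: partial_char_def)
  finally have "\<psi> (x [^] k) \<noteq> 0" by auto
  then have w: "exp (Ln (\<psi> (x [^] k)) / of_nat k) ^ k = \<psi> (x [^] k)" using k(1) by (simp add: exp_of_nat_mult[symmetric])
  obtain M' \<psi>1 where 1: "partial_char M' \<psi>1" "M \<subseteq> M'" "x \<in> M'" "\<forall>m\<in>M. \<psi>1 m = \<psi> m"
   using partial_char_extend[OF fin less.prems x(1) k w] by blast
  have M'c: "M' \<subseteq> carrier G" using 1(1) subgroup.subset by (auto simp: partial_char_def)
  have "card M < card M'" using 1 x M'c fin by (intro psubset_card_mono) (auto intro: finite_subset)
  moreover have "card M' <= card (carrier G)" using M'c fin by (rule card_mono[rotated])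
  ultimately have "card (carrier G) - card M' < card (carrier G) - card M" by linarith
  then obtain \<psi>2 where "partial_char (carrier G) \<psi>2" "\<forall>m\<in>M'. \<psi>2 m = \<psi>1 m" using less.hyps 1(1) by blast
  then show ?thesis using 1 by (intro exI[of _ \<psi>2]) auto
 qed (use less.prems in auto)
qed

text \<open>The trivial character of \<open>H\<close> is extended to \<open>a\<close> by a value
  different from 1, which is possible because the order of \<open>a\<close> modulo \<open>H\<close>
  exceeds 1, and then to the whole group.\<close>

lemma (in comm_group) separating_char:
 assumes fin: "finite (carrier G)" and H: "subgroup H G" and a: "a \<in> carrier G" "a \<notin> H"
 shows "\<exists>\<psi>. partial_char (carrier G) \<psi> \<and> (\<forall>h\<in>H. \<psi> h = 1) \<and> \<psi> a \<noteq> 1"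
proof -
 obtain k :: nat where k: "k > 0" "a [^] k \<in> H" "\<And>j. 0 < j ==> j < k ==> a [^] j \<notin> H"
  using least_power_in_subgroup[OF fin H a(1)] by blast
 have k2: "k > 1" using k a by (cases "k = 1") auto
 define w where "w = cis (2 * pi / real k)"
 have wk: "w ^ k = 1" using k(1) by (simp add: w_def Complex.DeMoivre)
 have w1: "w \<noteq> 1"
 proof
  assume "w = 1"
  then have "exp (of_real (2 * pi / real k) * \<i>) = exp 0" by (simp add: w_def cis_conv_exp mult.commute)
  then obtain n :: int where "2 * pi / real k = 2 * of_int n * pi"
   unfolding exp_eq by (auto simp: complex_eq_iff)
  then have "(1 / real k) * (2 * pi) = of_int n * (2 * pi)" by (simp add: mult_ac)
  then have "1 / real k = of_int n" using pi_neq_zero by (subst (asm) mult_right_cancel) auto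
  then have "real_of_int n * real_of_int (int k) = 1" using k(1) by (simp add: field_simps)
  then have "real_of_int (n * int k) = 1" by (simp only: of_int_mult)
  then have "n * int k = 1" by (simp only: of_int_eq_1_iff)
  then show False using k2 by (simp add: zmult_eq_1_iff)
 qed
 have "partial_char H (\<lambda>_. 1)" using H by (simp add: partial_char_def)
 then obtain M' \<psi>1 where 1: "partial_char M' \<psi>1" "H \<subseteq> M'" "a \<in> M'" "\<forall>m\<in>H. \<psi>1 m = 1" "\<psi>1 a = w"
  using partial_char_extend[OF fin _ a(1) k, of "\<lambda>_. 1" w] wk by auto
 obtain \<psi> where "partial_char (carrier G) \<psi>" "\<forall>m\<in>M'. \<psi> m = \<psi>1 m" using partial_char_total[OF fin 1(1)] by blast
 then show ?thesis using 1 w1 by (intro exI[of _ \<psi>]) auto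
qed

section \<open>Residue characters trivial on \<open>H\<close>\<close>

lemma finite_dchars:
 assumes "q > 0"
 shows "finite {\<xi>. dchar q \<xi>}"
proof -
 let ?R = "{0..<int q}" and ?V = "insert 0 {z :: complex. z ^ totient q = 1}"
 have "inj_on (\<lambda>\<xi>. restrict \<xi> ?R) {\<xi>. dchar q \<xi>}"
 proof (rule inj_onI, rule ext)
  fix \<xi> \<psi> :: "int => complex" and a :: int
  assume *: "\<xi> \<in> {\<xi>. dchar q \<xi>}" "\<psi> \<in> {\<xi>. dchar q \<xi>}" "restrict \<xi> ?R = restrict \<psi> ?R"
  have "a mod int q \<in> ?R" using assms by simp
  then have "\<xi> (a mod int q) = \<psi> (a mod int q)" using fun_cong[OF *(3), of "a mod int q"] by simp
  moreover have "[a mod int q = a] (mod int q)" by (simp add: cong_def)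
  ultimately show "\<xi> a = \<psi> a" using dchar_cong[of q \<xi> "a mod int q" a] dchar_cong[of q \<psi> "a mod int q" a] * by simp
 qed
 moreover have "(\<lambda>\<xi>. restrict \<xi> ?R) ` {\<xi>. dchar q \<xi>} \<subseteq> PiE ?R (\<lambda>_. ?V)"
 proof (clarify, rule PiE_I)
  fix \<xi> a assume \<xi>: "dchar q \<xi>" and a: "a \<in> ?R"
  show "restrict \<xi> ?R a \<in> ?V"
   using a dchar_totient[OF \<xi> _ assms, of a] dchar_eq_0_iff[OF \<xi>, of a] by (cases "coprime a (int q)") auto
 qed auto
 moreover have "finite (PiE ?R (\<lambda>_. ?V))"
  using assms by (intro finite_PiE) (auto intro!: finite_roots_unity simp: Suc_le_eq)
 ultimately show ?thesis by (meson finite_imageD finite_subset)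
qed

definition resid_chars :: "nat => int set => (int => complex) set" where
 "resid_chars q H = {\<xi>. dchar q \<xi> \<and> (\<forall>h\<in>H. \<xi> h = 1)}"

lemma char_group_resid_chars:
 assumes q: "q > 1" and H: "subgroup H (mod_units q)"
 shows "char_group q (resid_chars q H)"
 unfolding char_group_def
proof (intro conjI ballI)
 have Hc: "H \<subseteq> carrier (mod_units q)" using H by (rule subgroup.subset)
 show "finite (resid_chars q H)" using finite_dchars[of q] q by (auto simp: resid_chars_def)
 show "princ q \<in> resid_chars q H"
  using Hc by (auto simp: resid_chars_def dchar_princ princ_def carrier_mod_units[OF q])
 show "dchar q \<xi>" if "\<xi> \<in> resid_chars q H" for \<xi> using that by (simp add: resid_chars_def)
 show "(\<lambda>a. \<xi> a * \<psi> a) \<in> resid_chars q H" if "\<xi> \<in> resid_chars q H" "\<psi> \<in> resid_chars q H" for \<xi> \<psi>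
 proof -
  have d: "dchar q \<xi>" "dchar q \<psi>" using that by (auto simp: resid_chars_def)
  have "dchar q (\<lambda>a. \<xi> a * \<psi> a)"
   unfolding dchar_def
  proof (intro conjI allI impI)
   show "\<xi> (a * b) * \<psi> (a * b) = \<xi> a * \<psi> a * (\<xi> b * \<psi> b)" for a b
    by (simp add: dchar_mult[OF d(1)] dchar_mult[OF d(2)])
   show "\<xi> a * \<psi> a = \<xi> b * \<psi> b" if "[a = b] (mod int q)" for a b
    using dchar_cong[OF d(1) that] dchar_cong[OF d(2) that] by simp
   show "(\<xi> a * \<psi> a \<noteq> 0) = coprime a (int q)" for a
    using dchar_eq_0_iff[OF d(1), of a] dchar_eq_0_iff[OF d(2), of a] by simp
  qed
  then show ?thesis using that by (simp add: resid_chars_def)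
 qed
qed

lemma finite_carrier_mod_units: "q > 1 ==> finite (carrier (mod_units q))"
 by (rule finite_subset[of _ "{0..<int q}"]) (auto simp: carrier_mod_units)

lemma resid_chars_separate:
 assumes q: "q > 1" and H: "subgroup H (mod_units q)" and a: "coprime a (int q)" "a mod int q \<notin> H"
 shows "\<exists>\<xi>\<in>resid_chars q H. \<xi> a \<noteq> 1"
proof -
 interpret G: comm_group "mod_units q" using mod_units_group[OF q] .
 have carrier: "b mod int q \<in> carrier (mod_units q)" if b: "coprime b (int q)" for b
 proof -
  have c: "coprime (b mod int q) (int q)" using b q by simp
  then have "b mod int q \<noteq> 0" using q by auto
  moreover have "0 <= b mod int q" "b mod int q < int q" using q by simp_all
  ultimately show ?thesis using c by (simp add: carrier_mod_units[OF q])
 qed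
 obtain \<psi> where \<psi>: "G.partial_char (carrier (mod_units q)) \<psi>" "\<forall>h\<in>H. \<psi> h = 1" "\<psi> (a mod int q) \<noteq> 1"
  using G.separating_char[OF finite_carrier_mod_units[OF q] H carrier[OF a(1)] a(2)] by blast
 have \<psi>m: "\<psi> (x * y mod int q) = \<psi> x * \<psi> y" if "x \<in> carrier (mod_units q)" "y \<in> carrier (mod_units q)" for x y
  using \<psi>(1) that by (simp add: G.partial_char_def mult_mod_units)
 have \<psi>n: "\<psi> x \<noteq> 0" if "x \<in> carrier (mod_units q)" for x
 proof -
  have "\<psi> (x \<otimes>\<^bsub>mod_units q\<^esub> inv\<^bsub>mod_units q\<^esub> x) = \<psi> x * \<psi> (inv\<^bsub>mod_units q\<^esub> x)"
   using \<psi>(1) that G.inv_closed[OF that] unfolding G.partial_char_def by blast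
  moreover have "\<psi> (x \<otimes>\<^bsub>mod_units q\<^esub> inv\<^bsub>mod_units q\<^esub> x) = 1"
   using \<psi>(1) G.r_inv[OF that] by (simp add: G.partial_char_def)
  ultimately show ?thesis by auto
 qed
 define \<xi> where "\<xi> = (\<lambda>b. if coprime b (int q) then \<psi> (b mod int q) else 0)"
 have "dchar q \<xi>"
  unfolding dchar_def
 proof (intro conjI allI impI)
  fix b c
  show "\<xi> (b * c) = \<xi> b * \<xi> c"
  proof (cases "coprime b (int q) \<and> coprime c (int q)")
   case True
   then have "\<psi> ((b mod int q) * (c mod int q) mod int q) = \<psi> (b mod int q) * \<psi> (c mod int q)" by (intro \<psi>m carrier) auto
   then show ?thesis using True by (simp add: \<xi>_def mod_mult_eq)
  qed (auto simp: \<xi>_def)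
  show "\<xi> b = \<xi> c" if "[b = c] (mod int q)"
  proof -
   have "coprime b (int q) \<longleftrightarrow> coprime c (int q)" using that by (meson cong_imp_coprime cong_sym)
   moreover have "b mod int q = c mod int q" using that by (simp add: cong_def)
   ultimately show ?thesis by (simp add: \<xi>_def)
  qed
  show "(\<xi> b \<noteq> 0) = coprime b (int q)" using \<psi>n[OF carrier] by (simp add: \<xi>_def)
 qed
 moreover have "\<xi> h = 1" if "h \<in> H" for h
 proof -
  have "h \<in> carrier (mod_units q)" using subgroup.mem_carrier[OF H that] .
  then have "coprime h (int q)" "h mod int q = h" by (auto simp: carrier_mod_units[OF q])
  then show ?thesis using \<psi>(2) that by (simp add: \<xi>_def)
 qed
 moreover have "\<xi> a \<noteq> 1" using \<psi>(3) a(1) by (simp add: \<xi>_def)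
 ultimately show ?thesis by (auto simp: resid_chars_def)
qed

text \<open>Double count of the sum of all values on the unit group: separation and orthogonality in
  the characters give \<open>card H * card X\<close>, orthogonality in the residues gives the order
  of the group. The claim follows by Lagrange's theorem.\<close>

lemma card_resid_chars:
 assumes q: "q > 1" and H: "subgroup H (mod_units q)"
 shows "card (resid_chars q H) = subgroup_index (mod_units q) H"
proof -
 interpret G: comm_group "mod_units q" using mod_units_group[OF q] .
 define X where "X = resid_chars q H"
 let ?G = "carrier (mod_units q)"
 have X: "char_group q X" unfolding X_def by (rule char_group_resid_chars[OF q H])
 then have fin: "finite X" "princ q \<in> X" by (auto simp: char_group_def)
 have finG: "finite ?G" by (rule finite_carrier_mod_units[OF q])
 have HG: "H \<subseteq> ?G" using H by (rule subgroup.subset)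
 have Gc: "coprime a (int q)" "a mod int q = a" if "a \<in> ?G" for a using that by (auto simp: carrier_mod_units[OF q])
 have "(\<Sum>a\<in>?G. \<Sum>\<xi>\<in>X. \<xi> a) = (\<Sum>a\<in>?G. if a \<in> H then of_nat (card X) else 0)"
 proof (intro sum.cong refl)
  fix a assume a: "a \<in> ?G"
  have "(\<exists>\<xi>\<in>X. \<xi> a \<noteq> 1) \<longleftrightarrow> a \<notin> H"
   using resid_chars_separate[OF q H Gc(1)[OF a]] Gc(2)[OF a] by (auto simp: X_def resid_chars_def)
  then show "(\<Sum>\<xi>\<in>X. \<xi> a) = (if a \<in> H then of_nat (card X) else 0)"
   using char_group_sum[OF X Gc(1)[OF a]] by simp
 qed
 also have "... = (\<Sum>a\<in>H. of_nat (card X))"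
  using finG HG by (intro sum.mono_neutral_cong_right) auto
 also have "... = of_nat (card H * card X)" by simp
 finally have 1: "(\<Sum>a\<in>?G. \<Sum>\<xi>\<in>X. \<xi> a) = of_nat (card H * card X)" .
 have "(\<Sum>a\<in>?G. \<Sum>\<xi>\<in>X. \<xi> a) = (\<Sum>\<xi>\<in>X. \<Sum>a\<in>?G. \<xi> a)" by (rule sum.swap)
 also have "... = (\<Sum>\<xi>\<in>X. if \<xi> = princ q then of_nat (card ?G) else 0)"
 proof (intro sum.cong refl)
  fix \<xi> assume "\<xi> \<in> X"
  then have d: "dchar q \<xi>" by (simp add: X_def resid_chars_def)
  show "(\<Sum>a\<in>?G. \<xi> a) = (if \<xi> = princ q then of_nat (card ?G) else 0)"
  proof (cases "\<xi> = princ q")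
   case True
   have "(\<Sum>a\<in>?G. \<xi> a) = (\<Sum>a\<in>?G. 1)" using Gc(1) by (intro sum.cong refl) (simp add: True princ_def)
   then show ?thesis using True by simp
  next
   case False
   have "(\<Sum>a\<in>?G. \<xi> a) = (\<Sum>a\<in>{0..<int q}. \<xi> a)"
   proof (rule sum.mono_neutral_left)
    show "\<forall>a\<in>{0..<int q} - ?G. \<xi> a = 0"
    proof
     fix a assume a: "a \<in> {0..<int q} - ?G"
     have "\<not> coprime a (int q)"
     proof
      assume c: "coprime a (int q)"
      then have "a \<noteq> 0" using q by auto
      then show False using a c by (auto simp: carrier_mod_units[OF q])
     qed
     then show "\<xi> a = 0" using dchar_eq_0_iff[OF d] by simp
    qed
   qed (auto simp: carrier_mod_units[OF q])
   also have "... = 0" using dchar_period_sum[OF d] trivial_char_iff[OF d] False q by simp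
   finally show ?thesis using False by simp
  qed
 qed
 also have "... = of_nat (card ?G)" using fin by (simp add: sum.delta)
 finally have "of_nat (card H * card X) = (of_nat (card ?G) :: complex)" using 1 by simp
 then have "card H * card X = card ?G" by (simp only: of_nat_eq_iff)
 moreover have "subgroup_index (mod_units q) H * card H = card ?G"
  using G.lagrange[OF H] by (simp add: subgroup_index_def Coset.order_def)
 moreover have "card H > 0"
 proof -
  have "finite H" using finG HG by (rule finite_subset[rotated])
  moreover have "H \<noteq> {}" using subgroup.one_closed[OF H] by auto
  ultimately show ?thesis by (simp add: card_gt_0_iff)
 qed
 ultimately have "card H * card X = card H * subgroup_index (mod_units q) H" by (simp add: mult.commute)
 then show ?thesis using \<open>card H > 0\<close> by (simp add: X_def)
qed

text \<open>Multiplication by \<xi> permutes the group, so the product of all values at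
  \<open>a\<close> equals itself times the claimed power; the product is not 0.\<close>

lemma char_group_power_card:
 assumes X: "char_group Q X" and \<xi>: "\<xi> \<in> X" and a: "coprime a (int Q)"
 shows "\<xi> a ^ card X = 1"
proof -
 have nz: "\<psi> a \<noteq> 0" if "\<psi> \<in> X" for \<psi> using X that a dchar_eq_0_iff[of Q \<psi> a] by (auto simp: char_group_def)
 have fin: "finite X" using X by (simp add: char_group_def)
 have "(\<Prod>\<psi>\<in>X. \<psi> a) = (\<Prod>\<psi>\<in>X. \<xi> a * \<psi> a)"
  using prod.reindex_bij_betw[OF char_group_mult_bij[OF X \<xi>], of "\<lambda>\<psi>. \<psi> a"] by simp
 also have "... = \<xi> a ^ card X * (\<Prod>\<psi>\<in>X. \<psi> a)" by (simp add: prod.distrib)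
 finally have "(\<xi> a ^ card X - 1) * (\<Prod>\<psi>\<in>X. \<psi> a) = 0" by (simp only: left_diff_distrib) simp
 moreover have "(\<Prod>\<psi>\<in>X. \<psi> a) \<noteq> 0" using nz fin by (simp add: prod_zero_iff)
 ultimately show ?thesis by simp
qed

text \<open>Passing to the modulus \<open>q * Y\<close> makes the exponent of the group divide the modulus, which is
 what the structure theory of characters of bounded order needs.\<close>

lemma subgroup_char_family:
 assumes q: "q > 1" and H: "subgroup H (mod_units q)" "subgroup_index (mod_units q) H = Y" and Y: "Y >= 1"
 shows "\<exists>X. char_fam (q * Y) X \<and> card X <= Y \<and> (\<forall>\<xi>\<in>X. order_dvd Y (q * Y) \<xi>) \<and>
  (\<forall>p. coprime p (q * Y) --> (\<forall>\<xi>\<in>X. \<xi> (int p) = 1) --> int p mod int q \<in> H)"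
proof -
 define X0 where "X0 = resid_chars q H"
 have X0: "char_group q X0" unfolding X0_def by (rule char_group_resid_chars[OF q H(1)])
 have c0: "card X0 = Y" unfolding X0_def using card_resid_chars[OF q H(1)] H(2) by simp
 have X1: "char_group Y {princ Y}" by (auto simp: char_group_def dchar_princ) (auto simp: princ_def)
 \<comment> \<open>Multiplying by the principal character modulo \<open>Y\<close> is the lift to
   modulus \<open>q * Y\<close>; integers coprime to that modulus keep their character
   values.\<close>
 define X where "X = (\<lambda>(\<psi>, \<xi>) a. \<psi> a * \<xi> a) ` (X0 \<times> {princ Y})"
 have X: "char_group (q * Y) X" "card X <= Y"
  using char_group_product[OF X0 X1] c0 by (auto simp: X_def)
 have "char_fam (q * Y) X" using X(1) q Y by unfold_locales auto
 moreover have "order_dvd Y (q * Y) \<phi>" if "\<phi> \<in> X" for \<phi>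
  unfolding order_dvd_def
 proof (intro allI impI)
  fix a assume a: "coprime a (int (q * Y))"
  from that obtain \<psi> where \<psi>: "\<psi> \<in> X0" "\<phi> = (\<lambda>a. \<psi> a * princ Y a)" by (auto simp: X_def)
  have "coprime a (int q)" "coprime a (int Y)" using a by auto
  then show "\<phi> a ^ Y = 1" using char_group_power_card[OF X0 \<psi>(1), of a] c0 by (simp add: \<psi>(2) princ_def)
 qed
 moreover have "int p mod int q \<in> H" if p: "coprime p (q * Y)" "\<forall>\<xi>\<in>X. \<xi> (int p) = 1" for p
 proof (rule ccontr)
  assume n: "int p mod int q \<notin> H"
  have cp: "coprime (int p) (int q)" "coprime (int p) (int Y)" using p(1) by auto
  obtain \<psi> where \<psi>: "\<psi> \<in> X0" "\<psi> (int p) \<noteq> 1"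
   using resid_chars_separate[OF q H(1) cp(1) n] by (auto simp: X0_def)
  have "(\<lambda>a. \<psi> a * princ Y a) \<in> X" unfolding X_def using \<psi>(1) by force
  then have "\<psi> (int p) * princ Y (int p) = 1" using p(2) by (auto dest: bspec)
  then show False using \<psi>(2) cp(2) by (simp add: princ_def)
 qed
 ultimately show ?thesis using X(2) by blast
qed

section \<open>Integers that are almost squarefull\<close>

lemma squarefree_dvd_if_primes_dvd:
 fixes b x :: nat
 assumes "squarefree b" "x > 0" "\<And>p. prime p ==> p dvd b ==> p dvd x"
 shows "b dvd x"
proof (rule multiplicity_le_imp_dvd)
 show "b \<noteq> 0" using assms(1) by (metis not_squarefree_0)
 fix p :: nat assume p: "prime p"
 show "multiplicity p b <= multiplicity p x"
 proof (cases "p dvd b")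
  case True
  have "\<not> p ^ 2 dvd b" using squarefreeD[OF assms(1)] p by (auto simp: prime_nat_iff)
  then have "multiplicity p b < 2" using p by (intro multiplicity_lessI) (auto simp: prime_nat_iff \<open>b \<noteq> 0\<close>)
  moreover have "multiplicity p x > 0" using assms(2,3) p True by (simp add: prime_multiplicity_gt_zero_iff)
  ultimately show ?thesis by linarith
 qed (simp add: not_dvd_imp_multiplicity_0)
qed

text \<open>Write \<open>n = b a\<^sup>2\<close> with squarefree \<open>b\<close>; a prime divisor of \<open>b\<close> not dividing \<open>a\<close> divides \<open>n\<close> exactly once,
 so \<open>b\<close> divides \<open>a Q\<close>, and \<open>n\<close> is determined by \<open>a <= sqrt N\<close> and a divisor of \<open>a Q\<close>.\<close>

lemma sum_almost_squarefull_le: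
 fixes h :: "nat => real"
 assumes Q: "Q > 0" and h: "\<And>n. n \<in> {1..N} ==> h n <= D" "D >= 0"
  and supp: "\<And>n p. n \<in> {1..N} ==> h n \<noteq> 0 ==> prime p ==> p dvd n ==> \<not> p ^ 2 dvd n ==> p dvd Q"
  and T: "\<And>m. m \<in> {1..N * Q} ==> real (divisor_count m) <= T" "T >= 0"
 shows "(\<Sum>n=1..N. h n) <= sqrt N * T * D"
proof -
 define S where "S = {n \<in> {1..N}. h n \<noteq> 0}"
 define R where "R = nat \<lfloor>sqrt (real N)\<rfloor>"
 define W where "W = Sigma {1..R} (\<lambda>a. {b. b dvd a * Q})"
 have R: "a \<in> {1..R} \<longleftrightarrow> a >= 1 \<and> a ^ 2 <= N" for a
 proof -
  have "a <= R \<longleftrightarrow> real a <= sqrt (real N)" unfolding R_def by (simp add: le_nat_iff le_floor_iff)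
  also have "... \<longleftrightarrow> (real a) ^ 2 <= real N" by (metis abs_of_nat real_sqrt_abs real_sqrt_le_iff)
  also have "... \<longleftrightarrow> a ^ 2 <= N" by (simp flip: of_nat_power)
  finally show ?thesis by auto
 qed
 have finW: "finite W" unfolding W_def using Q by (intro finite_SigmaI) (auto intro!: finite_divisors_nat)
 have "S \<subseteq> (\<lambda>(a, b). b * a ^ 2) ` W"
 proof
  fix n assume "n \<in> S"
  then have n: "n \<in> {1..N}" "h n \<noteq> 0" "n > 0" by (auto simp: S_def)
  define a b where "a = square_part n" and "b = squarefree_part n"
  have nab: "n = b * a ^ 2" unfolding a_def b_def by (rule squarefree_decompose)
  have sf: "squarefree b" unfolding b_def by (rule squarefree_squarefree_part)
  have a0: "a > 0" using n(3) by (simp add: nab)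
  have "a ^ 2 <= n" using n(3) by (intro dvd_imp_le) (auto simp: nab)
  then have "a \<in> {1..R}" using n a0 by (simp only: R) auto
  moreover have "b dvd a * Q"
  proof (rule squarefree_dvd_if_primes_dvd[OF sf])
   show "a * Q > 0" using a0 Q by simp
   fix p :: nat assume p: "prime p" "p dvd b"
   show "p dvd a * Q"
   proof (cases "p dvd a")
    case False
    have "\<not> p ^ 2 dvd n"
    proof
     assume "p ^ 2 dvd n"
     moreover have "coprime (p ^ 2) (a ^ 2)" using False p(1) prime_imp_coprime by auto
     ultimately have "p ^ 2 dvd b" unfolding nab by (simp add: coprime_dvd_mult_left_iff)
     then have "p dvd 1" using squarefreeD[OF sf] by blast
     then show False using p(1) by (simp add: prime_nat_iff)
    qed
    moreover have "p dvd n" using p(2) by (simp add: nab)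
    ultimately show ?thesis using supp[OF n(1,2) p(1)] by simp
   qed simp
  qed
  ultimately have "(a, b) \<in> W" by (simp add: W_def)
  then show "n \<in> (\<lambda>(a, b). b * a ^ 2) ` W" using nab by force
 qed
 then have "card S <= card ((\<lambda>(a, b). b * a ^ 2) ` W)" using finW by (intro card_mono) auto
 also have "... <= card W" using finW by (rule card_image_le)
 also have "... = (\<Sum>a\<in>{1..R}. divisor_count (a * Q))"
  unfolding W_def divisor_count_def using Q by (intro card_SigmaI) (auto intro!: finite_divisors_nat)
 finally have "real (card S) <= (\<Sum>a\<in>{1..R}. real (divisor_count (a * Q)))" by (metis of_nat_le_iff of_nat_sum)
 also have "... <= (\<Sum>a\<in>{1..R}. T)"
 proof (intro sum_mono T(1))
  fix a assume "a \<in> {1..R}"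
  then have a: "1 <= a" "a ^ 2 <= N" using R by blast+
  have "a <= N" using le_square[of a] a(2) unfolding power2_eq_square by linarith
  then have "a * Q <= N * Q" by (intro mult_le_mono) auto
  moreover have "1 * 1 <= a * Q" using a(1) Q by (intro mult_le_mono) auto
  ultimately show "a * Q \<in> {1..N * Q}" by simp
 qed
 also have "... = real R * T" by simp
 also have "... <= sqrt N * T" using T(2) by (intro mult_right_mono) (auto simp: R_def)
 finally have cS: "real (card S) <= sqrt N * T" .
 have "(\<Sum>n=1..N. h n) = (\<Sum>n\<in>S. h n)" unfolding S_def by (intro sum.mono_neutral_right) auto
 also have "... <= (\<Sum>n\<in>S. D)" using h(1) by (intro sum_mono) (auto simp: S_def)
 also have "... = real (card S) * D" by simp
 also have "... <= sqrt N * T * D" using cS h(2) by (intro mult_right_mono)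
 finally show ?thesis .
qed

section \<open>Primes in a subgroup\<close>

text \<open>The length \<open>N\<close> exceeds the threshold \<open>U\<close> by a power of
  \<open>Q\<close>, so that the trivial sum of coefficients up to \<open>U\<close> is negligible.
  The contradiction is a comparison of exponents: Siegel's bound loses
  \<open>Q powr (- \<eta>)\<close>, every error term saves
  \<open>Q powr (- (2 * \<eta>))\<close>.\<close>

lemma family_prime:
 fixes Y :: nat and \<epsilon> :: real
 assumes \<epsilon>: "\<epsilon> > 0" and Y: "Y >= 1"
 shows "\<exists>Q0. \<forall>Q X. Q0 <= Q --> char_fam Q X --> card X <= Y --> Y dvd Q --> (\<forall>\<xi>\<in>X. order_dvd Y Q \<xi>) -->
  (\<exists>p. prime p \<and> coprime p Q \<and> real p <= 2 * real Q powr ((real Y - 1) / 4 + \<epsilon>) \<and> (\<forall>\<xi>\<in>X. \<xi> (int p) = 1))"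
proof -
 define \<epsilon>1 where "\<epsilon>1 = min (1 / 4) (\<epsilon> / (4 * Y))"
 have \<epsilon>1: "0 < \<epsilon>1" "\<epsilon>1 <= 1 / 4" "4 * Y * \<epsilon>1 <= \<epsilon>"
 proof -
  show "0 < \<epsilon>1" "\<epsilon>1 <= 1 / 4" using \<epsilon> Y by (auto simp: \<epsilon>1_def)
  have "\<epsilon>1 <= \<epsilon> / (4 * Y)" by (simp add: \<epsilon>1_def)
  then show "4 * Y * \<epsilon>1 <= \<epsilon>" using Y by (simp add: pos_le_divide_eq mult.commute)
 qed
 obtain \<delta> C :: real where \<delta>: "0 < \<delta>" "\<delta> <= 1 / 4" and C: "C >= 1" and sum_bound:
  "\<And>Q \<xi> N. Q > 0 ==> Y dvd Q ==> dchar Q \<xi> ==> order_dvd Y Q \<xi> ==> \<not> trivial_char Q \<xi> ==>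
   real Q powr (1 / 4 + \<epsilon>1) <= real N ==> norm (\<Sum>n=1..N. \<xi> (int n)) <= C * real N powr (1 - \<delta>)"
  using dchar_sum_bound[of Y \<epsilon>1] Y \<epsilon>1 by auto
 define \<theta> where "\<theta> = 1 / 4 + \<epsilon>1"
 have "\<exists>\<kappa> A. 0 < \<kappa> \<and> \<kappa> <= 1 / 2 \<and> A >= 1 \<and> (\<forall>Q X. char_fam Q X --> 4 <= real Q powr \<epsilon>1 --> card X <= Y -->
   (\<forall>g\<in>set (nontriv Q X). osc C \<delta> (real Q powr \<theta>) g) -->
   osc A \<kappa> (real Q powr ((card X - 1) * (\<theta> + \<epsilon>1))) (famF Q X))"
  using \<delta> C \<epsilon>1 by (intro family_osc) (auto simp: \<theta>_def)
 then obtain \<kappa> A where fo: "0 < \<kappa> \<and> \<kappa> <= 1 / 2 \<and> A >= 1 \<and> (\<forall>Q X. char_fam Q X --> 4 <= real Q powr \<epsilon>1 --> card X <= Y -->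
   (\<forall>g\<in>set (nontriv Q X). osc C \<delta> (real Q powr \<theta>) g) -->
   osc A \<kappa> (real Q powr ((card X - 1) * (\<theta> + \<epsilon>1))) (famF Q X))" by (elim exE)
 note \<kappa> = fo[THEN conjunct1] fo[THEN conjunct2, THEN conjunct1]
 note A = fo[THEN conjunct2, THEN conjunct2, THEN conjunct1]
 note o = fo[THEN conjunct2, THEN conjunct2, THEN conjunct2, rule_format]
 \<comment> \<open>Exponent of the threshold: at most \<open>Y - 1\<close> nontrivial characters
   with \<theta>\<open>+\<close>\<epsilon>1 each. The summand \<epsilon>\<open>/ 4\<close> keeps it
   positive when \<open>Y = 1\<close>.\<close>
 define \<omega> where "\<omega> = (real Y - 1) * (\<theta> + \<epsilon>1) + \<epsilon> / 4"
 define \<nu> where "\<nu> = \<omega> + \<epsilon> / 4"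
 have \<omega>: "\<omega> > 0" using Y \<epsilon> \<epsilon>1 by (auto simp: \<omega>_def \<theta>_def intro!: add_nonneg_pos mult_nonneg_nonneg)
 have \<nu>: "\<omega> <= \<nu>" "\<nu> <= (real Y - 1) / 4 + \<epsilon>"
 proof -
  show "\<omega> <= \<nu>" using \<epsilon> by (simp add: \<nu>_def)
  have "(real Y - 1) * (2 * \<epsilon>1) <= real Y * (2 * \<epsilon>1)" using \<epsilon>1 by (intro mult_right_mono) auto
  also have "... <= \<epsilon> / 2" using \<epsilon>1(3) by simp
  finally have "(real Y - 1) * (2 * \<epsilon>1) <= \<epsilon> / 2" .
  moreover have "\<nu> = (real Y - 1) / 4 + (real Y - 1) * (2 * \<epsilon>1) + \<epsilon> / 2"
   by (simp add: \<nu>_def \<omega>_def \<theta>_def algebra_simps)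
  ultimately show "\<nu> <= (real Y - 1) / 4 + \<epsilon>" by linarith
 qed
 \<comment> \<open>Three demands on the growth of coefficients:
   \<open>1 / 2 + 2 * e <= 3 / 4\<close> in the squarefull count, \<open>U powr (1 + e)\<close>
   below \<open>N\<close> by a power, and a divisor loss \<open>Q powr e\<close> well below the
   saving from \<open>N\<close>.\<close>
 define e where "e = min (1 / 8) (min (\<epsilon> / (8 * \<omega>)) (\<omega> / 8))"
 have e: "0 < e" "e <= 1 / 8" "e * \<omega> <= \<epsilon> / 8" "e <= \<omega> / 8"
 proof -
  show "0 < e" "e <= 1 / 8" "e <= \<omega> / 8" using \<epsilon> \<omega> by (auto simp: e_def)
  have "e <= \<epsilon> / (8 * \<omega>)" by (auto simp: e_def)
  then show "e * \<omega> <= \<epsilon> / 8" using \<omega> by (simp add: pos_le_divide_eq)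
 qed
 obtain B where B: "B >= 1" "\<And>Q X n. char_fam Q X ==> card X <= Y ==> n > 0 ==> norm (famF Q X n) <= B * real n powr e"
  "\<And>Q X n. char_fam Q X ==> card X <= Y ==> n > 0 ==> norm (dconv (famF Q X) (\<lambda>_. 1) n) <= B * real n powr e"
  using famF_powr_bound[OF e(1), of Y] by auto
 obtain D where D: "D >= 1" "\<And>n. n > 0 ==> real (divisor_count n) <= D * real n powr e"
  using divisor_bound[OF e(1)] by auto
 \<comment> \<open>The three entries of the minimum are the savings from the oscillation of
   \<open>famF\<close> beyond \<open>U\<close>, from \<open>U\<close> being shorter than
   \<open>N\<close>, and from the squarefull support. Half of the smallest is conceded to Siegel's
   bound.\<close>
 define \<eta> where "\<eta> = min (\<kappa> * \<omega>) (min (\<epsilon> / 8) (\<omega> / 8)) / 2"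
 have \<eta>: "0 < \<eta>" "2 * \<eta> <= \<kappa> * \<omega>" "2 * \<eta> <= \<epsilon> / 8" "2 * \<eta> <= \<omega> / 8"
  using \<kappa>(1) \<omega> \<epsilon> by (auto simp: \<eta>_def)
 obtain c where c: "c > 0" "\<And>Q X. char_fam Q X ==> Q >= 4 ==> card X <= Y ==> Re (famL Q X 1) >= c * real Q powr (- \<eta>)"
  using siegel[OF \<eta>(1), of Y] by auto
 define A1 where "A1 = A * (3 + 2 / \<kappa>)"
 define T where "T = A1 + 4 * B + 2 * A / \<kappa> + D * B"
 have A1: "A1 >= 0" using A \<kappa>(1) by (simp add: A1_def)
 have T: "T >= 0" using A1 A B(1) D(1) \<kappa>(1) by (simp add: T_def)
 \<comment> \<open>The second entry ensures the slack condition of \<open>family_osc\<close>; the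
   third makes \<open>Q powr \<eta>\<close> exceed the quotient of the error constant and Siegel's
   constant.\<close>
 define Q0 where "Q0 = max 4 (max (nat \<lceil>4 powr (1 / \<epsilon>1)\<rceil>) (nat \<lceil>(T / c + 1) powr (1 / \<eta>)\<rceil>))"
 show ?thesis
 proof (rule exI[of _ Q0], intro allI impI)
  fix Q X
  assume Q: "Q0 <= Q" and H: "char_fam Q X" "card X <= Y" and YQ: "Y dvd Q" and ord: "\<forall>\<xi>\<in>X. order_dvd Y Q \<xi>"
  interpret char_fam Q X by fact
  have Q4: "Q >= 4" using Q by (simp add: Q0_def)
  then have Q1: "real Q >= 1" by simp
  have Qe: "4 <= real Q powr \<epsilon>1"
  proof -
   have "4 powr (1 / \<epsilon>1) <= real (nat \<lceil>4 powr (1 / \<epsilon>1)\<rceil>)" by linarith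
   also have "... <= real Q0" unfolding Q0_def by (intro of_nat_mono) (simp only: le_max_iff_disj order_refl simp_thms)
   also have "... <= real Q" using Q by simp
   finally have "(4 powr (1 / \<epsilon>1)) powr \<epsilon>1 <= real Q powr \<epsilon>1" using \<epsilon>1 by (intro powr_mono2) auto
   then show ?thesis using \<epsilon>1 by (simp add: powr_powr)
  qed
  have Q\<eta>: "T / c < real Q powr \<eta>"
  proof -
   have "(T / c + 1) powr (1 / \<eta>) <= real (nat \<lceil>(T / c + 1) powr (1 / \<eta>)\<rceil>)" by linarith
   also have "... <= real Q0" unfolding Q0_def by (intro of_nat_mono) (simp only: le_max_iff_disj order_refl simp_thms)
   also have "... <= real Q" using Q by simp
   finally have "((T / c + 1) powr (1 / \<eta>)) powr \<eta> <= real Q powr \<eta>" using \<eta> by (intro powr_mono2) auto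
   moreover have "0 <= T / c" using T c(1) by simp
   ultimately show ?thesis using \<eta> by (simp add: powr_powr)
  qed
  show "\<exists>p. prime p \<and> coprime p Q \<and> real p <= 2 * real Q powr ((real Y - 1) / 4 + \<epsilon>) \<and> (\<forall>\<xi>\<in>X. \<xi> (int p) = 1)"
  proof (rule ccontr)
   assume none: "\<nexists>p. prime p \<and> coprime p Q \<and> real p <= 2 * real Q powr ((real Y - 1) / 4 + \<epsilon>) \<and> (\<forall>\<xi>\<in>X. \<xi> (int p) = 1)"
   define U where "U = nat \<lceil>real Q powr \<omega>\<rceil>"
   define N where "N = nat \<lceil>real Q powr \<nu>\<rceil>"
   let ?q = "real Q powr (- (2 * \<eta>))"
   have pw: "1 <= real Q powr \<omega>" "1 <= real Q powr \<nu>" using Q1 \<omega> \<nu> by (auto intro!: ge_one_powr_ge_zero)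
   have U: "real Q powr \<omega> <= real U" "real U <= 2 * real Q powr \<omega>" "U >= 1" using pw unfolding U_def by linarith+
   have N: "real Q powr \<nu> <= real N" "real N <= 2 * real Q powr \<nu>" "N >= 1" using pw unfolding N_def by linarith+
   have UN: "U <= N" unfolding U_def N_def using Q1 \<nu> by (intro nat_mono ceiling_mono powr_mono) auto
   let ?k = "real U powr (- \<kappa>)"
   have U0: "real U >= 1" and N0: "real N >= 1" using U N by simp_all
   have oF: "osc A \<kappa> (real U) (famF Q X)"
   proof -
    have g: "\<forall>g\<in>set (nontriv Q X). osc C \<delta> (real Q powr \<theta>) g"
    proof
     fix g assume "g \<in> set (nontriv Q X)"
     then obtain \<xi> where \<xi>: "\<xi> \<in> X" "\<xi> \<noteq> princ Q" "g = (\<lambda>n. \<xi> (int n))" by (auto simp: nontriv(1)[OF fin])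
     have "\<not> trivial_char Q \<xi>" using trivial_char_iff[OF dch[OF \<xi>(1)]] \<xi>(2) by simp
     then show "osc C \<delta> (real Q powr \<theta>) g"
      unfolding osc_def \<xi>(3) \<theta>_def using sum_bound[OF Q0 YQ dch[OF \<xi>(1)]] ord \<xi>(1) by blast
    qed
    have 1: "osc A \<kappa> (real Q powr ((card X - 1) * (\<theta> + \<epsilon>1))) (famF Q X)" by (rule o[OF H(1) Qe H(2)]) (use g in blast)
    have "real (card X - 1) * (\<theta> + \<epsilon>1) <= (real Y - 1) * (\<theta> + \<epsilon>1)"
     using H(2) card_pos \<epsilon>1 by (intro mult_right_mono) (auto simp: \<theta>_def of_nat_diff)
    then have "real (card X - 1) * (\<theta> + \<epsilon>1) <= \<omega>" using \<epsilon> by (simp add: \<omega>_def)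
    then have "real Q powr ((card X - 1) * (\<theta> + \<epsilon>1)) <= real Q powr \<omega>" using Q1 by (intro powr_mono)
    then have 2: "real Q powr ((card X - 1) * (\<theta> + \<epsilon>1)) <= real U" using U(1) by linarith
    show ?thesis using A by (intro osc_mono[OF 1 order_refl _ order_refl 2 U0]) auto
   qed
   let ?f = "dconv (famF Q X) (\<lambda>_. 1)" and ?P = "\<Sum>n=1..U. wt 1 (famF Q X) n"
   define h where "h = (\<lambda>n. Re (?f n))"
   have UQ: "?k <= ?q"
   proof -
    have "?k <= (real Q powr \<omega>) powr (- \<kappa>)" using U(1) pw Q4 \<kappa> by (intro powr_mono2') auto
    also have "... = real Q powr (- (\<kappa> * \<omega>))" by (simp add: powr_powr mult.commute)
    also have "... <= ?q" using Q1 \<eta> by (intro powr_mono) auto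
    finally show ?thesis .
   qed
   have sumF: "(\<Sum>n=1..U. norm (famF Q X n)) <= 4 * B * real N * ?q"
   proof -
    have "(\<Sum>n=1..U. norm (famF Q X n)) <= (\<Sum>n=1..U. B * real U powr e)"
    proof (rule sum_mono)
     fix n assume n: "n \<in> {1..U}"
     have "norm (famF Q X n) <= B * real n powr e" using n by (intro B(2) H) auto
     also have "... <= B * real U powr e" using n B(1) e by (intro mult_left_mono powr_mono2) auto
     finally show "norm (famF Q X n) <= B * real U powr e" .
    qed
    also have "... = B * (real U powr 1 * real U powr e)" using U0 by simp
    also have "real U powr 1 * real U powr e = real U powr (1 + e)" by (rule powr_add[symmetric])
    also have "... <= (2 * real Q powr \<omega>) powr (1 + e)" using U e by (intro powr_mono2) auto
    also have "... = 2 powr (1 + e) * (real Q powr \<omega>) powr (1 + e)" by (rule powr_mult)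
    also have "... <= 2 powr 2 * real Q powr (\<nu> - 2 * \<eta>)"
    proof (rule mult_mono)
     show "2 powr (1 + e) <= (2::real) powr 2" using e by (intro powr_mono) auto
     have "\<omega> * (1 + e) <= \<nu> - 2 * \<eta>" using e(3) \<eta>(3) \<epsilon> by (simp add: \<nu>_def algebra_simps)
     then show "(real Q powr \<omega>) powr (1 + e) <= real Q powr (\<nu> - 2 * \<eta>)"
      unfolding powr_powr using Q1 by (intro powr_mono)
    qed auto
    also have "real Q powr (\<nu> - 2 * \<eta>) = real Q powr \<nu> * ?q" unfolding powr_add[symmetric] by simp
    also have "B * (2 powr 2 * (real Q powr \<nu> * ?q)) <= B * (2 powr 2 * (real N * ?q))"
     using N(1) B(1) by (intro mult_left_mono mult_right_mono) auto
    finally show ?thesis using B(1) by simp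
   qed
   have low: "real N * (c * real Q powr (- \<eta>)) <= (\<Sum>n=1..N. h n) + real N * (A1 + 4 * B + 2 * A / \<kappa>) * ?q"
   proof -
    have 1: "norm ((\<Sum>n=1..N. ?f n) - of_nat N * ?P) <= (\<Sum>n=1..U. norm (famF Q X n)) + 2 * A / \<kappa> * real N * ?k"
     using \<kappa> A by (intro dconv_one_asymptotic[OF oF _ _ U(3) UN]) auto
    have 2: "norm (?P - famL Q X 1) <= A1 * ?k"
     using famL_sum_approx(2)[OF oF _ U(3) \<kappa>(1), of 1] A \<kappa>(1) by (simp add: A1_def)
    have "c * real Q powr (- \<eta>) <= Re (famL Q X 1)" by (rule c(2)[OF H(1) Q4 H(2)])
    also have "... <= Re ?P + A1 * ?k" using 2 abs_Re_le_cmod[of "?P - famL Q X 1"] by simp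
    finally have "real N * (c * real Q powr (- \<eta>)) <= real N * (Re ?P + A1 * ?k)" by (intro mult_left_mono) auto
    also have "... = real N * Re ?P + real N * A1 * ?k" by (simp add: algebra_simps)
    also have "real N * Re ?P <= (\<Sum>n=1..N. h n) + norm ((\<Sum>n=1..N. ?f n) - of_nat N * ?P)"
    proof -
     have "Re ((\<Sum>n=1..N. ?f n) - of_nat N * ?P) = (\<Sum>n=1..N. h n) - real N * Re ?P" by (simp add: h_def)
     then show ?thesis using abs_Re_le_cmod[of "(\<Sum>n=1..N. ?f n) - of_nat N * ?P"] by linarith
    qed
    finally have "real N * (c * real Q powr (- \<eta>)) <= (\<Sum>n=1..N. h n) + (4 * B * real N * ?q + 2 * A / \<kappa> * real N * ?k) + real N * A1 * ?k"
     using 1 sumF by linarith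
    also have "... <= (\<Sum>n=1..N. h n) + (4 * B * real N * ?q + 2 * A / \<kappa> * real N * ?q) + real N * A1 * ?q"
     using UQ A A1 \<kappa>(1) by (intro add_mono mult_left_mono order_refl) auto
    finally show ?thesis by (simp add: algebra_simps)
   qed
   have up: "(\<Sum>n=1..N. h n) <= real N * (D * B) * ?q"
   proof -
    have "(\<Sum>n=1..N. h n) <= sqrt N * (D * real (N * Q) powr e) * (B * real N powr e)"
    proof (rule sum_almost_squarefull_le[OF Q0])
     fix n assume n: "n \<in> {1..N}"
     have "h n <= norm (?f n)" unfolding h_def by (rule complex_Re_le_cmod)
     also have "... <= B * real n powr e" using n by (intro B(3) H) auto
     also have "... <= B * real N powr e" using n B(1) e by (intro mult_left_mono powr_mono2) auto
     finally show "h n <= B * real N powr e" .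
    next
     show "0 <= B * real N powr e" using B(1) by simp
    next
     fix n p assume n: "n \<in> {1..N}" "h n \<noteq> 0" and p: "prime p" "p dvd n" "\<not> p ^ 2 dvd n"
     show "p dvd Q"
     proof (rule ccontr)
      assume "\<not> p dvd Q"
      then have cp: "coprime p Q" using p(1) by (simp add: prime_imp_coprime)
      have "p <= n" using n(1) p(2) by (intro dvd_imp_le) auto
      then have "real p <= real N" using n(1) by simp
      \<comment> \<open>The factor 2 in the bound for \<open>p\<close> comes from rounding
        \<open>N\<close> up to an integer.\<close>
      also have "... <= 2 * real Q powr ((real Y - 1) / 4 + \<epsilon>)"
       using N(2) powr_mono[OF \<nu>(2) Q1] by linarith
      finally have "\<exists>\<xi>\<in>X. \<xi> (int p) \<noteq> 1" using none p(1) cp by blast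
      then have "?f n = 0" using n(1) by (intro famf_eq_0[OF p(1) cp _ _ p(2,3)]) auto
      then show False using n(2) by (simp add: h_def)
     qed
    next
     fix m assume m: "m \<in> {1..N * Q}"
     have "real (divisor_count m) <= D * real m powr e" using m by (intro D(2)) auto
     also have "... <= D * real (N * Q) powr e"
     proof (intro mult_left_mono powr_mono2)
      show "real m <= real (N * Q)" using m by (simp only: of_nat_le_iff) simp
     qed (use D(1) e in auto)
     finally show "real (divisor_count m) <= D * real (N * Q) powr e" .
    next
     show "0 <= D * real (N * Q) powr e" using D(1) by simp
    qed
    also have "real (N * Q) powr e = real N powr e * real Q powr e" by (simp add: powr_mult)
    also have "sqrt N * (D * (real N powr e * real Q powr e)) * (B * real N powr e)
      = D * B * ((real N powr (1 / 2) * real N powr e * real N powr e) * real Q powr e)" by (simp add: powr_half_sqrt)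
    also have "real N powr (1 / 2) * real N powr e * real N powr e = real N powr (1 / 2 + e + e)" unfolding powr_add ..
    also have "D * B * (real N powr (1 / 2 + e + e) * real Q powr e) <= D * B * (real N * real Q powr (- (\<omega> / 4)) * real Q powr (\<omega> / 8))"
    proof (rule mult_left_mono, rule mult_mono)
     have "real N powr (1 / 2 + e + e) <= real N powr (1 + - (1 / 4))" using N0 e by (intro powr_mono) auto
     also have "... = real N * real N powr (- (1 / 4))" using N0 by (simp only: powr_add) simp
     also have "real N powr (- (1 / 4)) <= (real Q powr \<nu>) powr (- (1 / 4))" using N(1) pw Q4 by (intro powr_mono2') auto
     also have "... = real Q powr (- (\<nu> / 4))" by (simp add: powr_powr)
     also have "... <= real Q powr (- (\<omega> / 4))" using Q1 \<nu> by (intro powr_mono) auto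
     finally show "real N powr (1 / 2 + e + e) <= real N * real Q powr (- (\<omega> / 4))" by (simp add: mult_left_mono)
     show "real Q powr e <= real Q powr (\<omega> / 8)" using Q1 e by (intro powr_mono) auto
    qed (use D(1) B(1) in auto)
    also have "real N * real Q powr (- (\<omega> / 4)) * real Q powr (\<omega> / 8) = real N * (real Q powr (- (\<omega> / 4)) * real Q powr (\<omega> / 8))" by (rule mult.assoc)
    also have "real Q powr (- (\<omega> / 4)) * real Q powr (\<omega> / 8) = real Q powr (- (\<omega> / 4) + \<omega> / 8)" by (rule powr_add[symmetric])
    also have "D * B * (real N * real Q powr (- (\<omega> / 4) + \<omega> / 8)) <= D * B * (real N * ?q)"
     using Q1 \<eta> D(1) B(1) by (intro mult_left_mono powr_mono) auto
    finally show ?thesis by (simp add: mult_ac)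
   qed
   have "real N * (c * real Q powr (- \<eta>)) <= real N * (D * B) * ?q + real N * (A1 + 4 * B + 2 * A / \<kappa>) * ?q"
    using low up by linarith
   also have "... = real N * (T * ?q)" unfolding T_def by (simp add: algebra_simps)
   finally have "c * real Q powr (- \<eta>) <= T * ?q" using N0 by (simp add: mult_le_cancel_left_pos)
   then have "c * real Q powr (- \<eta>) * real Q powr (2 * \<eta>) <= T * ?q * real Q powr (2 * \<eta>)"
    by (rule mult_right_mono) simp
   moreover have "real Q powr (- \<eta>) * real Q powr (2 * \<eta>) = real Q powr \<eta>" unfolding powr_add[symmetric] by simp
   moreover have "?q * real Q powr (2 * \<eta>) = 1" unfolding powr_add[symmetric] using Q1 by simp
   ultimately have "c * real Q powr \<eta> <= T" by (simp only: mult.assoc mult_1_right)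
   then have "real Q powr \<eta> <= T / c" using c(1) by (simp add: pos_le_divide_eq mult.commute)
   then show False using Q\<eta> by linarith
  qed
 qed
qed

theorem theorem2p4:
  fixes \<epsilon> :: real and Y :: nat
  assumes "\<epsilon> > 0" and "Y \<ge> 1"
  shows "\<exists>c\<^sub>0 :: real. c\<^sub>0 > 0 \<and>
    (\<exists>q\<^sub>0 :: nat. \<forall>q \<ge> q\<^sub>0. \<forall>H.
      subgroup H (mod_units q) \<and> subgroup_index (mod_units q) H = Y \<longrightarrow>
        (\<exists>p::nat. prime p \<and>
          real p \<le> c\<^sub>0 * real q powr ((real Y - 1) / 3 + \<epsilon>) \<and> int p mod int q \<in> H) \<and>
        (cube_free q \<longrightarrow>
          (\<exists>p::nat. prime p \<and>
            real p \<le> c\<^sub>0 * real q powr ((real Y - 1) / 4 + \<epsilon>) \<and> int p mod int q \<in> H)))"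
proof -
 obtain Q0 where Q0: "\<forall>Q X. Q0 <= Q --> char_fam Q X --> card X <= Y --> Y dvd Q --> (\<forall>\<xi>\<in>X. order_dvd Y Q \<xi>) -->
  (\<exists>p. prime p \<and> coprime p Q \<and> real p <= 2 * real Q powr ((real Y - 1) / 4 + \<epsilon>) \<and> (\<forall>\<xi>\<in>X. \<xi> (int p) = 1))"
  using family_prime[OF assms] by (elim exE)
 define E where "E = (real Y - 1) / 4 + \<epsilon>"
 have E: "E >= 0" "E <= (real Y - 1) / 3 + \<epsilon>" using assms by (simp_all add: E_def)
 \<comment> \<open>The family has modulus \<open>q * Y\<close>, and the fixed power of
   \<open>Y\<close> is moved into the constant.\<close>
 define c where "c = 2 * real Y powr E"
 have main: "\<exists>p::nat. prime p \<and> real p <= c * real q powr E \<and> int p mod int q \<in> H"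
  if q: "q >= max 2 Q0" and H: "subgroup H (mod_units q)" "subgroup_index (mod_units q) H = Y" for q H
 proof -
  have q1: "q > 1" using q by simp
  obtain X where X: "char_fam (q * Y) X" "card X <= Y" "\<forall>\<xi>\<in>X. order_dvd Y (q * Y) \<xi>"
   "\<forall>p. coprime p (q * Y) --> (\<forall>\<xi>\<in>X. \<xi> (int p) = 1) --> int p mod int q \<in> H"
   using subgroup_char_family[OF q1 H assms(2)] by blast
  have "q * 1 <= q * Y" using assms(2) by (intro mult_le_mono) auto
  moreover have "Q0 <= q" using q by simp
  ultimately have "Q0 <= q * Y" by linarith
  then obtain p where p: "prime p" "coprime p (q * Y)" "real p <= 2 * real (q * Y) powr E" "\<forall>\<xi>\<in>X. \<xi> (int p) = 1"
   using Q0[rule_format, OF _ X(1,2) _ bspec[OF X(3)]] unfolding E_def by auto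
  have "real p <= c * real q powr E" using p(3) by (simp add: c_def powr_mult mult_ac)
  then show ?thesis using p X(4) by blast
 qed
 have c: "c > 0" using assms by (simp add: c_def)
 show ?thesis
 proof (rule exI[of _ c], intro conjI c, rule exI[of _ "max 2 Q0"], intro allI impI)
  fix q H
  assume q: "max 2 Q0 <= q" and H: "subgroup H (mod_units q) \<and> subgroup_index (mod_units q) H = Y"
  obtain p where p: "prime p" "real p <= c * real q powr E" "int p mod int q \<in> H"
   using main[OF q] H by blast
  have "real q powr E <= real q powr ((real Y - 1) / 3 + \<epsilon>)" using E q by (intro powr_mono) auto
  then have "c * real q powr E <= c * real q powr ((real Y - 1) / 3 + \<epsilon>)" using c by (intro mult_left_mono) auto
  then have "real p <= c * real q powr ((real Y - 1) / 3 + \<epsilon>)" using p(2) by linarith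
  then show "(\<exists>p::nat. prime p \<and> real p <= c * real q powr ((real Y - 1) / 3 + \<epsilon>) \<and> int p mod int q \<in> H) \<and>
    (cube_free q --> (\<exists>p::nat. prime p \<and> real p <= c * real q powr ((real Y - 1) / 4 + \<epsilon>) \<and> int p mod int q \<in> H))"
   using p unfolding E_def by blast
 qed
qed

end
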